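(* Under the setting and assumptions of the context, for all sufficiently small $\varepsilon>0$, the minimum total number of conjugate gradient (CG) iterations $K_{\mathrm{acc}}(\varepsilon)$ needed to achieve $\|u-\widetilde u_{h,L_{\max}}\|_{L^2_\varrho(\Gamma;H_0^1(D))}<\varepsilon$ with the accelerated stochastic collocation algorithm is bounded by $$ \begin{aligned} K_{\mathrm{acc}}(\varepsilon)\le{}& C_1\left[\log\left(\frac{3C_{\mathrm{sc}}}{\varepsilon}\right)\right]^{N}\left[C_2+\frac{1}{\log 2}\log\log\left(\frac{3C_{\mathrm{sc}}}{\varepsilon}\right)\right]^{N-1}\\ &\times\frac{1}{\log\left(\frac{\sqrt{\overline\kappa}+1}{\sqrt{\overline\kappa}-1}\right)}\left\{C_5+2\left(2^{1/N}-1\right)\log\left(\frac{3C_{\mathrm{sc}}}{\varepsilon}\right)+2N\log\log\left[\frac{1}{rN}\log\left(\frac{3C_{\mathrm{sc}}}{\varepsilon}\right)\right]\right\}, \end{aligned} $$ where $\overline\kappa=\sup_{\mathbf y\in\Gamma}\kappa(\mathbf y)$, with $\kappa(\mathbf y)$ the condition number of $\mathbf A(\mathbf y)$ (for mesh size $h=h(\varepsilon)$), and $$ C_1=\left(\frac{\mathrm e}{\log 2}\right)^{N-1}\left(\frac{2}{rN}\right)^N,\quad C_2=1+\frac{1}{\log 2}\log\left(\frac{1}{rN}\right),\quad C_5=2N\log\left(\frac{2N}{\log 2}\right)+\log\left(4\sqrt{\frac{\alpha}{\beta}}\right). $$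
   Context: **PDE.** $D\subset\mathbb R^d$ ($d=1,2,3$) is a bounded domain, $\Gamma=[-1,1]^N$, and $\varrho(\mathbf y)=\prod_{n=1}^N\varrho_n(y_n)\in L^\infty(\Gamma)$ is a probability density on $\Gamma$. For $\mathbf y\in\Gamma$, $u(\mathbf y)\in H_0^1(D)$ solves $-\nabla\cdot(a(x,\mathbf y)\nabla u)=f(x,\mathbf y)$ in $D$, $u=0$ on $\partial D$, in weak form, with $0<a_{\min}\le a\le a_{\max}<\infty$ and $f$ square integrable. Constants $\alpha,\beta>0$, independent of $\mathbf y$, satisfy, for all $v,w\in H_0^1(D)$, $|\int_D a(\mathbf y)\nabla v\cdot\nabla w\,dx|\le\alpha\|v\|_{H_0^1(D)}\|w\|_{H_0^1(D)}$ and $\beta\|v\|^2_{H_0^1(D)}\le\int_D a(\mathbf y)|\nabla v|^2dx$. **Finite elements.** $W_h(D)\subset H_0^1(D)$ is a finite element space with basis $\varphi_1,\dots,\varphi_{M_h}$ on a uniform mesh of size $h$, $M_h=\mathcal O(1/h^d)$. $u_h(\mathbf y)=\sum_i c_i(\mathbf y)\varphi_i$ is the Galerkin solution; its coefficient vector $\mathbf c(\mathbf y)$ solves $\mathbf A(\mathbf y)\mathbf c(\mathbf y)=\mathbf f(\mathbf y)$, where $[\mathbf A(\mathbf y)]_{i,i'}=\int_D a(\mathbf y)\nabla\varphi_{i'}\cdot\nabla\varphi_i\,dx$ and $(\mathbf f(\mathbf y))_i=\int_D f(\mathbf y)\varphi_i\,dx$. Write $\|\mathbf c\|_{\mathbf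 A}^2=\mathbf c^\top\mathbf A\mathbf c$. Assume $u\in L^2_\varrho(\Gamma;H_0^1(D)\cap H^{s+1}(D))$, $s\in\mathbb N_+$, and let $C_{\mathrm{fem}}$ (independent of $h,\mathbf y$) be the constant with $\|u-u_h\|_{L^2_\varrho(\Gamma;H_0^1(D))}\le C_{\mathrm{fem}}h^s$. **Sparse grid interpolation.** Let $m(1)=1$, $m(l)=2^{l-1}+1$ for $l>1$; $\vartheta^1=\{0\}$, $\vartheta^l=\{-\cos(\pi(j-1)/(m(l)-1)):1\le j\le m(l)\}$ for $l>1$ (nested Clenshaw–Curtis points). $\mathscr U^{m(l)}$ is one-dimensional Lagrange interpolation at $\vartheta^l$ by polynomials of degree $m(l)-1$, and $\mathscr U^{m(0)}=0$. The isotropic sparse grid operator is $\mathcal I_L=\sum_{\mathbf l\in\mathbb N_+^N,\ \sum_n(l_n-1)\le L}\bigotimes_{n=1}^N(\mathscr U^{m(l_n)}-\mathscr U^{m(l_n-1)})$, $L\in\mathbb N_+$. It uses the nested points $\mathcal H_L=\bigcup_{\sum_n(l_n-1)=L}\vartheta^{l_1}\times\cdots\times\vartheta^{l_N}=\{\mathbf y_{L,j}\}_{j=1}^{M_L}$ and can be written $\mathcal I_L[v]=\sum_{j=1}^{M_L}v(\mathbf y_{L,j})\Psi_{L,j}$ with $\Psi_{L,j'}(\mathbf y_{L,j})=\delta_{jj'}$. Put $\Delta\mathcal H_1=\mathcal H_1$ and $\Delta\mathcal H_L=\mathcal H_L\setminus\mathcal H_{L-1}$ for $L\ge2$. **Regularity.**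 $u:\Gamma\to H_0^1(D)$ has a complex extension analytic on $\prod_n\Sigma(n;\gamma_n)\subset\mathbb C^N$, $\gamma_n>1$, where $\Sigma(n;\gamma_n)=\{\tfrac12(z+z^{-1}):z\in\mathbb C,\ 1\le|z|\le\gamma_n\}$ is the region bounded by the Bernstein ellipse; $u_h$ has the same property with the same region of analyticity. For a constant $0<\delta<1$ let $r=(1-\delta)\min_n\log\gamma_n$, and let $C_{\mathrm{sc}}>0$ (depending on $N,u,\delta$) be the constant such that $\|w-\mathcal I_L[w]\|_{L^\infty(\Gamma;H_0^1(D))}\le C_{\mathrm{sc}}\mathrm e^{-rN2^{L/N}}$ for $L\in\mathbb N_+$, for $w=u$ and likewise for $w=u_h$. **Accelerated algorithm.** For $L=1,\dots,L_{\max}$ and every $\mathbf y_{L,j}\in\Delta\mathcal H_L$, solve $\mathbf A(\mathbf y_{L,j})\mathbf c_{L,j}=\mathbf f(\mathbf y_{L,j})$ by CG to tolerance $\tau$, i.e. until the iterate $\widetilde{\mathbf c}_{L,j}$ satisfies $\|\mathbf c_{L,j}-\widetilde{\mathbf c}_{L,j}\|_{\mathbf A(\mathbf y_{L,j})}\le\tau$, starting from $\mathbf c^{(0)}_{L,j}=\sum_{j'=1}^{M_{L-1}}\widetilde{\mathbf c}_{L-1,j'}\Psi_{L-1,j'}(\mathbf y_{L,j})$ if $L\ge2$ and from the zero vector if $L=1$ (at points already in $\mathcal H_{L-1}$ the previously computed vectors are reused). Then $\widetilde u_{h,L}=\sum_{j=1}^{M_L}(\sum_i\widetilde c_{L,j,i}\varphi_i)\Psi_{L,j}$.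 **Iteration counts.** With $\mathbf c^{(k)}_{L,j}$ the $k$-th CG iterate, $k_{L,j}$ is the number of CG iterations required to achieve $\|\mathbf c_{L,j}-\mathbf c^{(k_{L,j})}_{L,j}\|_{\mathbf A(\mathbf y_{L,j})}\le\tau$ (it depends on the initial vector). $K_{\mathrm{acc}}=\sum_{L=1}^{L_{\max}}\sum_{\mathbf y_{L,j}\in\Delta\mathcal H_L}k_{L,j}$ is the total number of CG iterations used by the accelerated algorithm. $K_{\mathrm{acc}}(\varepsilon)$ is the minimum value of $K_{\mathrm{acc}}$ needed to satisfy the inequalities $$C_{\mathrm{fem}}h^s\le\tfrac{\varepsilon}{3},\qquad C_{\mathrm{sc}}\mathrm e^{-rN2^{L_{\max}/N}}\le\tfrac{\varepsilon}{3},\qquad (L_{\max}+2)^{2N}\tfrac{\tau}{\sqrt\beta}\le\tfrac{\varepsilon}{3},$$ which together suffice for $\|u-\widetilde u_{h,L_{\max}}\|_{L^2_\varrho(\Gamma;H_0^1(D))}\le\varepsilon$. The corresponding choices are $h(\varepsilon)=(\varepsilon/(3C_{\mathrm{fem}}))^{1/s}$, $L_{\max}(\varepsilon)=\left\lceil\frac{N}{\log2}\log\left(\frac1{rN}\log\frac{3C_{\mathrm{sc}}}{\varepsilon}\right)\right\rceil$ and $\tau(\varepsilon)=\sqrt\beta\,\varepsilon/(3(L_{\max}(\varepsilon)+2)^{2N})$. **Convention.** The integer quantities $K_{\mathrm{acc}}(\varepsilon)$ and $L_{\max}(\varepsilon)$ are treated as positive real numbers. *)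

theory Defs
  imports "HOL-Analysis.Analysis" "Jordan_Normal_Form.Matrix"
begin

text \<open>Both \<open>HOL-Analysis\<close> and \<open>Jordan_Normal_Form\<close> use the infixes \<open>$\<close> and \<open>\<bullet>\<close>.  Here
  \<open>y $ n\<close> is a component of a point of \<open>real^'n\<close>; matrices and vectors whose size \<open>M h\<close> depends on the
  mesh are those of \<open>Jordan_Normal_Form\<close>, written without these infixes.\<close>

no_notation Matrix.vec_index (infixl "$" 100)
no_notation Matrix.scalar_prod (infix "\<bullet>" 70)


section \<open>Sobolev spaces on an open set, for real or complex valued functions\<close>

text \<open>Elements of \<open>L\<^sup>2(D)\<close> and of the Sobolev spaces are represented by functions; only their class
  modulo equality almost everywhere on \<open>D\<close> matters.\<close>

primrec pderivs ::
  "'d::finite list \<Rightarrow> (real^'d \<Rightarrow> 'b::real_normed_vector) \<Rightarrow> real^'d \<Rightarrow> 'b" where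
  "pderivs [] \<phi> = \<phi>"
| "pderivs (j # js) \<phi> = (\<lambda>x. frechet_derivative (pderivs js \<phi>) (at x) (axis j 1))"

definition test_fun :: "(real^'d::finite) set \<Rightarrow> (real^'d \<Rightarrow> 'b::real_normed_vector) \<Rightarrow> bool" where
  "test_fun D \<phi> \<longleftrightarrow> (\<forall>js x. pderivs js \<phi> differentiable (at x)) \<and>
     (\<exists>K. compact K \<and> K \<subseteq> D \<and> (\<forall>x. x \<notin> K \<longrightarrow> \<phi> x = 0))"

definition L2_space :: "(real^'d::finite) set \<Rightarrow> (real^'d \<Rightarrow> 'b::euclidean_space) set" where
  "L2_space D = {v. v \<in> borel_measurable (lebesgue_on D) \<and>
     integrable (lebesgue_on D) (\<lambda>x. (norm (v x))\<^sup>2)}"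

definition has_weak_deriv ::
  "(real^'d::finite) set \<Rightarrow> 'd list \<Rightarrow> (real^'d \<Rightarrow> 'b::euclidean_space) \<Rightarrow> (real^'d \<Rightarrow> 'b) \<Rightarrow> bool" where
  "has_weak_deriv D js v g \<longleftrightarrow> (\<forall>\<phi> :: real^'d \<Rightarrow> real. test_fun D \<phi> \<longrightarrow>
     (LINT x|lebesgue_on D. pderivs js \<phi> x *\<^sub>R v x)
       = (- 1) ^ length js *\<^sub>R (LINT x|lebesgue_on D. \<phi> x *\<^sub>R g x))"

definition weak_deriv ::
  "(real^'d::finite) set \<Rightarrow> 'd list \<Rightarrow> (real^'d \<Rightarrow> 'b::euclidean_space) \<Rightarrow> real^'d \<Rightarrow> 'b" where
  "weak_deriv D js v = (SOME g. g \<in> L2_space D \<and> has_weak_deriv D js v g)"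

definition Sob_space :: "(real^'d::finite) set \<Rightarrow> nat \<Rightarrow> (real^'d \<Rightarrow> 'b::euclidean_space) set" where
  "Sob_space D k = {v. v \<in> L2_space D \<and>
     (\<forall>js. length js \<le> k \<longrightarrow> (\<exists>g. g \<in> L2_space D \<and> has_weak_deriv D js v g))}"

text \<open>Derivatives are indexed by lists of directions, so a mixed derivative is counted once for each
  ordering; this gives the usual \<open>H\<^sup>1\<close> norm for \<open>k = 1\<close> and a norm equivalent to the usual one for
  \<open>k > 1\<close>.\<close>

definition Sob_norm ::
  "(real^'d::finite) set \<Rightarrow> nat \<Rightarrow> (real^'d \<Rightarrow> 'b::euclidean_space) \<Rightarrow> real" where
  "Sob_norm D k v =
     sqrt (\<Sum>js | length js \<le> k. LINT x|lebesgue_on D. (norm (weak_deriv D js v x))\<^sup>2)"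

definition H10 :: "(real^'d::finite) set \<Rightarrow> (real^'d \<Rightarrow> 'b::euclidean_space) set" where
  "H10 D = {v. v \<in> Sob_space D 1 \<and>
     (\<exists>\<Phi> :: nat \<Rightarrow> real^'d \<Rightarrow> 'b. (\<forall>k. test_fun D (\<Phi> k)) \<and>
        (\<lambda>k. Sob_norm D 1 (\<lambda>x. v x - \<Phi> k x)) \<longlonglongrightarrow> 0)}"

definition H10_norm :: "(real^'d::finite) set \<Rightarrow> (real^'d \<Rightarrow> 'b::euclidean_space) \<Rightarrow> real" where
  "H10_norm D v = sqrt (LINT x|lebesgue_on D. (\<Sum>j\<in>UNIV. (norm (weak_deriv D [j] v x))\<^sup>2))"


section \<open>The parametrized diffusion problem\<close>

definition Gam :: "(real^'n::finite) set" where
  "Gam = {y. \<forall>n. y $ n \<in> {-1..1}}"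

definition joint_density :: "('n::finite \<Rightarrow> real \<Rightarrow> real) \<Rightarrow> real^'n \<Rightarrow> real" where
  "joint_density \<rho> y = (\<Prod>n\<in>UNIV. \<rho> n (y $ n))"

definition rho_measure :: "('n::finite \<Rightarrow> real \<Rightarrow> real) \<Rightarrow> (real^'n) measure" where
  "rho_measure \<rho> = density (lebesgue_on Gam) (\<lambda>y. ennreal (joint_density \<rho> y))"

definition bounded_probability_density :: "('n::finite \<Rightarrow> real \<Rightarrow> real) \<Rightarrow> bool" where
  "bounded_probability_density \<rho> \<longleftrightarrow>
     joint_density \<rho> \<in> borel_measurable (lebesgue_on Gam) \<and>
     (\<forall>y\<in>Gam. 0 \<le> joint_density \<rho> y) \<and>
     emeasure (rho_measure \<rho>) Gam = 1 \<and>
     (\<exists>B. AE y in lebesgue_on Gam. joint_density \<rho> y \<le> B)"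

definition energy_form ::
  "(real^'d::finite) set \<Rightarrow> (real^'d \<Rightarrow> real^'n \<Rightarrow> real) \<Rightarrow> real^'n::finite
     \<Rightarrow> (real^'d \<Rightarrow> real) \<Rightarrow> (real^'d \<Rightarrow> real) \<Rightarrow> real" where
  "energy_form D a y v w =
     (LINT x|lebesgue_on D. a x y * (\<Sum>j\<in>UNIV. weak_deriv D [j] v x * weak_deriv D [j] w x))"

definition weak_solution ::
  "(real^'d::finite) set \<Rightarrow> (real^'d \<Rightarrow> real^'n \<Rightarrow> real) \<Rightarrow> (real^'d \<Rightarrow> real^'n \<Rightarrow> real)
     \<Rightarrow> real^'n::finite \<Rightarrow> (real^'d \<Rightarrow> real) \<Rightarrow> bool" where
  "weak_solution D a f y v \<longleftrightarrow> v \<in> H10 D \<and>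
     (\<forall>w\<in>H10 D. energy_form D a y v w = (LINT x|lebesgue_on D. f x y * w x))"

text \<open>Membership in the Bochner space \<open>L\<^sup>2\<^sub>\<rho>(\<Gamma>; X)\<close>, where \<open>X\<close> is a space of functions on the spatial
  domain with norm \<open>nrm\<close>: strong measurability (almost everywhere limit of simple functions) and square
  integrability of the norm.\<close>

definition in_L2_rho ::
  "('n::finite \<Rightarrow> real \<Rightarrow> real) \<Rightarrow> (real^'d::finite \<Rightarrow> real) set \<Rightarrow> ((real^'d \<Rightarrow> real) \<Rightarrow> real)
     \<Rightarrow> (real^'n \<Rightarrow> real^'d \<Rightarrow> real) \<Rightarrow> bool" where
  "in_L2_rho \<rho> X nrm w \<longleftrightarrow>
     (AE y in rho_measure \<rho>. w y \<in> X) \<and>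
     (\<exists>S :: nat \<Rightarrow> real^'n \<Rightarrow> real^'d \<Rightarrow> real.
        (\<forall>k. finite (S k ` Gam) \<and> S k ` Gam \<subseteq> X \<and>
             (\<forall>v. {y \<in> Gam. S k y = v} \<in> sets (rho_measure \<rho>))) \<and>
        (AE y in rho_measure \<rho>. (\<lambda>k. nrm (\<lambda>x. S k y x - w y x)) \<longlonglongrightarrow> 0)) \<and>
     (\<integral>\<^sup>+ y. ennreal ((nrm (w y))\<^sup>2) \<partial>rho_measure \<rho>) < \<infinity>"

definition Bernstein_region :: "real \<Rightarrow> complex set" where
  "Bernstein_region g = {(z + inverse z) / 2 | z. 1 \<le> cmod z \<and> cmod z \<le> g}"

text \<open>Complex Frechet differentiability, at every point of the open set \<open>S\<close>, of a map with values in
  \<open>H\<^sub>0\<^sup>1(D; \<complex>)\<close>.\<close>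

definition H10_holomorphic_on ::
  "(real^'d::finite) set \<Rightarrow> (complex^'n::finite) set \<Rightarrow> (complex^'n \<Rightarrow> real^'d \<Rightarrow> complex) \<Rightarrow> bool" where
  "H10_holomorphic_on D S U \<longleftrightarrow> open S \<and> (\<forall>z\<in>S. U z \<in> H10 D) \<and>
     (\<forall>z\<in>S. \<exists>V :: 'n \<Rightarrow> real^'d \<Rightarrow> complex. (\<forall>n. V n \<in> H10 D) \<and>
        ((\<lambda>t. H10_norm D (\<lambda>x. U (z + t) x - U z x - (\<Sum>n\<in>UNIV. t $ n * V n x)) / norm t)
           \<longlongrightarrow> 0) (at 0))"

text \<open>As for \<open>analytic_on\<close>, analyticity on the closed region means holomorphy on an open neighbourhood.\<close>

definition has_analytic_extension ::
  "(real^'d::finite) set \<Rightarrow> ('n::finite \<Rightarrow> real) \<Rightarrow> (real^'n \<Rightarrow> real^'d \<Rightarrow> real) \<Rightarrow> bool" where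
  "has_analytic_extension D \<gamma> w \<longleftrightarrow>
     (\<exists>S U. H10_holomorphic_on D S U \<and>
        {z. \<forall>n. z $ n \<in> Bernstein_region (\<gamma> n)} \<subseteq> S \<and>
        (\<forall>y\<in>Gam. AE x in lebesgue_on D. U (\<chi> n. complex_of_real (y $ n)) x = complex_of_real (w y x)))"


section \<open>Finite elements\<close>

text \<open>A uniform mesh of size \<open>h\<close>: non-overlapping polytopes in the closure of \<open>D\<close>, of diameter at most
  \<open>h\<close> and containing a ball of radius \<open>\<sigma> h\<close>, with \<open>\<sigma>\<close> independent of \<open>h\<close>.  The cells are not
  required to exhaust a domain that is not polytopal.\<close>

definition uniform_mesh :: "real \<Rightarrow> real \<Rightarrow> (real^'d::finite) set \<Rightarrow> (real^'d) set set \<Rightarrow> bool" where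
  "uniform_mesh \<sigma> h D T \<longleftrightarrow> finite T \<and>
     (\<forall>c\<in>T. polytope c \<and> interior c \<subseteq> D \<and> diameter c \<le> h \<and> (\<exists>z. ball z (\<sigma> * h) \<subseteq> c)) \<and>
     pairwise (\<lambda>c c'. interior c \<inter> interior c' = {}) T"

definition polynomial_of_degree_le :: "nat \<Rightarrow> (real^'d::finite \<Rightarrow> real) \<Rightarrow> bool" where
  "polynomial_of_degree_le p P \<longleftrightarrow>
     (\<exists>q :: ('d \<Rightarrow> nat) \<Rightarrow> real. \<forall>x. P x =
        (\<Sum>e | (\<Sum>j\<in>UNIV. e j) \<le> p. q e * (\<Prod>j\<in>UNIV. (x $ j) ^ e j)))"

text \<open>\<open>\<phi> 0, \<dots>, \<phi> (M - 1)\<close> is the basis of a conforming finite element space on a uniform mesh of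
  size \<open>h\<close>: linearly independent functions in \<open>H\<^sub>0\<^sup>1(D)\<close>, polynomial on each cell, each supported in the
  cells around one point (its node), and at most \<open>n\<^sub>l\<^sub>o\<^sub>c\<close> of them (the local degrees of freedom)
  not vanishing on a given cell.\<close>

definition fe_basis ::
  "(real^'d::finite) set \<Rightarrow> real \<Rightarrow> nat \<Rightarrow> nat \<Rightarrow> real \<Rightarrow> nat \<Rightarrow> (nat \<Rightarrow> real^'d \<Rightarrow> real) \<Rightarrow> bool" where
  "fe_basis D \<sigma> p nloc h M \<phi> \<longleftrightarrow> 1 \<le> M \<and>
     (\<forall>i<M. \<phi> i \<in> H10 D) \<and>
     (\<forall>c :: nat \<Rightarrow> real. (AE x in lebesgue_on D. (\<Sum>i<M. c i * \<phi> i x) = 0) \<longrightarrow> (\<forall>i<M. c i = 0)) \<and>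
     (\<exists>T. uniform_mesh \<sigma> h D T \<and>
        (\<forall>i<M. \<exists>z. \<forall>x \<in> D - \<Union>{c \<in> T. z \<in> c}. \<phi> i x = 0) \<and>
        (\<forall>i<M. \<forall>c\<in>T. \<exists>P. polynomial_of_degree_le p P \<and> (\<forall>x\<in>interior c. \<phi> i x = P x)) \<and>
        (\<forall>c\<in>T. card {i. i < M \<and> (\<exists>x\<in>interior c. \<phi> i x \<noteq> 0)} \<le> nloc))"

definition stiffness ::
  "(real^'d::finite) set \<Rightarrow> (real^'d \<Rightarrow> real^'n \<Rightarrow> real) \<Rightarrow> nat \<Rightarrow> (nat \<Rightarrow> real^'d \<Rightarrow> real)
     \<Rightarrow> real^'n::finite \<Rightarrow> real mat" where
  "stiffness D a M \<phi> y = Matrix.mat M M (\<lambda>(i, i'). energy_form D a y (\<phi> i') (\<phi> i))"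

definition load_vec ::
  "(real^'d::finite) set \<Rightarrow> (real^'d \<Rightarrow> real^'n \<Rightarrow> real) \<Rightarrow> nat \<Rightarrow> (nat \<Rightarrow> real^'d \<Rightarrow> real)
     \<Rightarrow> real^'n::finite \<Rightarrow> real vec" where
  "load_vec D f M \<phi> y = Matrix.vec M (\<lambda>i. LINT x|lebesgue_on D. f x y * \<phi> i x)"

definition lin_sol :: "real mat \<Rightarrow> real vec \<Rightarrow> real vec" where
  "lin_sol A b = (THE c. c \<in> carrier_vec (dim_col A) \<and> mult_mat_vec A c = b)"

definition galerkin ::
  "(real^'d::finite) set \<Rightarrow> (real^'d \<Rightarrow> real^'n \<Rightarrow> real) \<Rightarrow> (real^'d \<Rightarrow> real^'n \<Rightarrow> real)
     \<Rightarrow> nat \<Rightarrow> (nat \<Rightarrow> real^'d \<Rightarrow> real) \<Rightarrow> real^'n::finite \<Rightarrow> real^'d \<Rightarrow> real" where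
  "galerkin D a f M \<phi> y x =
     (\<Sum>i<M. vec_index (lin_sol (stiffness D a M \<phi> y) (load_vec D f M \<phi> y)) i * \<phi> i x)"


section \<open>Condition number and conjugate gradients\<close>

definition vec_norm2 :: "real vec \<Rightarrow> real" where
  "vec_norm2 v = sqrt (scalar_prod v v)"

definition mat_norm2 :: "real mat \<Rightarrow> real" where
  "mat_norm2 A = Sup {vec_norm2 (mult_mat_vec A v) | v. v \<in> carrier_vec (dim_col A) \<and> vec_norm2 v \<le> 1}"

definition mat_inv :: "real mat \<Rightarrow> real mat" where
  "mat_inv A = (THE B. B \<in> carrier_mat (dim_col A) (dim_row A) \<and> inverts_mat A B \<and> inverts_mat B A)"

definition cond_number :: "real mat \<Rightarrow> real" where
  "cond_number A = mat_norm2 A * mat_norm2 (mat_inv A)"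

definition energy_norm :: "real mat \<Rightarrow> real vec \<Rightarrow> real" where
  "energy_norm A c = sqrt (scalar_prod c (mult_mat_vec A c))"

text \<open>The state is (iterate, residual, search direction).  Once the residual vanishes, \<open>x / 0 = 0\<close>
  makes the iteration stationary.\<close>

definition cg_step :: "real mat \<Rightarrow> real vec \<times> real vec \<times> real vec \<Rightarrow> real vec \<times> real vec \<times> real vec" where
  "cg_step A = (\<lambda>(x, r, p).
     let t = scalar_prod r r / scalar_prod p (mult_mat_vec A p);
         r' = r - smult_vec t (mult_mat_vec A p)
     in (x + smult_vec t p, r', r' + smult_vec (scalar_prod r' r' / scalar_prod r r) p))"

definition cg_iterate :: "real mat \<Rightarrow> real vec \<Rightarrow> real vec \<Rightarrow> nat \<Rightarrow> real vec" where
  "cg_iterate A b x0 k =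
     (let r0 = b - mult_mat_vec A x0 in fst ((cg_step A ^^ k) (x0, r0, r0)))"

definition cg_count :: "real mat \<Rightarrow> real vec \<Rightarrow> real vec \<Rightarrow> real \<Rightarrow> nat" where
  "cg_count A b x0 \<tau> = (LEAST k. energy_norm A (lin_sol A b - cg_iterate A b x0 k) \<le> \<tau>)"


section \<open>Sparse grid interpolation\<close>

definition cc_size :: "nat \<Rightarrow> nat" where
  "cc_size l = (if l = 0 then 0 else if l = 1 then 1 else 2 ^ (l - 1) + 1)"

definition cc_points :: "nat \<Rightarrow> real set" where
  "cc_points l = (if l = 0 then {} else if l = 1 then {0}
     else (\<lambda>j. - cos (pi * (real j - 1) / (real (cc_size l) - 1))) ` {1..cc_size l})"

definition lagrange_cardinal :: "nat \<Rightarrow> real \<Rightarrow> real \<Rightarrow> real" where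
  "lagrange_cardinal l x t = (\<Prod>x' \<in> cc_points l - {x}. (t - x') / (x - x'))"

text \<open>The tensor product of the operators \<open>\<U>\<^bsup>m(k\<^sub>n)\<^esup>\<close>; it is zero if some \<open>k n = 0\<close>.\<close>

definition tensor_interp :: "('n::finite \<Rightarrow> nat) \<Rightarrow> (real^'n \<Rightarrow> real) \<Rightarrow> real^'n \<Rightarrow> real" where
  "tensor_interp k v y =
     (\<Sum>q | \<forall>n. q $ n \<in> cc_points (k n). v q * (\<Prod>n\<in>UNIV. lagrange_cardinal (k n) (q $ n) (y $ n)))"

text \<open>The tensor product of the differences \<open>\<U>\<^bsup>m(l\<^sub>n)\<^esup> - \<U>\<^bsup>m(l\<^sub>n-1)\<^esup>\<close>, expanded by multilinearity.\<close>

definition tensor_difference :: "('n::finite \<Rightarrow> nat) \<Rightarrow> (real^'n \<Rightarrow> real) \<Rightarrow> real^'n \<Rightarrow> real" where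
  "tensor_difference l v y =
     (\<Sum>S\<in>UNIV. (- 1) ^ card S * tensor_interp (\<lambda>n. if n \<in> S then l n - 1 else l n) v y)"

definition sparse_interp :: "nat \<Rightarrow> (real^'n::finite \<Rightarrow> real) \<Rightarrow> real^'n \<Rightarrow> real" where
  "sparse_interp L v y =
     (\<Sum>l | (\<forall>n. 1 \<le> l n) \<and> (\<Sum>n\<in>UNIV. l n - 1) \<le> L. tensor_difference l v y)"

definition sparse_grid :: "nat \<Rightarrow> (real^'n::finite) set" where
  "sparse_grid L =
     (\<Union>l \<in> {l. (\<forall>n. 1 \<le> l n) \<and> (\<Sum>n\<in>UNIV. l n - 1) = L}. {q. \<forall>n. q $ n \<in> cc_points (l n)})"

definition new_points :: "nat \<Rightarrow> (real^'n::finite) set" where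
  "new_points L = (if L \<le> 1 then sparse_grid L else sparse_grid L - sparse_grid (L - 1))"

text \<open>\<open>\<Psi>\<^sub>L\<^sub>,\<^sub>j\<close> is indexed by the grid point \<open>q\<close> itself.  As the operator evaluates its argument only at
  points of the sparse grid, it equals the sum over \<open>q\<close> of \<open>v q\<close> times this function.\<close>

definition sparse_basis :: "nat \<Rightarrow> real^'n::finite \<Rightarrow> real^'n \<Rightarrow> real" where
  "sparse_basis L q = sparse_interp L (\<lambda>q'. if q' = q then 1 else 0)"


section \<open>The accelerated algorithm\<close>

definition start_vec ::
  "nat \<Rightarrow> nat \<Rightarrow> (real^'n::finite \<Rightarrow> real vec) \<Rightarrow> real^'n \<Rightarrow> real vec" where
  "start_vec M L c y = (if L \<le> 1 then zero_vec M
     else Matrix.vec M (\<lambda>i. \<Sum>q \<in> sparse_grid (L - 1). vec_index (c q) i * sparse_basis (L - 1) q y))"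

primrec acc_vec ::
  "(real^'n::finite \<Rightarrow> real mat) \<Rightarrow> (real^'n \<Rightarrow> real vec) \<Rightarrow> nat \<Rightarrow> real \<Rightarrow> nat \<Rightarrow> real^'n \<Rightarrow> real vec" where
  "acc_vec A b M \<tau> 0 = (\<lambda>y. zero_vec M)"
| "acc_vec A b M \<tau> (Suc L) = (\<lambda>y.
     if 1 \<le> L \<and> y \<in> sparse_grid L then acc_vec A b M \<tau> L y
     else let x0 = start_vec M (Suc L) (acc_vec A b M \<tau> L) y
          in cg_iterate (A y) (b y) x0 (cg_count (A y) (b y) x0 \<tau>))"

definition acc_iterations ::
  "(real^'n::finite \<Rightarrow> real mat) \<Rightarrow> (real^'n \<Rightarrow> real vec) \<Rightarrow> nat \<Rightarrow> real \<Rightarrow> nat \<Rightarrow> nat" where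
  "acc_iterations A b M \<tau> Lmax =
     (\<Sum>L = 1..Lmax. \<Sum>y \<in> new_points L.
        cg_count (A y) (b y) (start_vec M L (acc_vec A b M \<tau> (L - 1)) y) \<tau>)"

end

theory Submission
  imports Defs "Jordan_Normal_Form.Determinant" "HOL-Computational_Algebra.Polynomial"
    "HOL-Complex_Analysis.Conformal_Mappings"
begin

(* Merging the parent theories brings these two infixes back. *)
no_notation Matrix.vec_index (infixl "$" 100)
no_notation Matrix.scalar_prod (infix "\<bullet>" 70)

text \<open>
  The total number of iterations is bounded by the number of grid points times the largest number
  of iterations at one point, and crude estimates of both suffice, because the constants of the
  theorem leave room. Write \<open>X = ln (3 Csc / \<epsilon>)\<close>, let \<open>L\<close> be the maximal level and
  \<open>\<eta> = (sqrt \<kappa> + 1) / (sqrt \<kappa> - 1)\<close> with \<open>\<kappa> = kappabar \<epsilon>\<close>.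

  Conjugate gradients reduce the error in the energy norm by \<open>2 / \<eta>\<^sup>k\<close> after \<open>k\<close> steps
  (\<open>error_bound\<close>), so that \<open>ln (2 E / \<tau>) / ln \<eta> + 1\<close> iterations suffice if the initial error is at
  most \<open>E\<close>. The initial vectors are interpolants of vectors of bounded energy norm. The Lagrange
  polynomials at Clenshaw--Curtis points are bounded (\<open>lagrange_cardinal_bound\<close>), hence the sparse
  grid basis functions grow at most polynomially in \<open>L\<close>, and \<open>E\<close> is at most exponential in \<open>L\<close>.
  Since \<open>\<tau>\<close> is \<open>\<epsilon>\<close> up to powers of \<open>L\<close> and \<open>L\<close> is logarithmic in \<open>X\<close>, the numerator \<open>ln (2 E / \<tau>)\<close>
  is \<open>X\<close> plus lower order terms.

  The grid has at most \<open>2 ^ (L + 1) * ((L + N - 1) choose (N - 1))\<close> points, and \<open>2 ^ L\<close> is at most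
  \<open>2 * (X / (r * N)) ^ N\<close>. The product of both estimates has the same form as the claimed bound,
  with the leading constant \<open>4 / fact (N - 1)\<close> instead of
  \<open>2 ^ N * (e / (N * ln 2)) ^ (N - 1) * 2 * (2 powr (1 / N) - 1)\<close>. The former is strictly smaller
  (\<open>grid_constant_less\<close>; for \<open>N = 1\<close> the grid is counted more exactly), and the gap absorbs all
  terms of lower order (\<open>claimed_bound_eventually\<close>).

  One term is not obviously of lower order: the additional iteration per point that comes from
  rounding up. It is at most \<open>1 / ln \<eta>\<close> if \<open>\<eta> \<le> e\<close>, so \<open>\<kappa>\<close> must not be close to \<open>1\<close>. In fact \<open>\<kappa>\<close>
  tends to infinity as the mesh is refined (\<open>cond_unbounded\<close>), except when \<open>u\<close> vanishes for all
  parameters. The basis functions are supported in sets of diameter of the order of the mesh size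
  \<open>h\<close>, and the Poincare inequality there shows that the squared norm of a Galerkin solution is at
  most a constant times \<open>h\<^sup>2 \<kappa>\<close>. If \<open>\<kappa>\<close> remained bounded along some sequence of mesh sizes, the
  Galerkin solutions would tend to zero, so the solution \<open>u\<close> would vanish almost everywhere for
  the probability measure; but \<open>u\<close> depends analytically on the parameter, so its zeros form a null
  set unless \<open>u\<close> is zero throughout. In that exceptional case all load vectors vanish and there
  are no iterations at all (\<open>acc_iterations_zero\<close>).

  The parameters \<open>h\<close>, \<open>Lmax\<close> and \<open>tau\<close> satisfy the three accuracy inequalities, which makes their
  iteration number an upper bound of the minimum \<open>Kmin\<close>.
\<close>

section \<open>Conjugate gradients: optimality and the Chebyshev estimate\<close>

text \<open>Symmetry is expressed by the bilinear form because the algorithm only sees the matrix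
  through its products with vectors.\<close>

definition spd_mat :: "nat \<Rightarrow> real mat \<Rightarrow> bool" where
  "spd_mat n A \<longleftrightarrow> A \<in> carrier_mat n n \<and>
     (\<forall>v\<in>carrier_vec n. \<forall>w\<in>carrier_vec n. scalar_prod v (A *\<^sub>v w) = scalar_prod (A *\<^sub>v v) w) \<and>
     (\<forall>v\<in>carrier_vec n. v \<noteq> 0\<^sub>v n \<longrightarrow> 0 < scalar_prod v (A *\<^sub>v v))"

text \<open>A nonnegative quadratic polynomial has a nonpositive discriminant. For a nonnegative
  symmetric form this is the Cauchy--Schwarz inequality.\<close>

lemma discriminant_bound:
  fixes a b c :: real
  assumes "\<And>t. 0 \<le> a + 2 * t * b + t\<^sup>2 * c" "0 \<le> c"
  shows "b\<^sup>2 \<le> a * c"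
proof (cases "c = 0")
  case True
  have "b = 0"
  proof (rule ccontr)
    assume "b \<noteq> 0"
    with assms(1)[of "- (a + 1) / (2 * b)"] True assms(1)[of 0] show False by (simp add: field_simps)
  qed
  then show ?thesis using True by simp
next
  case False
  then have "0 < c" using assms(2) by simp
  have "0 \<le> a + 2 * (- b / c) * b + (- b / c)\<^sup>2 * c" by (rule assms(1))
  also have "\<dots> = a - b\<^sup>2 / c" using \<open>0 < c\<close> by (simp add: power2_eq_square field_simps)
  finally show ?thesis using \<open>0 < c\<close> by (simp add: field_simps)
qed

locale spd =
  fixes n :: nat and A :: "real mat"
  assumes spd_mat: "spd_mat n A"
begin

abbreviation V where "V \<equiv> carrier_vec n :: real vec set"
abbreviation ip :: "real vec \<Rightarrow> real vec \<Rightarrow> real" where "ip \<equiv> scalar_prod"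

lemma carrier_A: "A \<in> carrier_mat n n"
  using spd_mat by (simp add: spd_mat_def)

lemma A_closed [simp]: "v \<in> V \<Longrightarrow> A *\<^sub>v v \<in> V"
  using carrier_A by (rule mult_mat_vec_carrier)

lemma A_sym: "v \<in> V \<Longrightarrow> w \<in> V \<Longrightarrow> ip v (A *\<^sub>v w) = ip (A *\<^sub>v v) w"
  using spd_mat by (simp add: spd_mat_def)

lemma A_pos: "v \<in> V \<Longrightarrow> v \<noteq> 0\<^sub>v n \<Longrightarrow> 0 < ip v (A *\<^sub>v v)"
  using spd_mat unfolding spd_mat_def by blast

lemma ip_comm: "v \<in> V \<Longrightarrow> w \<in> V \<Longrightarrow> ip v w = ip w v"
  by (rule comm_scalar_prod)

lemma ip_add_left: "u \<in> V \<Longrightarrow> v \<in> V \<Longrightarrow> w \<in> V \<Longrightarrow> ip (u + v) w = ip u w + ip v w"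
  by (rule add_scalar_prod_distrib)
lemma ip_add_right: "u \<in> V \<Longrightarrow> v \<in> V \<Longrightarrow> w \<in> V \<Longrightarrow> ip u (v + w) = ip u v + ip u w"
  by (rule scalar_prod_add_distrib)
lemma ip_diff_left: "u \<in> V \<Longrightarrow> v \<in> V \<Longrightarrow> w \<in> V \<Longrightarrow> ip (u - v) w = ip u w - ip v w"
  by (rule minus_scalar_prod_distrib)
lemma ip_diff_right: "u \<in> V \<Longrightarrow> v \<in> V \<Longrightarrow> w \<in> V \<Longrightarrow> ip u (v - w) = ip u v - ip u w"
  by (rule scalar_prod_minus_distrib)
lemma ip_smult_left: "u \<in> V \<Longrightarrow> v \<in> V \<Longrightarrow> ip (c \<cdot>\<^sub>v u) v = c * ip u v"
  by (rule smult_scalar_prod_distrib)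
lemma ip_smult_right: "u \<in> V \<Longrightarrow> v \<in> V \<Longrightarrow> ip u (c \<cdot>\<^sub>v v) = c * ip u v"
  by (rule scalar_prod_smult_distrib)
lemma ip_zero_right: "v \<in> V \<Longrightarrow> ip v (0\<^sub>v n) = 0"
  by (rule scalar_prod_right_zero)

lemma A_add: "u \<in> V \<Longrightarrow> v \<in> V \<Longrightarrow> A *\<^sub>v (u + v) = A *\<^sub>v u + A *\<^sub>v v"
  using carrier_A by (rule mult_add_distrib_mat_vec)
lemma A_diff: "u \<in> V \<Longrightarrow> v \<in> V \<Longrightarrow> A *\<^sub>v (u - v) = A *\<^sub>v u - A *\<^sub>v v"
  using carrier_A by (rule mult_minus_distrib_mat_vec)
lemma A_smult: "u \<in> V \<Longrightarrow> A *\<^sub>v (c \<cdot>\<^sub>v u) = c \<cdot>\<^sub>v (A *\<^sub>v u)"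
  using carrier_A by (rule mult_mat_vec)
lemma A_zero: "A *\<^sub>v 0\<^sub>v n = 0\<^sub>v n"
  using A_smult[of "0\<^sub>v n" 0] carrier_A by (intro eq_vecI) auto

lemma ip_self_pos: "v \<in> V \<Longrightarrow> v \<noteq> 0\<^sub>v n \<Longrightarrow> 0 < ip v v"
proof -
  assume v: "v \<in> V" "v \<noteq> 0\<^sub>v n"
  then obtain i where i: "i < n" "vec_index v i \<noteq> 0"
    by (metis carrier_vecD eq_vecI index_zero_vec(1) index_zero_vec(2))
  have "0 < (\<Sum>i<n. vec_index v i * vec_index v i)"
    by (rule sum_pos2[of _ i]) (use i in \<open>auto simp: zero_less_mult_iff linorder_neq_iff\<close>)
  then show ?thesis using v by (simp add: scalar_prod_def atLeast0LessThan)
qed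

lemma A_nonneg: "v \<in> V \<Longrightarrow> 0 \<le> ip v (A *\<^sub>v v)"
  using A_pos[of v] by (cases "v = 0\<^sub>v n") (auto simp: A_zero ip_zero_right)

lemmas ip_expand = ip_add_left ip_add_right ip_diff_left ip_diff_right ip_smult_left ip_smult_right
  A_add A_diff A_smult

lemma energy_Cauchy_Schwarz:
  "v \<in> V \<Longrightarrow> w \<in> V \<Longrightarrow> (ip v (A *\<^sub>v w))\<^sup>2 \<le> ip v (A *\<^sub>v v) * ip w (A *\<^sub>v w)"
proof (rule discriminant_bound)
  fix t :: real assume vw: "v \<in> V" "w \<in> V"
  then have "ip (v + t \<cdot>\<^sub>v w) (A *\<^sub>v (v + t \<cdot>\<^sub>v w))
      = ip v (A *\<^sub>v v) + 2 * t * ip v (A *\<^sub>v w) + t\<^sup>2 * ip w (A *\<^sub>v w)"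
    using A_sym[of v w] ip_comm[of w "A *\<^sub>v v"] by (simp add: ip_expand power2_eq_square algebra_simps)
  then show "0 \<le> ip v (A *\<^sub>v v) + 2 * t * ip v (A *\<^sub>v w) + t\<^sup>2 * ip w (A *\<^sub>v w)"
    using A_nonneg[of "v + t \<cdot>\<^sub>v w"] vw by simp
qed (simp add: A_nonneg)

end

locale cg_run = spd +
  fixes b x0 xs :: "real vec"
  assumes b: "b \<in> V" and x0: "x0 \<in> V" and xs: "xs \<in> V" and A_xs: "A *\<^sub>v xs = b"
begin

definition st where "st k = (cg_step A ^^ k) (x0, b - A *\<^sub>v x0, b - A *\<^sub>v x0)"
definition x where "x k = fst (st k)"
definition r where "r k = fst (snd (st k))"
definition p where "p k = snd (snd (st k))"
definition t where "t k = ip (r k) (r k) / ip (p k) (A *\<^sub>v p k)"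
definition be where "be k = ip (r (Suc k)) (r (Suc k)) / ip (r k) (r k)"

lemma x_eq: "x k = cg_iterate A b x0 k"
  by (simp add: x_def st_def cg_iterate_def Let_def)

lemma x_0: "x 0 = x0" and r_0: "r 0 = b - A *\<^sub>v x0" and p_0: "p 0 = r 0"
  by (simp_all add: x_def r_def p_def st_def)

lemma x_Suc: "x (Suc k) = x k + t k \<cdot>\<^sub>v p k"
  and r_Suc: "r (Suc k) = r k - t k \<cdot>\<^sub>v (A *\<^sub>v p k)"
  and p_Suc: "p (Suc k) = r (Suc k) + be k \<cdot>\<^sub>v p k"
  by (simp_all add: x_def r_def p_def t_def be_def st_def cg_step_def Let_def split_beta)

lemma closed [simp]: "x k \<in> V" "r k \<in> V" "p k \<in> V"
proof -
  have "x k \<in> V \<and> r k \<in> V \<and> p k \<in> V"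
    by (induction k) (use x0 b in \<open>auto simp: x_0 r_0 p_0 x_Suc r_Suc p_Suc\<close>)
  then show "x k \<in> V" "r k \<in> V" "p k \<in> V" by auto
qed

lemma dims [simp]: "dim_vec (x k) = n" "dim_vec (r k) = n" "dim_vec (p k) = n" "dim_row A = n" "dim_col A = n"
    "dim_vec xs = n" "dim_vec x0 = n" "dim_vec b = n"
  using closed[of k] carrier_A xs x0 b unfolding carrier_vec_def carrier_mat_def by blast+

lemma residual: "r k = A *\<^sub>v (xs - x k)"
proof (induction k)
  case 0
  then show ?case using x0 xs by (simp add: r_0 x_0 A_diff A_xs)
next
  case (Suc k)
  have "r (Suc k) = A *\<^sub>v (xs - x k) - t k \<cdot>\<^sub>v (A *\<^sub>v p k)" by (simp add: r_Suc Suc)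
  also have "\<dots> = A *\<^sub>v (xs - x k - t k \<cdot>\<^sub>v p k)" using xs by (simp add: A_diff A_smult)
  also have "xs - x k - t k \<cdot>\<^sub>v p k = xs - x (Suc k)"
    unfolding x_Suc by (intro eq_vecI) auto
  finally show ?case .
qed

lemma error_zero: "r k = 0\<^sub>v n \<Longrightarrow> xs - x k = 0\<^sub>v n"
proof (rule ccontr)
  assume "r k = 0\<^sub>v n" "xs - x k \<noteq> 0\<^sub>v n"
  then show False using A_pos[of "xs - x k"] residual[of k] xs by (simp add: ip_zero_right)
qed

lemma stationary: "r k = 0\<^sub>v n \<Longrightarrow> r (k + j) = 0\<^sub>v n"
proof (induction j)
  case (Suc j)
  then have "t (k + j) = 0" by (simp add: t_def ip_zero_right)
  then show ?case using Suc by (auto simp: r_Suc intro!: eq_vecI)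
qed simp

text \<open>As long as no residual vanishes, \<open>W k\<close> is the Krylov space spanned by the first \<open>k\<close> search
  directions; the recursive form makes all arguments about it inductions on \<open>k\<close>.\<close>

primrec W :: "nat \<Rightarrow> real vec set" where
  "W 0 = {0\<^sub>v n}"
| "W (Suc k) = {w + c \<cdot>\<^sub>v p k | w c. w \<in> W k}"

lemma W_closed: "w \<in> W k \<Longrightarrow> w \<in> V"
  by (induction k arbitrary: w) auto

lemma W_zero: "0\<^sub>v n \<in> W k"
proof (induction k)
  case (Suc k)
  have "0\<^sub>v n = 0\<^sub>v n + 0 \<cdot>\<^sub>v p k" by (intro eq_vecI) auto
  with Suc show ?case unfolding W.simps(2) by blast
qed simp

lemma W_Suc: "w \<in> W k \<Longrightarrow> w \<in> W (Suc k)"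
proof -
  assume w: "w \<in> W k"
  have "w = w + 0 \<cdot>\<^sub>v p k" using W_closed[OF w] by (intro eq_vecI) auto
  with w show ?thesis unfolding W.simps(2) by blast
qed

lemma W_add: "v \<in> W k \<Longrightarrow> w \<in> W k \<Longrightarrow> v + w \<in> W k"
proof (induction k arbitrary: v w)
  case (Suc k)
  then obtain v' w' c d where *: "v = v' + c \<cdot>\<^sub>v p k" "w = w' + d \<cdot>\<^sub>v p k" "v' \<in> W k" "w' \<in> W k"
    by auto
  have "v + w = (v' + w') + (c + d) \<cdot>\<^sub>v p k"
    using *(3,4)[THEN W_closed] by (intro eq_vecI) (auto simp: *(1,2) algebra_simps)
  then show ?case using Suc.IH[OF *(3,4)] by auto
qed simp

lemma W_smult: "w \<in> W k \<Longrightarrow> a \<cdot>\<^sub>v w \<in> W k"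
proof (induction k arbitrary: w)
  case (Suc k)
  then obtain w' c where *: "w = w' + c \<cdot>\<^sub>v p k" "w' \<in> W k" by auto
  have "a \<cdot>\<^sub>v w = a \<cdot>\<^sub>v w' + (a * c) \<cdot>\<^sub>v p k"
    using *(2)[THEN W_closed] by (intro eq_vecI) (auto simp: *(1) algebra_simps)
  then show ?case using Suc.IH[OF *(2)] by auto
qed (auto intro!: eq_vecI)

lemma W_diff: "v \<in> W k \<Longrightarrow> w \<in> W k \<Longrightarrow> v - w \<in> W k"
proof -
  assume vw: "v \<in> W k" "w \<in> W k"
  have "v - w = v + (-1) \<cdot>\<^sub>v w" using vw[THEN W_closed] by (intro eq_vecI) auto
  then show ?thesis using vw by (simp add: W_add W_smult)
qed

lemma p_in_W: "p k \<in> W (Suc k)"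
proof -
  have "p k = 0\<^sub>v n + 1 \<cdot>\<^sub>v p k" by (intro eq_vecI) auto
  then show ?thesis using W_zero[of k] unfolding W.simps(2) by blast
qed

lemma x_in_W: "x k - x 0 \<in> W k"
proof (induction k)
  case 0
  show ?case by (auto intro!: eq_vecI)
next
  case (Suc k)
  have "x (Suc k) - x 0 = (x k - x 0) + t k \<cdot>\<^sub>v p k"
    unfolding x_Suc by (intro eq_vecI) auto
  with Suc show ?case by auto
qed

text \<open>The classical relations of conjugate gradients, which are only provable together: the
  residual is orthogonal to the Krylov space, the search direction is conjugate to it, and \<open>A\<close>
  maps it into the next one. Orthogonality of the new residual to \<open>p k\<close> is the choice of the step
  length, conjugacy of the new direction to \<open>p k\<close> is the choice of \<open>be k\<close>, and everything else
  follows from the relations one step before and the recursions.\<close>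

lemma invariants:
  assumes "\<And>j. j < k \<Longrightarrow> r j \<noteq> 0\<^sub>v n"
  shows "(\<forall>w\<in>W k. ip (r k) w = 0) \<and> (\<forall>w\<in>W k. ip (p k) (A *\<^sub>v w) = 0) \<and>
    p k - r k \<in> W k \<and> (\<forall>w\<in>W k. A *\<^sub>v w \<in> W (Suc k))"
  using assms
proof (induction k)
  case 0
  have "r 0 - r 0 = 0\<^sub>v n" by (intro eq_vecI) auto
  then show ?case using W_zero[of "Suc 0"] by (auto simp: ip_zero_right A_zero p_0 simp del: W.simps(2))
next
  case (Suc k)
  note IH1 = Suc.IH[OF Suc.prems[OF less_SucI], THEN conjunct1, rule_format]
    and IH2 = Suc.IH[OF Suc.prems[OF less_SucI], THEN conjunct2, THEN conjunct1, rule_format]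
    and IH3 = Suc.IH[OF Suc.prems[OF less_SucI], THEN conjunct2, THEN conjunct2, THEN conjunct1]
    and IH4 = Suc.IH[OF Suc.prems[OF less_SucI], THEN conjunct2, THEN conjunct2, THEN conjunct2, rule_format]
  have r0: "r k \<noteq> 0\<^sub>v n" by (rule Suc.prems) simp
  have rr: "0 < ip (r k) (r k)" using r0 by (intro ip_self_pos) auto
  have rp: "ip (r k) (p k) = ip (r k) (r k)"
    using IH1[OF _ IH3] by (simp add: ip_diff_right)
  have p0: "p k \<noteq> 0\<^sub>v n" using rr rp by (auto simp: ip_zero_right)
  have pp: "0 < ip (p k) (A *\<^sub>v p k)" using p0 by (intro A_pos) auto
  have t0: "0 < t k" using rr pp by (simp add: t_def)
  have tpp: "t k * ip (p k) (A *\<^sub>v p k) = ip (r k) (r k)" using pp by (simp add: t_def)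
  have rW: "r k \<in> W (Suc k)"
  proof -
    have "r k = p k - (p k - r k)" by (intro eq_vecI) auto
    also have "\<dots> \<in> W (Suc k)" by (intro W_diff p_in_W W_Suc IH3) auto
    finally show ?thesis .
  qed
  have orth: "ip (r (Suc k)) w = 0" if w: "w \<in> W (Suc k)" for w
  proof -
    from w obtain w' c where *: "w = w' + c \<cdot>\<^sub>v p k" "w' \<in> W k" by auto
    have w': "w' \<in> V" using *(2) by (rule W_closed)
    have "ip (r (Suc k)) w' = ip (r k) w' - t k * ip (p k) (A *\<^sub>v w')"
      using w' by (simp add: r_Suc ip_expand A_sym)
    also have "\<dots> = 0" using *(2) IH1 IH2 by simp
    finally have 1: "ip (r (Suc k)) w' = 0" .
    have "ip (r (Suc k)) (p k) = ip (r k) (p k) - t k * ip (p k) (A *\<^sub>v p k)"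
      by (simp add: r_Suc ip_expand A_sym)
    also have "\<dots> = 0" using rp tpp by simp
    finally show ?thesis using 1 w' by (simp add: * ip_expand)
  qed
  have conj: "ip (p (Suc k)) (A *\<^sub>v w) = 0" if w: "w \<in> W (Suc k)" for w
  proof -
    from w obtain w' c where *: "w = w' + c \<cdot>\<^sub>v p k" "w' \<in> W k" by auto
    have w': "w' \<in> V" using *(2) by (rule W_closed)
    have 1: "ip (p (Suc k)) (A *\<^sub>v w') = 0"
      using orth[OF IH4[OF _ *(2)]] IH2[OF _ *(2)] w' by (simp add: p_Suc ip_expand)
    have "t k \<cdot>\<^sub>v (A *\<^sub>v p k) = r k - r (Suc k)"
      unfolding r_Suc by (intro eq_vecI) auto
    then have "t k * ip (r (Suc k)) (A *\<^sub>v p k) = ip (r (Suc k)) (r k) - ip (r (Suc k)) (r (Suc k))"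
      using closed by (metis A_closed ip_diff_right ip_smult_right)
    also have "\<dots> = - ip (r (Suc k)) (r (Suc k))" using orth[OF rW] by simp
    finally have "t k * ip (p (Suc k)) (A *\<^sub>v p k)
        = - ip (r (Suc k)) (r (Suc k)) + be k * (t k * ip (p k) (A *\<^sub>v p k))"
      by (simp add: p_Suc ip_expand algebra_simps)
    also have "\<dots> = 0" using rr by (simp add: tpp be_def)
    finally have "ip (p (Suc k)) (A *\<^sub>v p k) = 0" using t0 by simp
    then show ?thesis using 1 w' by (simp add: * ip_expand)
  qed
  have pr: "p (Suc k) - r (Suc k) = be k \<cdot>\<^sub>v p k"
    unfolding p_Suc by (intro eq_vecI) auto
  have rW': "r (Suc k) \<in> W (Suc (Suc k))"
  proof -
    have "r (Suc k) = p (Suc k) - be k \<cdot>\<^sub>v p k"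
      unfolding p_Suc by (intro eq_vecI) auto
    also have "\<dots> \<in> W (Suc (Suc k))" by (intro W_diff p_in_W W_Suc W_smult)
    finally show ?thesis .
  qed
  have Ap: "A *\<^sub>v p k \<in> W (Suc (Suc k))"
  proof -
    have "A *\<^sub>v p k = (1 / t k) \<cdot>\<^sub>v (r k - r (Suc k))"
      unfolding r_Suc using t0 by (intro eq_vecI) auto
    also have "\<dots> \<in> W (Suc (Suc k))" by (intro W_smult W_diff rW' W_Suc[OF rW])
    finally show ?thesis .
  qed
  have AW: "A *\<^sub>v w \<in> W (Suc (Suc k))" if w: "w \<in> W (Suc k)" for w
  proof -
    from w obtain w' c where *: "w = w' + c \<cdot>\<^sub>v p k" "w' \<in> W k" by auto
    have w': "w' \<in> V" using *(2) by (rule W_closed)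
    have "A *\<^sub>v w = A *\<^sub>v w' + c \<cdot>\<^sub>v (A *\<^sub>v p k)" using w' by (simp add: * A_add A_smult)
    then show ?thesis using W_add[OF W_Suc[OF IH4[OF _ *(2)]] W_smult[OF Ap]] by simp
  qed
  show ?case using orth conj AW pr W_smult[OF p_in_W] by auto
qed

text \<open>The \<open>k\<close>-th error is conjugate to the Krylov space, so it is the shortest vector in the
  energy norm among all initial errors shifted by that space (Pythagoras).\<close>

lemma optimality:
  assumes "\<And>j. j < k \<Longrightarrow> r j \<noteq> 0\<^sub>v n" and w: "w \<in> W k"
  shows "ip (xs - x k) (A *\<^sub>v (xs - x k)) \<le> ip (xs - x 0 - w) (A *\<^sub>v (xs - x 0 - w))"
proof -
  define d where "d = x k - x 0 - w"
  have dW: "d \<in> W k" unfolding d_def by (intro W_diff x_in_W w)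
  have [simp]: "d \<in> V" "w \<in> V" using dW w by (auto intro: W_closed)
  define e where "e = xs - x k"
  have [simp]: "e \<in> V" using xs by (simp add: e_def)
  have eq: "xs - x 0 - w = e + d"
    unfolding d_def e_def by (intro eq_vecI) (auto simp: carrier_vecD[OF W_closed[OF w]])
  have "ip (r k) d = 0" using invariants[OF assms(1)] dW by auto
  then have 1: "ip (A *\<^sub>v e) d = 0" by (simp add: residual e_def)
  have 2: "ip e (A *\<^sub>v d) = 0" "ip d (A *\<^sub>v e) = 0"
    using 1 ip_comm[of d "A *\<^sub>v e"] A_sym[of e d] by simp_all
  have "ip (e + d) (A *\<^sub>v (e + d)) = ip e (A *\<^sub>v e) + ip d (A *\<^sub>v d)" by (simp add: ip_expand 2)
  then show ?thesis using A_nonneg[of d] unfolding eq by (simp add: e_def)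
qed

end

text \<open>\<open>lo\<close> and \<open>hi\<close> stand for bounds of the spectrum of \<open>A\<close>, expressed by quadratic forms. With
  \<open>B\<close> the affine function of \<open>A\<close> that maps \<open>[lo, hi]\<close> onto \<open>[-1, 1]\<close> and with \<open>ch\<close> its value at
  \<open>0\<close>, the classical argument compares the error with the Chebyshev polynomial \<open>T\<^sub>k(B) / T\<^sub>k(ch)\<close>,
  whose norm is controlled by \<open>\<bar>T\<^sub>k\<bar> \<le> 1\<close> on the spectrum.\<close>

locale cg_spectral = cg_run +
  fixes lo hi :: real
  assumes lo: "0 < lo" "lo < hi"
    and lower: "\<And>v. v \<in> V \<Longrightarrow> lo * ip v (A *\<^sub>v v) \<le> ip (A *\<^sub>v v) (A *\<^sub>v v)"
    and upper: "\<And>v. v \<in> V \<Longrightarrow> ip (A *\<^sub>v v) (A *\<^sub>v v) \<le> hi * ip v (A *\<^sub>v v)"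
begin

definition en where "en v w = ip v (A *\<^sub>v w)"
definition ch where "ch = (hi + lo) / (hi - lo)"
definition B where "B v = ch \<cdot>\<^sub>v v - (2 / (hi - lo)) \<cdot>\<^sub>v (A *\<^sub>v v)"
definition Q where "Q v = v - B (B v)"

lemma B_closed [simp]: "v \<in> V \<Longrightarrow> B v \<in> V" by (simp add: B_def)
lemma Q_closed [simp]: "v \<in> V \<Longrightarrow> Q v \<in> V" by (simp add: Q_def)

lemma en_sym: "v \<in> V \<Longrightarrow> w \<in> V \<Longrightarrow> en v w = en w v"
  using A_sym[of v w] ip_comm[of w "A *\<^sub>v v"] by (simp add: en_def)

lemma en_linear:
  "u \<in> V \<Longrightarrow> v \<in> V \<Longrightarrow> w \<in> V \<Longrightarrow> en (u + v) w = en u w + en v w"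
  "u \<in> V \<Longrightarrow> v \<in> V \<Longrightarrow> w \<in> V \<Longrightarrow> en u (v + w) = en u v + en u w"
  "u \<in> V \<Longrightarrow> v \<in> V \<Longrightarrow> w \<in> V \<Longrightarrow> en (u - v) w = en u w - en v w"
  "u \<in> V \<Longrightarrow> v \<in> V \<Longrightarrow> w \<in> V \<Longrightarrow> en u (v - w) = en u v - en u w"
  "u \<in> V \<Longrightarrow> v \<in> V \<Longrightarrow> en (c \<cdot>\<^sub>v u) v = c * en u v"
  "u \<in> V \<Longrightarrow> v \<in> V \<Longrightarrow> en u (c \<cdot>\<^sub>v v) = c * en u v"
  by (simp_all add: en_def ip_expand)

lemma en_A: "v \<in> V \<Longrightarrow> w \<in> V \<Longrightarrow> en (A *\<^sub>v v) w = en v (A *\<^sub>v w)"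
  by (simp add: en_def A_sym)

lemma en_B: "v \<in> V \<Longrightarrow> w \<in> V \<Longrightarrow> en (B v) w = en v (B w)"
  by (simp add: B_def en_linear en_A)

lemma B_linear:
  "u \<in> V \<Longrightarrow> v \<in> V \<Longrightarrow> B (u + v) = B u + B v"
  "u \<in> V \<Longrightarrow> v \<in> V \<Longrightarrow> B (u - v) = B u - B v"
  "u \<in> V \<Longrightarrow> B (c \<cdot>\<^sub>v u) = c \<cdot>\<^sub>v B u"
  by (auto simp: B_def A_add A_diff A_smult algebra_simps carrier_vecD intro!: eq_vecI)

text \<open>The operator \<open>Q = 1 - B\<^sup>2\<close> is a positive multiple of \<open>(A - lo)(hi - A)\<close>, a product of two
  commuting nonnegative operators. The identity
  \<open>(hi - A)(A - lo)\<^sup>2 + (A - lo)(hi - A)\<^sup>2 = (hi - lo)(A - lo)(hi - A)\<close> writes it as a sum of two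
  terms that are nonnegative by the assumptions, applied to \<open>(A - lo) v\<close> and \<open>(hi - A) v\<close>.\<close>

lemma Q_nonneg: assumes v: "v \<in> V" shows "0 \<le> en v (Q v)"
proof -
  define a0 where "a0 = en v v"
  define a1 where "a1 = en v (A *\<^sub>v v)"
  define a2 where "a2 = en v (A *\<^sub>v (A *\<^sub>v v))"
  define a3 where "a3 = en v (A *\<^sub>v (A *\<^sub>v (A *\<^sub>v v)))"
  have bounds: "lo * en w w \<le> en w (A *\<^sub>v w)" "en w (A *\<^sub>v w) \<le> hi * en w w" if "w \<in> V" for w
    using lower[OF that] upper[OF that] that by (simp_all add: en_def A_sym)
  define P where "P = A *\<^sub>v v - lo \<cdot>\<^sub>v v"
  define R where "R = hi \<cdot>\<^sub>v v - A *\<^sub>v v"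
  have [simp]: "P \<in> V" "R \<in> V" using v by (simp_all add: P_def R_def)
  have PP: "en P P = a2 - 2 * lo * a1 + lo\<^sup>2 * a0" "en P (A *\<^sub>v P) = a3 - 2 * lo * a2 + lo\<^sup>2 * a1"
    and RR: "en R R = a2 - 2 * hi * a1 + hi\<^sup>2 * a0" "en R (A *\<^sub>v R) = a3 - 2 * hi * a2 + hi\<^sup>2 * a1"
    using v by (simp_all add: P_def R_def en_linear A_diff A_smult en_A a0_def a1_def a2_def a3_def
        power2_eq_square algebra_simps)
  have "0 \<le> (hi * en P P - en P (A *\<^sub>v P)) + (en R (A *\<^sub>v R) - lo * en R R)"
    using bounds(2)[of P] bounds(1)[of R] by simp
  also have "\<dots> = (hi - lo) * ((hi + lo) * a1 - a2 - lo * hi * a0)"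
    unfolding PP RR by (simp add: power2_eq_square algebra_simps)
  finally have *: "0 \<le> (hi + lo) * a1 - a2 - lo * hi * a0"
    using lo by (simp add: zero_le_mult_iff)
  have "en v (Q v) = a0 - (ch\<^sup>2 * a0 - 2 * ch * (2 / (hi - lo)) * a1 + (2 / (hi - lo))\<^sup>2 * a2)"
    using v by (simp add: Q_def B_def en_linear A_diff A_smult a0_def a1_def a2_def
        power2_eq_square algebra_simps)
  also have "\<dots> = (2 / (hi - lo))\<^sup>2 * ((hi + lo) * a1 - a2 - lo * hi * a0)"
    using lo by (simp add: ch_def power2_eq_square divide_simps) (simp add: algebra_simps)
  finally show ?thesis using * by simp
qed

text \<open>The Chebyshev polynomials of the first and second kind, applied to the initial error:
  \<open>TS k = (T\<^sub>k\<^sub>+\<^sub>1(B) e, U\<^sub>k(B) e)\<close>. The simultaneous recursion of both kinds is the one for which the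
  Pell equation is visible.\<close>

primrec TS :: "nat \<Rightarrow> real vec \<times> real vec" where
  "TS 0 = (B (xs - x0), xs - x0)"
| "TS (Suc k) = (B (fst (TS k)) - Q (snd (TS k)), fst (TS k) + B (snd (TS k)))"

lemma TS_closed [simp]: "fst (TS k) \<in> V" "snd (TS k) \<in> V"
proof -
  have "fst (TS k) \<in> V \<and> snd (TS k) \<in> V" by (induction k) (use xs x0 in auto)
  then show "fst (TS k) \<in> V" "snd (TS k) \<in> V" by auto
qed

text \<open>This is the Pell equation \<open>T\<^sub>k\<^sub>+\<^sub>1(x)\<^sup>2 + (1 - x\<^sup>2) U\<^sub>k(x)\<^sup>2 = 1\<close> at \<open>x = B\<close>. As \<open>Q\<close> is
  nonnegative, it bounds \<open>T\<^sub>k\<^sub>+\<^sub>1(B) e\<close> by \<open>e\<close> in the energy norm, which is the part of the spectral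
  theorem that the classical argument uses.\<close>

lemma TS_energy:
  "en (fst (TS k)) (fst (TS k)) + en (snd (TS k)) (Q (snd (TS k))) = en (xs - x0) (xs - x0)"
proof (induction k)
  case 0
  then show ?case using xs x0 by (simp add: Q_def en_linear en_B)
next
  case (Suc k)
  define t s where "t = fst (TS k)" and "s = snd (TS k)"
  have [simp]: "t \<in> V" "s \<in> V" by (simp_all add: t_def s_def)
  have sym: "en s t = en t s" "en s (B t) = en t (B s)" "en s (B (B t)) = en t (B (B s))"
    "en s (B (B (B t))) = en t (B (B (B s)))"
    by (simp_all add: en_sym[of s] en_B)
  have "en (B t - Q s) (B t - Q s) + en (t + B s) (Q (t + B s)) = en t t + en s (Q s)"
    by (simp add: Q_def en_linear B_linear en_B sym)
  then show ?case using Suc by (simp add: t_def s_def)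
qed

text \<open>A vector \<open>P(A) e\<close>, with \<open>P\<close> a polynomial of degree at most \<open>j\<close> and \<open>P(0) = c\<close>, has this
  form. Keeping only \<open>c\<close> avoids polynomials of matrices.\<close>

definition form where "form j c v \<longleftrightarrow> (\<exists>w\<in>W j. v = c \<cdot>\<^sub>v (xs - x0) - w)"

lemma form_add: "form j c v \<Longrightarrow> form j d w \<Longrightarrow> form j (c + d) (v + w)"
  unfolding form_def
proof (elim bexE)
  fix a b assume *: "a \<in> W j" "b \<in> W j" "v = c \<cdot>\<^sub>v (xs - x0) - a" "w = d \<cdot>\<^sub>v (xs - x0) - b"
  show "\<exists>w'\<in>W j. v + w = (c + d) \<cdot>\<^sub>v (xs - x0) - w'"
    by (rule bexI[OF _ W_add[OF *(1,2)]], intro eq_vecI)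
      (use *(1,2)[THEN W_closed] in \<open>auto simp: *(3,4) algebra_simps\<close>)
qed

lemma form_smult: "form j c v \<Longrightarrow> form j (a * c) (a \<cdot>\<^sub>v v)"
  unfolding form_def
proof (elim bexE)
  fix b assume *: "b \<in> W j" "v = c \<cdot>\<^sub>v (xs - x0) - b"
  show "\<exists>w'\<in>W j. a \<cdot>\<^sub>v v = (a * c) \<cdot>\<^sub>v (xs - x0) - w'"
    by (rule bexI[OF _ W_smult[OF *(1), of a]], intro eq_vecI)
      (use *(1)[THEN W_closed] in \<open>auto simp: *(2) algebra_simps\<close>)
qed

lemma form_diff: "form j c v \<Longrightarrow> form j d w \<Longrightarrow> form j (c - d) (v - w)"
proof -
  assume *: "form j c v" "form j d w"
  have "v \<in> V" "w \<in> V" using * xs x0 W_closed unfolding form_def by auto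
  then have "v - w = v + (-1) \<cdot>\<^sub>v w" by (intro eq_vecI) auto
  then show ?thesis using form_add[OF *(1) form_smult[OF *(2), of "-1"]] by simp
qed

lemma form_Suc: "form j c v \<Longrightarrow> form (Suc j) c v"
  unfolding form_def using W_Suc by blast

lemma form_B:
  assumes "\<And>i. i < j \<Longrightarrow> r i \<noteq> 0\<^sub>v n" and "form j c v"
  shows "form (Suc j) (ch * c) (B v)"
proof -
  obtain w where w: "w \<in> W j" and v: "v = c \<cdot>\<^sub>v (xs - x0) - w" using assms(2) by (auto simp: form_def)
  have [simp]: "w \<in> V" using w by (rule W_closed)
  have "p 0 \<in> W (Suc j)"
  proof (induction j)
    case (Suc j) then show ?case by (rule W_Suc)
  qed (rule p_in_W)
  moreover have "p 0 = A *\<^sub>v (xs - x0)" by (simp add: p_0 residual x_0)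
  ultimately have r0: "A *\<^sub>v (xs - x0) \<in> W (Suc j)" by simp
  have Aw: "A *\<^sub>v w \<in> W (Suc j)" using invariants[OF assms(1)] w by blast
  have "form (Suc j) 0 (A *\<^sub>v v)"
    unfolding form_def
  proof
    show "A *\<^sub>v w - c \<cdot>\<^sub>v (A *\<^sub>v (xs - x0)) \<in> W (Suc j)" by (intro W_diff W_smult r0 Aw)
    show "A *\<^sub>v v = 0 \<cdot>\<^sub>v (xs - x0) - (A *\<^sub>v w - c \<cdot>\<^sub>v (A *\<^sub>v (xs - x0)))"
      unfolding v using xs x0 by (auto simp: A_diff A_smult intro!: eq_vecI)
  qed
  then have "form (Suc j) (ch * c - (2 / (hi - lo)) * 0) (B v)"
    unfolding B_def by (intro form_diff form_smult form_Suc[OF assms(2)])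
  then show ?thesis by simp
qed

text \<open>The values \<open>T\<^sub>k\<^sub>+\<^sub>1(ch)\<close> and \<open>U\<^sub>k(ch)\<close> for \<open>ch = (eta + 1 / eta) / 2\<close>, in closed form.\<close>

lemma TS_form:
  fixes eta :: real
  assumes nz: "\<And>i. i \<le> k \<Longrightarrow> r i \<noteq> 0\<^sub>v n" and eta: "1 < eta" "ch = (eta + 1 / eta) / 2"
  shows "form (Suc k) ((eta ^ Suc k + 1 / eta ^ Suc k) / 2) (fst (TS k)) \<and>
    form k ((eta ^ Suc k - 1 / eta ^ Suc k) / (eta - 1 / eta)) (snd (TS k))"
  using nz
proof (induction k)
  case 0
  have "xs - x0 = 1 \<cdot>\<^sub>v (xs - x0) - 0\<^sub>v n" by (intro eq_vecI) auto
  then have 1: "form 0 1 (xs - x0)" unfolding form_def using W_zero[of 0] by blast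
  have "eta - 1 / eta \<noteq> 0" using eta(1) by (simp add: field_simps) (smt (verit) mult_le_cancel_right2)
  moreover have "form (Suc 0) (ch * 1) (B (xs - x0))" by (rule form_B[OF _ 1]) simp
  ultimately show ?case using 1 eta(2) by simp
next
  case (Suc k)
  define \<tau> where "\<tau> = (eta ^ Suc k + 1 / eta ^ Suc k) / 2"
  define \<sigma> where "\<sigma> = (eta ^ Suc k - 1 / eta ^ Suc k) / (eta - 1 / eta)"
  have f: "form (Suc k) \<tau> (fst (TS k))" and g: "form k \<sigma> (snd (TS k))"
    using Suc by (auto simp: \<tau>_def \<sigma>_def)
  have Bf: "form (Suc (Suc k)) (ch * \<tau>) (B (fst (TS k)))" by (rule form_B[OF _ f]) (use Suc.prems in auto)
  have Bg: "form (Suc k) (ch * \<sigma>) (B (snd (TS k)))" by (rule form_B[OF _ g]) (use Suc.prems in auto)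
  have BBg: "form (Suc (Suc k)) (ch * (ch * \<sigma>)) (B (B (snd (TS k))))"
    by (rule form_B[OF _ Bg]) (use Suc.prems in auto)
  have "form (Suc (Suc k)) (ch * \<tau> - (\<sigma> - ch * (ch * \<sigma>))) (fst (TS (Suc k)))"
    unfolding TS.simps fst_conv Q_def by (intro form_diff Bf BBg form_Suc g)
  moreover have "form (Suc k) (\<tau> + ch * \<sigma>) (snd (TS (Suc k)))"
    unfolding TS.simps snd_conv by (intro form_add f Bg)
  moreover define q where "q = eta ^ Suc k"
  have e: "eta - 1 / eta \<noteq> 0" "eta \<noteq> 0" "eta * eta \<noteq> 1" and q: "q \<noteq> 0"
    using eta(1) by (auto simp: field_simps q_def) (smt (verit) mult_le_cancel_right2)+
  have "ch * \<tau> - (\<sigma> - ch * (ch * \<sigma>)) = (eta * q + 1 / (eta * q)) / 2"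
    using e q unfolding \<tau>_def \<sigma>_def eta(2) q_def[symmetric]
    by (simp add: divide_simps) (simp add: algebra_simps)
  moreover have "\<tau> + ch * \<sigma> = (eta * q - 1 / (eta * q)) / (eta - 1 / eta)"
    using e q unfolding \<tau>_def \<sigma>_def eta(2) q_def[symmetric]
    by (simp add: divide_simps) (simp add: algebra_simps)
  ultimately show ?case by (simp add: q_def)
qed

text \<open>The vector \<open>T\<^sub>k(B) e / T\<^sub>k(ch)\<close> is the initial error shifted by an element of the Krylov
  space, so optimality applies to it; and \<open>T\<^sub>k(ch) \<ge> eta\<^sup>k / 2\<close>. If a residual vanishes earlier, the
  iteration is stationary at the solution.\<close>

theorem error_bound:
  fixes eta :: real
  assumes eta: "1 < eta" "ch = (eta + 1 / eta) / 2"
  shows "energy_norm A (xs - x k) \<le> 2 * (1 / eta) ^ k * energy_norm A (xs - x0)"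
proof (cases "\<exists>j\<le>k. r j = 0\<^sub>v n")
  case True
  then obtain j where j: "j \<le> k" "r j = 0\<^sub>v n" by auto
  then have "r k = 0\<^sub>v n" using stationary[of j "k - j"] by simp
  then have "xs - x k = 0\<^sub>v n" by (rule error_zero)
  moreover have "0 \<le> energy_norm A (xs - x0)" using A_nonneg[of "xs - x0"] xs x0 by (simp add: energy_norm_def)
  ultimately show ?thesis using eta by (simp add: energy_norm_def A_zero ip_zero_right)
next
  case False
  then have nz: "r j \<noteq> 0\<^sub>v n" if "j \<le> k" for j using that by auto
  define e where "e = xs - x0"
  have e: "e \<in> V" using xs x0 by (simp add: e_def)
  show ?thesis
  proof (cases k)
    case 0
    then show ?thesis using A_nonneg[OF e] by (simp add: x_0 e_def energy_norm_def)
  next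
    case (Suc m)
    \<comment> \<open>this is \<open>T\<^sub>k(ch)\<close>\<close>
    define \<tau> where "\<tau> = (eta ^ k + 1 / eta ^ k) / 2"
    have \<tau>: "eta ^ k / 2 \<le> \<tau>" "0 < eta ^ k" "0 < \<tau>" using eta by (auto simp: \<tau>_def add_pos_pos)
    obtain w where w: "w \<in> W k" "fst (TS m) = \<tau> \<cdot>\<^sub>v e - w"
      using TS_form[OF _ eta, of m] nz Suc by (auto simp: form_def e_def \<tau>_def)
    have wV: "w \<in> V" using w(1) by (rule W_closed)
    have "ip (xs - x k) (A *\<^sub>v (xs - x k))
        \<le> ip (xs - x 0 - (1 / \<tau>) \<cdot>\<^sub>v w) (A *\<^sub>v (xs - x 0 - (1 / \<tau>) \<cdot>\<^sub>v w))"
      by (rule optimality) (use nz w in \<open>auto intro: W_smult\<close>)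
    also have "xs - x 0 - (1 / \<tau>) \<cdot>\<^sub>v w = (1 / \<tau>) \<cdot>\<^sub>v fst (TS m)"
      unfolding w(2) using wV e \<tau>(3) by (auto simp: x_0 e_def right_diff_distrib intro!: eq_vecI)
    also have "ip \<dots> (A *\<^sub>v \<dots>) = (1 / \<tau>)\<^sup>2 * en (fst (TS m)) (fst (TS m))"
      by (simp add: ip_expand en_def power2_eq_square)
    also have "\<dots> \<le> (1 / \<tau>)\<^sup>2 * en e e"
      using TS_energy[of m] Q_nonneg[of "snd (TS m)"] by (intro mult_left_mono) (auto simp: e_def)
    finally have "energy_norm A (xs - x k) \<le> (1 / \<tau>) * energy_norm A e"
      using \<tau>(3) real_sqrt_le_mono
      by (fastforce simp: energy_norm_def en_def real_sqrt_mult real_sqrt_divide)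
    also have "\<dots> \<le> (2 * (1 / eta) ^ k) * energy_norm A e"
      using \<tau> A_nonneg[OF e] by (intro mult_right_mono) (auto simp: energy_norm_def field_simps)
    finally show ?thesis by (simp add: e_def)
  qed
qed

end

section \<open>The condition number and the number of iterations\<close>

lemma scalar_prod_self_nonneg: "0 \<le> scalar_prod (v :: real vec) v"
  by (auto simp: scalar_prod_def intro!: sum_nonneg)

lemma vec_norm2_nonneg: "0 \<le> vec_norm2 v"
  by (simp add: vec_norm2_def scalar_prod_self_nonneg)

lemma vec_norm2_sq: "(vec_norm2 v)\<^sup>2 = scalar_prod v v"
  by (simp add: vec_norm2_def scalar_prod_self_nonneg)

lemma vec_norm2_smult: "vec_norm2 (c \<cdot>\<^sub>v v) = \<bar>c\<bar> * vec_norm2 v"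
proof -
  have "scalar_prod (c \<cdot>\<^sub>v v) (c \<cdot>\<^sub>v v) = c\<^sup>2 * scalar_prod v v"
    by (simp add: scalar_prod_def sum_distrib_left power2_eq_square mult_ac)
  then show ?thesis by (simp add: vec_norm2_def real_sqrt_mult)
qed

lemma vec_norm2_zero: "vec_norm2 (0\<^sub>v n) = 0"
  by (simp add: vec_norm2_def scalar_prod_def)

lemma abs_scalar_prod_le:
  assumes "v \<in> carrier_vec n" "w \<in> carrier_vec n"
  shows "\<bar>scalar_prod v w\<bar> \<le> vec_norm2 v * vec_norm2 w"
proof -
  have "(scalar_prod v w)\<^sup>2 \<le> scalar_prod v v * scalar_prod w w"
    using Cauchy_Schwarz_ineq_sum[of "vec_index v" "vec_index w" "{0..<n}"] assms
    by (simp add: scalar_prod_def power2_eq_square)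
  then have "sqrt ((scalar_prod v w)\<^sup>2) \<le> sqrt (scalar_prod v v * scalar_prod w w)"
    by (rule real_sqrt_le_mono)
  then show ?thesis by (simp add: vec_norm2_def real_sqrt_mult)
qed

lemma mat_vec_norm2_bounded:
  assumes A: "A \<in> carrier_mat m n" and v: "v \<in> carrier_vec n"
  shows "vec_norm2 (A *\<^sub>v v) \<le> sqrt (\<Sum>i<m. (vec_norm2 (row A i))\<^sup>2) * vec_norm2 v"
proof -
  have "scalar_prod (A *\<^sub>v v) (A *\<^sub>v v) = (\<Sum>i<m. (scalar_prod (row A i) v)\<^sup>2)"
    using A by (simp add: scalar_prod_def[of "A *\<^sub>v v"] atLeast0LessThan power2_eq_square)
  also have "\<dots> \<le> (\<Sum>i<m. (vec_norm2 (row A i))\<^sup>2 * (vec_norm2 v)\<^sup>2)"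
  proof (rule sum_mono)
    fix i assume "i \<in> {..<m}"
    then have "\<bar>scalar_prod (row A i) v\<bar> \<le> vec_norm2 (row A i) * vec_norm2 v"
      using A v by (intro abs_scalar_prod_le[of _ n]) auto
    then have "\<bar>scalar_prod (row A i) v\<bar>\<^sup>2 \<le> (vec_norm2 (row A i) * vec_norm2 v)\<^sup>2"
      by (intro power_mono) auto
    then show "(scalar_prod (row A i) v)\<^sup>2 \<le> (vec_norm2 (row A i))\<^sup>2 * (vec_norm2 v)\<^sup>2"
      by (simp add: power_mult_distrib)
  qed
  finally have "(vec_norm2 (A *\<^sub>v v))\<^sup>2 \<le> (\<Sum>i<m. (vec_norm2 (row A i))\<^sup>2) * (vec_norm2 v)\<^sup>2"
    by (simp add: vec_norm2_sq sum_distrib_right)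
  then have "sqrt ((vec_norm2 (A *\<^sub>v v))\<^sup>2) \<le> sqrt ((\<Sum>i<m. (vec_norm2 (row A i))\<^sup>2) * (vec_norm2 v)\<^sup>2)"
    by (rule real_sqrt_le_mono)
  then show ?thesis by (simp add: real_sqrt_mult vec_norm2_nonneg)
qed

lemma mat_norm2_bound:
  assumes A: "A \<in> carrier_mat m n" and v: "v \<in> carrier_vec n"
  shows "vec_norm2 (A *\<^sub>v v) \<le> mat_norm2 A * vec_norm2 v"
proof (cases "vec_norm2 v = 0")
  case True
  then show ?thesis using mat_vec_norm2_bounded[OF A v] by simp
next
  case False
  then have pos: "0 < vec_norm2 v" using vec_norm2_nonneg[of v] by simp
  let ?S = "{vec_norm2 (A *\<^sub>v v) | v. v \<in> carrier_vec (dim_col A) \<and> vec_norm2 v \<le> 1}"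
  have bdd: "bdd_above ?S"
  proof (rule bdd_aboveI)
    fix y assume "y \<in> ?S"
    then obtain w where w: "w \<in> carrier_vec n" "vec_norm2 w \<le> 1" "y = vec_norm2 (A *\<^sub>v w)" using A by auto
    have "y \<le> sqrt (\<Sum>i<m. (vec_norm2 (row A i))\<^sup>2) * vec_norm2 w"
      unfolding w(3) by (rule mat_vec_norm2_bounded[OF A w(1)])
    also have "\<dots> \<le> sqrt (\<Sum>i<m. (vec_norm2 (row A i))\<^sup>2) * 1"
      using w(2) by (intro mult_left_mono) (auto intro: sum_nonneg)
    finally show "y \<le> sqrt (\<Sum>i<m. (vec_norm2 (row A i))\<^sup>2)" by simp
  qed
  define w where "w = (1 / vec_norm2 v) \<cdot>\<^sub>v v"
  have "vec_norm2 (A *\<^sub>v w) \<in> ?S"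
    using A v pos by (auto simp: w_def vec_norm2_smult)
  then have "vec_norm2 (A *\<^sub>v w) \<le> mat_norm2 A"
    unfolding mat_norm2_def using bdd by (intro cSup_upper)
  moreover have "A *\<^sub>v w = (1 / vec_norm2 v) \<cdot>\<^sub>v (A *\<^sub>v v)"
    unfolding w_def by (rule mult_mat_vec[OF A v])
  ultimately show ?thesis using pos by (simp add: vec_norm2_smult field_simps)
qed

lemma mat_norm2_le:
  assumes A: "A \<in> carrier_mat m n" and le: "\<And>v. v \<in> carrier_vec n \<Longrightarrow> vec_norm2 (A *\<^sub>v v) \<le> C * vec_norm2 v"
    and C: "0 \<le> C"
  shows "mat_norm2 A \<le> C"
  unfolding mat_norm2_def
proof (rule cSup_least)
  show "{vec_norm2 (A *\<^sub>v v) |v. v \<in> carrier_vec (dim_col A) \<and> vec_norm2 v \<le> 1} \<noteq> {}"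
    by (auto intro!: exI[of _ "0\<^sub>v (dim_col A)"] simp: vec_norm2_zero)
  fix y assume "y \<in> {vec_norm2 (A *\<^sub>v v) |v. v \<in> carrier_vec (dim_col A) \<and> vec_norm2 v \<le> 1}"
  then obtain w where w: "w \<in> carrier_vec n" "vec_norm2 w \<le> 1" "y = vec_norm2 (A *\<^sub>v w)" using A by auto
  show "y \<le> C" using le[OF w(1)] w(2,3) mult_left_mono[OF w(2) C] by simp
qed

lemma mat_norm2_nonneg: "A \<in> carrier_mat m n \<Longrightarrow> 0 \<le> mat_norm2 A"
proof -
  assume A: "A \<in> carrier_mat m n"
  show ?thesis
  proof (cases "\<exists>v\<in>carrier_vec n. vec_norm2 v \<noteq> 0")
    case True
    then obtain v where v: "v \<in> carrier_vec n" "0 < vec_norm2 v" using vec_norm2_nonneg less_eq_real_def by metis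
    have "0 \<le> mat_norm2 A * vec_norm2 v"
      using mat_norm2_bound[OF A v(1)] vec_norm2_nonneg order_trans by blast
    then show ?thesis using v(2) by (simp add: zero_le_mult_iff)
  next
    case False
    then have z: "vec_norm2 v = 0" if "v \<in> carrier_vec n" for v :: "real vec" using that by auto
    have "{vec_norm2 (A *\<^sub>v v) |v. v \<in> carrier_vec (dim_col A) \<and> vec_norm2 v \<le> 1} = {0}"
    proof safe
      fix v :: "real vec" assume v: "v \<in> carrier_vec (dim_col A)"
      show "vec_norm2 (A *\<^sub>v v) = 0"
        using mat_vec_norm2_bounded[OF A, of v] z[of v] v A vec_norm2_nonneg[of "A *\<^sub>v v"] by simp
    next
      have "A *\<^sub>v 0\<^sub>v n = 0\<^sub>v m" using A by (intro eq_vecI) auto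
      then show "\<exists>v. 0 = vec_norm2 (A *\<^sub>v v) \<and> v \<in> carrier_vec (dim_col A) \<and> vec_norm2 v \<le> 1"
        using A by (intro exI[of _ "0\<^sub>v n"]) (auto simp: vec_norm2_zero)
    qed
    then show ?thesis by (simp add: mat_norm2_def)
  qed
qed

context spd
begin

lemma mat_inv: "mat_inv A \<in> carrier_mat n n" "A * mat_inv A = 1\<^sub>m n" "mat_inv A * A = 1\<^sub>m n"
proof -
  have "det A \<noteq> 0"
    using det_0_iff_vec_prod_zero[OF carrier_A] A_pos by (metis ip_zero_right less_irrefl)
  then have "A \<in> Units (ring_mat TYPE(real) n ())" by (rule det_non_zero_imp_unit[OF carrier_A])
  then obtain B where B: "B \<in> carrier_mat n n" "B * A = 1\<^sub>m n" "A * B = 1\<^sub>m n"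
    by (auto simp: Units_def ring_mat_def)
  have "mat_inv A = B"
    unfolding mat_inv_def
  proof (rule the_equality)
    show "B \<in> carrier_mat (dim_col A) (dim_row A) \<and> inverts_mat A B \<and> inverts_mat B A"
      using B carrier_A by (auto simp: inverts_mat_def)
  next
    fix C assume C: "C \<in> carrier_mat (dim_col A) (dim_row A) \<and> inverts_mat A C \<and> inverts_mat C A"
    then have C': "C \<in> carrier_mat n n" "C * A = 1\<^sub>m n" using carrier_A by (auto simp: inverts_mat_def)
    have "C = C * (A * B)" using B C' by simp
    also have "\<dots> = (C * A) * B" using B C' carrier_A by (intro assoc_mult_mat[symmetric, of C n n A n B n]) auto
    also have "\<dots> = B" using B C' by simp
    finally show "C = B" .
  qed
  then show "mat_inv A \<in> carrier_mat n n" "A * mat_inv A = 1\<^sub>m n" "mat_inv A * A = 1\<^sub>m n" using B by auto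
qed

lemma inv_A: "v \<in> V \<Longrightarrow> mat_inv A *\<^sub>v (A *\<^sub>v v) = v"
  using assoc_mult_mat_vec[OF mat_inv(1) carrier_A, of v] mat_inv(3) by simp

lemma A_inv: "v \<in> V \<Longrightarrow> A *\<^sub>v (mat_inv A *\<^sub>v v) = v"
  using assoc_mult_mat_vec[OF carrier_A mat_inv(1), of v] mat_inv(2) by simp

lemma lin_sol_eqI: "c \<in> V \<Longrightarrow> A *\<^sub>v c = b \<Longrightarrow> lin_sol A b = c"
  unfolding lin_sol_def
  by (rule the_equality) (use carrier_A inv_A in \<open>auto, metis\<close>)

lemma lin_sol: assumes "b \<in> V" shows "lin_sol A b \<in> V" "A *\<^sub>v lin_sol A b = b"
proof -
  have "mat_inv A *\<^sub>v b \<in> V" using mat_inv(1) assms by (rule mult_mat_vec_carrier)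
  moreover from this have "lin_sol A b = mat_inv A *\<^sub>v b" by (rule lin_sol_eqI) (rule A_inv[OF assms])
  ultimately show "lin_sol A b \<in> V" "A *\<^sub>v lin_sol A b = b" using A_inv[OF assms] by auto
qed

lemma norm_A_le: "v \<in> V \<Longrightarrow> vec_norm2 (A *\<^sub>v v) \<le> mat_norm2 A * vec_norm2 v"
  by (rule mat_norm2_bound[OF carrier_A])

lemma norm_le_inv: "v \<in> V \<Longrightarrow> vec_norm2 v \<le> mat_norm2 (mat_inv A) * vec_norm2 (A *\<^sub>v v)"
  using mat_norm2_bound[OF mat_inv(1), of "A *\<^sub>v v"] by (simp add: inv_A)

text \<open>For symmetric positive definite \<open>A\<close> the norm bounds the Rayleigh quotients of \<open>A\<close> on the
  energy space. With \<open>w = A v\<close>, Cauchy--Schwarz in the energy form gives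
  \<open>(w, w)\<^sup>2 = (v, A w)\<^sup>2 \<le> (v, A v) (w, A w)\<close>, and \<open>(w, A w)\<close> is at most the norm of \<open>A\<close> times
  \<open>(w, w)\<close>.\<close>

lemma norm_sq_le_energy: "v \<in> V \<Longrightarrow> (vec_norm2 (A *\<^sub>v v))\<^sup>2 \<le> mat_norm2 A * ip v (A *\<^sub>v v)"
proof (cases "A *\<^sub>v v = 0\<^sub>v n")
  case True
  assume "v \<in> V"
  then show ?thesis using True by (simp add: vec_norm2_zero ip_zero_right)
next
  case False
  assume v: "v \<in> V"
  define w where "w = A *\<^sub>v v"
  have w: "w \<in> V" using v by (simp add: w_def)
  have pos: "0 < ip w w" using ip_self_pos[OF w] False by (simp add: w_def)
  have "(ip w w)\<^sup>2 = (ip v (A *\<^sub>v w))\<^sup>2" using v w by (simp add: w_def A_sym)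
  also have "\<dots> \<le> ip v (A *\<^sub>v v) * ip w (A *\<^sub>v w)" using v w by (rule energy_Cauchy_Schwarz)
  finally have CS: "(ip w w)\<^sup>2 \<le> ip v (A *\<^sub>v v) * ip w (A *\<^sub>v w)" .
  have "ip w (A *\<^sub>v w) \<le> vec_norm2 w * vec_norm2 (A *\<^sub>v w)"
    using abs_scalar_prod_le[of w n "A *\<^sub>v w"] w by simp
  also have "\<dots> \<le> vec_norm2 w * (mat_norm2 A * vec_norm2 w)"
    using norm_A_le[OF w] by (intro mult_left_mono vec_norm2_nonneg)
  also have "\<dots> = mat_norm2 A * ip w w" by (simp flip: vec_norm2_sq add: power2_eq_square)
  finally have "ip v (A *\<^sub>v v) * ip w (A *\<^sub>v w) \<le> ip v (A *\<^sub>v v) * (mat_norm2 A * ip w w)"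
    using A_nonneg[OF v] by (rule mult_left_mono)
  with CS have "ip w w * ip w w \<le> (ip v (A *\<^sub>v v) * mat_norm2 A) * ip w w"
    by (simp add: power2_eq_square mult_ac)
  then have "ip w w \<le> ip v (A *\<^sub>v v) * mat_norm2 A" using pos by simp
  then show ?thesis by (simp add: vec_norm2_sq w_def mult.commute)
qed

lemma energy_le_inv: "v \<in> V \<Longrightarrow> ip v (A *\<^sub>v v) \<le> mat_norm2 (mat_inv A) * (vec_norm2 (A *\<^sub>v v))\<^sup>2"
proof -
  assume v: "v \<in> V"
  have "ip v (A *\<^sub>v v) \<le> vec_norm2 v * vec_norm2 (A *\<^sub>v v)"
    using abs_scalar_prod_le[of v n "A *\<^sub>v v"] v by simp
  also have "\<dots> \<le> (mat_norm2 (mat_inv A) * vec_norm2 (A *\<^sub>v v)) * vec_norm2 (A *\<^sub>v v)"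
    using norm_le_inv[OF v] by (intro mult_right_mono vec_norm2_nonneg)
  finally show ?thesis by (simp add: power2_eq_square mult_ac)
qed

lemma diag_le_norm: "i < n \<Longrightarrow> A $$ (i, i) \<le> mat_norm2 A"
proof -
  assume i: "i < n"
  have u: "unit_vec n i \<in> V" by simp
  have n1: "vec_norm2 (unit_vec n i) = 1" using i by (simp add: vec_norm2_def)
  have "A $$ (i, i) = ip (unit_vec n i) (A *\<^sub>v unit_vec n i)"
    using i carrier_A by simp
  also have "\<dots> \<le> vec_norm2 (unit_vec n i) * vec_norm2 (A *\<^sub>v unit_vec n i)"
    using abs_scalar_prod_le[of "unit_vec n i" n "A *\<^sub>v unit_vec n i"] u A_closed[OF u] by linarith
  also have "\<dots> \<le> mat_norm2 A" using norm_A_le[OF u] n1 by simp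
  finally show ?thesis .
qed

lemma cond_number_ge_1: assumes "0 < n" shows "1 \<le> cond_number A"
proof -
  have u: "unit_vec n 0 \<in> V" by simp
  have n1: "vec_norm2 (unit_vec n 0) = 1" using assms by (simp add: vec_norm2_def)
  have "1 \<le> mat_norm2 (mat_inv A) * vec_norm2 (A *\<^sub>v unit_vec n 0)" using norm_le_inv[OF u] n1 by simp
  also have "\<dots> \<le> mat_norm2 (mat_inv A) * (mat_norm2 A * 1)"
    using norm_A_le[OF u] n1 mat_norm2_nonneg[OF mat_inv(1)] by (intro mult_left_mono) auto
  finally show ?thesis by (simp add: cond_number_def mult.commute)
qed

text \<open>The spectral bounds are \<open>1 / \<parallel>A\<^sup>-\<^sup>1\<parallel>\<close> and \<open>K\<close> times this number. Then
  \<open>ch = (K + 1) / (K - 1)\<close>, which is \<open>(eta + 1 / eta) / 2\<close> for the rate \<open>eta\<close> of the statement.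
  Taking \<open>K\<close> above the condition number keeps the interval nondegenerate and the rate uniform in
  the parameter.\<close>

lemma cg_error_bound:
  assumes n: "0 < n" and K: "cond_number A \<le> K" "1 < K" and b: "b \<in> V" and x0: "x0 \<in> V"
  shows "energy_norm A (lin_sol A b - cg_iterate A b x0 k)
    \<le> 2 * (1 / ((sqrt K + 1) / (sqrt K - 1))) ^ k * energy_norm A (lin_sol A b - x0)"
proof -
  define I where "I = mat_norm2 (mat_inv A)"
  have KI: "mat_norm2 A * I \<le> K" using K by (simp add: cond_number_def I_def)
  have "0 < mat_norm2 A * I" using cond_number_ge_1[OF n] by (simp add: cond_number_def I_def)
  then have I: "0 < I" "0 < mat_norm2 A"
    using mat_norm2_nonneg[OF mat_inv(1)] mat_norm2_nonneg[OF carrier_A] by (auto simp: I_def zero_less_mult_iff)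
  interpret cg_spectral n A b x0 "lin_sol A b" "1 / I" "K * (1 / I)"
  proof unfold_locales
    show "b \<in> V" "x0 \<in> V" "lin_sol A b \<in> V" "A *\<^sub>v lin_sol A b = b" using b x0 lin_sol[OF b] by auto
    show "0 < 1 / I" "1 / I < K * (1 / I)" using I K by (auto simp: divide_strict_right_mono)
    fix v assume v: "v \<in> V"
    show "1 / I * ip v (A *\<^sub>v v) \<le> ip (A *\<^sub>v v) (A *\<^sub>v v)"
      using energy_le_inv[OF v] I by (simp add: vec_norm2_sq I_def field_simps)
    have "ip (A *\<^sub>v v) (A *\<^sub>v v) \<le> mat_norm2 A * ip v (A *\<^sub>v v)"
      using norm_sq_le_energy[OF v] by (simp add: vec_norm2_sq)
    also have "\<dots> \<le> K * (1 / I) * ip v (A *\<^sub>v v)"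
      using KI I A_nonneg[OF v] by (intro mult_right_mono) (auto simp: field_simps)
    finally show "ip (A *\<^sub>v v) (A *\<^sub>v v) \<le> K * (1 / I) * ip v (A *\<^sub>v v)" .
  qed
  define q where "q = sqrt K"
  have q: "1 < q" "K = q * q" using K by (auto simp: q_def)
  show ?thesis
    unfolding x_eq[symmetric]
  proof (rule error_bound)
    show "1 < (sqrt K + 1) / (sqrt K - 1)" using q by (simp add: q_def[symmetric] field_simps)
    have q1: "q - 1 \<noteq> 0" "q * q - 1 \<noteq> 0" "q + 1 \<noteq> 0"
      using q mult_strict_mono[of 1 q 1 q] by auto
    have "ch = (K * (1 / I) + 1 / I) / (K * (1 / I) - 1 / I)" by (rule ch_def)
    also have "\<dots> = ((K + 1) * (1 / I)) / ((K - 1) * (1 / I))" by (simp only: ring_distribs mult_1_left)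
    also have "\<dots> = (K + 1) / (K - 1)" by (rule mult_divide_mult_cancel_right) (use I in simp)
    also have "\<dots> = ((q + 1) / (q - 1) + 1 / ((q + 1) / (q - 1))) / 2"
      unfolding q(2) using q1 by (simp add: divide_simps) (simp add: algebra_simps)
    finally show "ch = ((sqrt K + 1) / (sqrt K - 1) + 1 / ((sqrt K + 1) / (sqrt K - 1))) / 2"
      by (simp add: q_def)
  qed
qed

text \<open>The count is the least index that reaches the tolerance; the first part says that such an
  index exists, the second follows by solving \<open>2 E / eta\<^sup>k \<le> \<tau>\<close> for \<open>k\<close>.\<close>

lemma cg_count_bounds:
  assumes n: "0 < n" and K: "cond_number A \<le> K" "1 < K" and b: "b \<in> V" and x0: "x0 \<in> V" and \<tau>: "0 < \<tau>"
  shows "energy_norm A (lin_sol A b - cg_iterate A b x0 (cg_count A b x0 \<tau>)) \<le> \<tau>" (is ?th1)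
    and "energy_norm A (lin_sol A b - x0) \<le> E \<Longrightarrow> \<tau> \<le> 2 * E \<Longrightarrow>
      real (cg_count A b x0 \<tau>) \<le> ln (2 * E / \<tau>) / ln ((sqrt K + 1) / (sqrt K - 1)) + 1"
proof -
  define eta where "eta = (sqrt K + 1) / (sqrt K - 1)"
  have eta: "1 < eta" using K(2) by (simp add: eta_def field_simps)
  have main: "energy_norm A (lin_sol A b - cg_iterate A b x0 (nat \<lceil>ln (2 * E / \<tau>) / ln eta\<rceil>)) \<le> \<tau>"
    if E: "energy_norm A (lin_sol A b - x0) \<le> E" "\<tau> \<le> 2 * E" for E
  proof -
    define k where "k = nat \<lceil>ln (2 * E / \<tau>) / ln eta\<rceil>"
    have E0: "0 < E" using E(2) \<tau> by simp
    have "ln (2 * E / \<tau>) / ln eta \<le> real k" unfolding k_def by (rule real_nat_ceiling_ge)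
    then have "ln (2 * E / \<tau>) \<le> real k * ln eta" using eta by (simp add: field_simps)
    also have "\<dots> = ln (eta ^ k)" using eta by (simp add: ln_realpow)
    finally have "2 * E / \<tau> \<le> eta ^ k" using eta E0 \<tau> by (simp add: ln_le_cancel_iff)
    then have le: "2 * (1 / eta) ^ k * E \<le> \<tau>" using eta \<tau> by (simp add: field_simps)
    have "energy_norm A (lin_sol A b - cg_iterate A b x0 k)
        \<le> 2 * (1 / eta) ^ k * energy_norm A (lin_sol A b - x0)"
      unfolding eta_def by (rule cg_error_bound[OF n K b x0])
    also have "\<dots> \<le> 2 * (1 / eta) ^ k * E" using E eta by (intro mult_left_mono) auto
    finally show ?thesis using le by (simp add: k_def)
  qed
  \<comment> \<open>some bound of the initial error to which the estimate applies\<close>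
  have "energy_norm A (lin_sol A b - x0) \<le> max (energy_norm A (lin_sol A b - x0)) \<tau>"
    "\<tau> \<le> 2 * max (energy_norm A (lin_sol A b - x0)) \<tau>" using \<tau> by auto
  from main[OF this] show ?th1 unfolding cg_count_def by (rule LeastI)
  assume E: "energy_norm A (lin_sol A b - x0) \<le> E" "\<tau> \<le> 2 * E"
  have "cg_count A b x0 \<tau> \<le> nat \<lceil>ln (2 * E / \<tau>) / ln eta\<rceil>"
    unfolding cg_count_def by (rule Least_le) (rule main[OF E])
  moreover have "0 \<le> ln (2 * E / \<tau>) / ln eta" using E \<tau> eta by simp
  ultimately show "real (cg_count A b x0 \<tau>) \<le> ln (2 * E / \<tau>) / ln ((sqrt K + 1) / (sqrt K - 1)) + 1"
    unfolding eta_def[symmetric] by linarith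
qed

end

section \<open>Lagrange polynomials at Clenshaw--Curtis points\<close>

lemma chebyshev_polynomial:
  "\<exists>p :: real poly. degree p \<le> m \<and> (\<forall>\<theta>. poly p (cos \<theta>) = cos (real m * \<theta>))"
proof (induction m rule: less_induct)
  case (less m)
  consider "m = 0" | "m = 1" | k where "m = Suc (Suc k)" by (metis One_nat_def not0_implies_Suc)
  then show ?case
  proof cases
    case 1
    then show ?thesis by (intro exI[of _ 1]) simp
  next
    case 2
    then show ?thesis by (intro exI[of _ "[:0, 1:]"]) simp
  next
    case (3 k)
    obtain p q :: "real poly" where p: "degree p \<le> Suc k" "\<And>\<theta>. poly p (cos \<theta>) = cos (real (Suc k) * \<theta>)"
      and q: "degree q \<le> k" "\<And>\<theta>. poly q (cos \<theta>) = cos (real k * \<theta>)"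
      using less.IH[of "Suc k"] less.IH[of k] 3 by auto
    have "degree (pCons 0 (Polynomial.smult 2 p) - q) \<le> m"
      using p(1) q(1) 3 degree_pCons_le[of 0 "Polynomial.smult 2 p"] by (intro degree_diff_le) auto
    moreover have "poly (pCons 0 (Polynomial.smult 2 p) - q) (cos \<theta>) = cos (real m * \<theta>)" for \<theta>
    proof -
      have "cos (real (Suc k) * \<theta> + \<theta>) + cos (real (Suc k) * \<theta> - \<theta>) = 2 * cos (real (Suc k) * \<theta>) * cos \<theta>"
        by (simp add: cos_add cos_diff)
      moreover have "real (Suc k) * \<theta> + \<theta> = real m * \<theta>" "real (Suc k) * \<theta> - \<theta> = real k * \<theta>"
        using 3 by (simp_all add: algebra_simps)
      ultimately show ?thesis using p(2) q(2) by (simp add: algebra_simps)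
    qed
    ultimately show ?thesis by blast
  qed
qed

text \<open>The Dirichlet kernel with halved end terms (the trapezoidal rule). It vanishes at the
  multiples of \<open>pi / n\<close> that are not multiples of \<open>2 pi\<close>, and differences and sums of the angles
  of two different Clenshaw--Curtis nodes are of this kind.\<close>

definition dkernel :: "nat \<Rightarrow> real \<Rightarrow> real" where
  "dkernel n \<phi> = (\<Sum>m\<le>n. (if m = 0 \<or> m = n then 1 / 2 else 1) * cos (real m * \<phi>))"

lemma dkernel_altdef: "0 < n \<Longrightarrow> dkernel n \<phi> = 1 / 2 + (\<Sum>m\<in>{1..<n}. cos (real m * \<phi>)) + cos (real n * \<phi>) / 2"
proof -
  assume n: "0 < n"
  have "{..n} = insert 0 (insert n {1..<n})" using n by auto
  then have "dkernel n \<phi> = 1 / 2 + (cos (real n * \<phi>) / 2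
      + (\<Sum>m\<in>{1..<n}. (if m = 0 \<or> m = n then 1 / 2 else 1) * cos (real m * \<phi>)))"
    using n by (simp add: dkernel_def)
  also have "(\<Sum>m\<in>{1..<n}. (if m = 0 \<or> m = n then 1 / 2 else 1) * cos (real m * \<phi>)) = (\<Sum>m\<in>{1..<n}. cos (real m * \<phi>))"
    by (intro sum.cong) auto
  finally show ?thesis by simp
qed

lemma dkernel_sin: "0 < n \<Longrightarrow> 2 * sin (\<phi> / 2) * dkernel n \<phi> = sin (real n * \<phi>) * cos (\<phi> / 2)"
proof -
  have *: "2 * sin (\<phi> / 2) * (1 / 2 + (\<Sum>m\<in>{1..<Suc n}. cos (real m * \<phi>)) + cos (real (Suc n) * \<phi>) / 2)
    = sin (real (Suc n) * \<phi>) * cos (\<phi> / 2)" for n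
  proof (induction n)
    case 0
    have "sin \<phi> = 2 * sin (\<phi> / 2) * cos (\<phi> / 2)" using sin_double[of "\<phi> / 2"] by simp
    moreover have "cos \<phi> = 2 * (cos (\<phi> / 2))\<^sup>2 - 1" using cos_double_cos[of "\<phi> / 2"] by simp
    ultimately have "2 * sin (\<phi> / 2) * (1 / 2 + cos \<phi> / 2) = sin \<phi> * cos (\<phi> / 2)"
      by (simp only: power2_eq_square) (simp add: field_simps)
    then show ?case by simp
  next
    case (Suc n)
    define a where "a = real (Suc n) * \<phi>"
    have a: "real (Suc (Suc n)) * \<phi> = a + \<phi>" by (simp add: a_def algebra_simps)
    have s: "sin \<phi> = 2 * sin (\<phi> / 2) * cos (\<phi> / 2)" using sin_double[of "\<phi> / 2"] by simp
    have c: "cos \<phi> = 1 - 2 * (sin (\<phi> / 2))\<^sup>2" using cos_double_sin[of "\<phi> / 2"] by simp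
    have c': "cos \<phi> = 2 * (cos (\<phi> / 2))\<^sup>2 - 1" using cos_double_cos[of "\<phi> / 2"] by simp
    have "2 * sin (\<phi> / 2) * (1 / 2 + (\<Sum>m\<in>{1..<Suc (Suc n)}. cos (real m * \<phi>)) + cos (real (Suc (Suc n)) * \<phi>) / 2)
      = 2 * sin (\<phi> / 2) * (1 / 2 + (\<Sum>m\<in>{1..<Suc n}. cos (real m * \<phi>)) + cos a / 2)
        + sin (\<phi> / 2) * (cos a + cos (a + \<phi>))"
      by (simp add: a[symmetric]) (simp add: a_def algebra_simps)
    also have "\<dots> = sin a * cos (\<phi> / 2) + sin (\<phi> / 2) * (cos a + cos (a + \<phi>))"
      using Suc by (simp add: a_def)
    also have "sin (\<phi> / 2) * (cos a + cos (a + \<phi>))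
        = sin (\<phi> / 2) * (cos a * (1 + cos \<phi>) - sin a * sin \<phi>)"
      by (simp add: cos_add algebra_simps)
    also have "\<dots> = 2 * sin (\<phi> / 2) * cos (\<phi> / 2) * cos a * cos (\<phi> / 2) - 2 * (sin (\<phi> / 2))\<^sup>2 * sin a * cos (\<phi> / 2)"
      unfolding s by (simp add: c' power2_eq_square algebra_simps)
    also have "\<dots> = sin \<phi> * cos a * cos (\<phi> / 2) - (1 - cos \<phi>) * sin a * cos (\<phi> / 2)"
      unfolding s using c by simp
    also have "sin a * cos (\<phi> / 2) + (sin \<phi> * cos a * cos (\<phi> / 2) - (1 - cos \<phi>) * sin a * cos (\<phi> / 2))
       = sin (a + \<phi>) * cos (\<phi> / 2)"
      by (simp add: sin_add algebra_simps)
    finally show ?case unfolding a .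
  qed
  assume "0 < n"
  then obtain k where "n = Suc k" by (cases n) auto
  then show ?thesis using *[of k] dkernel_altdef[of n \<phi>] by simp
qed

lemma dkernel_zero: "0 < n \<Longrightarrow> dkernel n 0 = real n"
  by (simp add: dkernel_altdef)

lemma dkernel_node:
  assumes "0 < n" "0 < i" "i < 2 * n"
  shows "dkernel n (real i * pi / real n) = 0"
proof -
  have "0 < real i * pi / real n / 2" "real i * pi / real n / 2 < pi"
    using assms by (auto simp: field_simps)
  then have "0 < sin (real i * pi / real n / 2)" by (rule sin_gt_zero)
  moreover have "sin (real n * (real i * pi / real n)) = 0" using assms(1) by (simp add: sin_npi)
  ultimately show ?thesis using dkernel_sin[OF assms(1), of "real i * pi / real n"] by simp
qed

lemma dkernel_minus: "dkernel n (- \<phi>) = dkernel n \<phi>"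
  by (simp add: dkernel_def)

lemma abs_dkernel_le: "0 < n \<Longrightarrow> \<bar>dkernel n \<phi>\<bar> \<le> real n"
proof -
  assume n: "0 < n"
  have "\<bar>dkernel n \<phi>\<bar> \<le> (\<Sum>m\<le>n. \<bar>(if m = 0 \<or> m = n then 1 / 2 else 1) * cos (real m * \<phi>)\<bar>)"
    unfolding dkernel_def by (rule sum_abs)
  also have "\<dots> \<le> (\<Sum>m\<le>n. (if m = 0 \<or> m = n then 1 / 2 else 1) * cos (real m * 0))"
    by (intro sum_mono) (auto simp: abs_mult)
  also have "\<dots> = real n" using dkernel_zero[OF n] by (simp add: dkernel_def)
  finally show ?thesis .
qed

lemma cc_points_altdef:
  assumes "2 \<le> l"
  shows "cc_points l = (\<lambda>i. cos (real i * pi / 2 ^ (l - 1))) ` {..2 ^ (l - 1)}"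
proof -
  define n where "n = (2::nat) ^ (l - 1)"
  have n: "0 < n" by (simp add: n_def)
  have "cc_points l = (\<lambda>j. - cos (pi * (real j - 1) / real n)) ` {1..n + 1}"
    using assms by (simp add: cc_points_def cc_size_def n_def)
  also have "{1..n + 1} = (\<lambda>i. n + 1 - i) ` {..n}"
  proof -
    have "j \<in> (\<lambda>i. n + 1 - i) ` {..n}" if "j \<in> {1..n + 1}" for j
      using that by (intro image_eqI[of _ _ "n + 1 - j"]) auto
    then show ?thesis by auto
  qed
  also have "(\<lambda>j. - cos (pi * (real j - 1) / real n)) ` (\<lambda>i. n + 1 - i) ` {..n} = (\<lambda>i. cos (real i * pi / real n)) ` {..n}"
    unfolding image_image
  proof (rule image_cong[OF refl])
    fix i assume "i \<in> {..n}"
    then have "pi * (real (n + 1 - i) - 1) / real n = pi - real i * pi / real n"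
      using n by (simp add: of_nat_diff field_simps)
    then show "- cos (pi * (real (n + 1 - i) - 1) / real n) = cos (real i * pi / real n)" by simp
  qed
  finally show ?thesis by (simp add: n_def)
qed

lemma cc_nodes_inj: "0 < n \<Longrightarrow> inj_on (\<lambda>i. cos (real i * pi / real n)) {..n}"
proof (rule inj_onI)
  fix i j assume n: "0 < n" and *: "i \<in> {..n}" "j \<in> {..n}" "cos (real i * pi / real n) = cos (real j * pi / real n)"
  have "0 \<le> real m * pi / real n \<and> real m * pi / real n \<le> pi" if "m \<in> {..n}" for m
    using that n by (simp add: divide_le_eq mult.commute)
  then have "real i * pi / real n = real j * pi / real n"
    using cos_inj_pi[of "real i * pi / real n" "real j * pi / real n"] * by blast
  then show "i = j" using n by simp
qed

lemma finite_cc_points [simp]: "finite (cc_points l)"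
  by (simp add: cc_points_def)

lemma cc_points_subset: "cc_points l \<subseteq> {-1..1}"
  unfolding cc_points_def by (auto simp: minus_le_iff)

lemma card_cc_points: "2 \<le> l \<Longrightarrow> card (cc_points l) = 2 ^ (l - 1) + 1"
  using card_image[OF cc_nodes_inj[of "2 ^ (l - 1)"]] by (simp add: cc_points_altdef)

text \<open>The cardinal function at the node \<open>cos a\<close> is, at \<open>cos \<theta>\<close>, the multiple \<open>c / n\<close> of
  \<open>dkernel n (\<theta> - a) + dkernel n (\<theta> + a)\<close>: by the addition theorem this is a polynomial of degree
  \<open>n\<close> in \<open>cos \<theta>\<close>, and it has the right values at the \<open>n + 1\<close> nodes. Since the kernel is bounded by
  \<open>n\<close>, every cardinal function is bounded by a constant, independently of the level.\<close>

lemma lagrange_cardinal_bound: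
  assumes x: "x \<in> cc_points l" and t: "t \<in> {-1..1}"
  shows "\<bar>lagrange_cardinal l x t\<bar> \<le> 2"
proof (cases "2 \<le> l")
  case False
  then have "cc_points l - {x} = {}" using x by (auto simp: cc_points_def split: if_splits)
  then show ?thesis unfolding lagrange_cardinal_def \<open>cc_points l - {x} = {}\<close> by simp
next
  case True
  define n where "n = (2::nat) ^ (l - 1)"
  have n: "0 < n" by (simp add: n_def)
  have pts: "cc_points l = (\<lambda>i. cos (real i * pi / real n)) ` {..n}"
    using cc_points_altdef[OF True] by (simp add: n_def)
  obtain k where k: "k \<le> n" "x = cos (real k * pi / real n)" using x pts by auto
  define a where "a = real k * pi / real n"
  \<comment> \<open>at the end points both kernels contribute, which halves the factor\<close>
  define c where "c = (if k = 0 \<or> k = n then 1 / 2 else (1::real))"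
  have "\<exists>P. \<forall>m. degree (P m :: real poly) \<le> m \<and> (\<forall>\<theta>. poly (P m) (cos \<theta>) = cos (real m * \<theta>))"
    by (rule choice) (use chebyshev_polynomial in blast)
  then obtain P :: "nat \<Rightarrow> real poly" where P: "\<And>m. degree (P m) \<le> m" "\<And>m \<theta>. poly (P m) (cos \<theta>) = cos (real m * \<theta>)"
    by blast
  define q where "q = Polynomial.smult (2 * c / real n) (\<Sum>m\<le>n. Polynomial.smult ((if m = 0 \<or> m = n then 1 / 2 else 1) * cos (real m * a)) (P m))"
  have degq: "degree q \<le> n"
    unfolding q_def using P(1) by (intro order_trans[OF degree_smult_le] degree_sum_le) (auto intro: order_trans)
  have q: "poly q (cos \<theta>) = c / real n * (dkernel n (\<theta> - a) + dkernel n (\<theta> + a))" for \<theta>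
  proof -
    have "dkernel n (\<theta> - a) + dkernel n (\<theta> + a)
        = (\<Sum>m\<le>n. (if m = 0 \<or> m = n then 1 / 2 else 1) * (2 * cos (real m * a) * cos (real m * \<theta>)))"
      unfolding dkernel_def sum.distrib[symmetric]
      by (intro sum.cong) (auto simp: cos_add cos_diff algebra_simps)
    then show ?thesis by (simp add: q_def poly_sum P(2) sum_distrib_left mult_ac)
  qed
  have q1: "poly q x = 1"
  proof -
    have "poly q x = c / real n * (real n + dkernel n (2 * a))"
    proof -
      have "x = cos a" by (simp add: k a_def)
      then show ?thesis using q[of a] n by (simp add: dkernel_zero flip: mult_2)
    qed
    also have "dkernel n (2 * a) = (if k = 0 \<or> k = n then real n else 0)"
    proof -
      consider "k = 0" | "k = n" | "0 < k" "k < n" using k by linarith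
      then show ?thesis
      proof cases
        case 1 then show ?thesis using n by (simp add: a_def dkernel_zero)
      next
        case 2
        then have "2 * a = 2 * pi" using n by (simp add: a_def)
        moreover have "cos (real m * (2 * pi)) = 1" for m by (metis cos_2npi mult.assoc mult.commute)
        then have "dkernel n (2 * pi) = dkernel n 0" by (simp add: dkernel_def)
        ultimately show ?thesis using 2 n by (simp add: dkernel_zero)
      next
        case 3
        have "2 * a = real (2 * k) * pi / real n" by (simp add: a_def)
        then show ?thesis using 3 n dkernel_node[of n "2 * k"] by (metis mult_less_cancel1 nat_0_less_mult_iff less_irrefl zero_less_numeral)
      qed
    qed
    finally show ?thesis using n by (auto simp: c_def)
  qed
  have q0: "poly q y = 0" if y: "y \<in> cc_points l - {x}" for y
  proof -
    obtain j where j: "j \<le> n" "y = cos (real j * pi / real n)" using y pts by auto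
    have jk: "j \<noteq> k" using y j k by auto
    have "dkernel n (real j * pi / real n - a) = 0"
    proof (cases "k < j")
      case True
      have "real j * pi / real n - a = real (j - k) * pi / real n"
        using True by (simp add: a_def of_nat_diff diff_divide_distrib left_diff_distrib)
      then show ?thesis using dkernel_node[of n "j - k"] True n j by simp
    next
      case False
      have "real j * pi / real n - a = - (real (k - j) * pi / real n)"
        using False by (simp add: a_def of_nat_diff diff_divide_distrib left_diff_distrib)
      then show ?thesis using dkernel_node[of n "k - j"] False n k jk by (simp add: dkernel_minus del: of_nat_diff)
    qed
    moreover have "dkernel n (real j * pi / real n + a) = 0"
    proof -
      have "real j * pi / real n + a = real (j + k) * pi / real n" by (simp add: a_def add_divide_distrib distrib_right)
      moreover have "0 < j + k" "j + k < 2 * n" using jk j(1) k(1) by linarith+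
      ultimately show ?thesis using dkernel_node[of n "j + k"] n by metis
    qed
    ultimately show ?thesis unfolding j(2) q by simp
  qed
  define g where "g = (\<Prod>y\<in>cc_points l - {x}. Polynomial.smult (1 / (x - y)) [:- y, 1:])"
  have card: "card (cc_points l) = n + 1" using card_cc_points[OF True] by (simp add: n_def)
  have degg: "degree g \<le> n"
  proof -
    have "degree g \<le> (\<Sum>y\<in>cc_points l - {x}. 1)"
      unfolding g_def by (rule order_trans[OF degree_prod_sum_le]) (auto intro!: sum_mono)
    then show ?thesis using card x by simp
  qed
  have "q = g"
  proof (rule poly_eqI_degree[where A = "cc_points l"])
    fix y assume y: "y \<in> cc_points l"
    show "poly q y = poly g y"
    proof (cases "y = x")
      case True
      have "poly g x = (\<Prod>y\<in>cc_points l - {x}. 1)"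
        unfolding g_def poly_prod
      proof (rule prod.cong[OF refl])
        fix z assume "z \<in> cc_points l - {x}"
        then have "x - z \<noteq> 0" by auto
        then show "poly (Polynomial.smult (1 / (x - z)) [:- z, 1:]) x = 1" by (simp add: diff_divide_distrib[symmetric])
      qed
      then show ?thesis using q1 True by simp
    next
      case False
      have "poly g y = 0" unfolding g_def poly_prod
        by (rule prod_zero[OF _ bexI[of _ y]]) (use y False in simp_all)
      then show ?thesis using q0[of y] y False by simp
    qed
  qed (use degq degg card in auto)
  moreover have "lagrange_cardinal l x t = poly g t"
    unfolding g_def poly_prod lagrange_cardinal_def
    by (rule prod.cong[OF refl]) (simp add: diff_divide_distrib)
  ultimately have "lagrange_cardinal l x t = poly q (cos (arccos t))" using t by simp
  then have "\<bar>lagrange_cardinal l x t\<bar> = c / real n * \<bar>dkernel n (arccos t - a) + dkernel n (arccos t + a)\<bar>"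
    unfolding q by (simp add: abs_mult c_def)
  also have "\<dots> \<le> c / real n * (real n + real n)"
    using abs_dkernel_le[OF n, of "arccos t - a"] abs_dkernel_le[OF n, of "arccos t + a"]
    by (intro mult_left_mono) (auto simp: c_def)
  also have "\<dots> \<le> 2" using n by (simp add: c_def)
  finally show ?thesis .
qed

section \<open>Sparse grids\<close>

lemma grid_eq_image: "{q :: real^'n::finite. \<forall>n. q $ n \<in> A n} = vec_lambda ` (Pi\<^sub>E UNIV A)"
proof -
  have "q \<in> vec_lambda ` (Pi\<^sub>E UNIV A)" if "\<forall>n. q $ n \<in> A n" for q
    using that by (intro image_eqI[of _ _ "vec_nth q"]) auto
  then show ?thesis by auto
qed

lemma finite_grid: "(\<And>n. finite (A n)) \<Longrightarrow> finite {q :: real^'n::finite. \<forall>n. q $ n \<in> A n}"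
  unfolding grid_eq_image by (intro finite_imageI finite_PiE) auto

lemma card_grid: "(\<And>n. finite (A n)) \<Longrightarrow> card {q :: real^'n::finite. \<forall>n. q $ n \<in> A n} \<le> (\<Prod>n\<in>UNIV. card (A n))"
  unfolding grid_eq_image using card_image_le[of "Pi\<^sub>E UNIV A" vec_lambda] card_PiE[of UNIV A]
  by (simp add: finite_PiE)

lemma tensor_interp_delta_bound:
  fixes y :: "real^'n::finite"
  assumes y: "y \<in> Gam"
  shows "\<bar>tensor_interp k (\<lambda>q'. if q' = q then 1 else 0) y\<bar> \<le> 2 ^ CARD('n)"
proof -
  let ?G = "{q :: real^'n. \<forall>n. q $ n \<in> cc_points (k n)}"
  have fin: "finite ?G" by (rule finite_grid) simp
  have eq: "tensor_interp k (\<lambda>q'. if q' = q then 1 else 0) y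
      = (if q \<in> ?G then \<Prod>n\<in>UNIV. lagrange_cardinal (k n) (q $ n) (y $ n) else 0)"
  proof -
    have "tensor_interp k (\<lambda>q'. if q' = q then 1 else 0) y
        = (\<Sum>q'\<in>?G. if q' = q then \<Prod>n\<in>UNIV. lagrange_cardinal (k n) (q' $ n) (y $ n) else 0)"
      unfolding tensor_interp_def by (rule sum.cong[OF refl]) simp
    then show ?thesis by (simp only: sum.delta[OF fin])
  qed
  show ?thesis
  proof (cases "q \<in> ?G")
    case True
    have bd: "\<bar>lagrange_cardinal (k n) (q $ n) (y $ n)\<bar> \<le> 2" for n
      using True y by (intro lagrange_cardinal_bound) (simp_all add: Gam_def)
    have "\<bar>\<Prod>n\<in>UNIV. lagrange_cardinal (k n) (q $ n) (y $ n)\<bar> \<le> (\<Prod>n\<in>(UNIV :: 'n set). 2)"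
      unfolding abs_prod by (intro prod_mono conjI abs_ge_zero bd)
    then have "\<bar>\<Prod>n\<in>UNIV. lagrange_cardinal (k n) (q $ n) (y $ n)\<bar> \<le> 2 ^ CARD('n)"
      by (simp only: prod_constant)
    then show ?thesis by (simp only: eq if_P[OF True])
  next
    case False
    show ?thesis by (subst eq, subst if_not_P[OF False]) simp
  qed
qed

lemma finite_levels_le:
  "finite {l :: 'n::finite \<Rightarrow> nat. (\<forall>n. 1 \<le> l n) \<and> (\<Sum>n\<in>UNIV. l n - 1) \<le> L}" (is ?fin)
  "card {l :: 'n::finite \<Rightarrow> nat. (\<forall>n. 1 \<le> l n) \<and> (\<Sum>n\<in>UNIV. l n - 1) \<le> L} \<le> (L + 1) ^ CARD('n)" (is ?card)
proof -
  have sub: "{l :: 'n \<Rightarrow> nat. (\<forall>n. 1 \<le> l n) \<and> (\<Sum>n\<in>UNIV. l n - 1) \<le> L} \<subseteq> Pi\<^sub>E UNIV (\<lambda>_. {1..L + 1})"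
  proof safe
    fix l :: "'n \<Rightarrow> nat" and n assume *: "\<forall>n. 1 \<le> l n" "(\<Sum>n\<in>UNIV. l n - 1) \<le> L"
    have "l n - 1 \<le> (\<Sum>n\<in>UNIV. l n - 1)" by (rule member_le_sum) auto
    then show "l n \<in> {1..L + 1}" using * by auto
  qed auto
  have fin: "finite (Pi\<^sub>E UNIV (\<lambda>_ :: 'n. {1..L + 1}))" by (intro finite_PiE) auto
  show ?fin using sub fin by (rule finite_subset)
  show ?card using card_mono[OF fin sub] by (simp add: card_PiE)
qed

text \<open>The sparse grid operator is a sum over at most \<open>(L + 1)\<^sup>N\<close> levels of \<open>2\<^sup>N\<close> signed tensor
  products, and each of these has cardinal functions bounded by \<open>2\<^sup>N\<close>. Only polynomial growth in
  \<open>L\<close> matters: the bound enters the iteration count through its logarithm.\<close>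

lemma sparse_basis_bound:
  fixes y :: "real^'n::finite"
  assumes y: "y \<in> Gam"
  shows "\<bar>sparse_basis L q y\<bar> \<le> (4 * (real L + 1)) ^ CARD('n)"
proof -
  let ?I = "{l :: 'n \<Rightarrow> nat. (\<forall>n. 1 \<le> l n) \<and> (\<Sum>n\<in>UNIV. l n - 1) \<le> L}"
  let ?v = "\<lambda>q'. if q' = q then 1 else (0::real)"
  have td: "\<bar>tensor_difference l ?v y\<bar> \<le> 4 ^ CARD('n)" for l :: "'n \<Rightarrow> nat"
  proof -
    have "\<bar>tensor_difference l ?v y\<bar> \<le> (\<Sum>S\<in>(UNIV :: 'n set set). 2 ^ CARD('n))"
      unfolding tensor_difference_def
    proof (rule order_trans[OF sum_abs], rule sum_mono)
      fix S :: "'n set"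
      show "\<bar>(- 1) ^ card S * tensor_interp (\<lambda>n. if n \<in> S then l n - 1 else l n) ?v y\<bar> \<le> 2 ^ CARD('n)"
        using tensor_interp_delta_bound[OF y, of "\<lambda>n. if n \<in> S then l n - 1 else l n" q] by (simp add: abs_mult)
    qed
    also have "\<dots> = 4 ^ CARD('n)" using card_Pow[of "UNIV :: 'n set"] by (simp add: power_mult_distrib[symmetric])
    finally show ?thesis .
  qed
  have "\<bar>sparse_basis L q y\<bar> \<le> (\<Sum>l\<in>?I. 4 ^ CARD('n))"
    unfolding sparse_basis_def sparse_interp_def
    by (rule order_trans[OF sum_abs]) (rule sum_mono, rule td)
  also have "\<dots> = real (card ?I) * 4 ^ CARD('n)" by simp
  also have "\<dots> \<le> real ((L + 1) ^ CARD('n)) * 4 ^ CARD('n)"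
    by (intro mult_right_mono of_nat_mono finite_levels_le(2)) simp
  finally show ?thesis by (simp add: power_mult_distrib[symmetric] algebra_simps)
qed

lemma sparse_grid_subset_Gam: "sparse_grid L \<subseteq> (Gam :: (real^'n::finite) set)"
proof
  fix q :: "real^'n" assume "q \<in> sparse_grid L"
  then obtain l where l: "\<forall>n. 1 \<le> l n" "(\<Sum>n\<in>UNIV. l n - 1) = L" "\<forall>n. q $ n \<in> cc_points (l n)"
    by (auto simp: sparse_grid_def)
  have "q $ n \<in> {-1..1}" for n using l(3) cc_points_subset[of "l n"] by blast
  then show "q \<in> Gam" by (simp add: Gam_def)
qed

lemma finite_sparse_grid: "finite (sparse_grid L :: (real^'n::finite) set)"
proof -
  have "finite {l :: 'n \<Rightarrow> nat. (\<forall>n. 1 \<le> l n) \<and> (\<Sum>n\<in>UNIV. l n - 1) = L}"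
    by (rule finite_subset[OF _ finite_levels_le(1)[of L]]) auto
  then show ?thesis unfolding sparse_grid_def by (intro finite_UN_I finite_grid) auto
qed

lemma cc_points_nested: assumes "1 \<le> l" shows "cc_points l \<subseteq> cc_points (Suc l)"
proof (cases "l = 1")
  case True
  have "0 \<in> cc_points 2" by (subst cc_points_altdef) (auto intro!: image_eqI[of _ _ 1])
  then show ?thesis using True by (simp add: cc_points_def[of "Suc 0"] numeral_2_eq_2)
next
  case False
  show ?thesis
  proof
    fix x assume "x \<in> cc_points l"
    then obtain i where i: "i \<le> 2 ^ (l - 1)" "x = cos (real i * pi / 2 ^ (l - 1))"
      using False assms by (auto simp: cc_points_altdef)
    obtain k where k: "l = Suc k" using assms by (cases l) auto
    have "x = cos (real (2 * i) * pi / 2 ^ (Suc l - 1))" using i k by simp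
    then show "x \<in> cc_points (Suc l)" using i assms k False
      by (subst cc_points_altdef) (auto intro!: image_eqI[of _ _ "2 * i"])
  qed
qed

lemma zero_in_cc_points: "1 \<le> l \<Longrightarrow> 0 \<in> cc_points l"
proof (induction l rule: dec_induct)
  case base
  show ?case by (simp add: cc_points_def)
next
  case (step l)
  then show ?case using cc_points_nested[of l] by auto
qed

lemma sparse_grid_nested: "sparse_grid L \<subseteq> (sparse_grid (Suc L) :: (real^'n::finite) set)"
proof
  fix q :: "real^'n" assume "q \<in> sparse_grid L"
  then obtain l where l: "\<forall>n. 1 \<le> l n" "(\<Sum>n\<in>UNIV. l n - 1) = L" "\<forall>n. q $ n \<in> cc_points (l n)"
    by (auto simp: sparse_grid_def)
  obtain m :: 'n where True by simp
  define l' where "l' = l(m := Suc (l m))"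
  have "(\<Sum>n\<in>UNIV. l' n - 1) = (l m) + (\<Sum>n\<in>UNIV - {m}. l n - 1)"
    by (subst sum.remove[of _ m]) (auto simp: l'_def intro!: sum.cong)
  moreover have "(\<Sum>n\<in>UNIV. l n - 1) = (l m - 1) + (\<Sum>n\<in>UNIV - {m}. l n - 1)"
    by (subst sum.remove[of _ m]) auto
  ultimately have "(\<Sum>n\<in>UNIV. l' n - 1) = Suc L" using l(1)[rule_format, of m] l(2) by simp
  moreover have "\<forall>n. q $ n \<in> cc_points (l' n)" using l(3) cc_points_nested[of "l m"] l(1) by (auto simp: l'_def)
  moreover have "\<forall>n. 1 \<le> l' n" using l(1) by (auto simp: l'_def)
  ultimately show "q \<in> sparse_grid (Suc L)" unfolding sparse_grid_def by blast
qed

text \<open>Every point of the final grid is new on exactly one level, so summing over new points counts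
  the grid.\<close>

lemma sum_card_new_points:
  "(\<Sum>L = 1..Suc m. card (new_points L :: (real^'n::finite) set)) = card (sparse_grid (Suc m) :: (real^'n) set)"
proof (induction m)
  case 0
  then show ?case by (simp add: new_points_def)
next
  case (Suc m)
  have "card (new_points (Suc (Suc m)) :: (real^'n) set)
      = card (sparse_grid (Suc (Suc m)) :: (real^'n) set) - card (sparse_grid (Suc m) :: (real^'n) set)"
    unfolding new_points_def by (simp add: card_Diff_subset[OF finite_sparse_grid sparse_grid_nested])
  moreover have "card (sparse_grid (Suc m) :: (real^'n) set) \<le> card (sparse_grid (Suc (Suc m)) :: (real^'n) set)"
    by (intro card_mono finite_sparse_grid sparse_grid_nested)
  ultimately show ?case using Suc by simp
qed

text \<open>The node \<open>0\<close> belongs to all positive levels, which removes one of the \<open>2 ^ (l - 1) + 1\<close>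
  nodes.\<close>

lemma card_cc_diff: assumes "1 \<le> l" shows "card (cc_points l - cc_points (l - 1)) \<le> 2 ^ (l - 1)"
proof (cases "l = 1")
  case True
  then show ?thesis by (simp add: cc_points_def)
next
  case False
  have "1 \<le> l - 1" using assms False by simp
  then have "card (cc_points l - cc_points (l - 1)) \<le> card (cc_points l - {0})"
    using zero_in_cc_points[of "l - 1"] by (intro card_mono) auto
  also have "\<dots> = 2 ^ (l - 1)" using zero_in_cc_points[of l] assms False by (simp add: card_cc_points)
  finally show ?thesis .
qed

text \<open>Stars and bars, after listing the index type.\<close>

lemma card_compositions:
  "card {l :: 'n::finite \<Rightarrow> nat. (\<forall>n. 1 \<le> l n) \<and> (\<Sum>n\<in>UNIV. l n - 1) = j} \<le> (j + CARD('n) - 1) choose j"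
proof -
  obtain xs :: "'n list" where xs: "set xs = UNIV" "distinct xs" using finite_distinct_list[OF finite[of "UNIV :: 'n set"]] by auto
  have len: "length xs = CARD('n)" using xs distinct_card[of xs] by simp
  let ?A = "{l :: 'n \<Rightarrow> nat. (\<forall>n. 1 \<le> l n) \<and> (\<Sum>n\<in>UNIV. l n - 1) = j}"
  let ?B = "{ys :: nat list. length ys = CARD('n) \<and> sum_list ys = j}"
  have inj: "inj_on (\<lambda>l. map (\<lambda>n. l n - 1) xs) ?A"
  proof (rule inj_onI)
    fix l l' assume *: "l \<in> ?A" "l' \<in> ?A" "map (\<lambda>n. l n - 1) xs = map (\<lambda>n. l' n - 1) xs"
    then have "l n - 1 = l' n - 1" for n using xs(1) by (auto simp: map_eq_conv)
    moreover have "1 \<le> l n" "1 \<le> l' n" for n using * by auto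
    ultimately show "l = l'" by (intro ext) (metis le_add_diff_inverse)
  qed
  have im: "(\<lambda>l. map (\<lambda>n. l n - 1) xs) ` ?A \<subseteq> ?B"
    using sum_list_distinct_conv_sum_set[OF xs(2)] xs(1) len by auto
  have fin: "finite ?B"
    by (rule finite_subset[OF _ finite_lists_length_eq[of "{..j}" "CARD('n)"]]) (auto dest: member_le_sum_list)
  have "card ?A \<le> card ?B" by (rule card_inj_on_le[OF inj im fin])
  also have "\<dots> = (j + CARD('n) - 1) choose j" by (rule card_length_sum_list)
  finally show ?thesis .
qed

lemma sum_power_of_2_le: "(\<Sum>j\<le>m. (2::nat) ^ j) \<le> 2 ^ Suc m"
  by (induction m) simp_all

text \<open>Each point is attributed to the tuple of the first levels that contain its coordinates. A
  tuple with excess \<open>j\<close> receives at most \<open>2\<^sup>j\<close> points, there are at most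
  \<open>(j + N - 1) choose (N - 1)\<close> such tuples, and \<open>j\<close> runs up to \<open>L\<close>.\<close>

lemma card_sparse_grid_le:
  "card (sparse_grid L :: (real^'n::finite) set) \<le> 2 ^ Suc L * ((L + CARD('n) - 1) choose (CARD('n) - 1))"
proof -
  let ?N = "CARD('n)"
  let ?I = "\<lambda>j. {l :: 'n \<Rightarrow> nat. (\<forall>n. 1 \<le> l n) \<and> (\<Sum>n\<in>UNIV. l n - 1) = j}"
  let ?G = "\<lambda>l. {q :: real^'n. \<forall>n. q $ n \<in> cc_points (l n) - cc_points (l n - 1)}"
  have N: "0 < ?N" by simp
  have sub: "(sparse_grid L :: (real^'n) set) \<subseteq> (\<Union>j\<in>{..L}. \<Union>l\<in>?I j. ?G l)"
  proof
    fix q :: "real^'n" assume "q \<in> sparse_grid L"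
    then obtain l where l: "\<forall>n. 1 \<le> l n" "(\<Sum>n\<in>UNIV. l n - 1) = L" "\<forall>n. q $ n \<in> cc_points (l n)"
      by (auto simp: sparse_grid_def)
    define k where "k n = (LEAST i. q $ n \<in> cc_points i)" for n
    have k: "q $ n \<in> cc_points (k n)" "k n \<le> l n" for n
      unfolding k_def using l(3) by (auto intro: LeastI Least_le)
    have k1: "1 \<le> k n" for n using k(1)[of n] by (cases "k n") (auto simp: cc_points_def)
    have "q $ n \<notin> cc_points (k n - 1)" for n
      using not_less_Least[of "k n - 1" "\<lambda>i. q $ n \<in> cc_points i"] k1[of n] by (auto simp: k_def)
    then have "q \<in> ?G k" using k(1) by auto
    moreover have "(\<Sum>n\<in>UNIV. k n - 1) \<le> L" unfolding l(2)[symmetric] using k(2) by (intro sum_mono diff_le_mono) auto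
    ultimately show "q \<in> (\<Union>j\<in>{..L}. \<Union>l\<in>?I j. ?G l)" using k1 by blast
  qed
  have finI: "finite (?I j)" for j
    by (rule finite_subset[OF _ finite_levels_le(1)[of j]]) auto
  have finG: "finite (?G l)" for l by (rule finite_grid) simp
  have cardG: "card (?G l) \<le> 2 ^ j" if "l \<in> ?I j" for l j
  proof -
    have "card (?G l) \<le> (\<Prod>n\<in>UNIV. card (cc_points (l n) - cc_points (l n - 1)))" by (rule card_grid) simp
    also have "\<dots> \<le> (\<Prod>n\<in>UNIV. 2 ^ (l n - 1))" by (rule prod_mono, rule conjI, simp, rule card_cc_diff) (use that in blast)
    also have "\<dots> = 2 ^ j" using that by (simp add: power_sum[symmetric])
    finally show ?thesis .
  qed
  have "card (sparse_grid L :: (real^'n) set) \<le> card (\<Union>j\<in>{..L}. \<Union>l\<in>?I j. ?G l)"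
    by (rule card_mono[OF _ sub]) (intro finite_UN_I finI finG finite_atMost)
  also have "\<dots> \<le> (\<Sum>j\<le>L. card (\<Union>l\<in>?I j. ?G l))" by (rule card_UN_le) simp
  also have "\<dots> \<le> (\<Sum>j\<le>L. ((L + ?N - 1) choose (?N - 1)) * 2 ^ j)"
  proof (rule sum_mono)
    fix j assume j: "j \<in> {..L}"
    have "card (\<Union>l\<in>?I j. ?G l) \<le> (\<Sum>l\<in>?I j. card (?G l))" by (rule card_UN_le[OF finI])
    also have "\<dots> \<le> (\<Sum>l\<in>?I j. 2 ^ j)" by (rule sum_mono) (rule cardG)
    also have "\<dots> = card (?I j) * 2 ^ j" by simp
    also have "\<dots> \<le> ((L + ?N - 1) choose (?N - 1)) * 2 ^ j"
    proof (rule mult_right_mono)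
      have "card (?I j) \<le> (j + ?N - 1) choose j" by (rule card_compositions)
      also have "\<dots> = (j + ?N - 1) choose (?N - 1)" using N by (subst binomial_symmetric) (auto simp: Suc_leI)
      also have "\<dots> \<le> (L + ?N - 1) choose (?N - 1)" using j by (intro binomial_right_mono) simp
      finally show "card (?I j) \<le> (L + ?N - 1) choose (?N - 1)" .
    qed simp
    finally show "card (\<Union>l\<in>?I j. ?G l) \<le> ((L + ?N - 1) choose (?N - 1)) * 2 ^ j" .
  qed
  also have "\<dots> = ((L + ?N - 1) choose (?N - 1)) * (\<Sum>j\<le>L. 2 ^ j)" by (simp add: sum_distrib_left)
  also have "(\<Sum>j\<le>L. (2::nat) ^ j) \<le> 2 ^ Suc L" by (rule sum_power_of_2_le)
  finally show ?thesis by (simp add: mult.commute)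
qed

text \<open>For one parameter the general count is too large by a factor of about two, which the
  constants of the final bound do not leave room for.\<close>

lemma card_sparse_grid_1:
  assumes N: "CARD('n::finite) = 1" and L: "1 \<le> L"
  shows "card (sparse_grid L :: (real^'n) set) \<le> 2 ^ L + 1"
proof -
  obtain m :: 'n where U: "UNIV = {m}" using N by (auto simp: card_1_singleton_iff)
  have "(sparse_grid L :: (real^'n) set) \<subseteq> {q. \<forall>n. q $ n \<in> cc_points (Suc L)}"
  proof
    fix q :: "real^'n" assume "q \<in> sparse_grid L"
    then obtain l where l: "\<forall>n. 1 \<le> l n" "(\<Sum>n\<in>UNIV. l n - 1) = L" "\<forall>n. q $ n \<in> cc_points (l n)"
      by (auto simp: sparse_grid_def)
    have "l m = Suc L" using l(1,2) unfolding U by (metis Suc_pred' diff_Suc_1 finite.emptyI sum.empty sum.insert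
        add_0_right empty_iff le_add_diff_inverse plus_1_eq_Suc)
    moreover have "n = m" for n using U by auto
    ultimately have "q $ n \<in> cc_points (Suc L)" for n using l(3) by metis
    then show "q \<in> {q. \<forall>n. q $ n \<in> cc_points (Suc L)}" by blast
  qed
  then have "card (sparse_grid L :: (real^'n) set) \<le> card {q :: real^'n. \<forall>n. q $ n \<in> cc_points (Suc L)}"
    by (rule card_mono[rotated]) (rule finite_grid, rule finite_cc_points)
  also have "\<dots> \<le> (\<Prod>n\<in>(UNIV :: 'n set). card (cc_points (Suc L)))" by (rule card_grid) simp
  also have "\<dots> = 2 ^ L + 1" using L N by (simp add: card_cc_points)
  finally show ?thesis .
qed

section \<open>Test functions\<close>

definition smooth :: "(real^'d::finite \<Rightarrow> real) \<Rightarrow> bool" where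
  "smooth \<phi> \<longleftrightarrow> (\<forall>js x. pderivs js \<phi> differentiable (at x))"

definition pd :: "'d \<Rightarrow> (real^'d::finite \<Rightarrow> real) \<Rightarrow> real^'d \<Rightarrow> real" where
  "pd j \<phi> x = frechet_derivative \<phi> (at x) (axis j 1)"

lemma pderivs_Cons_pd: "pderivs (j # js) \<phi> = pd j (pderivs js \<phi>)"
  by (simp add: pd_def fun_eq_iff)

lemma pderivs_single: "pderivs [j] \<phi> = pd j \<phi>"
  by (simp add: pd_def fun_eq_iff)

lemma pderivs_append: "pderivs (js @ [j]) \<phi> = pderivs js (pd j \<phi>)"
  by (induction js) (simp_all add: pd_def[abs_def])

lemma smooth_differentiable: "smooth \<phi> \<Longrightarrow> \<phi> differentiable (at x)"
  unfolding smooth_def by (metis pderivs.simps(1))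

lemma smooth_pd: "smooth \<phi> \<Longrightarrow> smooth (pd j \<phi>)"
  unfolding smooth_def by (metis pderivs_append)

lemma smooth_continuous: "smooth \<phi> \<Longrightarrow> continuous_on S \<phi>"
  by (meson continuous_at_imp_continuous_on differentiable_imp_continuous_within smooth_differentiable)

text \<open>Smoothness is membership in a class of differentiable functions that is closed under partial
  derivatives. This avoids formulas for higher derivatives.\<close>

lemma smooth_coinduct:
  assumes "\<phi> \<in> S" "\<And>\<psi> x. \<psi> \<in> S \<Longrightarrow> \<psi> differentiable (at x)" "\<And>\<psi> j. \<psi> \<in> S \<Longrightarrow> pd j \<psi> \<in> S"
  shows "smooth \<phi>"
proof -
  have "pderivs js \<phi> \<in> S" for js
    by (induction js) (use assms in \<open>auto simp: pderivs_Cons_pd simp del: pderivs.simps(2)\<close>)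
  then show ?thesis using assms(2) by (auto simp: smooth_def)
qed

lemma pd_eqI: "(\<phi> has_derivative \<phi>') (at x) \<Longrightarrow> pd j \<phi> x = \<phi>' (axis j 1)"
  using frechet_derivative_at by (fastforce simp: pd_def)

lemma pd_has_derivative: "\<phi> differentiable (at x) \<Longrightarrow> (\<phi> has_derivative frechet_derivative \<phi> (at x)) (at x)"
  by (simp add: frechet_derivative_works)

lemma pd_add: "f differentiable (at x) \<Longrightarrow> g differentiable (at x) \<Longrightarrow> pd j (\<lambda>x. f x + g x) x = pd j f x + pd j g x"
  by (subst pd_eqI[OF has_derivative_add[OF pd_has_derivative pd_has_derivative]]) (auto simp: pd_def)

lemma pd_mult: "f differentiable (at x) \<Longrightarrow> g differentiable (at x) \<Longrightarrow> pd j (\<lambda>x. f x * g x) x = f x * pd j g x + pd j f x * g x"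
  by (subst pd_eqI[OF has_derivative_mult[OF pd_has_derivative pd_has_derivative]]) (auto simp: pd_def)

text \<open>The algebra generated by the smooth functions is closed under partial derivatives, by the
  Leibniz rule; hence sums and products of smooth functions are smooth.\<close>

inductive_set smooth_alg :: "(real^'d::finite \<Rightarrow> real) set" where
  base: "smooth f \<Longrightarrow> f \<in> smooth_alg"
| add: "f \<in> smooth_alg \<Longrightarrow> g \<in> smooth_alg \<Longrightarrow> (\<lambda>x. f x + g x) \<in> smooth_alg"
| mult: "f \<in> smooth_alg \<Longrightarrow> g \<in> smooth_alg \<Longrightarrow> (\<lambda>x. f x * g x) \<in> smooth_alg"

lemma smooth_alg_smooth: "f \<in> smooth_alg \<Longrightarrow> smooth f"
proof (erule smooth_coinduct)
  fix \<psi> :: "real^'d \<Rightarrow> real" and x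
  assume "\<psi> \<in> smooth_alg" then show "\<psi> differentiable at x"
    by (induction arbitrary: x) (auto intro: smooth_differentiable)
next
  fix \<psi> :: "real^'d \<Rightarrow> real" and j
  assume "\<psi> \<in> smooth_alg"
  then have "pd j \<psi> \<in> smooth_alg \<and> (\<forall>x. \<psi> differentiable at x)"
  proof induction
    case (base f)
    then show ?case by (auto intro: smooth_pd smooth_alg.base smooth_differentiable)
  next
    case (add f g)
    then have "pd j (\<lambda>x. f x + g x) = (\<lambda>x. pd j f x + pd j g x)" by (auto simp: pd_add)
    with add show ?case by (auto intro: smooth_alg.add)
  next
    case (mult f g)
    then have "pd j (\<lambda>x. f x * g x) = (\<lambda>x. f x * pd j g x + pd j f x * g x)" by (auto simp: pd_mult)
    with mult show ?case by (auto intro!: smooth_alg.add smooth_alg.mult)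
  qed
  then show "pd j \<psi> \<in> smooth_alg" by simp
qed

lemma smooth_add: "smooth f \<Longrightarrow> smooth g \<Longrightarrow> smooth (\<lambda>x. f x + g x)"
  and smooth_mult: "smooth f \<Longrightarrow> smooth g \<Longrightarrow> smooth (\<lambda>x. f x * g x)"
  by (blast intro: smooth_alg_smooth smooth_alg.intros)+

lemma smooth_affine: "smooth (\<lambda>x::real^'d::finite. a * x $ j + b)"
proof (rule smooth_coinduct[where S = "range (\<lambda>(a, b) (x::real^'d). a * x $ j + b)"])
  show "(\<lambda>x::real^'d. a * x $ j + b) \<in> range (\<lambda>(a, b) x. a * x $ j + b)"
    by (auto intro!: range_eqI[of _ _ "(a, b)"])
  have d: "((\<lambda>x::real^'d. a * x $ j + b) has_derivative (\<lambda>x. a * x $ j)) (at x)" for a b x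
    by (auto intro!: derivative_eq_intros bounded_linear_imp_has_derivative)
  fix \<psi> :: "real^'d \<Rightarrow> real" assume "\<psi> \<in> range (\<lambda>(a, b) x. a * x $ j + b)"
  then obtain a b where \<psi>: "\<psi> = (\<lambda>x. a * x $ j + b)" by auto
  show "\<psi> differentiable at x" for x unfolding \<psi> using d by (auto simp: differentiable_def)
  have "pd i \<psi> = (\<lambda>x. 0 * x $ j + a * axis i 1 $ j)" for i
    unfolding \<psi> by (auto simp: pd_eqI[OF d])
  then show "pd i \<psi> \<in> range (\<lambda>(a, b) x. a * x $ j + b)" for i
    by (intro range_eqI[of _ _ "(0, a * axis i 1 $ j)"]) auto
qed

lemma smooth_const: "smooth (\<lambda>x::real^'d::finite. b)"
  using smooth_affine[of 0 _ b] by simp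

lemma smooth_prod: "(\<And>i. i \<in> I \<Longrightarrow> smooth (f i)) \<Longrightarrow> smooth (\<lambda>x. \<Prod>i\<in>I. f i x)"
  by (induction I rule: infinite_finite_induct) (auto intro: smooth_const smooth_mult)

text \<open>The family of functions \<open>P (1 / t) exp (- 1 / t)\<close>, extended by \<open>0\<close>, contains the standard
  smooth function that vanishes on a half line, and it is closed under differentiation.\<close>

definition flat :: "real poly \<Rightarrow> real \<Rightarrow> real" where
  "flat P t = (if t \<le> 0 then 0 else poly P (1 / t) * exp (- (1 / t)))"

lemma poly_times_exp_tendsto: "((\<lambda>s::real. poly P s * exp (- s)) \<longlongrightarrow> 0) at_top"
proof -
  have "((\<lambda>s. \<Sum>i\<le>degree P. coeff P i * (s ^ i / exp s)) \<longlongrightarrow> (\<Sum>i\<le>degree P. coeff P i * 0)) at_top"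
    by (intro tendsto_sum tendsto_mult tendsto_const tendsto_power_div_exp_0)
  moreover have "(\<lambda>s. \<Sum>i\<le>degree P. coeff P i * (s ^ i / exp s)) = (\<lambda>s. poly P s * exp (- s))"
    by (simp add: poly_altdef sum_divide_distrib exp_minus divide_inverse sum_distrib_right mult.assoc)
  ultimately show ?thesis by simp
qed

lemma flat_deriv:
  "(flat P has_real_derivative flat ([:0, 0, 1:] * (P - pderiv P)) t) (at t)"
proof -
  consider "t < 0" | "t = 0" | "0 < t" by linarith
  then show ?thesis
  proof cases
    case 1
    have "((\<lambda>_. 0) has_real_derivative 0) (at t)" by simp
    then have "(flat P has_real_derivative 0) (at t)"
      by (rule has_field_derivative_transform_within[of _ _ _ _ "- t"]) (use 1 in \<open>auto simp: flat_def dist_real_def\<close>)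
    then show ?thesis using 1 by (simp add: flat_def)
  next
    case 2
    have "((\<lambda>h. poly (pCons 0 P) (inverse h) * exp (- inverse h)) \<longlongrightarrow> 0) (at_right 0)"
      using filterlim_compose[OF poly_times_exp_tendsto[of "pCons 0 P"] filterlim_inverse_at_top_right] by simp
    then have "((\<lambda>h. flat P h / h) \<longlongrightarrow> 0) (at_right 0)"
      by (rule Lim_transform_eventually) (auto simp: eventually_at_filter flat_def inverse_eq_divide)
    moreover have "((\<lambda>h. flat P h / h) \<longlongrightarrow> 0) (at_left 0)"
      by (rule Lim_transform_eventually[OF tendsto_const]) (auto simp: eventually_at_filter flat_def)
    ultimately have "((\<lambda>h. flat P h / h) \<longlongrightarrow> 0) (at 0)" by (simp add: filterlim_split_at)
    then show ?thesis using 2 by (simp add: DERIV_def flat_def)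
  next
    case 3
    have "((\<lambda>t. poly P (1 / t) * exp (- (1 / t))) has_real_derivative
        poly (pderiv P) (1 / t) * (- (1 / t\<^sup>2)) * exp (- (1 / t)) + exp (- (1 / t)) * (1 / t\<^sup>2) * poly P (1 / t)) (at t)"
      using 3 by (auto intro!: derivative_eq_intros DERIV_chain2[OF poly_DERIV] simp: power2_eq_square)
    also have "poly (pderiv P) (1 / t) * (- (1 / t\<^sup>2)) * exp (- (1 / t)) + exp (- (1 / t)) * (1 / t\<^sup>2) * poly P (1 / t)
        = flat ([:0, 0, 1:] * (P - pderiv P)) t"
      using 3 by (simp add: flat_def power2_eq_square algebra_simps)
    finally show ?thesis
      by (rule has_field_derivative_transform_within[of _ _ _ _ t]) (use 3 in \<open>auto simp: flat_def dist_real_def\<close>)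
  qed
qed

lemma smooth_flat: "smooth (\<lambda>x::real^'d::finite. flat P (k * x $ j + d))"
proof (rule smooth_coinduct[where S = "range (\<lambda>(c, P) (x::real^'d). c * flat P (k * x $ j + d))"])
  show "(\<lambda>x::real^'d. flat P (k * x $ j + d)) \<in> range (\<lambda>(c, P) x. c * flat P (k * x $ j + d))"
    by (auto intro!: range_eqI[of _ _ "(1, P)"])
  have D: "((\<lambda>x::real^'d. c * flat P (k * x $ j + d)) has_derivative
      (\<lambda>h. c * (k * h $ j * flat ([:0, 0, 1:] * (P - pderiv P)) (k * x $ j + d)))) (at x)" for c P x
  proof -
    have 1: "(flat P has_derivative (\<lambda>h. h * flat ([:0, 0, 1:] * (P - pderiv P)) (k * x $ j + d))) (at (k * x $ j + d))"
      using flat_deriv[of P "k * x $ j + d"] by (simp add: has_field_derivative_def mult.commute[of _ "flat _ _"])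
    have 2: "((\<lambda>x::real^'d. k * x $ j + d) has_derivative (\<lambda>h. k * h $ j)) (at x)"
      by (auto intro!: derivative_eq_intros bounded_linear_imp_has_derivative)
    show ?thesis using has_derivative_mult_right[OF has_derivative_compose[OF 2 1], of c] by simp
  qed
  fix \<psi> :: "real^'d \<Rightarrow> real" assume "\<psi> \<in> range (\<lambda>(c, P) x. c * flat P (k * x $ j + d))"
  then obtain c P where \<psi>: "\<psi> = (\<lambda>x. c * flat P (k * x $ j + d))" by auto
  show "\<psi> differentiable at x" for x unfolding \<psi> using D by (auto simp: differentiable_def)
  have "pd i \<psi> = (\<lambda>x. (c * (k * axis i 1 $ j)) * flat ([:0, 0, 1:] * (P - pderiv P)) (k * x $ j + d))" for i
    unfolding \<psi> by (auto simp: pd_eqI[OF D])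
  then show "pd i \<psi> \<in> range (\<lambda>(c, P) x. c * flat P (k * x $ j + d))" for i
    by (intro range_eqI[of _ _ "(c * (k * axis i 1 $ j), [:0, 0, 1:] * (P - pderiv P))"]) auto
qed

lemma test_fun_iff: "test_fun D (\<phi> :: real^'d::finite \<Rightarrow> real) \<longleftrightarrow>
    smooth \<phi> \<and> (\<exists>K. compact K \<and> K \<subseteq> D \<and> (\<forall>x. x \<notin> K \<longrightarrow> \<phi> x = 0))"
  by (simp add: test_fun_def smooth_def)

lemma test_fun_smooth: "test_fun D \<phi> \<Longrightarrow> smooth \<phi>" for \<phi> :: "real^'d::finite \<Rightarrow> real"
  by (simp add: test_fun_iff)

lemma test_fun_outside: "test_fun D \<phi> \<Longrightarrow> x \<notin> D \<Longrightarrow> \<phi> x = 0" for \<phi> :: "real^'d::finite \<Rightarrow> real"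
  by (auto simp: test_fun_iff)

lemma test_fun_pd: "test_fun D \<phi> \<Longrightarrow> test_fun D (pd j \<phi>)"
proof -
  assume t: "test_fun D \<phi>"
  then obtain K where K: "compact K" "K \<subseteq> D" "\<And>x. x \<notin> K \<Longrightarrow> \<phi> x = 0" by (auto simp: test_fun_iff)
  have "pd j \<phi> x = 0" if "x \<notin> K" for x
  proof -
    have op: "open (- K)" using K(1) by (simp add: compact_imp_closed open_Compl)
    have "((\<lambda>x. 0) has_derivative (\<lambda>x. 0)) (at x)" by simp
    then have "(\<phi> has_derivative (\<lambda>x. 0)) (at x)"
      by (rule has_derivative_transform_within_open[OF _ op]) (use that K in auto)
    from pd_eqI[OF this] show ?thesis .
  qed
  then show ?thesis using t K by (auto simp: test_fun_iff smooth_pd)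
qed

lemma test_fun_mult: "test_fun D \<phi> \<Longrightarrow> smooth \<psi> \<Longrightarrow> test_fun D (\<lambda>x. \<psi> x * \<phi> x)"
  unfolding test_fun_iff by (metis mult_zero_right smooth_mult)

lemma test_fun_bounded:
  fixes \<phi> :: "real^'d::finite \<Rightarrow> real"
  assumes "test_fun D \<phi>" shows "\<exists>C. \<forall>x. \<bar>\<phi> x\<bar> \<le> C"
proof -
  obtain K where K: "compact K" "\<And>x. x \<notin> K \<Longrightarrow> \<phi> x = 0" using assms by (auto simp: test_fun_iff)
  have "compact (\<phi> ` K)" using assms K(1) by (intro compact_continuous_image smooth_continuous) (auto simp: test_fun_iff)
  then obtain C where C: "\<And>x. x \<in> K \<Longrightarrow> \<bar>\<phi> x\<bar> \<le> C" using compact_imp_bounded bounded_iff by (metis imageI real_norm_def)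
  have "\<bar>\<phi> x\<bar> \<le> max C 0" for x using C[of x] K(2)[of x] by (cases "x \<in> K") auto
  then show ?thesis by blast
qed

lemma test_fun_borel: "test_fun D \<phi> \<Longrightarrow> \<phi> \<in> borel_measurable borel" for \<phi> :: "real^'d::finite \<Rightarrow> real"
  by (intro borel_measurable_continuous_onI smooth_continuous test_fun_smooth)

text \<open>The integral of a partial derivative is the limit of the integrals of difference quotients,
  and these vanish by translation invariance. All integrations by parts below are instances of
  it.\<close>

lemma integral_pd_zero:
  fixes F :: "real^'d::finite \<Rightarrow> real"
  assumes t: "test_fun D F"
  shows "(LINT x|lborel. pd j F x) = 0"
proof -
  obtain K where K: "compact K" "\<And>x. x \<notin> K \<Longrightarrow> F x = 0" using t by (auto simp: test_fun_iff)
  obtain R where "0 < R" "\<forall>x\<in>K. norm x \<le> R" using compact_imp_bounded[OF K(1)] bounded_pos by blast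
  then have R: "K \<subseteq> cball 0 R" "0 < R" by auto
  obtain C where C: "\<And>x. \<bar>pd j F x\<bar> \<le> C" using test_fun_bounded[OF test_fun_pd[OF t]] by blast
  have C0: "0 \<le> C" using C[of 0] by linarith
  define e :: "real^'d" where "e = axis j 1"
  have ne: "norm e = 1" by (simp add: e_def norm_axis_1)
  have sm: "F differentiable (at x)" for x using t by (simp add: test_fun_iff smooth_differentiable)
  have der: "((\<lambda>s. F (x + s *\<^sub>R e)) has_real_derivative pd j F (x + s *\<^sub>R e)) (at s)" for x s
  proof -
    have 1: "((\<lambda>s. x + s *\<^sub>R e) has_derivative (\<lambda>s. s *\<^sub>R e)) (at s)" by (auto intro!: derivative_eq_intros)
    have 2: "(F has_derivative frechet_derivative F (at (x + s *\<^sub>R e))) (at (x + s *\<^sub>R e))"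
      by (rule pd_has_derivative[OF sm])
    have "((\<lambda>s. F (x + s *\<^sub>R e)) has_derivative (\<lambda>r. frechet_derivative F (at (x + s *\<^sub>R e)) (r *\<^sub>R e))) (at s)"
      using has_derivative_compose[OF 1, of F "frechet_derivative F (at (x + s *\<^sub>R e))"] 2 by simp
    moreover have "frechet_derivative F (at (x + s *\<^sub>R e)) (r *\<^sub>R e) = pd j F (x + s *\<^sub>R e) * r" for r
      using linear_cmul[OF linear_frechet_derivative[OF sm], of "x + s *\<^sub>R e" r e] by (simp add: pd_def e_def)
    ultimately show ?thesis by (simp add: has_field_derivative_def)
  qed
  define h where "h n = 1 / real (Suc n)" for n
  have h: "0 < h n" "h n \<le> 1" for n by (auto simp: h_def)
  have hlim: "h \<longlonglongrightarrow> 0" unfolding h_def by (rule LIMSEQ_Suc) (rule lim_1_over_n)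
  define q where "q n x = (F (x + h n *\<^sub>R e) - F x) / h n" for n x
  have Fm: "F \<in> borel_measurable borel" using t by (rule test_fun_borel)
  have Fi: "integrable lborel F"
  proof -
    have "integrable lborel (\<lambda>x. indicator K x *\<^sub>R F x)"
      using t K(1) by (intro borel_integrable_compact smooth_continuous test_fun_smooth)
    moreover have "indicator K x *\<^sub>R F x = F x" for x using K(2)[of x] by (cases "x \<in> K") auto
    ultimately show ?thesis by (simp only:)
  qed
  have shift: "(LINT x|lborel. F (x + c)) = (LINT x|lborel. F x)" "integrable lborel (\<lambda>x. F (x + c))" for c
  proof -
    have "(LINT x|distr lborel borel ((+) c). F x) = (LINT x|lborel. F (c + x))"
      by (rule integral_distr) (auto simp: Fm)
    then show "(LINT x|lborel. F (x + c)) = (LINT x|lborel. F x)" by (simp add: lborel_distr_plus add.commute)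
    have "integrable (distr lborel borel ((+) c)) F \<longleftrightarrow> integrable lborel (\<lambda>x. F (c + x))"
      by (rule integrable_distr_eq) (auto simp: Fm)
    then show "integrable lborel (\<lambda>x. F (x + c))" using Fi by (simp add: lborel_distr_plus add.commute)
  qed
  have int0: "(LINT x|lborel. q n x) = 0" for n
    using shift Fi by (simp add: q_def)
  have "(\<lambda>n. LINT x|lborel. q n x) \<longlonglongrightarrow> (LINT x|lborel. pd j F x)"
  proof (rule integral_dominated_convergence[where w = "\<lambda>x. indicator (cball 0 (R + 1)) x *\<^sub>R C"])
    show "pd j F \<in> borel_measurable lborel" using test_fun_borel[OF test_fun_pd[OF t]] by simp
    show "q n \<in> borel_measurable lborel" for n
      using Fm unfolding q_def by measurable
    show "integrable lborel (\<lambda>x. indicator (cball 0 (R + 1)) x *\<^sub>R C)"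
      by (intro borel_integrable_compact continuous_intros) auto
    show "AE x in lborel. (\<lambda>n. q n x) \<longlonglongrightarrow> pd j F x"
    proof (rule AE_I2)
      fix x
      have "((\<lambda>s. (F (x + s *\<^sub>R e) - F x) / s) \<longlongrightarrow> pd j F x) (at 0)"
        using der[of x 0] by (simp add: DERIV_def)
      moreover have "filterlim h (at 0) sequentially"
        using hlim h by (auto simp: filterlim_at less_imp_neq[symmetric] intro!: always_eventually)
      ultimately show "(\<lambda>n. q n x) \<longlonglongrightarrow> pd j F x" unfolding q_def by (rule filterlim_compose)
    qed
    show "AE x in lborel. norm (q n x) \<le> indicator (cball 0 (R + 1)) x *\<^sub>R C" for n
    proof (rule AE_I2)
      fix x
      show "norm (q n x) \<le> indicator (cball 0 (R + 1)) x *\<^sub>R C"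
      proof (cases "x \<in> cball 0 (R + 1)")
        case True
        \<comment> \<open>the mean value theorem supplies the dominating function\<close>
        obtain z where "F (x + h n *\<^sub>R e) - F (x + 0 *\<^sub>R e) = (h n - 0) * pd j F (x + z *\<^sub>R e)"
          using MVT2[of 0 "h n" "\<lambda>s. F (x + s *\<^sub>R e)" "\<lambda>s. pd j F (x + s *\<^sub>R e)"] der h by blast
        then have "q n x = pd j F (x + z *\<^sub>R e)" using h[of n] by (simp add: q_def)
        then show ?thesis using True C by simp
      next
        case False
        then have n: "R + 1 < norm x" by simp
        have "norm x \<le> norm (x + h n *\<^sub>R e) + norm (h n *\<^sub>R e)" by (metis add_diff_cancel norm_triangle_ineq4)
        then have "R < norm (x + h n *\<^sub>R e)" using n h[of n] ne by simp
        then have "F (x + h n *\<^sub>R e) = 0" "F x = 0" using n R(1) by (auto intro!: K(2))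
        then show ?thesis using False by (simp add: q_def)
      qed
    qed
  qed
  then have "(\<lambda>n. 0) \<longlonglongrightarrow> (LINT x|lborel. pd j F x)" by (simp add: int0)
  then show ?thesis by (simp add: LIMSEQ_const_iff)
qed

section \<open>The fundamental lemma of the calculus of variations\<close>

lemma set_integrable_lebesgue_borel:
  fixes h :: "'a::euclidean_space \<Rightarrow> 'b::euclidean_space"
  assumes "integrable lebesgue h" "A \<in> sets lebesgue"
  shows "set_integrable lebesgue A h"
  using integrable_mult_indicator[OF assms(2,1)] by (simp add: set_integrable_def)

lemma sigma_finite_lebesgue: "sigma_finite_measure (lebesgue :: 'a::euclidean_space measure)"
proof
  show "\<exists>A::'a set set. countable A \<and> A \<subseteq> sets lebesgue \<and> \<Union>A = space lebesgue \<and> (\<forall>a\<in>A. emeasure lebesgue a \<noteq> \<infinity>)"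
  proof (intro exI[of _ "range (\<lambda>n. cball 0 (real n))"] conjI ballI)
    show "\<Union>(range (\<lambda>n. cball (0::'a) (real n))) = space lebesgue" using real_arch_simple by auto
    fix a assume "a \<in> range (\<lambda>n. cball (0::'a) (real n))"
    then show "emeasure lebesgue a \<noteq> \<infinity>"
      using emeasure_lborel_cball_finite[of "0::'a"] by (auto simp: less_top[symmetric])
  qed auto
qed

text \<open>Open boxes form an intersection-stable generator of the Borel sets, so the integral vanishes
  over every Borel set (the total integral takes care of complements), hence over every Lebesgue
  set.\<close>

lemma AE_zero_if_box_integrals_zero:
  fixes h :: "'a::euclidean_space \<Rightarrow> 'b::euclidean_space"
  assumes h: "integrable lebesgue h" and tot: "(LINT x|lebesgue. h x) = 0"
    and box: "\<And>a b. (LINT x:box a b|lebesgue. h x) = 0"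
  shows "AE x in lebesgue. h x = 0"
proof (rule sigma_finite_measure.density_zero[OF sigma_finite_lebesgue h])
  have borel0: "(LINT x:A|lebesgue. h x) = 0" if "A \<in> sets borel" for A
  proof -
    have eqb: "sets (borel :: 'a measure) = sigma_sets UNIV (range (\<lambda>(a, b). box a b :: 'a set))"
      by (subst borel_eq_box) (rule sets_measure_of, simp)
    from that have *: "A \<in> sigma_sets UNIV (range (\<lambda>(a, b). box a b :: 'a set))" unfolding eqb .
    have r: "range (\<lambda>(a, b). box a b :: 'a set) \<subseteq> Pow UNIV" by simp
    have st: "Int_stable (range (\<lambda>(a, b). box a b :: 'a set))"
      by (auto simp: Int_stable_def box_Int_box)
    show ?thesis
      using st r *
    proof (induction rule: sigma_sets_induct_disjoint)
      case (basic A) then show ?case using box by auto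
    next
      case empty show ?case by (simp add: set_lebesgue_integral_def)
    next
      case (compl A)
      then have "A \<in> sets borel" unfolding eqb by simp
      then have A: "A \<in> sets lebesgue" by simp
      have "(LINT x:(UNIV - A) \<union> A|lebesgue. h x) = (LINT x:UNIV - A|lebesgue. h x) + (LINT x:A|lebesgue. h x)"
        using A by (intro set_integral_Un set_integrable_lebesgue_borel[OF h]) auto
      moreover have "(UNIV - A) \<union> A = UNIV" by auto
      ultimately show ?case using compl tot by (simp add: set_lebesgue_integral_def)
    next
      case (union A)
      then have "A i \<in> sets borel" for i unfolding eqb by blast
      then have A: "A i \<in> sets lebesgue" for i by simp
      have "(LINT x:(\<Union>i. A i)|lebesgue. h x) = (\<Sum>i. (LINT x:(A i)|lebesgue. h x))"
        using union A by (intro lebesgue_integral_countable_add set_integrable_lebesgue_borel[OF h])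
          (auto simp: disjoint_family_on_def)
      then show ?case using union by simp
    qed
  qed
  fix A :: "'a set" assume "A \<in> sets lebesgue"
  then obtain S N N' where A: "A = S \<union> N" "N \<subseteq> N'" "N' \<in> null_sets lborel" "S \<in> sets lborel"
    by (rule sets_completionE)
  have "AE x in lebesgue. x \<notin> N'" using A(3) by (intro AE_not_in) (auto simp: null_sets_completionI)
  moreover have "set_borel_measurable lebesgue B h" if "B \<in> sets lebesgue" for B
    using that h unfolding set_borel_measurable_def
    by (intro borel_measurable_scaleR borel_measurable_indicator) auto
  ultimately have "(LINT x:A|lebesgue. h x) = (LINT x:S|lebesgue. h x)"
    using \<open>A \<in> sets lebesgue\<close> A(4)
    by (intro set_integral_cong_set) (auto simp: A(1) dest!: subsetD[OF A(2)])
  then show "(LINT x:A|lebesgue. h x) = 0" using borel0[of S] A(4) by simp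
qed

text \<open>Test functions with values in \<open>[0, 1]\<close> that converge to the indicator function of an open
  box. The affine arguments have the literal shape required by the smoothness of \<open>flat\<close>.\<close>

definition box_bump :: "nat \<Rightarrow> real^'d \<Rightarrow> real^'d \<Rightarrow> real^'d::finite \<Rightarrow> real" where
  "box_bump k a b x = (\<Prod>j\<in>UNIV. flat [:1:] (real (Suc k) * x $ j + (- real (Suc k) * a $ j)) *
     flat [:1:] (- real (Suc k) * x $ j + real (Suc k) * b $ j))"

lemma flat_1: "flat [:1:] t = (if t \<le> 0 then 0 else exp (- (1 / t)))"
  by (simp add: flat_def)

lemma flat_1_range: "0 \<le> flat [:1:] t" "flat [:1:] t \<le> 1"
  by (auto simp: flat_1)

lemma box_bump_test_fun: "cbox a b \<subseteq> D \<Longrightarrow> test_fun D (box_bump k a b)"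
  unfolding test_fun_iff
proof (intro conjI exI[of _ "cbox a b"] allI impI)
  show "smooth (box_bump k a b)"
    unfolding box_bump_def by (intro smooth_prod smooth_mult smooth_flat)
  fix x assume "x \<notin> cbox a b"
  then obtain j where j: "x $ j < a $ j \<or> b $ j < x $ j" by (auto simp: mem_box_cart not_le)
  have "real (Suc k) * x $ j \<le> real (Suc k) * a $ j \<or> real (Suc k) * b $ j \<le> real (Suc k) * x $ j"
    using j by (auto intro!: mult_left_mono)
  then have "flat [:1:] (real (Suc k) * x $ j + (- real (Suc k) * a $ j)) *
     flat [:1:] (- real (Suc k) * x $ j + real (Suc k) * b $ j) = 0"
    by (auto simp: flat_1 simp del: of_nat_Suc)
  then show "box_bump k a b x = 0" unfolding box_bump_def by (intro prod_zero) auto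
qed auto

lemma box_bump_range: "0 \<le> box_bump k a b x" "box_bump k a b x \<le> 1"
  unfolding box_bump_def
  by (auto intro!: prod_nonneg prod_le_1 mult_le_one simp: flat_1_range simp del: of_nat_Suc)

lemma box_bump_tendsto: "(\<lambda>k. box_bump k a b x) \<longlonglongrightarrow> indicator (box a b) x"
proof (cases "x \<in> box a b")
  case True
  have lim: "(\<lambda>k. flat [:1:] (real (Suc k) * c)) \<longlonglongrightarrow> 1" if "0 < c" for c
  proof -
    have "(\<lambda>k. exp (- (1 / c * (1 / real (Suc k))))) \<longlonglongrightarrow> exp (- (1 / c * 0))"
      by (intro tendsto_intros LIMSEQ_Suc[OF lim_1_over_n])
    moreover have "flat [:1:] (real (Suc k) * c) = exp (- (1 / c * (1 / real (Suc k))))" for k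
    proof -
      have "0 < real (Suc k) * c" using that by simp
      then show ?thesis by (simp add: flat_1 mult.commute del: of_nat_Suc)
    qed
    ultimately show ?thesis by simp
  qed
  have "(\<lambda>k. \<Prod>j\<in>UNIV. flat [:1:] (real (Suc k) * (x $ j - a $ j)) * flat [:1:] (real (Suc k) * (b $ j - x $ j)))
      \<longlonglongrightarrow> (\<Prod>j\<in>(UNIV::'a set). 1 * 1)"
    using True by (intro tendsto_prod tendsto_mult lim) (auto simp: mem_box_cart)
  moreover have "box_bump k a b x = (\<Prod>j\<in>UNIV. flat [:1:] (real (Suc k) * (x $ j - a $ j)) * flat [:1:] (real (Suc k) * (b $ j - x $ j)))" for k
    unfolding box_bump_def by (intro prod.cong refl arg_cong2[where f = "(*)"] arg_cong[where f = "flat [:1:]"])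
      (simp_all add: algebra_simps)
  ultimately show ?thesis using True by simp
next
  case False
  then obtain j where j: "x $ j \<le> a $ j \<or> b $ j \<le> x $ j" by (auto simp: mem_box_cart not_less)
  have "box_bump k a b x = 0" for k
  proof -
    have "real (Suc k) * x $ j \<le> real (Suc k) * a $ j \<or> real (Suc k) * b $ j \<le> real (Suc k) * x $ j"
      using j by (auto intro!: mult_left_mono)
    then have "flat [:1:] (real (Suc k) * x $ j + (- real (Suc k) * a $ j)) *
       flat [:1:] (- real (Suc k) * x $ j + real (Suc k) * b $ j) = 0"
      by (auto simp: flat_1 simp del: of_nat_Suc)
    then show ?thesis unfolding box_bump_def by (intro prod_zero) auto
  qed
  then show ?thesis using False by simp
qed

lemma sets_lebesgue_open: "open D \<Longrightarrow> D \<in> sets lebesgue"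
  by (simp add: borel_open)

lemma borel_measurable_lebesgue_on: "f \<in> borel_measurable borel \<Longrightarrow> f \<in> borel_measurable (lebesgue_on D)"
  by (intro measurable_restrict_space1 measurable_completion) simp

lemma LINT_lebesgue_on: "D \<in> sets lebesgue \<Longrightarrow> (LINT x|lebesgue_on D. f x) = (LINT x|lebesgue. indicator D x *\<^sub>R f x)"
  for f :: "'a::euclidean_space \<Rightarrow> 'b::euclidean_space"
  by (rule integral_restrict_space) simp

text \<open>By dominated convergence the integral of \<open>g\<close> vanishes over every box whose closure lies in
  \<open>D\<close>, so \<open>g\<close> vanishes almost everywhere on such boxes; countably many of them cover \<open>D\<close>.\<close>

lemma fundamental_lemma:
  fixes g :: "real^'d::finite \<Rightarrow> 'b::euclidean_space"
  assumes D: "open D" and g: "integrable (lebesgue_on D) g"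
    and zero: "\<And>\<phi>. test_fun D \<phi> \<Longrightarrow> (LINT x|lebesgue_on D. \<phi> x *\<^sub>R g x) = 0"
  shows "AE x in lebesgue_on D. g x = 0"
proof -
  have DL: "D \<in> sets lebesgue" using D by (rule sets_lebesgue_open)
  define g0 where "g0 x = indicator D x *\<^sub>R g x" for x
  have g0: "integrable lebesgue g0"
    using g DL unfolding g0_def by (subst (asm) integrable_restrict_space) auto
  have box0: "(LINT x:box a b|lebesgue. g0 x) = 0" if "cbox a b \<subseteq> D" for a b
  proof -
    have "(\<lambda>k. LINT x|lebesgue. box_bump k a b x *\<^sub>R g0 x) \<longlonglongrightarrow> (LINT x|lebesgue. indicator (box a b) x *\<^sub>R g0 x)"
    proof (rule integral_dominated_convergence[where w = "\<lambda>x. norm (g0 x)"])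
      show "integrable lebesgue (\<lambda>x. norm (g0 x))" using g0 by simp
      show "(\<lambda>x. indicator (box a b) x *\<^sub>R g0 x) \<in> borel_measurable lebesgue"
        using g0 by (intro borel_measurable_scaleR borel_measurable_indicator) auto
      show "(\<lambda>x. box_bump k a b x *\<^sub>R g0 x) \<in> borel_measurable lebesgue" for k
        using g0 test_fun_borel[OF box_bump_test_fun[OF that, of k]]
        by (intro borel_measurable_scaleR) (auto intro: measurable_completion)
      show "AE x in lebesgue. (\<lambda>k. box_bump k a b x *\<^sub>R g0 x) \<longlonglongrightarrow> indicator (box a b) x *\<^sub>R g0 x"
        by (intro AE_I2 tendsto_scaleR box_bump_tendsto tendsto_const)
      show "AE x in lebesgue. norm (box_bump k a b x *\<^sub>R g0 x) \<le> norm (g0 x)" for k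
        by (intro AE_I2) (auto simp: box_bump_range intro!: mult_left_le_one_le)
    qed
    moreover have "(LINT x|lebesgue. box_bump k a b x *\<^sub>R g0 x) = 0" for k
      using zero[OF box_bump_test_fun[OF that, of k]] unfolding LINT_lebesgue_on[OF DL] g0_def
      by (simp add: mult.commute)
    ultimately show ?thesis by (simp add: set_lebesgue_integral_def LIMSEQ_const_iff)
  qed
  have AEbox: "AE x in lebesgue. x \<in> cbox a b \<longrightarrow> g0 x = 0" if "cbox a b \<subseteq> D" for a b
  proof -
    define h where "h x = indicator (box a b) x *\<^sub>R g0 x" for x
    have hint: "integrable lebesgue h" unfolding h_def
      using set_integrable_lebesgue_borel[OF g0, of "box a b"] by (simp add: set_integrable_def)
    have "AE x in lebesgue. h x = 0"
    proof (rule AE_zero_if_box_integrals_zero[OF hint])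
      show "(LINT x|lebesgue. h x) = 0" using box0[OF that] by (simp add: h_def set_lebesgue_integral_def)
      fix c d :: "real^'d"
      have "(LINT x:box c d|lebesgue. h x) = (LINT x:box a b \<inter> box c d|lebesgue. g0 x)"
        unfolding set_lebesgue_integral_def h_def by (intro Bochner_Integration.integral_cong) (auto simp: indicator_def)
      also have "\<dots> = 0"
      proof (cases "box a b \<inter> box c d = {}")
        case False
        obtain a' b' where *: "box a b \<inter> box c d = box a' b'" unfolding box_Int_box by blast
        have "cbox a' b' = closure (box a' b')" using False * by (simp add: closure_box)
        also have "\<dots> \<subseteq> closure (box a b)" using * by (intro closure_mono) auto
        also have "\<dots> \<subseteq> cbox a b" by (intro closure_minimal box_subset_cbox closed_cbox)
        finally show ?thesis using that box0 * by auto
      qed (simp add: set_lebesgue_integral_def)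
      finally show "(LINT x:box c d|lebesgue. h x) = 0" .
    qed
    moreover have "AE x in lebesgue. x \<notin> cbox a b - box a b"
      using negligible_frontier_interval[of a b] by (intro AE_not_in) (simp add: negligible_iff_null_sets)
    ultimately show ?thesis by eventually_elim (auto simp: h_def)
  qed
  obtain \<D> where \<D>: "countable \<D>" "\<D> \<subseteq> Pow D" "\<And>X. X \<in> \<D> \<Longrightarrow> \<exists>a b. X = cbox a b" "\<Union>\<D> = D"
    using open_countable_Union_open_cbox[OF D] by blast
  have "AE x in lebesgue. \<forall>X\<in>\<D>. x \<in> X \<longrightarrow> g0 x = 0"
    unfolding AE_ball_countable[OF \<D>(1)] using AEbox \<D>(2,3) by (metis Pow_iff subsetD)
  then have "AE x in lebesgue. x \<in> D \<longrightarrow> g x = 0"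
  proof eventually_elim
    case (elim x)
    show ?case
    proof
      assume "x \<in> D"
      then have "g0 x = 0" using elim \<D>(4) by auto
      then show "g x = 0" using \<open>x \<in> D\<close> by (simp add: g0_def)
    qed
  qed
  then show ?thesis using DL by (subst AE_restrict_space_iff) auto
qed

section \<open>Square integrable functions\<close>

text \<open>Square integrability on an arbitrary measure space, for functions with values in a Euclidean
  space: the values are functions themselves, their gradients, and gradients of complex
  functions.\<close>

definition L2s :: "'a measure \<Rightarrow> ('a \<Rightarrow> 'b::euclidean_space) \<Rightarrow> bool" where
  "L2s M F \<longleftrightarrow> F \<in> borel_measurable M \<and> integrable M (\<lambda>x. (norm (F x))\<^sup>2)"

definition l2 :: "'a measure \<Rightarrow> ('a \<Rightarrow> 'b::euclidean_space) \<Rightarrow> real" where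
  "l2 M F = sqrt (LINT x|M. (norm (F x))\<^sup>2)"

lemma L2_space_iff: "v \<in> L2_space D \<longleftrightarrow> L2s (lebesgue_on D) v"
  by (simp add: L2_space_def L2s_def)

lemma L2s_measurable: "L2s M F \<Longrightarrow> F \<in> borel_measurable M"
  by (simp add: L2s_def)

lemma l2_nonneg: "0 \<le> l2 M F"
  by (simp add: l2_def)

lemma l2_sq: "(l2 M F)\<^sup>2 = (LINT x|M. (norm (F x))\<^sup>2)"
  by (simp add: l2_def)

lemma L2s_product_integrable:
  assumes "L2s M F" "L2s M H"
  shows "integrable M (\<lambda>x. norm (F x) * norm (H x))"
proof (rule Bochner_Integration.integrable_bound)
  show "integrable M (\<lambda>x. (norm (F x))\<^sup>2 + (norm (H x))\<^sup>2)"
    using assms by (auto simp: L2s_def)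
  show "(\<lambda>x. norm (F x) * norm (H x)) \<in> borel_measurable M"
    using assms by (auto simp: L2s_def)
  have "a * b \<le> a\<^sup>2 + b\<^sup>2" if "0 \<le> a" "0 \<le> b" for a b :: real
    using sum_squares_bound[of a b] mult_nonneg_nonneg[OF that] by linarith
  then show "AE x in M. norm (norm (F x) * norm (H x)) \<le> norm ((norm (F x))\<^sup>2 + (norm (H x))\<^sup>2)"
    by (intro AE_I2) (simp add: abs_mult)
qed

lemma L2s_inner_integrable:
  assumes "L2s M F" "L2s M H" shows "integrable M (\<lambda>x. F x \<bullet> H x)"
  by (rule Bochner_Integration.integrable_bound[OF L2s_product_integrable[OF assms]])
    (use assms in \<open>auto simp: L2s_def abs_mult Cauchy_Schwarz_ineq2 intro!: borel_measurable_inner\<close>)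

lemma L2s_bounded_linear:
  assumes T: "bounded_linear T" and F: "L2s M F"
  shows "L2s M (\<lambda>x. T (F x))"
  unfolding L2s_def
proof
  obtain K where K: "\<And>x. norm (T x) \<le> norm x * K" "0 \<le> K" using bounded_linear.nonneg_bounded[OF T] by blast
  have m: "F \<in> borel_measurable M" using F by (rule L2s_measurable)
  have "T \<in> borel_measurable borel"
    using T by (intro borel_measurable_continuous_onI linear_continuous_on)
  from measurable_compose[OF m this] show m': "(\<lambda>x. T (F x)) \<in> borel_measurable M" .
  show "integrable M (\<lambda>x. (norm (T (F x)))\<^sup>2)"
  proof (rule Bochner_Integration.integrable_bound)
    show "integrable M (\<lambda>x. (norm (F x))\<^sup>2 * K\<^sup>2)" using F by (simp add: L2s_def)
    show "(\<lambda>x. (norm (T (F x)))\<^sup>2) \<in> borel_measurable M" using m' by simp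
    show "AE x in M. norm ((norm (T (F x)))\<^sup>2) \<le> norm ((norm (F x))\<^sup>2 * K\<^sup>2)"
      using power_mono[OF K(1) norm_ge_zero, of _ 2] by (intro AE_I2) (simp add: power_mult_distrib)
  qed
qed

lemma L2s_add:
  assumes F: "L2s M F" and H: "L2s M H"
  shows "L2s M (\<lambda>x. F x + H x)"
  unfolding L2s_def
proof
  show m: "(\<lambda>x. F x + H x) \<in> borel_measurable M" using assms by (intro borel_measurable_add L2s_measurable)
  have *: "(norm (a + b))\<^sup>2 \<le> 2 * (norm a)\<^sup>2 + 2 * (norm b)\<^sup>2" for a b :: 'b
    using power_mono[OF norm_triangle_ineq[of a b] norm_ge_zero, of 2] sum_squares_bound[of "norm a" "norm b"]
    by (simp add: power2_sum)
  show "integrable M (\<lambda>x. (norm (F x + H x))\<^sup>2)"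
    by (rule Bochner_Integration.integrable_bound[of M "\<lambda>x. 2 * (norm (F x))\<^sup>2 + 2 * (norm (H x))\<^sup>2"])
      (use assms m * in \<open>auto simp: L2s_def\<close>)
qed

lemma L2s_scaleR: "L2s M F \<Longrightarrow> L2s M (\<lambda>x. c *\<^sub>R F x)"
  by (rule L2s_bounded_linear[OF bounded_linear_scaleR_right])

lemma L2s_diff: "L2s M F \<Longrightarrow> L2s M H \<Longrightarrow> L2s M (\<lambda>x. F x - H x)"
  using L2s_add[of M F "\<lambda>x. (-1) *\<^sub>R H x"] L2s_scaleR[of M H "-1"] by simp

lemma L2s_zero: "L2s M (\<lambda>x. 0)"
  by (simp add: L2s_def)

lemma L2s_sum: "(\<And>i. i \<in> I \<Longrightarrow> L2s M (F i)) \<Longrightarrow> L2s M (\<lambda>x. \<Sum>i\<in>I. F i x)"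
  by (induction I rule: infinite_finite_induct) (auto intro: L2s_zero L2s_add)

lemma L2s_bounded_mult:
  assumes F: "L2s M F" and b: "b \<in> borel_measurable M" "AE x in M. \<bar>b x\<bar> \<le> B"
  shows "L2s M (\<lambda>x. b x *\<^sub>R F x)"
  unfolding L2s_def
proof
  show m: "(\<lambda>x. b x *\<^sub>R F x) \<in> borel_measurable M" by (rule borel_measurable_scaleR[OF b(1) L2s_measurable[OF F]])
  show "integrable M (\<lambda>x. (norm (b x *\<^sub>R F x))\<^sup>2)"
  proof (rule Bochner_Integration.integrable_bound)
    show "integrable M (\<lambda>x. B\<^sup>2 * (norm (F x))\<^sup>2)" using F by (simp add: L2s_def)
    show "(\<lambda>x. (norm (b x *\<^sub>R F x))\<^sup>2) \<in> borel_measurable M"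
      by (rule borel_measurable_power[OF measurable_compose[OF m borel_measurable_norm]])
    show "AE x in M. norm ((norm (b x *\<^sub>R F x))\<^sup>2) \<le> norm (B\<^sup>2 * (norm (F x))\<^sup>2)"
      using b(2)
    proof eventually_elim
      case (elim x)
      then have "\<bar>b x\<bar>\<^sup>2 \<le> B\<^sup>2" by (intro power_mono) auto
      then show ?case by (simp add: power_mult_distrib mult_right_mono)
    qed
  qed
qed

lemma L2s_Cauchy_Schwarz:
  assumes F: "L2s M F" and H: "L2s M H"
  shows "(LINT x|M. norm (F x) * norm (H x)) \<le> l2 M F * l2 M H"
proof -
  have i: "integrable M (\<lambda>x. (norm (F x))\<^sup>2)" "integrable M (\<lambda>x. (norm (H x))\<^sup>2)"
    "integrable M (\<lambda>x. norm (F x) * norm (H x))"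
    using F H L2s_product_integrable[OF F H] by (auto simp: L2s_def)
  have "(LINT x|M. norm (F x) * norm (H x))\<^sup>2 \<le> (LINT x|M. (norm (F x))\<^sup>2) * (LINT x|M. (norm (H x))\<^sup>2)"
  proof (rule discriminant_bound)
    fix t :: real
    have "0 \<le> (LINT x|M. (norm (F x) + t * norm (H x))\<^sup>2)" by simp
    also have "(\<lambda>x. (norm (F x) + t * norm (H x))\<^sup>2)
        = (\<lambda>x. (norm (F x))\<^sup>2 + 2 * t * (norm (F x) * norm (H x)) + t\<^sup>2 * (norm (H x))\<^sup>2)"
      by (simp add: power2_eq_square algebra_simps)
    finally show "0 \<le> (LINT x|M. (norm (F x))\<^sup>2) + 2 * t * (LINT x|M. norm (F x) * norm (H x))
        + t\<^sup>2 * (LINT x|M. (norm (H x))\<^sup>2)" using i by simp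
  qed simp
  then have "sqrt ((LINT x|M. norm (F x) * norm (H x))\<^sup>2) \<le> l2 M F * l2 M H"
    unfolding l2_def real_sqrt_mult[symmetric] by (rule real_sqrt_le_mono)
  then show ?thesis by simp
qed

lemma L2s_inner_le:
  assumes F: "L2s M F" and H: "L2s M H"
  shows "\<bar>LINT x|M. F x \<bullet> H x\<bar> \<le> l2 M F * l2 M H"
proof -
  have "\<bar>LINT x|M. F x \<bullet> H x\<bar> \<le> (LINT x|M. \<bar>F x \<bullet> H x\<bar>)" by (rule integral_abs_bound)
  also have "\<dots> \<le> (LINT x|M. norm (F x) * norm (H x))"
    using L2s_inner_integrable[OF F H] L2s_product_integrable[OF F H]
    by (intro integral_mono) (auto simp: Cauchy_Schwarz_ineq2)
  finally show ?thesis using L2s_Cauchy_Schwarz[OF F H] by simp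
qed

lemma l2_triangle:
  assumes F: "L2s M F" and H: "L2s M H"
  shows "l2 M (\<lambda>x. F x + H x) \<le> l2 M F + l2 M H"
proof -
  have i: "integrable M (\<lambda>x. (norm (F x))\<^sup>2)" "integrable M (\<lambda>x. (norm (H x))\<^sup>2)"
    "integrable M (\<lambda>x. norm (F x) * norm (H x))" "integrable M (\<lambda>x. (norm (F x + H x))\<^sup>2)"
    using F H L2s_product_integrable[OF F H] L2s_add[OF F H] by (auto simp: L2s_def)
  have "(l2 M (\<lambda>x. F x + H x))\<^sup>2 \<le> (LINT x|M. (norm (F x))\<^sup>2 + 2 * (norm (F x) * norm (H x)) + (norm (H x))\<^sup>2)"
    unfolding l2_sq
  proof (rule integral_mono)
    fix x show "(norm (F x + H x))\<^sup>2 \<le> (norm (F x))\<^sup>2 + 2 * (norm (F x) * norm (H x)) + (norm (H x))\<^sup>2"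
      using power_mono[OF norm_triangle_ineq[of "F x" "H x"] norm_ge_zero, of 2] by (simp add: power2_sum algebra_simps)
  qed (use i in auto)
  also have "\<dots> \<le> (l2 M F + l2 M H)\<^sup>2"
    using L2s_Cauchy_Schwarz[OF F H] i by (simp add: power2_sum l2_sq)
  finally show ?thesis by (rule power2_le_imp_le) (simp add: l2_nonneg)
qed

lemma l2_scaleR: "l2 M (\<lambda>x. c *\<^sub>R F x) = \<bar>c\<bar> * l2 M F"
proof -
  have "(LINT x|M. (norm (c *\<^sub>R F x))\<^sup>2) = c\<^sup>2 * (LINT x|M. (norm (F x))\<^sup>2)"
    by (simp add: power_mult_distrib)
  then show ?thesis by (simp add: l2_def real_sqrt_mult)
qed

lemma l2_zero: "l2 M (\<lambda>x. 0) = 0"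
  by (simp add: l2_def)

lemma l2_minus_commute: "l2 M (\<lambda>x. F x - H x) = l2 M (\<lambda>x. H x - F x)"
  by (simp add: l2_def norm_minus_commute)

lemma l2_cong_AE:
  "F \<in> borel_measurable M \<Longrightarrow> H \<in> borel_measurable M \<Longrightarrow> AE x in M. F x = H x \<Longrightarrow> l2 M F = l2 M H"
  unfolding l2_def by (intro arg_cong[where f = sqrt] integral_cong_AE) auto

lemma l2_mono_AE:
  assumes "L2s M H" "F \<in> borel_measurable M" "AE x in M. norm (F x) \<le> norm (H x)"
  shows "l2 M F \<le> l2 M H"
  unfolding l2_def
proof (rule real_sqrt_le_mono, rule integral_mono_AE')
  show "integrable M (\<lambda>x. (norm (H x))\<^sup>2)" using assms by (simp add: L2s_def)
  show "AE x in M. (norm (F x))\<^sup>2 \<le> (norm (H x))\<^sup>2"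
    using assms(3) by eventually_elim (auto intro: power_mono)
qed auto

lemma l2_sum:
  "(\<And>i. i \<in> I \<Longrightarrow> L2s M (F i)) \<Longrightarrow> l2 M (\<lambda>x. \<Sum>i\<in>I. F i x) \<le> (\<Sum>i\<in>I. l2 M (F i))"
proof (induction I rule: infinite_finite_induct)
  case (insert i I)
  have "l2 M (\<lambda>x. F i x + (\<Sum>i\<in>I. F i x)) \<le> l2 M (F i) + l2 M (\<lambda>x. \<Sum>i\<in>I. F i x)"
    using insert.prems by (intro l2_triangle L2s_sum) auto
  also have "\<dots> \<le> l2 M (F i) + (\<Sum>i\<in>I. l2 M (F i))" using insert by auto
  finally show ?case using insert by simp
qed (auto simp: l2_zero)

lemma l2_triangle_diff:
  assumes F: "L2s M F" and H: "L2s M H"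
  shows "\<bar>l2 M F - l2 M H\<bar> \<le> l2 M (\<lambda>x. F x - H x)"
  using l2_triangle[OF L2s_diff[OF F H] H] l2_triangle[OF L2s_diff[OF H F] F] l2_minus_commute[of M F H] by simp

lemma l2_eq_0_AE:
  assumes F: "L2s M F" and z: "l2 M F = 0"
  shows "AE x in M. F x = 0"
proof -
  have "(LINT x|M. (norm (F x))\<^sup>2) = 0" using z by (simp add: l2_def)
  then have "AE x in M. (norm (F x))\<^sup>2 = 0"
    using F by (subst (asm) integral_nonneg_eq_0_iff_AE) (auto simp: L2s_def)
  then show ?thesis by simp
qed

text \<open>\<open>L\<^sup>2\<close> limits may be taken in both factors of an integrated product.\<close>

lemma l2_product_tendsto:
  fixes F H :: "'a \<Rightarrow> real"
  assumes F: "L2s M F" "\<And>k. L2s M (Fk k)" "(\<lambda>k. l2 M (\<lambda>x. F x - Fk k x)) \<longlonglongrightarrow> 0"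
    and H: "L2s M H" "\<And>k. L2s M (Hk k)" "(\<lambda>k. l2 M (\<lambda>x. H x - Hk k x)) \<longlonglongrightarrow> 0"
  shows "(\<lambda>k. LINT x|M. Fk k x * Hk k x) \<longlonglongrightarrow> (LINT x|M. F x * H x)"
proof -
  let ?a = "\<lambda>k. l2 M (\<lambda>x. F x - Fk k x)" and ?b = "\<lambda>k. l2 M (\<lambda>x. H x - Hk k x)"
  have bound: "\<bar>(LINT x|M. Fk k x * Hk k x) - (LINT x|M. F x * H x)\<bar>
      \<le> ?a k * (l2 M H + ?b k) + l2 M F * ?b k" for k
  proof -
    have i: "integrable M (\<lambda>x. Fk k x * Hk k x)" "integrable M (\<lambda>x. F x * H x)" "integrable M (\<lambda>x. F x * Hk k x)"
      using L2s_inner_integrable[OF F(2) H(2)] L2s_inner_integrable[OF F(1) H(1)] L2s_inner_integrable[OF F(1) H(2)] by simp_all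
    have "(LINT x|M. Fk k x * Hk k x) - (LINT x|M. F x * H x)
       = - (LINT x|M. (F x - Fk k x) * Hk k x) - (LINT x|M. F x * (H x - Hk k x))"
      using i by (simp add: left_diff_distrib right_diff_distrib)
    also have "\<bar>\<dots>\<bar> \<le> ?a k * l2 M (Hk k) + l2 M F * ?b k"
      using L2s_inner_le[OF L2s_diff[OF F(1) F(2)] H(2), of k k] L2s_inner_le[OF F(1) L2s_diff[OF H(1) H(2)], of k]
      by simp
    also have "l2 M (Hk k) \<le> l2 M H + ?b k"
      using l2_triangle_diff[OF H(1) H(2), of k] by simp
    finally show ?thesis by (simp add: mult_left_mono l2_nonneg)
  qed
  have lim: "(\<lambda>k. ?a k * (l2 M H + ?b k) + l2 M F * ?b k) \<longlonglongrightarrow> 0 * (l2 M H + 0) + l2 M F * 0"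
    by (intro tendsto_add tendsto_mult tendsto_const F H)
  have "(\<lambda>k. (LINT x|M. Fk k x * Hk k x) - (LINT x|M. F x * H x)) \<longlonglongrightarrow> 0"
  proof (rule Lim_null_comparison[OF always_eventually])
    show "\<forall>k. norm ((LINT x|M. Fk k x * Hk k x) - (LINT x|M. F x * H x)) \<le> ?a k * (l2 M H + ?b k) + l2 M F * ?b k"
      unfolding real_norm_def using bound by blast
    show "(\<lambda>k. ?a k * (l2 M H + ?b k) + l2 M F * ?b k) \<longlonglongrightarrow> 0" using lim by (simp only: mult_zero_left mult_zero_right add_0)
  qed
  then show ?thesis by (rule LIM_zero_cancel)
qed

section \<open>Weak derivatives\<close>

text \<open>Boundedness makes coordinates bounded and the measure finite; both are used for the Poincare
  inequality and for the integrability of square integrable functions.\<close>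

locale bdd_open =
  fixes D :: "(real^'d::finite) set"
  assumes openD: "open D" and bddD: "bounded D"
begin

abbreviation M where "M \<equiv> lebesgue_on D"

lemma sets_D: "D \<in> sets lebesgue"
  using openD by (rule sets_lebesgue_open)

lemma fin: "finite_measure M"
  using lmeasurable_open[OF bddD openD] by (rule finite_measure_lebesgue_on)

lemma L2_integrable: "L2s M v \<Longrightarrow> integrable M v"
proof (rule Bochner_Integration.integrable_bound)
  assume v: "L2s M v"
  show "integrable M (\<lambda>x. 1 + (norm (v x))\<^sup>2)"
    using v by (intro Bochner_Integration.integrable_add finite_measure.integrable_const[OF fin]) (simp add: L2s_def)
  show "v \<in> borel_measurable M" using v by (rule L2s_measurable)
  have "a \<le> 1 + a\<^sup>2" for a :: real
  proof -
    have "2 * a \<le> a\<^sup>2 + 1" using sum_squares_bound[of a 1] by simp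
    moreover have "0 \<le> a\<^sup>2" by simp
    ultimately show ?thesis by linarith
  qed
  then show "AE x in M. norm (v x) \<le> norm (1 + (norm (v x))\<^sup>2)" by simp
qed

lemma bounded_L2s: "f \<in> borel_measurable M \<Longrightarrow> (\<And>x. norm (f x) \<le> B) \<Longrightarrow> L2s M f"
  unfolding L2s_def
proof
  assume m: "f \<in> borel_measurable M" and B: "\<And>x. norm (f x) \<le> B"
  show "f \<in> borel_measurable M" by fact
  show "integrable M (\<lambda>x. (norm (f x))\<^sup>2)"
    by (rule Bochner_Integration.integrable_bound[OF finite_measure.integrable_const[OF fin, of "B\<^sup>2"]])
      (use m B in \<open>auto intro!: AE_I2 power_mono\<close>)
qed

lemma test_fun_measurable: "test_fun D \<phi> \<Longrightarrow> \<phi> \<in> borel_measurable M"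
  for \<phi> :: "real^'d \<Rightarrow> real"
  by (rule borel_measurable_lebesgue_on) (rule test_fun_borel)

lemma test_fun_L2s: "test_fun D \<phi> \<Longrightarrow> L2s M \<phi>" for \<phi> :: "real^'d \<Rightarrow> real"
proof -
  assume t: "test_fun D \<phi>"
  then obtain C where "\<And>x. \<bar>\<phi> x\<bar> \<le> C" using test_fun_bounded by blast
  then show ?thesis by (intro bounded_L2s[OF test_fun_measurable[OF t], of C]) simp
qed

lemma test_fun_pderivs: "test_fun D \<phi> \<Longrightarrow> test_fun D (pderivs js \<phi>)" for \<phi> :: "real^'d \<Rightarrow> real"
  by (induction js) (auto simp: pderivs_Cons_pd test_fun_pd simp del: pderivs.simps(2))

lemma test_times_integrable:
  fixes v :: "real^'d \<Rightarrow> 'b::euclidean_space"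
  assumes "test_fun D \<phi>" "L2s M v" shows "integrable M (\<lambda>x. \<phi> x *\<^sub>R v x)"
proof -
  obtain C where C: "\<And>x. \<bar>\<phi> x\<bar> \<le> C" using test_fun_bounded[OF assms(1)] by blast
  have "L2s M (\<lambda>x. \<phi> x *\<^sub>R v x)"
    using C by (intro L2s_bounded_mult[OF assms(2) test_fun_measurable[OF assms(1)]]) auto
  then show ?thesis by (rule L2_integrable)
qed

lemma fundamental_lemma_L2:
  fixes g :: "real^'d \<Rightarrow> 'b::euclidean_space"
  assumes "L2s M g" "\<And>\<phi>. test_fun D \<phi> \<Longrightarrow> (LINT x|M. \<phi> x *\<^sub>R g x) = 0"
  shows "AE x in M. g x = 0"
  using fundamental_lemma[OF openD L2_integrable[OF assms(1)] assms(2)] .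

text \<open>The choice operator in the definition of \<open>weak_deriv\<close> is harmless: by the fundamental lemma
  any two weak derivatives agree almost everywhere.\<close>

lemma weak_deriv_unique:
  fixes v :: "real^'d \<Rightarrow> 'b::euclidean_space"
  assumes "L2s M g" "L2s M h" "has_weak_deriv D js v g" "has_weak_deriv D js v h"
  shows "AE x in M. g x = h x"
proof -
  have "AE x in M. g x - h x = 0"
  proof (rule fundamental_lemma_L2[OF L2s_diff[OF assms(1,2)]])
    fix \<phi> :: "real^'d \<Rightarrow> real" assume t: "test_fun D \<phi>"
    have "(- 1) ^ length js *\<^sub>R (LINT x|M. \<phi> x *\<^sub>R g x) = (- 1) ^ length js *\<^sub>R (LINT x|M. \<phi> x *\<^sub>R h x)"
      using trans[OF sym[OF assms(3)[unfolded has_weak_deriv_def, rule_format, OF t]]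
          assms(4)[unfolded has_weak_deriv_def, rule_format, OF t]] .
    then have "(LINT x|M. \<phi> x *\<^sub>R g x) = (LINT x|M. \<phi> x *\<^sub>R h x)" by simp
    then show "(LINT x|M. \<phi> x *\<^sub>R (g x - h x)) = 0"
      using test_times_integrable[OF t assms(1)] test_times_integrable[OF t assms(2)]
      by (simp add: scaleR_diff_right)
  qed
  then show ?thesis by simp
qed

lemma has_weak_deriv_add:
  fixes v w :: "real^'d \<Rightarrow> 'b::euclidean_space"
  assumes "L2s M v" "L2s M w" "L2s M g" "L2s M h" "has_weak_deriv D js v g" "has_weak_deriv D js w h"
  shows "has_weak_deriv D js (\<lambda>x. v x + w x) (\<lambda>x. g x + h x)"
  unfolding has_weak_deriv_def
proof (intro allI impI)
  fix \<phi> :: "real^'d \<Rightarrow> real" assume t: "test_fun D \<phi>"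
  have "(LINT x|M. pderivs js \<phi> x *\<^sub>R v x) = (- 1) ^ length js *\<^sub>R (LINT x|M. \<phi> x *\<^sub>R g x)"
    "(LINT x|M. pderivs js \<phi> x *\<^sub>R w x) = (- 1) ^ length js *\<^sub>R (LINT x|M. \<phi> x *\<^sub>R h x)"
    using assms(5,6) t by (auto simp: has_weak_deriv_def)
  then show "(LINT x|M. pderivs js \<phi> x *\<^sub>R (v x + w x)) = (- 1) ^ length js *\<^sub>R (LINT x|M. \<phi> x *\<^sub>R (g x + h x))"
    using t assms(1-4) by (simp add: scaleR_add_right test_times_integrable test_fun_pderivs)
qed

lemma has_weak_deriv_linear:
  fixes v :: "real^'d \<Rightarrow> 'b::euclidean_space" and T :: "'b \<Rightarrow> 'c::euclidean_space"
  assumes T: "bounded_linear T" and "L2s M v" "L2s M g" "has_weak_deriv D js v g"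
  shows "has_weak_deriv D js (\<lambda>x. T (v x)) (\<lambda>x. T (g x))"
  unfolding has_weak_deriv_def
proof (intro allI impI)
  fix \<phi> :: "real^'d \<Rightarrow> real" assume t: "test_fun D \<phi>"
  interpret T: bounded_linear T by (rule T)
  have *: "(LINT x|M. \<psi> x *\<^sub>R T (w x)) = T (LINT x|M. \<psi> x *\<^sub>R w x)" if "test_fun D \<psi>" "L2s M w" for \<psi> w
    using integral_bounded_linear[OF T test_times_integrable[OF that]] by (simp add: T.scaleR)
  show "(LINT x|M. pderivs js \<phi> x *\<^sub>R T (v x)) = (- 1) ^ length js *\<^sub>R (LINT x|M. \<phi> x *\<^sub>R T (g x))"
    using assms(4) t *[OF t assms(3)] *[OF test_fun_pderivs[OF t] assms(2), of js]
    by (simp add: has_weak_deriv_def T.scaleR)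
qed

lemma has_weak_deriv_cong_AE:
  fixes v :: "real^'d \<Rightarrow> 'b::euclidean_space"
  assumes "L2s M v" "L2s M w" "AE x in M. v x = w x" "has_weak_deriv D js v g"
  shows "has_weak_deriv D js w g"
  unfolding has_weak_deriv_def
proof (intro allI impI)
  fix \<phi> :: "real^'d \<Rightarrow> real" assume t: "test_fun D \<phi>"
  have "(LINT x|M. pderivs js \<phi> x *\<^sub>R w x) = (LINT x|M. pderivs js \<phi> x *\<^sub>R v x)"
    using assms(1,2) test_fun_measurable[OF test_fun_pderivs[OF t, of js]] assms(3)
    by (intro integral_cong_AE) (auto simp: L2s_def)
  then show "(LINT x|M. pderivs js \<phi> x *\<^sub>R w x) = (- 1) ^ length js *\<^sub>R (LINT x|M. \<phi> x *\<^sub>R g x)"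
    using assms(4) t by (simp add: has_weak_deriv_def)
qed

lemma weak_deriv_works:
  assumes "\<exists>g. L2s M g \<and> has_weak_deriv D js v g"
  shows "L2s M (weak_deriv D js v)" "has_weak_deriv D js v (weak_deriv D js v)"
  using someI_ex[OF assms[folded L2_space_iff]] by (simp_all add: weak_deriv_def L2_space_iff[symmetric])

lemma weak_deriv_eqI:
  assumes "L2s M g" "has_weak_deriv D js v g"
  shows "AE x in M. weak_deriv D js v x = g x"
  using weak_deriv_unique[OF weak_deriv_works(1) assms(1) weak_deriv_works(2) assms(2)] assms by blast

lemma has_weak_deriv_Nil: "has_weak_deriv D [] v v"
  by (simp add: has_weak_deriv_def)

definition S1 :: "(real^'d \<Rightarrow> 'b::euclidean_space) set" where "S1 = Sob_space D 1"

lemma Sob1_iff: "v \<in> S1 \<longleftrightarrow> L2s M v \<and> (\<forall>j. \<exists>g. L2s M g \<and> has_weak_deriv D [j] v g)"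
proof -
  have "length js \<le> 1 \<longleftrightarrow> js = [] \<or> (\<exists>j. js = [j])" for js :: "'d list"
    by (cases js rule: remdups_adj.cases) auto
  then show ?thesis using has_weak_deriv_Nil by (fastforce simp: S1_def Sob_space_def L2_space_iff)
qed

lemma Sob1I: "L2s M v \<Longrightarrow> (\<And>j. L2s M (g j)) \<Longrightarrow> (\<And>j. has_weak_deriv D [j] v (g j)) \<Longrightarrow> v \<in> S1"
  unfolding Sob1_iff by blast

lemma Sob1_L2s: "v \<in> S1 \<Longrightarrow> L2s M v"
  by (simp add: Sob1_iff)

lemma Sob1_deriv:
  assumes "v \<in> S1"
  shows "L2s M (weak_deriv D [j] v)" "has_weak_deriv D [j] v (weak_deriv D [j] v)"
  using weak_deriv_works[of "[j]" v] assms by (auto simp: Sob1_iff)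

definition grad :: "(real^'d \<Rightarrow> 'b::euclidean_space) \<Rightarrow> real^'d \<Rightarrow> 'b^'d" where
  "grad v x = (\<chi> j. weak_deriv D [j] v x)"

lemma norm_vec_sq: "(norm (g :: 'b::euclidean_space^'d))\<^sup>2 = (\<Sum>j\<in>UNIV. (norm (g $ j))\<^sup>2)"
  by (simp add: norm_vec_def L2_set_def sum_nonneg)

lemma H10_norm_eq: "H10_norm D v = l2 M (grad v)"
  by (simp add: H10_norm_def l2_def norm_vec_sq grad_def)

lemma L2s_vec:
  fixes G :: "'d \<Rightarrow> real^'d \<Rightarrow> 'b::euclidean_space"
  assumes "\<And>j. L2s M (G j)"
  shows "L2s M (\<lambda>x. \<chi> j. G j x)"
proof -
  have bl: "bounded_linear (\<lambda>a::'b. \<chi> i. if i = j then a else 0)" for j :: 'd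
  proof (rule bounded_linear_intro[where K = 1])
    fix a :: 'b
    have "(norm (\<chi> i. if i = j then a else 0))\<^sup>2 = (norm a)\<^sup>2"
      by (simp add: norm_vec_sq if_distrib[of "\<lambda>z. (norm z)\<^sup>2"] cong: if_cong)
    then show "norm (\<chi> i. if i = j then a else 0) \<le> norm a * 1" by simp
  qed (auto simp: Finite_Cartesian_Product.vec_eq_iff)
  have "(\<lambda>x. \<chi> j. G j x) = (\<lambda>x. \<Sum>j\<in>UNIV. \<chi> i. if i = j then G j x else 0)"
    by (auto simp: Finite_Cartesian_Product.vec_eq_iff fun_eq_iff)
  then show ?thesis using L2s_sum[of UNIV M "\<lambda>j x. \<chi> i. if i = j then G j x else 0"]
    L2s_bounded_linear[OF bl assms] by auto
qed

lemma L2s_grad: "v \<in> S1 \<Longrightarrow> L2s M (grad v)"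
  unfolding grad_def by (intro L2s_vec Sob1_deriv)

lemma grad_eqI:
  assumes "\<And>j. L2s M (g j)" "\<And>j. has_weak_deriv D [j] v (g j)"
  shows "AE x in M. grad v x = (\<chi> j. g j x)"
proof -
  have "AE x in M. \<forall>j\<in>UNIV. weak_deriv D [j] v x = g j x"
    by (intro AE_finite_allI weak_deriv_eqI assms) auto
  then show ?thesis by eventually_elim (simp add: grad_def)
qed

lemma Sob1_add: "v \<in> S1 \<Longrightarrow> w \<in> S1 \<Longrightarrow> (\<lambda>x. v x + w x) \<in> S1"
  by (rule Sob1I[where g = "\<lambda>j x. weak_deriv D [j] v x + weak_deriv D [j] w x"])
    (intro L2s_add has_weak_deriv_add Sob1_deriv Sob1_L2s; assumption)+

lemma grad_add:
  assumes "v \<in> S1" "w \<in> S1"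
  shows "AE x in M. grad (\<lambda>x. v x + w x) x = grad v x + grad w x"
proof -
  have "AE x in M. grad (\<lambda>x. v x + w x) x = (\<chi> j. weak_deriv D [j] v x + weak_deriv D [j] w x)"
    using assms by (intro grad_eqI L2s_add has_weak_deriv_add Sob1_deriv Sob1_L2s)
  then show ?thesis by eventually_elim (simp add: grad_def Finite_Cartesian_Product.vec_eq_iff)
qed

lemma Sob1_linear: "bounded_linear T \<Longrightarrow> v \<in> S1 \<Longrightarrow> (\<lambda>x. T (v x)) \<in> S1"
  by (rule Sob1I[where g = "\<lambda>j x. T (weak_deriv D [j] v x)"])
    (simp_all add: L2s_bounded_linear has_weak_deriv_linear Sob1_deriv Sob1_L2s)

lemma grad_linear:
  assumes "bounded_linear T" "v \<in> S1"
  shows "AE x in M. grad (\<lambda>x. T (v x)) x = (\<chi> j. T (grad v x $ j))"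
proof -
  have "AE x in M. grad (\<lambda>x. T (v x)) x = (\<chi> j. T (weak_deriv D [j] v x))"
    using assms(2)
    by (intro grad_eqI L2s_bounded_linear[OF assms(1)] has_weak_deriv_linear[OF assms(1)] Sob1_deriv Sob1_L2s)
  then show ?thesis by eventually_elim (simp add: grad_def)
qed

lemma Sob1_zero: "(\<lambda>x. 0) \<in> S1"
  by (rule Sob1I[where g = "\<lambda>_ _. 0"]) (auto simp: L2s_zero has_weak_deriv_def)

lemma Sob1_sum: "(\<And>i. i \<in> I \<Longrightarrow> v i \<in> S1) \<Longrightarrow> (\<lambda>x. \<Sum>i\<in>I. v i x) \<in> S1"
  by (induction I rule: infinite_finite_induct) (simp_all add: Sob1_zero Sob1_add)

lemma Sob1_diff: "v \<in> S1 \<Longrightarrow> w \<in> S1 \<Longrightarrow> (\<lambda>x. v x - w x) \<in> S1"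
  using Sob1_add[of v "\<lambda>x. - w x"] Sob1_linear[OF bounded_linear_minus[OF bounded_linear_ident], of w] by simp

lemma grad_diff:
  assumes "v \<in> S1" "w \<in> S1"
  shows "AE x in M. grad (\<lambda>x. v x - w x) x = grad v x - grad w x"
proof -
  have "(\<lambda>x. - w x) \<in> S1"
    using Sob1_linear[OF bounded_linear_minus[OF bounded_linear_ident] assms(2)] .
  from grad_add[OF assms(1) this] grad_linear[OF bounded_linear_minus[OF bounded_linear_ident] assms(2)]
  show ?thesis by eventually_elim (simp add: Finite_Cartesian_Product.vec_eq_iff)
qed

lemma H10_norm_triangle_diff:
  assumes "v \<in> S1" "w \<in> S1"
  shows "\<bar>H10_norm D v - H10_norm D w\<bar> \<le> H10_norm D (\<lambda>x. v x - w x)"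
proof -
  have "H10_norm D (\<lambda>x. v x - w x) = l2 M (\<lambda>x. grad v x - grad w x)"
    unfolding H10_norm_eq using assms grad_diff[OF assms]
    by (intro l2_cong_AE) (auto intro!: L2s_measurable L2s_grad Sob1_diff L2s_diff)
  then show ?thesis unfolding H10_norm_eq using l2_triangle_diff[OF L2s_grad[OF assms(1)] L2s_grad[OF assms(2)]] by simp
qed

lemma H10_norm_triangle:
  assumes "v \<in> S1" "w \<in> S1"
  shows "H10_norm D (\<lambda>x. v x + w x) \<le> H10_norm D v + H10_norm D w"
proof -
  have "H10_norm D (\<lambda>x. v x + w x) = l2 M (\<lambda>x. grad v x + grad w x)"
    unfolding H10_norm_eq using assms grad_add[OF assms]
    by (intro l2_cong_AE) (auto intro!: L2s_measurable L2s_grad Sob1_add L2s_add)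
  then show ?thesis unfolding H10_norm_eq using l2_triangle[OF L2s_grad[OF assms(1)] L2s_grad[OF assms(2)]] by simp
qed

end

section \<open>The Poincare inequality on a slab\<close>

context bdd_open
begin

lemma integral_pd_zero_on: "test_fun D F \<Longrightarrow> (LINT x|M. pd j F x) = 0"
proof -
  assume t: "test_fun D F"
  have "(LINT x|M. pd j F x) = (LINT x|lebesgue. indicator D x *\<^sub>R pd j F x)"
    by (rule LINT_lebesgue_on[OF sets_D])
  also have "(\<lambda>x. indicator D x *\<^sub>R pd j F x) = pd j F"
    using test_fun_outside[OF test_fun_pd[OF t, of j]] by (auto simp: fun_eq_iff indicator_def)
  also have "(LINT x|lebesgue. pd j F x) = (LINT x|lborel. pd j F x)"
    by (rule integral_completion) (use test_fun_borel[OF test_fun_pd[OF t, of j]] in simp)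
  finally show ?thesis using integral_pd_zero[OF t] by simp
qed

text \<open>Integration by parts: the derivative of the product of two test functions has integral
  zero.\<close>

lemma test_fun_has_weak_deriv:
  assumes "test_fun D \<Phi>" shows "has_weak_deriv D [j] \<Phi> (pd j \<Phi>)"
  unfolding has_weak_deriv_def pderivs_single
proof (intro allI impI)
  fix \<phi> :: "real^'d \<Rightarrow> real" assume t: "test_fun D \<phi>"
  have "pd j (\<lambda>x. \<phi> x * \<Phi> x) = (\<lambda>x. \<phi> x * pd j \<Phi> x + pd j \<phi> x * \<Phi> x)"
    using assms t by (auto simp: fun_eq_iff intro!: pd_mult smooth_differentiable test_fun_smooth)
  then have "(LINT x|M. \<phi> x * pd j \<Phi> x + pd j \<phi> x * \<Phi> x) = 0"
    using integral_pd_zero_on[OF test_fun_mult[OF assms test_fun_smooth[OF t]], of j] by simp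
  moreover have "integrable M (\<lambda>x. \<phi> x * pd j \<Phi> x)" "integrable M (\<lambda>x. pd j \<phi> x * \<Phi> x)"
    using test_times_integrable[OF t test_fun_L2s[OF test_fun_pd[OF assms]], of j]
      test_times_integrable[OF test_fun_pd[OF t] test_fun_L2s[OF assms], of j] by simp_all
  ultimately show "(LINT x|M. pd j \<phi> x *\<^sub>R \<Phi> x) = (- 1) ^ length [j] *\<^sub>R (LINT x|M. \<phi> x *\<^sub>R pd j \<Phi> x)"
    by simp
qed

lemma Sob_norm_ge:
  fixes v :: "real^'d \<Rightarrow> 'b::euclidean_space"
  assumes "length js \<le> k" shows "l2 M (weak_deriv D js v) \<le> Sob_norm D k v"
  unfolding l2_def Sob_norm_def
proof (rule real_sqrt_le_mono)
  have "finite {js :: 'd list. length js \<le> k}"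
    using finite_lists_length_le[of "UNIV :: 'd set" k] by simp
  then show "(LINT x|M. (norm (weak_deriv D js v x))\<^sup>2)
      \<le> (\<Sum>js | length js \<le> k. LINT x|M. (norm (weak_deriv D js v x))\<^sup>2)"
    using assms member_le_sum[of js "{js. length js \<le> k}" "\<lambda>js. LINT x|M. (norm (weak_deriv D js v x))\<^sup>2"] by simp
qed

text \<open>\<open>v\<close> is a limit of test functions and \<open>G\<close> the limit of their partial derivatives. This
  describes \<open>H\<^sub>0\<^sup>1\<close> without mentioning weak derivatives, and it is stable under linear combinations
  and under passing to the limit in integrals.\<close>

definition h10_approx :: "(real^'d \<Rightarrow> real) \<Rightarrow> ('d \<Rightarrow> real^'d \<Rightarrow> real) \<Rightarrow> bool" where
  "h10_approx v G \<longleftrightarrow> L2s M v \<and> (\<forall>j. L2s M (G j)) \<and> (\<exists>\<Phi>. (\<forall>k::nat. test_fun D (\<Phi> k)) \<and>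
     (\<lambda>k. l2 M (\<lambda>x. v x - \<Phi> k x)) \<longlonglongrightarrow> 0 \<and> (\<forall>j. (\<lambda>k. l2 M (\<lambda>x. G j x - pd j (\<Phi> k) x)) \<longlonglongrightarrow> 0))"

lemma H10_Sob1: "v \<in> H10 D \<Longrightarrow> v \<in> S1"
  by (simp add: H10_def S1_def)

lemma H10_approx:
  assumes "v \<in> H10 D" shows "h10_approx v (\<lambda>j. weak_deriv D [j] v)"
proof -
  obtain \<Phi> :: "nat \<Rightarrow> real^'d \<Rightarrow> real" where \<Phi>: "\<And>k. test_fun D (\<Phi> k)" "(\<lambda>k. Sob_norm D 1 (\<lambda>x. v x - \<Phi> k x)) \<longlonglongrightarrow> 0"
    using assms by (auto simp: H10_def)
  have v: "v \<in> S1" using assms by (rule H10_Sob1)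
  have \<Phi>L: "L2s M (\<Phi> k)" "L2s M (pd j (\<Phi> k))" for k j
    using \<Phi>(1) by (auto intro: test_fun_L2s test_fun_pd)
  have d0: "l2 M (\<lambda>x. v x - \<Phi> k x) \<le> Sob_norm D 1 (\<lambda>x. v x - \<Phi> k x)" for k
  proof -
    have L: "L2s M (\<lambda>x. v x - \<Phi> k x)" using Sob1_L2s[OF v] \<Phi>L by (intro L2s_diff)
    have "l2 M (\<lambda>x. v x - \<Phi> k x) = l2 M (weak_deriv D [] (\<lambda>x. v x - \<Phi> k x))"
    proof (rule l2_cong_AE)
      show "weak_deriv D [] (\<lambda>x. v x - \<Phi> k x) \<in> borel_measurable M"
        using weak_deriv_works(1)[of "[]" "\<lambda>x. v x - \<Phi> k x"] L has_weak_deriv_Nil L2s_measurable by blast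
      show "AE x in M. v x - \<Phi> k x = weak_deriv D [] (\<lambda>x. v x - \<Phi> k x) x"
        using weak_deriv_eqI[OF L has_weak_deriv_Nil] by eventually_elim simp
    qed (use L in \<open>rule L2s_measurable\<close>)
    then show ?thesis using Sob_norm_ge[of "[]" 1 "\<lambda>x. v x - \<Phi> k x"] by simp
  qed
  have d1: "l2 M (\<lambda>x. weak_deriv D [j] v x - pd j (\<Phi> k) x) \<le> Sob_norm D 1 (\<lambda>x. v x - \<Phi> k x)" for k j
  proof -
    have L: "L2s M (\<lambda>x. weak_deriv D [j] v x + (- 1) *\<^sub>R pd j (\<Phi> k) x)"
      by (intro L2s_add L2s_scaleR Sob1_deriv v \<Phi>L)
    have W: "has_weak_deriv D [j] (\<lambda>x. v x + (- 1) *\<^sub>R \<Phi> k x) (\<lambda>x. weak_deriv D [j] v x + (- 1) *\<^sub>R pd j (\<Phi> k) x)"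
      by (intro has_weak_deriv_add has_weak_deriv_linear[OF bounded_linear_scaleR_right]
          L2s_scaleR Sob1_deriv Sob1_L2s v \<Phi>L test_fun_has_weak_deriv \<Phi>)
    have "AE x in M. weak_deriv D [j] (\<lambda>x. v x + (- 1) *\<^sub>R \<Phi> k x) x = weak_deriv D [j] v x + (- 1) *\<^sub>R pd j (\<Phi> k) x"
      by (rule weak_deriv_eqI[OF L W])
    then have "l2 M (\<lambda>x. weak_deriv D [j] v x + (- 1) *\<^sub>R pd j (\<Phi> k) x) = l2 M (weak_deriv D [j] (\<lambda>x. v x + (- 1) *\<^sub>R \<Phi> k x))"
      using L weak_deriv_works(1)[of "[j]" "\<lambda>x. v x + (- 1) *\<^sub>R \<Phi> k x"] W
      by (intro l2_cong_AE) (auto intro: L2s_measurable)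
    then show ?thesis using Sob_norm_ge[of "[j]" 1 "\<lambda>x. v x - \<Phi> k x"] by simp
  qed
  show ?thesis
    unfolding h10_approx_def
  proof (intro conjI allI exI[of _ \<Phi>])
    show "(\<lambda>k. l2 M (\<lambda>x. v x - \<Phi> k x)) \<longlonglongrightarrow> 0"
      by (rule Lim_null_comparison[OF always_eventually \<Phi>(2)]) (use d0 in \<open>simp add: l2_nonneg\<close>)
    show "(\<lambda>k. l2 M (\<lambda>x. weak_deriv D [j] v x - pd j (\<Phi> k) x)) \<longlonglongrightarrow> 0" for j
      by (rule Lim_null_comparison[OF always_eventually \<Phi>(2)]) (use d1 in \<open>simp add: l2_nonneg\<close>)
  qed (use v \<Phi> in \<open>auto intro: Sob1_L2s Sob1_deriv\<close>)
qed

lemma h10_approx_zero: "h10_approx (\<lambda>x. 0) (\<lambda>j x. 0)"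
proof -
  have t: "test_fun D (\<lambda>x::real^'d. 0::real)"
    unfolding test_fun_iff using smooth_const[of 0] by (auto intro: exI[of _ "{}"])
  have z: "pd j (\<lambda>x::real^'d. 0) = (\<lambda>x. 0)" for j
    by (auto simp: fun_eq_iff intro!: pd_eqI[where \<phi>' = "\<lambda>x. 0", simplified])
  show ?thesis unfolding h10_approx_def
    by (intro conjI allI exI[of _ "\<lambda>_ _. 0"]) (auto simp: L2s_zero t z l2_zero)
qed

lemma h10_approx_add_scaled:
  assumes "h10_approx v G" "h10_approx w H"
  shows "h10_approx (\<lambda>x. c * v x + w x) (\<lambda>j x. c * G j x + H j x)"
proof -
  have L: "L2s M v" "\<And>j. L2s M (G j)" "L2s M w" "\<And>j. L2s M (H j)" using assms by (auto simp: h10_approx_def)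
  obtain \<Phi> where \<Phi>: "\<And>k. test_fun D (\<Phi> k)" "(\<lambda>k. l2 M (\<lambda>x. v x - \<Phi> k x)) \<longlonglongrightarrow> 0"
      "\<And>j. (\<lambda>k. l2 M (\<lambda>x. G j x - pd j (\<Phi> k) x)) \<longlonglongrightarrow> 0" using assms(1) by (auto simp: h10_approx_def)
  obtain \<Psi> where \<Psi>: "\<And>k. test_fun D (\<Psi> k)" "(\<lambda>k. l2 M (\<lambda>x. w x - \<Psi> k x)) \<longlonglongrightarrow> 0"
      "\<And>j. (\<lambda>k. l2 M (\<lambda>x. H j x - pd j (\<Psi> k) x)) \<longlonglongrightarrow> 0" using assms(2) by (auto simp: h10_approx_def)
  have lin: "l2 M (\<lambda>x. (c * f x + g x) - (c * f' x + g' x)) \<le> \<bar>c\<bar> * l2 M (\<lambda>x. f x - f' x) + l2 M (\<lambda>x. g x - g' x)"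
    if "L2s M f" "L2s M f'" "L2s M g" "L2s M g'" for f f' g g' :: "real^'d \<Rightarrow> real"
  proof -
    have "l2 M (\<lambda>x. c *\<^sub>R (f x - f' x) + (g x - g' x)) \<le> l2 M (\<lambda>x. c *\<^sub>R (f x - f' x)) + l2 M (\<lambda>x. g x - g' x)"
      using that by (intro l2_triangle L2s_scaleR L2s_diff)
    moreover have "(\<lambda>x. c *\<^sub>R (f x - f' x) + (g x - g' x)) = (\<lambda>x. (c * f x + g x) - (c * f' x + g' x))"
      by (simp add: algebra_simps)
    ultimately show ?thesis using l2_scaleR[of M c "\<lambda>x. f x - f' x"] by simp
  qed
  define \<Theta> where "\<Theta> k x = c * \<Phi> k x + \<Psi> k x" for k x
  have sm: "smooth (\<Phi> k)" "smooth (\<Psi> k)" for k using \<Phi> \<Psi> by (auto intro: test_fun_smooth)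
  have test: "test_fun D (\<Theta> k)" for k
  proof -
    obtain K1 K2 where K: "compact K1" "K1 \<subseteq> D" "\<And>x. x \<notin> K1 \<Longrightarrow> \<Phi> k x = 0" "compact K2" "K2 \<subseteq> D" "\<And>x. x \<notin> K2 \<Longrightarrow> \<Psi> k x = 0"
      using \<Phi>(1)[of k] \<Psi>(1)[of k] unfolding test_fun_iff by metis
    show ?thesis unfolding test_fun_iff \<Theta>_def
      by (intro conjI smooth_add smooth_mult smooth_const sm exI[of _ "K1 \<union> K2"]) (use K in auto)
  qed
  have pdT: "pd j (\<Theta> k) = (\<lambda>x. c * pd j (\<Phi> k) x + pd j (\<Psi> k) x)" for j k
  proof
    fix x
    have "((\<lambda>x::real^'d. c) has_derivative (\<lambda>x. 0)) (at x)" by simp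
    from pd_eqI[OF this] have c0: "pd j (\<lambda>x::real^'d. c) x = 0" by simp
    have "pd j (\<Theta> k) x = pd j (\<lambda>x. c * \<Phi> k x) x + pd j (\<Psi> k) x"
      unfolding \<Theta>_def by (intro pd_add smooth_differentiable smooth_mult smooth_const sm)
    also have "pd j (\<lambda>x. c * \<Phi> k x) x = c * pd j (\<Phi> k) x + pd j (\<lambda>x. c) x * \<Phi> k x"
      by (intro pd_mult smooth_differentiable smooth_const sm)
    finally show "pd j (\<Theta> k) x = c * pd j (\<Phi> k) x + pd j (\<Psi> k) x" using c0 by simp
  qed
  have lim: "(\<lambda>k. l2 M (\<lambda>x. (c * f x + g x) - (c * f' k x + g' k x))) \<longlonglongrightarrow> 0"
    if "L2s M f" "\<And>k. L2s M (f' k)" "L2s M g" "\<And>k. L2s M (g' k)"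
      "(\<lambda>k. l2 M (\<lambda>x. f x - f' k x)) \<longlonglongrightarrow> 0" "(\<lambda>k. l2 M (\<lambda>x. g x - g' k x)) \<longlonglongrightarrow> 0"
    for f g :: "real^'d \<Rightarrow> real" and f' g' :: "nat \<Rightarrow> real^'d \<Rightarrow> real"
  proof (rule Lim_null_comparison[OF always_eventually])
    show "\<forall>k. norm (l2 M (\<lambda>x. (c * f x + g x) - (c * f' k x + g' k x)))
        \<le> \<bar>c\<bar> * l2 M (\<lambda>x. f x - f' k x) + l2 M (\<lambda>x. g x - g' k x)"
      using lin[OF that(1,2,3,4)] by (simp add: l2_nonneg)
    have "(\<lambda>k. \<bar>c\<bar> * l2 M (\<lambda>x. f x - f' k x) + l2 M (\<lambda>x. g x - g' k x)) \<longlonglongrightarrow> \<bar>c\<bar> * 0 + 0"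
      by (intro tendsto_intros that)
    then show "(\<lambda>k. \<bar>c\<bar> * l2 M (\<lambda>x. f x - f' k x) + l2 M (\<lambda>x. g x - g' k x)) \<longlonglongrightarrow> 0" by simp
  qed
  show ?thesis
    unfolding h10_approx_def
  proof (intro conjI allI exI[of _ \<Theta>])
    show "L2s M (\<lambda>x. c * v x + w x)" using L2s_add[OF L2s_scaleR[OF L(1), of c] L(3)] by simp
    show "L2s M (\<lambda>x. c * G j x + H j x)" for j using L2s_add[OF L2s_scaleR[OF L(2), of c j] L(4)[of j]] by simp
    show "(\<lambda>k. l2 M (\<lambda>x. c * v x + w x - \<Theta> k x)) \<longlonglongrightarrow> 0"
      unfolding \<Theta>_def by (rule lim) (use L \<Phi> \<Psi> in \<open>auto intro: test_fun_L2s\<close>)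
    show "(\<lambda>k. l2 M (\<lambda>x. c * G j x + H j x - pd j (\<Theta> k) x)) \<longlonglongrightarrow> 0" for j
      unfolding pdT by (rule lim) (use L \<Phi> \<Psi> in \<open>auto intro: test_fun_L2s test_fun_L2s[OF test_fun_pd]\<close>)
  qed (rule test)
qed

lemma h10_approx_sum:
  "finite I \<Longrightarrow> (\<And>i. i \<in> I \<Longrightarrow> h10_approx (v i) (G i)) \<Longrightarrow>
    h10_approx (\<lambda>x. \<Sum>i\<in>I. c i * v i x) (\<lambda>j x. \<Sum>i\<in>I. c i * G i j x)"
proof (induction I rule: finite_induct)
  case (insert i I)
  then show ?case using h10_approx_add_scaled[of "v i" "G i" "\<lambda>x. \<Sum>i\<in>I. c i * v i x" "\<lambda>j x. \<Sum>i\<in>I. c i * G i j x" "c i"] by simp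
qed (simp add: h10_approx_zero)

lemma coord_bounded: "\<exists>B. \<forall>x\<in>D. \<bar>x $ j - z\<bar> \<le> B"
proof -
  obtain B where B: "\<And>x. x \<in> D \<Longrightarrow> norm x \<le> B" using bddD bounded_iff by blast
  have "\<bar>x $ j - z\<bar> \<le> B + \<bar>z\<bar>" if "x \<in> D" for x
    using component_le_norm_cart[of x j] B[OF that] by linarith
  then show ?thesis by blast
qed

text \<open>Integration by parts against a linear weight: as \<open>x\<^sub>j - z\<close> has derivative \<open>1\<close>, the \<open>j\<close>-th
  derivative of \<open>(x\<^sub>j - z) v\<^sup>2\<close> is \<open>v\<^sup>2 + 2 (x\<^sub>j - z) v \<partial>\<^sub>j v\<close>, and its integral vanishes for test
  functions.\<close>

lemma Poincare_identity:
  assumes "h10_approx v G"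
  shows "(LINT x|M. v x * v x) = - 2 * (LINT x|M. (x $ j - z) * v x * G j x)"
proof -
  obtain \<Phi> where \<Phi>: "\<And>k. test_fun D (\<Phi> k)" "(\<lambda>k. l2 M (\<lambda>x. v x - \<Phi> k x)) \<longlonglongrightarrow> 0"
      "\<And>j. (\<lambda>k. l2 M (\<lambda>x. G j x - pd j (\<Phi> k) x)) \<longlonglongrightarrow> 0" using assms(1) by (auto simp: h10_approx_def)
  have L: "L2s M v" "L2s M (G j)" using assms by (auto simp: h10_approx_def)
  have \<Phi>L: "L2s M (\<Phi> k)" "L2s M (pd j (\<Phi> k))" for k using \<Phi>(1) by (auto intro: test_fun_L2s test_fun_pd)
  obtain B where B: "\<And>x. x \<in> D \<Longrightarrow> \<bar>x $ j - z\<bar> \<le> B" using coord_bounded by blast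
  have m: "(\<lambda>x. x $ j - z) \<in> borel_measurable M"
    by (intro borel_measurable_lebesgue_on borel_measurable_continuous_onI continuous_intros)
  have aeB: "AE x in M. \<bar>x $ j - z\<bar> \<le> B" using B by (intro AE_I2) (simp add: space_restrict_space)
  have W: "L2s M (\<lambda>x. (x $ j - z) * f x)" if "L2s M f" for f :: "real^'d \<Rightarrow> real"
    using L2s_bounded_mult[OF that m aeB] by simp
  have id: "(LINT x|M. \<Phi> k x * \<Phi> k x) = - 2 * (LINT x|M. ((x $ j - z) * \<Phi> k x) * pd j (\<Phi> k) x)" for k
  proof -
    have sm: "smooth (\<lambda>x::real^'d. x $ j - z)" using smooth_affine[of 1 j "- z"] by simp
    have sk: "smooth (\<Phi> k)" by (rule test_fun_smooth[OF \<Phi>(1)])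
    have t: "test_fun D (\<lambda>x. ((x $ j - z) * \<Phi> k x) * \<Phi> k x)"
      by (intro test_fun_mult \<Phi> smooth_mult sm sk)
    have d1: "pd j (\<lambda>x::real^'d. x $ j - z) x = 1" for x
    proof -
      have "((\<lambda>x::real^'d. x $ j - z) has_derivative (\<lambda>h. h $ j)) (at x)"
        by (auto intro!: derivative_eq_intros bounded_linear_imp_has_derivative)
      from pd_eqI[OF this] show ?thesis by simp
    qed
    have e1: "pd j (\<lambda>x. ((x $ j - z) * \<Phi> k x) * \<Phi> k x) x
        = ((x $ j - z) * \<Phi> k x) * pd j (\<Phi> k) x + pd j (\<lambda>x. (x $ j - z) * \<Phi> k x) x * \<Phi> k x" for x
      by (intro pd_mult smooth_differentiable smooth_mult sm sk)
    have e2: "pd j (\<lambda>x. (x $ j - z) * \<Phi> k x) x = (x $ j - z) * pd j (\<Phi> k) x + pd j (\<lambda>x. x $ j - z) x * \<Phi> k x" for x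
      by (intro pd_mult smooth_differentiable sm sk)
    have "pd j (\<lambda>x. ((x $ j - z) * \<Phi> k x) * \<Phi> k x) x
        = 2 * (((x $ j - z) * \<Phi> k x) * pd j (\<Phi> k) x) + \<Phi> k x * \<Phi> k x" for x
      unfolding e1 e2 d1 by (simp add: algebra_simps)
    then have "(LINT x|M. 2 * (((x $ j - z) * \<Phi> k x) * pd j (\<Phi> k) x) + \<Phi> k x * \<Phi> k x) = 0"
      using integral_pd_zero_on[OF t, of j] by simp
    moreover have "integrable M (\<lambda>x. ((x $ j - z) * \<Phi> k x) * pd j (\<Phi> k) x)" "integrable M (\<lambda>x. \<Phi> k x * \<Phi> k x)"
      using L2s_inner_integrable[OF W[OF \<Phi>L(1)] \<Phi>L(2), of k k] L2s_inner_integrable[OF \<Phi>L(1) \<Phi>L(1), of k k] by simp_all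
    ultimately show ?thesis by simp
  qed
  have wlim: "(\<lambda>k. l2 M (\<lambda>x. (x $ j - z) * v x - (x $ j - z) * \<Phi> k x)) \<longlonglongrightarrow> 0"
  proof (rule Lim_null_comparison[OF always_eventually])
    show "\<forall>k. norm (l2 M (\<lambda>x. (x $ j - z) * v x - (x $ j - z) * \<Phi> k x)) \<le> \<bar>B\<bar> * l2 M (\<lambda>x. v x - \<Phi> k x)"
    proof
      fix k
      have "l2 M (\<lambda>x. (x $ j - z) * v x - (x $ j - z) * \<Phi> k x) \<le> l2 M (\<lambda>x. B *\<^sub>R (v x - \<Phi> k x))"
      proof (rule l2_mono_AE)
        show "L2s M (\<lambda>x. B *\<^sub>R (v x - \<Phi> k x))" by (intro L2s_scaleR L2s_diff L \<Phi>L)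
        show "(\<lambda>x. (x $ j - z) * v x - (x $ j - z) * \<Phi> k x) \<in> borel_measurable M"
          by (intro L2s_measurable L2s_diff W L \<Phi>L)
        show "AE x in M. norm ((x $ j - z) * v x - (x $ j - z) * \<Phi> k x) \<le> norm (B *\<^sub>R (v x - \<Phi> k x))"
          using aeB
        proof eventually_elim
          case (elim x)
          have "\<bar>x $ j - z\<bar> * \<bar>v x - \<Phi> k x\<bar> \<le> \<bar>B\<bar> * \<bar>v x - \<Phi> k x\<bar>" using elim by (intro mult_right_mono) auto
          then show ?case by (simp add: abs_mult right_diff_distrib[symmetric])
        qed
      qed
      then show "norm (l2 M (\<lambda>x. (x $ j - z) * v x - (x $ j - z) * \<Phi> k x)) \<le> \<bar>B\<bar> * l2 M (\<lambda>x. v x - \<Phi> k x)"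
        by (simp add: l2_scaleR[of M B "\<lambda>x. v x - \<Phi> k x", simplified] l2_nonneg)
    qed
    have "(\<lambda>k. \<bar>B\<bar> * l2 M (\<lambda>x. v x - \<Phi> k x)) \<longlonglongrightarrow> \<bar>B\<bar> * 0" by (intro tendsto_intros \<Phi>)
    then show "(\<lambda>k. \<bar>B\<bar> * l2 M (\<lambda>x. v x - \<Phi> k x)) \<longlonglongrightarrow> 0" by simp
  qed
  have l1: "(\<lambda>k. LINT x|M. \<Phi> k x * \<Phi> k x) \<longlonglongrightarrow> (LINT x|M. v x * v x)"
    by (intro l2_product_tendsto L \<Phi>L \<Phi>)
  have "(\<lambda>k. LINT x|M. ((x $ j - z) * \<Phi> k x) * pd j (\<Phi> k) x) \<longlonglongrightarrow> (LINT x|M. ((x $ j - z) * v x) * G j x)"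
    by (intro l2_product_tendsto W L \<Phi>L \<Phi> wlim)
  then have l2: "(\<lambda>k. - 2 * (LINT x|M. ((x $ j - z) * \<Phi> k x) * pd j (\<Phi> k) x)) \<longlonglongrightarrow> - 2 * (LINT x|M. ((x $ j - z) * v x) * G j x)"
    by (intro tendsto_mult tendsto_const)
  show ?thesis using LIMSEQ_unique[OF l1] l2 unfolding id by simp
qed

text \<open>Only the extent of the support of \<open>v\<close> in one direction enters. For a finite element basis
  function it is of the order of the mesh size, and this power of the mesh size is what makes
  condition numbers grow.\<close>

lemma Poincare_inequality:
  assumes v: "h10_approx v G" and R: "0 \<le> R" "AE x in M. v x \<noteq> 0 \<longrightarrow> \<bar>x $ j - z\<bar> \<le> R"
  shows "l2 M v \<le> 2 * R * l2 M (G j)"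
proof -
  have L: "L2s M v" "L2s M (G j)" using v by (auto simp: h10_approx_def)
  have "(l2 M v)\<^sup>2 = - 2 * (LINT x|M. (x $ j - z) * v x * G j x)"
    using Poincare_identity[OF v, of j z] by (simp add: l2_sq) (simp add: power2_eq_square)
  also have "\<dots> \<le> 2 * (LINT x|M. \<bar>(x $ j - z) * v x * G j x\<bar>)"
    using integral_abs_bound[of M "\<lambda>x. (x $ j - z) * v x * G j x"] by linarith
  also have "(LINT x|M. \<bar>(x $ j - z) * v x * G j x\<bar>) \<le> (LINT x|M. R * (norm (v x) * norm (G j x)))"
  proof (rule integral_mono_AE')
    show "integrable M (\<lambda>x. R * (norm (v x) * norm (G j x)))" using L2s_product_integrable[OF L] by simp
    show "AE x in M. \<bar>(x $ j - z) * v x * G j x\<bar> \<le> R * (norm (v x) * norm (G j x))"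
      using R(2)
    proof eventually_elim
      case (elim x)
      then show ?case
        by (cases "v x = 0") (auto simp: abs_mult mult.assoc intro!: mult_right_mono)
    qed
  qed (use R(1) in simp)
  also have "(LINT x|M. R * (norm (v x) * norm (G j x))) \<le> R * (l2 M v * l2 M (G j))"
    using L2s_Cauchy_Schwarz[OF L] R(1) by (simp add: mult_left_mono)
  finally have *: "l2 M v * l2 M v \<le> (2 * R * l2 M (G j)) * l2 M v" by (simp add: power2_eq_square mult_ac)
  show ?thesis
  proof (cases "l2 M v = 0")
    case True then show ?thesis using R(1) l2_nonneg[of M "G j"] by simp
  next
    case False
    then have "0 < l2 M v" using l2_nonneg[of M v] by simp
    then show ?thesis using * by simp
  qed
qed

end

section \<open>Zeros of analytic families\<close>

definition cvec :: "real^'n \<Rightarrow> complex^'n::finite" where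
  "cvec y = (\<chi> n. complex_of_real (y $ n))"

lemma cvec_nth [simp]: "cvec y $ n = complex_of_real (y $ n)"
  by (simp add: cvec_def)

lemma norm_cvec: "norm (cvec y) = norm y"
  by (simp add: norm_vec_def)

lemma cvec_diff: "cvec (x - y) = cvec x - cvec y"
  by (simp add: Finite_Cartesian_Product.vec_eq_iff)

lemma interval_in_Bernstein_region:
  assumes "x \<in> {-1..1}" "1 < g" shows "complex_of_real x \<in> Bernstein_region g"
proof -
  have "complex_of_real x = (cis (arccos x) + inverse (cis (arccos x))) / 2"
    using assms(1) by (simp add: complex_eq_iff)
  then show ?thesis using assms(2) unfolding Bernstein_region_def
    by (intro CollectI exI[of _ "cis (arccos x)"]) simp
qed

text \<open>The Hermitian inner product of complex vectors.\<close>

definition hip :: "complex^'d \<Rightarrow> complex^'d::finite \<Rightarrow> complex" where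
  "hip a b = (\<Sum>j\<in>UNIV. a $ j * cnj (b $ j))"

lemma norm_hip_le: "cmod (hip a b) \<le> norm a * norm b"
proof -
  have "cmod (hip a b) \<le> (\<Sum>j\<in>UNIV. cmod (a $ j) * cmod (b $ j))"
    unfolding hip_def by (rule order_trans[OF norm_sum]) (simp add: norm_mult)
  also have "\<dots> \<le> norm a * norm b"
    unfolding norm_vec_def using L2_set_mult_ineq[of "\<lambda>j. cmod (a $ j)" "\<lambda>j. cmod (b $ j)" UNIV] by simp
  finally show ?thesis .
qed

lemma hip_add: "hip (a + a') b = hip a b + hip a' b"
  by (simp add: hip_def distrib_right sum.distrib)

lemma hip_diff: "hip (a - a') b = hip a b - hip a' b"
  by (simp add: hip_def left_diff_distrib sum_subtractf)

lemma hip_smult: "hip (\<chi> j. c * a $ j) b = c * hip a b"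
  by (simp add: hip_def sum_distrib_left mult.assoc)

lemma hip_self: "hip a a = complex_of_real ((norm a)\<^sup>2)"
proof -
  have "hip a a = (\<Sum>j\<in>UNIV. complex_of_real ((cmod (a $ j))\<^sup>2))"
    unfolding hip_def by (intro sum.cong refl) (simp add: complex_norm_square[symmetric])
  then show ?thesis by (simp add: norm_vec_def L2_set_def sum_nonneg)
qed

context bdd_open
begin

lemma S1_cong_AE:
  assumes "v \<in> S1" "L2s M w" "AE x in M. v x = w x"
  shows "w \<in> S1" "AE x in M. grad w x = grad v x" "H10_norm D w = H10_norm D v"
proof -
  have W: "has_weak_deriv D [j] w (weak_deriv D [j] v)" for j
    by (rule has_weak_deriv_cong_AE[OF Sob1_L2s[OF assms(1)] assms(2,3) Sob1_deriv(2)[OF assms(1)]])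
  show w: "w \<in> S1" by (rule Sob1I[OF assms(2) Sob1_deriv(1)[OF assms(1)] W])
  have "AE x in M. grad w x = (\<chi> j. weak_deriv D [j] v x)"
    by (rule grad_eqI[OF Sob1_deriv(1)[OF assms(1)] W])
  then show g: "AE x in M. grad w x = grad v x" by (simp add: grad_def)
  show "H10_norm D w = H10_norm D v" unfolding H10_norm_eq
    by (intro l2_cong_AE L2s_measurable L2s_grad w assms(1) g)
qed

lemma H10_norm_of_real:
  fixes v :: "real^'d \<Rightarrow> real"
  assumes v: "v \<in> S1" shows "H10_norm D (\<lambda>x. complex_of_real (v x)) = H10_norm D v"
proof -
  have bl: "bounded_linear complex_of_real" by (rule bounded_linear_of_real)
  have "AE x in M. grad (\<lambda>x. complex_of_real (v x)) x = (\<chi> j. complex_of_real (grad v x $ j))"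
    by (rule grad_linear[OF bl v])
  then have "AE x in M. (norm (grad (\<lambda>x. complex_of_real (v x)) x))\<^sup>2 = (norm (grad v x))\<^sup>2"
    by eventually_elim (simp add: norm_vec_def)
  then show ?thesis unfolding H10_norm_eq l2_def
    using L2s_measurable[OF L2s_grad[OF v]] L2s_measurable[OF L2s_grad[OF Sob1_linear[OF bl v]]]
    by (intro arg_cong[where f = sqrt] integral_cong_AE) auto
qed

text \<open>The Hermitian inner product of \<open>H\<^sub>0\<^sup>1(D; \<complex>)\<close>, linear in its second argument: a continuous
  linear functional that turns analytic families of functions into analytic scalar functions.\<close>

definition pair :: "(real^'d \<Rightarrow> complex) \<Rightarrow> (real^'d \<Rightarrow> complex) \<Rightarrow> complex" where
  "pair w v = (LINT x|M. hip (grad v x) (grad w x))"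

lemma hip_grad_integrable:
  assumes "v \<in> S1" "w \<in> S1" shows "integrable M (\<lambda>x. hip (grad v x) (grad w x))"
proof (rule Bochner_Integration.integrable_bound[OF L2s_product_integrable[OF L2s_grad[OF assms(1)] L2s_grad[OF assms(2)]]])
  have m: "(\<lambda>x. grad v x $ j) \<in> borel_measurable M" if "v \<in> S1" for v :: "real^'d \<Rightarrow> complex" and j
    using L2s_measurable[OF Sob1_deriv(1)[OF that, of j]] by (simp add: grad_def)
  have "(\<lambda>x. \<Sum>j\<in>UNIV. grad v x $ j * cnj (grad w x $ j)) \<in> borel_measurable M"
  proof (intro borel_measurable_sum borel_measurable_times m assms)
    fix j
    have "cnj \<in> borel_measurable borel" by (intro borel_measurable_continuous_onI continuous_intros)
    from measurable_compose[OF m[OF assms(2)] this] show "(\<lambda>x. cnj (grad w x $ j)) \<in> borel_measurable M" .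
  qed
  then show "(\<lambda>x. hip (grad v x) (grad w x)) \<in> borel_measurable M" by (simp add: hip_def)
qed (auto intro!: AE_I2 order_trans[OF norm_hip_le])

lemma pair_bound: assumes "v \<in> S1" "w \<in> S1" shows "cmod (pair w v) \<le> H10_norm D v * H10_norm D w"
proof -
  have "cmod (pair w v) \<le> (LINT x|M. cmod (hip (grad v x) (grad w x)))" unfolding pair_def by (rule integral_norm_bound)
  also have "\<dots> \<le> (LINT x|M. norm (grad v x) * norm (grad w x))"
    using hip_grad_integrable[OF assms] L2s_product_integrable[OF L2s_grad[OF assms(1)] L2s_grad[OF assms(2)]]
    by (intro integral_mono norm_hip_le) auto
  also have "\<dots> \<le> H10_norm D v * H10_norm D w" unfolding H10_norm_eq
    by (rule L2s_Cauchy_Schwarz[OF L2s_grad[OF assms(1)] L2s_grad[OF assms(2)]])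
  finally show ?thesis .
qed

lemma bounded_linear_complex_mult: "bounded_linear (\<lambda>z::complex. c * z)"
  by (rule bounded_linear_mult_right)

lemma pair_cong: "v \<in> S1 \<Longrightarrow> w \<in> S1 \<Longrightarrow> integrable M (\<lambda>x. hip (g x) (grad w x)) \<Longrightarrow>
    AE x in M. grad v x = g x \<Longrightarrow> pair w v = (LINT x|M. hip (g x) (grad w x))"
  unfolding pair_def
  using hip_grad_integrable[of v w] by (intro integral_cong_AE) (auto intro: borel_measurable_integrable)

lemma pair_add: assumes "v \<in> S1" "v' \<in> S1" "w \<in> S1" shows "pair w (\<lambda>x. v x + v' x) = pair w v + pair w v'"
proof -
  have "pair w (\<lambda>x. v x + v' x) = (LINT x|M. hip (grad v x + grad v' x) (grad w x))"
    using assms by (intro pair_cong Sob1_add grad_add) (simp_all add: hip_add hip_grad_integrable)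
  then show ?thesis using assms by (simp add: hip_add hip_grad_integrable pair_def)
qed

lemma pair_diff: assumes "v \<in> S1" "v' \<in> S1" "w \<in> S1" shows "pair w (\<lambda>x. v x - v' x) = pair w v - pair w v'"
proof -
  have "pair w (\<lambda>x. v x - v' x) = (LINT x|M. hip (grad v x - grad v' x) (grad w x))"
    using assms by (intro pair_cong Sob1_diff grad_diff) (simp_all add: hip_diff hip_grad_integrable)
  then show ?thesis using assms by (simp add: hip_diff hip_grad_integrable pair_def)
qed

lemma pair_smult: assumes "v \<in> S1" "w \<in> S1" shows "pair w (\<lambda>x. c * v x) = c * pair w v"
proof -
  have "pair w (\<lambda>x. c * v x) = (LINT x|M. hip (\<chi> j. c * grad v x $ j) (grad w x))"
    using assms by (intro pair_cong Sob1_linear[OF bounded_linear_complex_mult] grad_linear[OF bounded_linear_complex_mult])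
      (simp_all add: hip_smult hip_grad_integrable)
  then show ?thesis using assms by (simp add: hip_smult hip_grad_integrable pair_def)
qed

lemma S1_smult: "v \<in> S1 \<Longrightarrow> (\<lambda>x. c * v x) \<in> S1" for v :: "real^'d \<Rightarrow> complex"
  by (rule Sob1_linear[OF bounded_linear_complex_mult])

lemma pair_sum:
  "finite I \<Longrightarrow> (\<And>i. i \<in> I \<Longrightarrow> v i \<in> S1) \<Longrightarrow> w \<in> S1 \<Longrightarrow>
    pair w (\<lambda>x. \<Sum>i\<in>I. c i * v i x) = (\<Sum>i\<in>I. c i * pair w (v i))"
proof (induction I rule: finite_induct)
  case empty
  have "pair w (\<lambda>x. 0) = 0 * pair w w" using pair_smult[of w w 0] empty by simp
  then show ?case by simp
next
  case (insert i I)
  have "pair w (\<lambda>x. c i * v i x + (\<Sum>i\<in>I. c i * v i x)) = pair w (\<lambda>x. c i * v i x) + pair w (\<lambda>x. \<Sum>i\<in>I. c i * v i x)"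
    using insert.prems by (intro pair_add S1_smult Sob1_sum) auto
  then show ?case using insert by (simp add: pair_smult)
qed

lemma H10_norm_smult: "v \<in> S1 \<Longrightarrow> H10_norm D (\<lambda>x. c * v x) = cmod c * H10_norm D v"
  for v :: "real^'d \<Rightarrow> complex"
proof -
  assume v: "v \<in> S1"
  have g: "AE x in M. grad (\<lambda>x. c * v x) x = (\<chi> j. c * grad v x $ j)"
    by (rule grad_linear[OF bounded_linear_complex_mult v])
  then have "AE x in M. (norm (grad (\<lambda>x. c * v x) x))\<^sup>2 = (cmod c)\<^sup>2 * (norm (grad v x))\<^sup>2"
    by eventually_elim (simp add: norm_vec_sq norm_mult power_mult_distrib sum_distrib_left)
  then have "(LINT x|M. (norm (grad (\<lambda>x. c * v x) x))\<^sup>2) = (LINT x|M. (cmod c)\<^sup>2 * (norm (grad v x))\<^sup>2)"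
    using L2s_measurable[OF L2s_grad[OF v]] L2s_measurable[OF L2s_grad[OF S1_smult[OF v, of c]]]
    by (intro integral_cong_AE) auto
  then show ?thesis unfolding H10_norm_eq l2_def by (simp add: real_sqrt_mult)
qed

lemma H10_norm_zero: "H10_norm D (\<lambda>x. 0 :: 'b::euclidean_space) = 0"
proof -
  have "AE x in M. grad (\<lambda>x. 0 :: 'b) x = (\<chi> j. 0)"
    by (rule grad_eqI[where g = "\<lambda>_ _. 0"]) (auto simp: L2s_zero has_weak_deriv_def)
  then have "AE x in M. grad (\<lambda>x. 0 :: 'b) x = 0" by eventually_elim (simp add: Finite_Cartesian_Product.vec_eq_iff)
  then have "l2 M (grad (\<lambda>x. 0 :: 'b)) = l2 M (\<lambda>x. 0 :: 'b^'d)"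
    by (intro l2_cong_AE L2s_measurable L2s_grad Sob1_zero L2s_zero) auto
  then show ?thesis by (simp add: H10_norm_eq l2_zero)
qed

lemma H10_norm_sum_le:
  fixes v :: "'i \<Rightarrow> real^'d \<Rightarrow> complex"
  shows "finite I \<Longrightarrow> (\<And>i. i \<in> I \<Longrightarrow> v i \<in> S1) \<Longrightarrow>
    H10_norm D (\<lambda>x. \<Sum>i\<in>I. c i * v i x) \<le> (\<Sum>i\<in>I. cmod (c i) * H10_norm D (v i))"
proof (induction I rule: finite_induct)
  case empty
  then show ?case by (simp add: H10_norm_zero)
next
  case (insert i I)
  have "H10_norm D (\<lambda>x. c i * v i x + (\<Sum>i\<in>I. c i * v i x)) \<le> H10_norm D (\<lambda>x. c i * v i x) + H10_norm D (\<lambda>x. \<Sum>i\<in>I. c i * v i x)"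
    using insert.prems by (intro H10_norm_triangle S1_smult Sob1_sum) auto
  then show ?case using insert by (simp add: H10_norm_smult)
qed

lemma H10_in_S1: "v \<in> H10 D \<Longrightarrow> v \<in> S1"
  by (simp add: H10_def S1_def)

lemma H10_norm_nonneg: "0 \<le> H10_norm D v"
  by (simp add: H10_norm_eq l2_nonneg)

lemma holomorphic_remainder:
  assumes hol: "H10_holomorphic_on D S U" and z: "z \<in> S"
  obtains V where "\<And>n. V n \<in> S1"
    "((\<lambda>t. H10_norm D (\<lambda>x. U (z + t) x - U z x - (\<Sum>n\<in>UNIV. t $ n * V n x)) / norm t) \<longlongrightarrow> 0) (at 0)"
proof -
  from hol z obtain V where "\<forall>n. V n \<in> H10 D"
    "((\<lambda>t. H10_norm D (\<lambda>x. U (z + t) x - U z x - (\<Sum>n\<in>UNIV. t $ n * V n x)) / norm t) \<longlongrightarrow> 0) (at 0)"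
    unfolding H10_holomorphic_on_def by blast
  then show thesis using that[of V] H10_in_S1 by blast
qed

lemma holomorphic_tendsto:
  assumes hol: "H10_holomorphic_on D S (U :: complex^'n::finite \<Rightarrow> real^'d \<Rightarrow> complex)" and z: "z \<in> S"
  shows "((\<lambda>t. H10_norm D (\<lambda>x. U (z + t) x - U z x)) \<longlongrightarrow> 0) (at 0)"
proof -
  obtain V where V: "\<And>n. V n \<in> S1"
    "((\<lambda>t. H10_norm D (\<lambda>x. U (z + t) x - U z x - (\<Sum>n\<in>UNIV. t $ n * V n x)) / norm t) \<longlongrightarrow> 0) (at 0)"
    using holomorphic_remainder[OF assms] by blast
  let ?R = "\<lambda>t. H10_norm D (\<lambda>x. U (z + t) x - U z x - (\<Sum>n\<in>UNIV. t $ n * V n x))"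
  have "open S" using hol by (simp add: H10_holomorphic_on_def)
  have US: "U z \<in> S1" if "z \<in> S" for z using hol that H10_in_S1 by (auto simp: H10_holomorphic_on_def)
  have ev: "\<forall>\<^sub>F t in at 0. z + t \<in> S"
  proof -
    have "((\<lambda>t. z + t) \<longlongrightarrow> z + 0) (at 0)" by (intro tendsto_intros)
    then show ?thesis using \<open>open S\<close> z by (intro topological_tendstoD[of _ _ _ S]) auto
  qed
  show ?thesis
  proof (rule Lim_null_comparison)
    show "\<forall>\<^sub>F t in at 0. norm (H10_norm D (\<lambda>x. U (z + t) x - U z x))
        \<le> ?R t / norm t * norm t + (\<Sum>n\<in>UNIV. cmod (t $ n) * H10_norm D (V n))"
      using ev eventually_neq_at_within[of 0 0 UNIV]
    proof eventually_elim
      case (elim t)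
      have "H10_norm D (\<lambda>x. U (z + t) x - U z x) = H10_norm D (\<lambda>x. (U (z + t) x - U z x - (\<Sum>n\<in>UNIV. t $ n * V n x)) + (\<Sum>n\<in>UNIV. t $ n * V n x))"
        by simp
      also have "\<dots> \<le> ?R t + H10_norm D (\<lambda>x. \<Sum>n\<in>UNIV. t $ n * V n x)"
        using elim z V(1) by (intro H10_norm_triangle Sob1_diff Sob1_sum S1_smult US) auto
      also have "H10_norm D (\<lambda>x. \<Sum>n\<in>UNIV. t $ n * V n x) \<le> (\<Sum>n\<in>UNIV. cmod (t $ n) * H10_norm D (V n))"
        using V(1) by (intro H10_norm_sum_le) auto
      finally show ?case using elim by (simp add: H10_norm_nonneg)
    qed
    have "((\<lambda>t. ?R t / norm t * norm t + (\<Sum>n\<in>UNIV. cmod (t $ n) * H10_norm D (V n))) \<longlongrightarrow>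
        0 * norm (0 :: complex^'n) + (\<Sum>n\<in>UNIV. cmod ((0 :: complex^'n) $ n) * H10_norm D (V n))) (at 0)"
      by (intro tendsto_intros V(2))
    then show "((\<lambda>t. ?R t / norm t * norm t + (\<Sum>n\<in>UNIV. cmod (t $ n) * H10_norm D (V n))) \<longlongrightarrow> 0) (at 0)" by simp
  qed
qed

text \<open>Pairing with a fixed function and restricting to a complex line reduces a Frechet
  holomorphic map to a holomorphic function of one variable.\<close>

lemma holomorphic_pair_line:
  fixes U :: "complex^'n::finite \<Rightarrow> real^'d \<Rightarrow> complex"
  assumes hol: "H10_holomorphic_on D S U" and w: "w \<in> S1"
  shows "(\<lambda>\<zeta>. pair w (U (\<chi> n. a $ n + \<zeta> * b $ n))) holomorphic_on {\<zeta>. (\<chi> n. a $ n + \<zeta> * b $ n) \<in> S}"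
proof (rule holomorphic_onI)
  fix \<zeta> assume "\<zeta> \<in> {\<zeta>. (\<chi> n. a $ n + \<zeta> * b $ n) \<in> S}"
  define ln where "ln \<zeta> = (\<chi> n. a $ n + \<zeta> * b $ n)" for \<zeta>
  define z where "z = ln \<zeta>"
  have z: "z \<in> S" using \<open>\<zeta> \<in> _\<close> by (simp add: z_def ln_def)
  have "open S" using hol by (simp add: H10_holomorphic_on_def)
  have US: "U z \<in> S1" if "z \<in> S" for z using hol that H10_in_S1 by (auto simp: H10_holomorphic_on_def)
  have add: "ln (\<zeta> + s) = z + (\<chi> n. s * b $ n)" for s
    by (simp add: z_def ln_def Finite_Cartesian_Product.vec_eq_iff algebra_simps)
  have nrm: "norm (\<chi> n. s * b $ n) = cmod s * norm b" for s
    by (simp add: norm_vec_def norm_mult L2_set_right_distrib)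
  obtain V where V: "\<And>n. V n \<in> S1"
    "((\<lambda>t. H10_norm D (\<lambda>x. U (z + t) x - U z x - (\<Sum>n\<in>UNIV. t $ n * V n x)) / norm t) \<longlongrightarrow> 0) (at 0)"
    using holomorphic_remainder[OF hol z] by blast
  define R where "R t = H10_norm D (\<lambda>x. U (z + t) x - U z x - (\<Sum>n\<in>UNIV. t $ n * V n x))" for t
  define d where "d = (\<Sum>n\<in>UNIV. b $ n * pair w (V n))"
  have "((\<lambda>s. (pair w (U (ln (\<zeta> + s))) - pair w (U (ln \<zeta>))) / s) \<longlongrightarrow> d) (at 0)"
  proof (cases "b = 0")
    case True
    then have "ln (\<zeta> + s) = ln \<zeta>" for s by (simp add: ln_def)
    then show ?thesis using True by (simp add: d_def)
  next
    case False
    have lim0: "filterlim (\<lambda>s. \<chi> n. s * b $ n) (at 0) (at (0::complex))"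
      unfolding filterlim_at
    proof
      show "((\<lambda>s. \<chi> n. s * b $ n) \<longlongrightarrow> 0) (at 0)"
      proof (rule tendsto_norm_zero_cancel)
        have "((\<lambda>s. cmod s * norm b) \<longlongrightarrow> 0 * norm b) (at 0)"
          by (intro tendsto_mult tendsto_const tendsto_norm_zero tendsto_ident_at)
        then show "((\<lambda>s. norm (\<chi> n. s * b $ n)) \<longlongrightarrow> 0) (at 0)" by (simp add: nrm)
      qed
      have "(\<chi> n. s * b $ n) \<noteq> 0" if "s \<noteq> 0" for s
        using nrm[of s] that False by (metis mult_eq_0_iff norm_eq_zero)
      then show "\<forall>\<^sub>F s in at 0. (\<chi> n. s * b $ n) \<in> UNIV \<and> (\<chi> n. s * b $ n) \<noteq> 0"
        by (auto simp: eventually_at_filter)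
    qed
    have ev: "\<forall>\<^sub>F s in at 0. ln (\<zeta> + s) \<in> S"
    proof -
      have "((\<lambda>s. z + (\<chi> n. s * b $ n)) \<longlongrightarrow> z + 0) (at 0)"
        using lim0 by (intro tendsto_add tendsto_const) (simp add: filterlim_at)
      then show ?thesis unfolding add using \<open>open S\<close> z by (intro topological_tendstoD[of _ _ _ S]) auto
    qed
    have Rl: "((\<lambda>s. R (\<chi> n. s * b $ n) / norm (\<chi> n. s * b $ n)) \<longlongrightarrow> 0) (at 0)"
      using filterlim_compose[OF V(2) lim0] by (simp add: R_def)
    have "((\<lambda>s. (pair w (U (ln (\<zeta> + s))) - pair w (U (ln \<zeta>))) / s - d) \<longlongrightarrow> 0) (at 0)"
    proof (rule Lim_null_comparison)
      show "\<forall>\<^sub>F s in at 0. norm ((pair w (U (ln (\<zeta> + s))) - pair w (U (ln \<zeta>))) / s - d)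
          \<le> R (\<chi> n. s * b $ n) / norm (\<chi> n. s * b $ n) * (norm b * H10_norm D w)"
        using ev eventually_neq_at_within[of 0 0 UNIV]
      proof eventually_elim
        case (elim s)
        let ?t = "\<chi> n. s * b $ n"
        have s0: "s \<noteq> 0" using elim by auto
        have zt: "z + ?t \<in> S" using elim by (simp add: add)
        have "pair w (\<lambda>x. U (z + ?t) x - U z x - (\<Sum>n\<in>UNIV. ?t $ n * V n x))
            = pair w (U (z + ?t)) - pair w (U z) - (\<Sum>n\<in>UNIV. ?t $ n * pair w (V n))"
          using US[OF zt] US[OF z] V(1) w
          by (subst pair_diff) (auto intro!: Sob1_diff Sob1_sum S1_smult simp: pair_diff pair_sum simp del: vec_lambda_beta)
        also have "(\<Sum>n\<in>UNIV. ?t $ n * pair w (V n)) = s * d" by (simp add: d_def sum_distrib_left mult.assoc)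
        finally have eq: "pair w (U (ln (\<zeta> + s))) - pair w (U (ln \<zeta>)) - s * d
            = pair w (\<lambda>x. U (z + ?t) x - U z x - (\<Sum>n\<in>UNIV. ?t $ n * V n x))"
          by (simp add: add z_def)
        have "(pair w (U (ln (\<zeta> + s))) - pair w (U (ln \<zeta>))) / s - d
            = (pair w (U (ln (\<zeta> + s))) - pair w (U (ln \<zeta>)) - s * d) / s" using s0 by (simp add: field_simps)
        then have "norm ((pair w (U (ln (\<zeta> + s))) - pair w (U (ln \<zeta>))) / s - d)
            = cmod (pair w (\<lambda>x. U (z + ?t) x - U z x - (\<Sum>n\<in>UNIV. ?t $ n * V n x))) / cmod s"
          unfolding eq by (simp add: norm_divide)
        also have "\<dots> \<le> R ?t * H10_norm D w / cmod s"
          unfolding R_def using US[OF zt] US[OF z] V(1) w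
          by (intro divide_right_mono pair_bound Sob1_diff Sob1_sum S1_smult) auto
        also have "\<dots> = R ?t / norm ?t * (norm b * H10_norm D w)"
          using s0 False by (simp add: nrm)
        finally show ?case .
      qed
      show "((\<lambda>s. R (\<chi> n. s * b $ n) / norm (\<chi> n. s * b $ n) * (norm b * H10_norm D w)) \<longlongrightarrow> 0) (at 0)"
        using tendsto_mult[OF Rl tendsto_const[of "norm b * H10_norm D w"]] by simp
    qed
    then show ?thesis by (rule LIM_zero_cancel)
  qed
  then have "((\<lambda>\<zeta>. pair w (U (ln \<zeta>))) has_field_derivative d) (at \<zeta>)" by (simp add: DERIV_def)
  then show "(\<lambda>\<zeta>. pair w (U (\<chi> n. a $ n + \<zeta> * b $ n))) field_differentiable at \<zeta> within {\<zeta>. (\<chi> n. a $ n + \<zeta> * b $ n) \<in> S}"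
    unfolding ln_def using field_differentiable_at_within field_differentiable_def by blast
qed

text \<open>By Tonelli the set of pairs \<open>(c, x)\<close> with \<open>c x \<in> Z\<close> is null, because its sections at fixed
  \<open>x\<close> are countable. So for some \<open>c \<ge> 1/2\<close> the dilated set \<open>Z / c\<close> is negligible, and with it \<open>Z\<close>.\<close>

lemma negligible_if_rays_countable:
  fixes Z :: "'a::euclidean_space set"
  assumes cl: "closed Z" and cnt: "\<And>x. countable {c \<in> {1/2..1}. c *\<^sub>R x \<in> Z}"
  shows "negligible Z"
proof -
  define P where "P = {p :: real \<times> 'a. fst p \<in> {1/2..1} \<and> fst p *\<^sub>R snd p \<in> Z}"
  have "closed ({1/2..1::real} \<times> (UNIV :: 'a set))" by (intro closed_Times) auto
  then have "closed (({1/2..1::real} \<times> UNIV) \<inter> (\<lambda>p :: real \<times> 'a. fst p *\<^sub>R snd p) -` Z)"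
    by (intro continuous_closed_preimage continuous_intros cl)
  moreover have "({1/2..1::real} \<times> UNIV) \<inter> (\<lambda>p :: real \<times> 'a. fst p *\<^sub>R snd p) -` Z = P"
    by (auto simp: P_def)
  ultimately have "P \<in> sets borel" by simp
  then have P: "P \<in> sets (lborel \<Otimes>\<^sub>M (lborel :: 'a measure))" by (simp add: borel_prod[symmetric] sets_pair_measure_cong[OF sets_lborel sets_lborel])
  have "emeasure (lborel \<Otimes>\<^sub>M lborel) P = (\<integral>\<^sup>+ x. emeasure lborel ((\<lambda>c. (c, x)) -` P) \<partial>lborel)"
    by (rule lborel_pair.emeasure_pair_measure_alt2[OF P])
  also have "\<dots> = 0"
  proof -
    have "emeasure lborel ((\<lambda>c. (c, x)) -` P) = 0" for x
    proof -
      have "(\<lambda>c. (c, x)) -` P = {c \<in> {1/2..1}. c *\<^sub>R x \<in> Z}" by (auto simp: P_def)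
      then show ?thesis using cnt[of x] by (simp add: emeasure_lborel_countable)
    qed
    then show ?thesis by simp
  qed
  finally have "(\<integral>\<^sup>+ c. emeasure lborel (Pair c -` P) \<partial>lborel) = 0"
    using lborel.emeasure_pair_measure_alt[OF P] by simp
  then have ae: "AE c in lborel. emeasure lborel (Pair c -` P) = 0"
    using lborel.measurable_emeasure_Pair[OF P] by (subst (asm) nn_integral_0_iff_AE) auto
  have "\<exists>c\<in>{1/2..1}. emeasure lborel (Pair c -` P) = 0"
  proof (rule ccontr)
    assume "\<not> ?thesis"
    then have "c \<notin> {1/2..1}" if "emeasure lborel (Pair c -` P) = 0" for c using that by blast
    then have *: "AE c in lborel. c \<notin> {1/2..1::real}" by (rule AE_mp[OF ae AE_I2[OF impI]])
    have "{1/2..1::real} \<in> null_sets lborel" by (rule AE_iff_null_sets[THEN iffD2, OF _ *]) simp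
    then have "emeasure lborel {1/2..1::real} = 0" by (rule null_setsD1)
    then show False using emeasure_lborel_Icc[of "1/2" "1::real"] by simp
  qed
  then obtain c :: real where c: "c \<in> {1/2..1}" "emeasure lborel (Pair c -` P) = 0" by blast
  have "Pair c -` P \<in> sets lborel" using sets_Pair1[OF P] by simp
  then have "Pair c -` P \<in> null_sets lborel" using c(2) by auto
  then have "negligible (Pair c -` P)" by (simp add: negligible_iff_null_sets null_sets_completionI)
  then have "negligible ((\<lambda>x. c *\<^sub>R x) ` (Pair c -` P))"
    by (intro negligible_differentiable_image_negligible) (auto intro!: derivative_intros)
  moreover have "Z \<subseteq> (\<lambda>x. c *\<^sub>R x) ` (Pair c -` P)"
  proof
    fix z assume "z \<in> Z"
    then show "z \<in> (\<lambda>x. c *\<^sub>R x) ` (Pair c -` P)"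
      using c(1) by (intro image_eqI[of _ _ "(1 / c) *\<^sub>R z"]) (auto simp: P_def)
  qed
  ultimately show ?thesis by (rule negligible_subset)
qed

lemma Gam_convex: "convex (Gam :: (real^'n::finite) set)" and Gam_compact: "compact (Gam :: (real^'n::finite) set)"
proof -
  have *: "(Gam :: (real^'n) set) = cbox (\<chi> n. (-1::real)) (\<chi> n. (1::real))" by (auto simp: Gam_def mem_box_cart)
  show "convex (Gam :: (real^'n) set)" unfolding * by (rule convex_box(1))
  show "compact (Gam :: (real^'n) set)" unfolding * by (rule compact_cbox)
qed

text \<open>If \<open>w\<close> does not vanish at \<open>y1\<close>, then pairing the extension with its value at \<open>y1\<close> gives a
  scalar function that is nonzero at \<open>y1\<close> and vanishes wherever \<open>w\<close> does. On every ray from \<open>y1\<close>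
  it is the restriction of a holomorphic function, so it has finitely many zeros there, and
  \<open>negligible_if_rays_countable\<close> applies. The first part is continuity, a consequence of
  differentiability.\<close>

lemma analytic_extension_zero_set:
  fixes w :: "real^'n::finite \<Rightarrow> real^'d \<Rightarrow> real"
  assumes an: "has_analytic_extension D \<gamma> w" and \<gamma>: "\<And>n. 1 < \<gamma> n" and w: "\<And>y. y \<in> Gam \<Longrightarrow> w y \<in> S1"
  shows "\<And>y. y \<in> Gam \<Longrightarrow> ((\<lambda>y'. H10_norm D (\<lambda>x. w y' x - w y x)) \<longlongrightarrow> 0) (at y within Gam)"
    and "\<And>y1. y1 \<in> Gam \<Longrightarrow> H10_norm D (w y1) \<noteq> 0 \<Longrightarrow> negligible {y \<in> Gam. H10_norm D (w y) = 0}"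
proof -
  obtain S U where SU: "H10_holomorphic_on D S U" "{z. \<forall>n. z $ n \<in> Bernstein_region (\<gamma> n)} \<subseteq> S"
    "\<And>y. y \<in> Gam \<Longrightarrow> AE x in M. U (cvec y) x = complex_of_real (w y x)"
    using an unfolding has_analytic_extension_def cvec_def by blast
  have GS: "cvec y \<in> S" if "y \<in> Gam" for y
    using that \<gamma> by (intro subsetD[OF SU(2)]) (auto simp: Gam_def intro!: interval_in_Bernstein_region)
  have "open S" using SU(1) by (simp add: H10_holomorphic_on_def)
  have US: "U z \<in> S1" if "z \<in> S" for z using SU(1) that H10_in_S1 by (auto simp: H10_holomorphic_on_def)
  have nrm: "H10_norm D (U (cvec y)) = H10_norm D (w y)" if y: "y \<in> Gam" for y
  proof -
    have "(\<lambda>x. complex_of_real (w y x)) \<in> S1" by (rule Sob1_linear[OF bounded_linear_of_real w[OF y]])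
    from S1_cong_AE(3)[OF US[OF GS[OF y]] Sob1_L2s[OF this] SU(3)[OF y]] H10_norm_of_real[OF w[OF y]]
    show ?thesis by simp
  qed
  have nrmd: "H10_norm D (\<lambda>x. U (cvec y') x - U (cvec y) x) = H10_norm D (\<lambda>x. w y' x - w y x)"
    if y: "y \<in> Gam" and y': "y' \<in> Gam" for y y'
  proof -
    have d: "(\<lambda>x. w y' x - w y x) \<in> S1" by (intro Sob1_diff w y y')
    have c: "(\<lambda>x. complex_of_real (w y' x - w y x)) \<in> S1" by (rule Sob1_linear[OF bounded_linear_of_real d])
    have "AE x in M. U (cvec y') x - U (cvec y) x = complex_of_real (w y' x - w y x)"
      using SU(3)[OF y] SU(3)[OF y'] by eventually_elim simp
    from S1_cong_AE(3)[OF Sob1_diff[OF US[OF GS[OF y']] US[OF GS[OF y]]] Sob1_L2s[OF c] this] H10_norm_of_real[OF d]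
    show ?thesis by simp
  qed
  show cont: "((\<lambda>y'. H10_norm D (\<lambda>x. w y' x - w y x)) \<longlongrightarrow> 0) (at y within Gam)" if y: "y \<in> Gam" for y
  proof -
    have lim: "filterlim (\<lambda>y'. cvec (y' - y)) (at 0) (at y within Gam)"
      unfolding filterlim_at
    proof
      have "((\<lambda>y'. y' - y) \<longlongrightarrow> y - y) (at y within Gam)" by (intro tendsto_intros)
      then have "((\<lambda>y'. norm (cvec (y' - y))) \<longlongrightarrow> 0) (at y within Gam)" by (simp add: norm_cvec tendsto_norm_zero)
      then show "((\<lambda>y'. cvec (y' - y)) \<longlongrightarrow> 0) (at y within Gam)" by (rule tendsto_norm_zero_cancel)
      have "cvec (y' - y) \<noteq> 0" if "y' \<noteq> y" for y' using norm_cvec[of "y' - y"] that by auto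
      then show "\<forall>\<^sub>F y' in at y within Gam. cvec (y' - y) \<in> UNIV \<and> cvec (y' - y) \<noteq> 0"
        by (auto simp: eventually_at_filter)
    qed
    have "((\<lambda>y'. H10_norm D (\<lambda>x. U (cvec y + cvec (y' - y)) x - U (cvec y) x)) \<longlongrightarrow> 0) (at y within Gam)"
      by (rule filterlim_compose[OF holomorphic_tendsto[OF SU(1) GS[OF y]] lim])
    moreover have "\<forall>\<^sub>F y' in at y within Gam. H10_norm D (\<lambda>x. U (cvec y + cvec (y' - y)) x - U (cvec y) x) = H10_norm D (\<lambda>x. w y' x - w y x)"
      using nrmd[OF y] by (auto simp: eventually_at_filter cvec_diff)
    ultimately show ?thesis by (rule Lim_transform_eventually)
  qed
  fix y1 :: "real^'n" assume y1: "y1 \<in> Gam" and nz: "H10_norm D (w y1) \<noteq> 0"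
  define w0 where "w0 = U (cvec y1)"
  have w0: "w0 \<in> S1" using US[OF GS[OF y1]] by (simp add: w0_def)
  define F where "F y = pair w0 (U (cvec y))" for y
  have F1: "F y1 \<noteq> 0"
  proof -
    have "F y1 = (LINT x|M. complex_of_real ((norm (grad w0 x))\<^sup>2))"
      by (simp add: F_def pair_def hip_self w0_def)
    also have "\<dots> = complex_of_real ((H10_norm D w0)\<^sup>2)"
      by (simp add: H10_norm_eq l2_sq integral_complex_of_real del: of_real_power)
    finally show ?thesis using nz nrm[OF y1] by (simp add: w0_def)
  qed
  define Z where "Z = {y \<in> Gam. F y = 0}"
  have Fcont: "continuous_on Gam F"
    unfolding continuous_on_def
  proof
    fix y :: "real^'n" assume y: "y \<in> Gam"
    have "((\<lambda>y'. F y' - F y) \<longlongrightarrow> 0) (at y within Gam)"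
    proof (rule Lim_null_comparison)
      have "norm (F y' - F y) \<le> H10_norm D (\<lambda>x. w y' x - w y x) * H10_norm D w0" if y': "y' \<in> Gam" for y'
      proof -
        have "F y' - F y = pair w0 (\<lambda>x. U (cvec y') x - U (cvec y) x)"
          unfolding F_def using US[OF GS[OF y]] US[OF GS[OF y']] w0 by (intro pair_diff[symmetric])
        then show ?thesis using pair_bound[OF Sob1_diff[OF US[OF GS[OF y']] US[OF GS[OF y]]] w0] nrmd[OF y y'] by simp
      qed
      then show "\<forall>\<^sub>F y' in at y within Gam. norm (F y' - F y) \<le> H10_norm D (\<lambda>x. w y' x - w y x) * H10_norm D w0"
        by (auto simp: eventually_at_filter)
      show "((\<lambda>y'. H10_norm D (\<lambda>x. w y' x - w y x) * H10_norm D w0) \<longlongrightarrow> 0) (at y within Gam)"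
        using tendsto_mult[OF cont[OF y] tendsto_const[of "H10_norm D w0"]] by simp
    qed
    then show "(F \<longlongrightarrow> F y) (at y within Gam)" by (rule LIM_zero_cancel)
  qed
  have clZ: "closed Z"
    unfolding Z_def by (rule continuous_closed_preimage_constant[OF Fcont compact_imp_closed[OF Gam_compact]])
  have cnt: "countable {c \<in> {1/2..1}. c *\<^sub>R x \<in> (\<lambda>y. y - y1) ` Z}" for x
  proof -
    define O1 where "O1 = {\<zeta>. (\<chi> n. cvec y1 $ n + \<zeta> * cvec x $ n) \<in> S}"
    define g where "g \<zeta> = pair w0 (U (\<chi> n. cvec y1 $ n + \<zeta> * cvec x $ n))" for \<zeta>
    have hol: "g holomorphic_on O1" unfolding g_def O1_def by (rule holomorphic_pair_line[OF SU(1) w0])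
    have opO: "open O1"
    proof -
      have "continuous_on UNIV (\<lambda>\<zeta>. \<chi> n. cvec y1 $ n + \<zeta> * cvec x $ n)" by (intro continuous_intros)
      from open_vimage[OF \<open>open S\<close> this] show ?thesis by (simp add: O1_def vimage_def)
    qed
    have real_line: "(\<chi> n. cvec y1 $ n + complex_of_real c * cvec x $ n) = cvec (y1 + c *\<^sub>R x)" for c
      by (simp add: Finite_Cartesian_Product.vec_eq_iff)
    \<comment> \<open>the domain of the scalar function need not be connected; the ray inside the parameter box
      lies in one component\<close>
    define C where "C = connected_component_set O1 0"
    have C: "open C" "connected C" "C \<subseteq> O1"
      using opO by (simp_all add: C_def open_connected_component connected_component_subset)
    have I: "convex {c \<in> {0..1}. y1 + c *\<^sub>R x \<in> Gam}"
    proof (rule convexI)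
      fix a b u v :: real
      assume *: "a \<in> {c \<in> {0..1}. y1 + c *\<^sub>R x \<in> Gam}" "b \<in> {c \<in> {0..1}. y1 + c *\<^sub>R x \<in> Gam}" "0 \<le> u" "0 \<le> v" "u + v = 1"
      have "u *\<^sub>R a + v *\<^sub>R b \<in> {0..1}" using * by (intro convexD[OF convex_real_interval(5)]) auto
      moreover have "u *\<^sub>R (y1 + a *\<^sub>R x) + v *\<^sub>R (y1 + b *\<^sub>R x) \<in> Gam"
        using * by (intro convexD[OF Gam_convex]) auto
      moreover have "u *\<^sub>R (y1 + a *\<^sub>R x) + v *\<^sub>R (y1 + b *\<^sub>R x) = (u + v) *\<^sub>R y1 + (u *\<^sub>R a + v *\<^sub>R b) *\<^sub>R x"
        by (simp add: algebra_simps)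
      ultimately show "u *\<^sub>R a + v *\<^sub>R b \<in> {c \<in> {0..1}. y1 + c *\<^sub>R x \<in> Gam}" using *(5) by simp
    qed
    have IO: "complex_of_real ` {c \<in> {0..1}. y1 + c *\<^sub>R x \<in> Gam} \<subseteq> O1"
      using GS by (auto simp: O1_def real_line simp del: cvec_nth)
    have "connected (complex_of_real ` {c \<in> {0..1}. y1 + c *\<^sub>R x \<in> Gam})"
      by (intro connected_continuous_image convex_connected I continuous_intros)
    then have IC: "complex_of_real ` {c \<in> {0..1}. y1 + c *\<^sub>R x \<in> Gam} \<subseteq> C"
      unfolding C_def using y1 by (intro connected_component_maximal IO) auto
    then have C0: "0 \<in> C" using y1 by (metis (mono_tags, lifting) IC add.right_neutral atLeastAtMost_iff image_eqI mem_Collect_eq of_real_0 order_refl scaleR_zero_left subsetD zero_le_one)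
    have g0: "g 0 \<noteq> 0" using F1 real_line[of 0] by (simp add: g_def F_def)
    define K where "K = complex_of_real ` {c \<in> {0..1}. y1 + c *\<^sub>R x \<in> Gam}"
    have "closed ({0..1} \<inter> (\<lambda>c. y1 + c *\<^sub>R x) -` Gam)"
      by (intro continuous_closed_preimage continuous_intros compact_imp_closed[OF Gam_compact] closed_atLeastAtMost)
    moreover have "bounded ({0..1} \<inter> (\<lambda>c. y1 + c *\<^sub>R x) -` Gam)" by (rule bounded_subset[OF bounded_closed_interval[of 0 1]]) blast
    ultimately have "compact ({0..1} \<inter> (\<lambda>c. y1 + c *\<^sub>R x) -` Gam)"
      unfolding compact_eq_bounded_closed by blast
    moreover have "{0..1} \<inter> (\<lambda>c. y1 + c *\<^sub>R x) -` Gam = {c \<in> {0..1}. y1 + c *\<^sub>R x \<in> Gam}" by auto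
    ultimately have "compact K" unfolding K_def by (intro compact_continuous_image continuous_intros) simp
    have cz: "finite {\<zeta> \<in> K. g \<zeta> = 0}"
    proof (cases "g constant_on C")
      case True
      then have "g \<zeta> = g 0" if "\<zeta> \<in> C" for \<zeta> using C0 that by (metis constant_on_def)
      then have "{\<zeta> \<in> K. g \<zeta> = 0} = {}" using g0 IC by (auto simp: K_def)
      then show ?thesis by (simp only: finite.emptyI)
    next
      case False
      have "K \<subseteq> C" using IC by (simp add: K_def)
      from holomorphic_compact_finite_zeros[OF holomorphic_on_subset[OF hol C(3)] C(1,2) \<open>compact K\<close> this False]
      show ?thesis .
    qed
    have "{c \<in> {1/2..1}. c *\<^sub>R x \<in> (\<lambda>y. y - y1) ` Z} \<subseteq> Re ` {\<zeta> \<in> K. g \<zeta> = 0}"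
    proof
      fix c :: real assume "c \<in> {c \<in> {1/2..1}. c *\<^sub>R x \<in> (\<lambda>y. y - y1) ` Z}"
      then have c: "c \<in> {0..1}" "y1 + c *\<^sub>R x \<in> Z" by (auto simp: algebra_simps)
      then have "complex_of_real c \<in> K" by (auto simp: Z_def K_def)
      moreover have "g (complex_of_real c) = 0" using c(2) by (simp add: g_def real_line Z_def F_def del: cvec_nth)
      ultimately show "c \<in> Re ` {\<zeta> \<in> K. g \<zeta> = 0}" by (intro image_eqI[of _ _ "complex_of_real c"]) auto
    qed
    then show ?thesis by (rule countable_subset[OF _ countable_finite[OF finite_imageI[OF cz]]])
  qed
  have "negligible ((\<lambda>y. y - y1) ` Z)"
  proof (rule negligible_if_rays_countable[OF _ cnt])
    have "(\<lambda>y. y - y1) ` Z = (+) (- y1) ` Z" by (intro image_cong) auto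
    then show "closed ((\<lambda>y. y - y1) ` Z)" using closed_translation[OF clZ, of "- y1"] by simp
  qed
  then have "negligible ((+) y1 ` (\<lambda>y. y - y1) ` Z)" by (rule negligible_translation)
  then have nZ: "negligible Z" by (simp add: image_image)
  have "{y \<in> Gam. H10_norm D (w y) = 0} \<subseteq> Z"
  proof
    fix y assume "y \<in> {y \<in> Gam. H10_norm D (w y) = 0}"
    then have y: "y \<in> Gam" "H10_norm D (w y) = 0" by auto
    have "cmod (F y) \<le> 0" using pair_bound[OF US[OF GS[OF y(1)]] w0] nrm[OF y(1)] y(2) by (simp add: F_def)
    then show "y \<in> Z" using y by (simp add: Z_def)
  qed
  then show "negligible {y \<in> Gam. H10_norm D (w y) = 0}" using nZ negligible_subset by blast
qed

end

section \<open>The diffusion problem and its stiffness matrices\<close>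

lemma l2_le_0: "l2 M F \<le> 0 \<Longrightarrow> l2 M F = 0"
  using l2_nonneg[of M F] by simp

locale diffusion = bdd_open D for D :: "(real^'d::finite) set" +
  fixes a f :: "real^'d \<Rightarrow> real^'n::finite \<Rightarrow> real" and u :: "real^'n \<Rightarrow> real^'d \<Rightarrow> real"
    and amin amax :: real
  assumes a_meas: "\<And>y. y \<in> Gam \<Longrightarrow> (\<lambda>x. a x y) \<in> borel_measurable M"
    and amin: "0 < amin" "amin \<le> amax"
    and a_bounds: "\<And>y. y \<in> Gam \<Longrightarrow> AE x in M. amin \<le> a x y \<and> a x y \<le> amax"
    and f_L2: "\<And>y. y \<in> Gam \<Longrightarrow> L2s M (\<lambda>x. f x y)"
    and u_sol: "\<And>y. y \<in> Gam \<Longrightarrow> weak_solution D a f y (u y)"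
begin

text \<open>The gradient weighted by the square root of the coefficient turns the energy form into an
  ordinary \<open>L\<^sup>2\<close> inner product, so that Cauchy--Schwarz and the triangle inequality need no
  separate proof for energy norms.\<close>

definition wt :: "real^'n \<Rightarrow> (real^'d \<Rightarrow> real^'d) \<Rightarrow> real^'d \<Rightarrow> real^'d" where
  "wt y F x = sqrt (a x y) *\<^sub>R F x"

lemma amax: "0 < amax" using amin by simp

lemma L2s_wt: assumes y: "y \<in> Gam" and F: "L2s M F" shows "L2s M (wt y F)"
  unfolding wt_def
proof (rule L2s_bounded_mult[OF F])
  show "(\<lambda>x. sqrt (a x y)) \<in> borel_measurable M"
    using measurable_compose[OF a_meas[OF y] borel_measurable_continuous_onI[OF continuous_on_real_sqrt[OF continuous_on_id]]]
    by simp
  show "AE x in M. \<bar>sqrt (a x y)\<bar> \<le> sqrt amax"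
    using a_bounds[OF y] by eventually_elim (use amin in auto)
qed

lemma l2_wt_le: assumes y: "y \<in> Gam" and F: "L2s M F" shows "l2 M (wt y F) \<le> sqrt amax * l2 M F"
proof -
  have "l2 M (wt y F) \<le> l2 M (\<lambda>x. sqrt amax *\<^sub>R F x)"
  proof (rule l2_mono_AE[OF L2s_scaleR[OF F] L2s_measurable[OF L2s_wt[OF y F]]])
    show "AE x in M. norm (wt y F x) \<le> norm (sqrt amax *\<^sub>R F x)"
      using a_bounds[OF y]
    proof eventually_elim
      case (elim x)
      then show ?case using amin by (auto simp: wt_def intro!: mult_right_mono)
    qed
  qed
  then show ?thesis using amin by (simp add: l2_scaleR)
qed

lemma l2_le_wt: assumes y: "y \<in> Gam" and F: "L2s M F" shows "sqrt amin * l2 M F \<le> l2 M (wt y F)"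
proof -
  have "l2 M (\<lambda>x. sqrt amin *\<^sub>R F x) \<le> l2 M (wt y F)"
  proof (rule l2_mono_AE[OF L2s_wt[OF y F] L2s_measurable[OF L2s_scaleR[OF F]]])
    show "AE x in M. norm (sqrt amin *\<^sub>R F x) \<le> norm (wt y F x)"
      using a_bounds[OF y]
    proof eventually_elim
      case (elim x)
      then show ?case using amin by (auto simp: wt_def intro!: mult_right_mono)
    qed
  qed
  then show ?thesis using amin by (simp add: l2_scaleR)
qed

lemma energy_form_eq:
  assumes y: "y \<in> Gam" and v: "v \<in> S1" and w: "w \<in> S1"
  shows "energy_form D a y v w = (LINT x|M. wt y (grad v) x \<bullet> wt y (grad w) x)"
proof -
  have m: "(\<lambda>x. weak_deriv D [j] v x) \<in> borel_measurable M" if "v \<in> S1" for v :: "real^'d \<Rightarrow> real" and j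
    using L2s_measurable[OF Sob1_deriv(1)[OF that, of j]] .
  show ?thesis
    unfolding energy_form_def
  proof (rule integral_cong_AE)
    show "(\<lambda>x. a x y * (\<Sum>j\<in>UNIV. weak_deriv D [j] v x * weak_deriv D [j] w x)) \<in> borel_measurable M"
      by (intro borel_measurable_times borel_measurable_sum a_meas y m v w)
    show "(\<lambda>x. wt y (grad v) x \<bullet> wt y (grad w) x) \<in> borel_measurable M"
      by (intro borel_measurable_inner L2s_measurable L2s_wt L2s_grad y v w)
    show "AE x in M. a x y * (\<Sum>j\<in>UNIV. weak_deriv D [j] v x * weak_deriv D [j] w x) = wt y (grad v) x \<bullet> wt y (grad w) x"
      using a_bounds[OF y]
    proof eventually_elim
      case (elim x)
      then have "sqrt (a x y) * (sqrt (a x y) * s) = a x y * s" for s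
        using amin by (simp add: mult.assoc[symmetric])
      then have "sqrt (a x y) * (sqrt (a x y) * (grad v x \<bullet> grad w x)) = a x y * (grad v x \<bullet> grad w x)" .
      then have "wt y (grad v) x \<bullet> wt y (grad w) x = a x y * (grad v x \<bullet> grad w x)"
        unfolding wt_def inner_scaleR_left inner_scaleR_right .
      then show ?case by (simp add: inner_vec_def grad_def)
    qed
  qed
qed

lemma u_H10: "y \<in> Gam \<Longrightarrow> u y \<in> S1"
  using u_sol by (simp add: weak_solution_def H10_in_S1)

end

locale fe_space = diffusion D a f u amin amax
  for D :: "(real^'d::finite) set" and a f :: "real^'d \<Rightarrow> real^'n::finite \<Rightarrow> real" and u amin amax +
  fixes \<sigma> t :: real and p nloc n :: nat and \<phi> :: "nat \<Rightarrow> real^'d \<Rightarrow> real"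
  assumes fe: "fe_basis D \<sigma> p nloc t n \<phi>" and t: "0 < t"
begin

lemma n_pos: "0 < n"
  using fe by (simp add: fe_basis_def)

lemma \<phi>_H10: "i < n \<Longrightarrow> \<phi> i \<in> H10 D"
  using fe by (simp add: fe_basis_def)

lemma \<phi>_S1: "i < n \<Longrightarrow> \<phi> i \<in> S1"
  using \<phi>_H10 H10_in_S1 by blast

abbreviation A where "A y \<equiv> stiffness D a n \<phi> y"
abbreviation b where "b y \<equiv> load_vec D f n \<phi> y"

text \<open>The gradient of the finite element function with coefficient vector \<open>c\<close>.\<close>

definition G :: "real vec \<Rightarrow> real^'d \<Rightarrow> real^'d" where
  "G c x = (\<Sum>i<n. vec_index c i *\<^sub>R grad (\<phi> i) x)"

lemma L2s_G: "L2s M (G c)"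
  unfolding G_def by (intro L2s_sum L2s_scaleR L2s_grad \<phi>_S1) simp

lemma wt_G: "wt y (G c) x = (\<Sum>i<n. vec_index c i *\<^sub>R wt y (grad (\<phi> i)) x)"
  by (simp add: wt_def G_def scaleR_sum_right mult.commute)

lemma A_carrier: "A y \<in> carrier_mat n n"
  by (simp add: stiffness_def)

lemma b_carrier: "b y \<in> carrier_vec n"
  by (simp add: load_vec_def)

lemma scalar_prod_A:
  assumes y: "y \<in> Gam" and c: "c \<in> carrier_vec n" "c' \<in> carrier_vec n"
  shows "scalar_prod c (A y *\<^sub>v c') = (LINT x|M. wt y (G c) x \<bullet> wt y (G c') x)"
proof -
  have int: "integrable M (\<lambda>x. wt y (grad (\<phi> i)) x \<bullet> wt y (grad (\<phi> i')) x)" if "i < n" "i' < n" for i i'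
    using that by (intro L2s_inner_integrable L2s_wt L2s_grad \<phi>_S1 y)
  have "(LINT x|M. wt y (G c) x \<bullet> wt y (G c') x)
      = (LINT x|M. (\<Sum>i<n. \<Sum>i'<n. vec_index c i * vec_index c' i' * (wt y (grad (\<phi> i)) x \<bullet> wt y (grad (\<phi> i')) x)))"
    by (simp add: wt_G inner_sum_left inner_sum_right sum_distrib_left mult.assoc)
      (subst sum.swap, simp add: mult.left_commute)
  also have "\<dots> = (\<Sum>i<n. LINT x|M. (\<Sum>i'<n. vec_index c i * vec_index c' i' * (wt y (grad (\<phi> i)) x \<bullet> wt y (grad (\<phi> i')) x)))"
    by (intro Bochner_Integration.integral_sum Bochner_Integration.integrable_sum integrable_mult_right int) simp_all
  also have "\<dots> = (\<Sum>i<n. \<Sum>i'<n. LINT x|M. vec_index c i * vec_index c' i' * (wt y (grad (\<phi> i)) x \<bullet> wt y (grad (\<phi> i')) x))"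
    by (intro sum.cong refl Bochner_Integration.integral_sum integrable_mult_right int) simp_all
  also have "\<dots> = (\<Sum>i<n. \<Sum>i'<n. vec_index c i * vec_index c' i' * (LINT x|M. wt y (grad (\<phi> i)) x \<bullet> wt y (grad (\<phi> i')) x))"
    by simp
  also have "\<dots> = (\<Sum>i<n. \<Sum>i'<n. vec_index c i * vec_index c' i' * energy_form D a y (\<phi> i') (\<phi> i))"
    by (intro sum.cong refl) (simp add: energy_form_eq[OF y \<phi>_S1 \<phi>_S1] inner_commute)
  also have "\<dots> = scalar_prod c (A y *\<^sub>v c')"
    using c by (simp add: scalar_prod_def stiffness_def atLeast0LessThan sum_distrib_left mult_ac)
  finally show ?thesis by simp
qed

lemma h10_approx_combination:
  "h10_approx (\<lambda>x. \<Sum>i<n. vec_index c i * \<phi> i x) (\<lambda>j x. G c x $ j)"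
proof -
  have "h10_approx (\<lambda>x. \<Sum>i<n. vec_index c i * \<phi> i x) (\<lambda>j x. \<Sum>i<n. vec_index c i * weak_deriv D [j] (\<phi> i) x)"
    by (intro h10_approx_sum H10_approx \<phi>_H10) auto
  then show ?thesis by (simp add: G_def grad_def)
qed

lemma l2_component_le: "L2s M F \<Longrightarrow> l2 M (\<lambda>x. F x $ j) \<le> l2 M F" for F :: "real^'d \<Rightarrow> real^'d"
proof (rule l2_mono_AE)
  assume F: "L2s M F"
  show "(\<lambda>x. F x $ j) \<in> borel_measurable M"
    by (rule L2s_measurable[OF L2s_bounded_linear[OF bounded_linear_vec_nth F]])
qed (auto simp: component_le_norm_cart)

text \<open>If the energy of a coefficient vector vanishes, so does the gradient of its finite element
  function, hence the function by the Poincare inequality, hence the vector by linear independence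
  of the basis.\<close>

lemma spd_A: assumes y: "y \<in> Gam" shows "spd_mat n (A y)"
  unfolding spd_mat_def
proof (intro conjI ballI impI)
  show "A y \<in> carrier_mat n n" by (rule A_carrier)
  fix v w :: "real vec" assume vw: "v \<in> carrier_vec n" "w \<in> carrier_vec n"
  have "scalar_prod (A y *\<^sub>v v) w = scalar_prod w (A y *\<^sub>v v)"
    using vw A_carrier by (intro comm_scalar_prod[of _ n]) (auto intro: mult_mat_vec_carrier)
  then show "scalar_prod v (A y *\<^sub>v w) = scalar_prod (A y *\<^sub>v v) w"
    using scalar_prod_A[OF y vw] scalar_prod_A[OF y vw(2,1)] by (simp add: inner_commute)
next
  fix v :: "real vec" assume v: "v \<in> carrier_vec n" "v \<noteq> 0\<^sub>v n"
  have nn: "scalar_prod v (A y *\<^sub>v v) = (l2 M (wt y (G v)))\<^sup>2"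
    using scalar_prod_A[OF y v(1) v(1)] by (simp add: l2_sq power2_norm_eq_inner)
  have "l2 M (wt y (G v)) \<noteq> 0"
  proof
    assume "l2 M (wt y (G v)) = 0"
    then have "sqrt amin * l2 M (G v) \<le> 0" using l2_le_wt[OF y L2s_G, of v] by simp
    then have G0: "l2 M (G v) = 0" using amin l2_nonneg[of M "G v"] by (simp add: mult_le_0_iff)
    obtain j :: 'd where True by simp
    obtain R where R: "\<And>x. x \<in> D \<Longrightarrow> \<bar>x $ j - 0\<bar> \<le> R" using coord_bounded by blast
    have "l2 M (\<lambda>x. \<Sum>i<n. vec_index v i * \<phi> i x) \<le> 2 * max R 0 * l2 M (\<lambda>x. G v x $ j)"
    proof (rule Poincare_inequality[OF h10_approx_combination])
      show "AE x in M. (\<Sum>i<n. vec_index v i * \<phi> i x) \<noteq> 0 \<longrightarrow> \<bar>x $ j - 0\<bar> \<le> max R 0"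
        using R by (intro AE_I2) (auto simp: space_restrict_space le_max_iff_disj)
    qed simp
    also have "\<dots> \<le> 2 * max R 0 * l2 M (G v)" by (intro mult_left_mono l2_component_le L2s_G) simp
    finally have "l2 M (\<lambda>x. \<Sum>i<n. vec_index v i * \<phi> i x) \<le> 0" unfolding G0 by simp
    then have "l2 M (\<lambda>x. \<Sum>i<n. vec_index v i * \<phi> i x) = 0" by (rule l2_le_0)
    then have "AE x in M. (\<Sum>i<n. vec_index v i * \<phi> i x) = 0"
      using h10_approx_combination[of v] by (intro l2_eq_0_AE) (auto simp: h10_approx_def)
    then have "\<forall>i<n. vec_index v i = 0" using fe unfolding fe_basis_def by blast
    then have "v = 0\<^sub>v n" using v(1) by (intro eq_vecI) auto
    then show False using v(2) by simp
  qed
  then show "0 < scalar_prod v (A y *\<^sub>v v)" unfolding nn by simp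
qed

lemma energy_norm_eq: "y \<in> Gam \<Longrightarrow> c \<in> carrier_vec n \<Longrightarrow> energy_norm (A y) c = l2 M (wt y (G c))"
  using scalar_prod_A[of y c c] by (simp add: energy_norm_def l2_def power2_norm_eq_inner)

abbreviation c where "c y \<equiv> lin_sol (A y) (b y)"

lemma c_carrier: "y \<in> Gam \<Longrightarrow> c y \<in> carrier_vec n"
  and A_c: "y \<in> Gam \<Longrightarrow> A y *\<^sub>v c y = b y"
  using spd.lin_sol[OF spd.intro[OF spd_A] b_carrier] by auto

lemma b_eq: assumes y: "y \<in> Gam" and i: "i < n"
  shows "vec_index (b y) i = (LINT x|M. wt y (grad (u y)) x \<bullet> wt y (grad (\<phi> i)) x)"
proof -
  have "vec_index (b y) i = energy_form D a y (u y) (\<phi> i)"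
    using u_sol[OF y] i \<phi>_H10[OF i] by (simp add: load_vec_def weak_solution_def)
  then show ?thesis using energy_form_eq[OF y u_H10[OF y] \<phi>_S1[OF i]] by simp
qed

lemma b_zero: assumes y: "y \<in> Gam" and z: "H10_norm D (u y) = 0" shows "b y = 0\<^sub>v n"
proof (rule eq_vecI)
  fix i assume "i < dim_vec (0\<^sub>v n :: real vec)"
  then have i: "i < n" by simp
  have "l2 M (wt y (grad (u y))) \<le> 0" using l2_wt_le[OF y L2s_grad[OF u_H10[OF y]]] z by (simp add: H10_norm_eq)
  then have l0: "l2 M (wt y (grad (u y))) = 0" by (rule l2_le_0)
  have "\<bar>vec_index (b y) i\<bar> \<le> l2 M (wt y (grad (u y))) * l2 M (wt y (grad (\<phi> i)))"
    unfolding b_eq[OF y i] by (intro L2s_inner_le L2s_wt L2s_grad y u_H10 \<phi>_S1 i)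
  then show "vec_index (b y) i = vec_index (0\<^sub>v n) i" using l0 i by simp
qed (simp add: load_vec_def)

text \<open>The Galerkin solution is the orthogonal projection of the exact solution in the energy inner
  product.\<close>

lemma galerkin_energy_le:
  assumes y: "y \<in> Gam" shows "energy_norm (A y) (c y) \<le> sqrt amax * H10_norm D (u y)"
proof -
  let ?e = "l2 M (wt y (G (c y)))"
  have "?e\<^sup>2 = scalar_prod (c y) (A y *\<^sub>v c y)"
    using scalar_prod_A[OF y c_carrier[OF y] c_carrier[OF y]] by (simp add: l2_sq power2_norm_eq_inner)
  also have "\<dots> = (\<Sum>i<n. vec_index (c y) i * vec_index (b y) i)"
    using A_c[OF y] c_carrier[OF y] by (simp add: scalar_prod_def load_vec_def atLeast0LessThan)
  also have "\<dots> = (\<Sum>i<n. vec_index (c y) i * (LINT x|M. wt y (grad (u y)) x \<bullet> wt y (grad (\<phi> i)) x))"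
    by (intro sum.cong refl) (simp add: b_eq[OF y])
  also have "\<dots> = (LINT x|M. wt y (grad (u y)) x \<bullet> wt y (G (c y)) x)"
  proof -
    have int: "integrable M (\<lambda>x. wt y (grad (u y)) x \<bullet> wt y (grad (\<phi> i)) x)" if "i < n" for i
      using that by (intro L2s_inner_integrable L2s_wt L2s_grad u_H10 \<phi>_S1 y)
    show ?thesis using int by (simp add: wt_G inner_sum_right Bochner_Integration.integral_sum)
  qed
  also have "\<dots> \<le> l2 M (wt y (grad (u y))) * ?e"
    using L2s_inner_le[OF L2s_wt[OF y L2s_grad[OF u_H10[OF y]]] L2s_wt[OF y L2s_G[of "c y"]]] by simp
  finally have *: "?e * ?e \<le> l2 M (wt y (grad (u y))) * ?e" by (simp add: power2_eq_square)
  have "?e \<le> l2 M (wt y (grad (u y)))"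
  proof (cases "?e = 0")
    case False
    then have "0 < ?e" using l2_nonneg[of M "wt y (G (c y))"] by simp
    then show ?thesis using * by simp
  qed (simp add: l2_nonneg)
  also have "\<dots> \<le> sqrt amax * H10_norm D (u y)"
    unfolding H10_norm_eq by (rule l2_wt_le[OF y L2s_grad[OF u_H10[OF y]]])
  finally show ?thesis by (simp add: energy_norm_eq[OF y c_carrier[OF y]])
qed

lemma galerkin_S1: "galerkin D a f n \<phi> y \<in> S1"
  and grad_galerkin: "AE x in M. grad (galerkin D a f n \<phi> y) x = G (c y) x"
proof -
  let ?g = "\<lambda>j x. \<Sum>i<n. vec_index (c y) i *\<^sub>R weak_deriv D [j] (\<phi> i) x"
  have eq: "galerkin D a f n \<phi> y = (\<lambda>x. \<Sum>i<n. vec_index (c y) i *\<^sub>R \<phi> i x)"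
    by (simp add: galerkin_def fun_eq_iff)
  have S: "(\<lambda>x. \<Sum>i<m. vec_index (c y) i *\<^sub>R \<phi> i x) \<in> S1 \<and>
    (\<forall>j. has_weak_deriv D [j] (\<lambda>x. \<Sum>i<m. vec_index (c y) i *\<^sub>R \<phi> i x) (\<lambda>x. \<Sum>i<m. vec_index (c y) i *\<^sub>R weak_deriv D [j] (\<phi> i) x))"
    if "m \<le> n" for m
    using that
  proof (induction m)
    case 0
    then show ?case by (simp add: Sob1_zero has_weak_deriv_def)
  next
    case (Suc m)
    have m: "\<phi> m \<in> S1" using Suc.prems by (intro \<phi>_S1) simp
    have sm: "(\<lambda>x. vec_index (c y) m *\<^sub>R \<phi> m x) \<in> S1" by (rule Sob1_linear[OF bounded_linear_scaleR_right m])
    have IH: "(\<lambda>x. \<Sum>i<m. vec_index (c y) i *\<^sub>R \<phi> i x) \<in> S1"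
      "\<And>j. has_weak_deriv D [j] (\<lambda>x. \<Sum>i<m. vec_index (c y) i *\<^sub>R \<phi> i x) (\<lambda>x. \<Sum>i<m. vec_index (c y) i *\<^sub>R weak_deriv D [j] (\<phi> i) x)"
      using Suc by auto
    have L: "L2s M (\<lambda>x. \<Sum>i<m. vec_index (c y) i *\<^sub>R weak_deriv D [j] (\<phi> i) x)" for j
      using Suc.prems by (intro L2s_sum L2s_scaleR Sob1_deriv \<phi>_S1) auto
    show ?case
    proof (intro conjI allI)
      show "(\<lambda>x. \<Sum>i<Suc m. vec_index (c y) i *\<^sub>R \<phi> i x) \<in> S1"
        unfolding sum.lessThan_Suc by (rule Sob1_add[OF IH(1) sm])
      show "has_weak_deriv D [j] (\<lambda>x. \<Sum>i<Suc m. vec_index (c y) i *\<^sub>R \<phi> i x)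
          (\<lambda>x. \<Sum>i<Suc m. vec_index (c y) i *\<^sub>R weak_deriv D [j] (\<phi> i) x)" for j
        unfolding sum.lessThan_Suc
        by (rule has_weak_deriv_add[OF Sob1_L2s[OF IH(1)] Sob1_L2s[OF sm] L L2s_scaleR[OF Sob1_deriv(1)[OF m]] IH(2)
              has_weak_deriv_linear[OF bounded_linear_scaleR_right Sob1_L2s[OF m] Sob1_deriv[OF m]]])
    qed
  qed
  show "galerkin D a f n \<phi> y \<in> S1" unfolding eq using S[of n] by simp
  have "AE x in M. grad (galerkin D a f n \<phi> y) x = (\<chi> j. ?g j x)"
    unfolding eq using S[of n]
    by (intro grad_eqI) (auto intro!: L2s_sum L2s_scaleR Sob1_deriv \<phi>_S1 simp del: real_scaleR_def)
  then show "AE x in M. grad (galerkin D a f n \<phi> y) x = G (c y) x"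
    by eventually_elim (simp add: G_def grad_def Finite_Cartesian_Product.vec_eq_iff)
qed

lemma H10_norm_galerkin: "H10_norm D (galerkin D a f n \<phi> y) = l2 M (G (c y))"
  unfolding H10_norm_eq
  by (intro l2_cong_AE L2s_measurable L2s_grad galerkin_S1 L2s_G grad_galerkin)

end

section \<open>Galerkin solutions and the condition number\<close>

context fe_space
begin

text \<open>The cells on which a basis function does not vanish contain its node, and they have diameter
  at most \<open>t\<close>.\<close>

lemma local_support:
  assumes i: "i < n"
  obtains z where "\<And>x. x \<in> D \<Longrightarrow> \<phi> i x \<noteq> 0 \<Longrightarrow> dist x z \<le> t"
proof -
  obtain T where T: "uniform_mesh \<sigma> t D T" "\<And>i. i < n \<Longrightarrow> \<exists>z. \<forall>x \<in> D - \<Union>{c \<in> T. z \<in> c}. \<phi> i x = 0"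
    using fe unfolding fe_basis_def by blast
  obtain z where z: "\<forall>x \<in> D - \<Union>{c \<in> T. z \<in> c}. \<phi> i x = 0" using T(2)[OF i] by blast
  have "dist x z \<le> t" if x: "x \<in> D" "\<phi> i x \<noteq> 0" for x
  proof -
    obtain c where c: "c \<in> T" "z \<in> c" "x \<in> c" using z x by blast
    have "polytope c" "diameter c \<le> t" using T(1) c(1) by (auto simp: uniform_mesh_def)
    then show ?thesis using diameter_bounded_bound[OF polytope_imp_bounded c(3,2)] by simp
  qed
  then show ?thesis using that by blast
qed

text \<open>Outside the null set of cell boundaries a point lies in the interior of a cell, or in no
  cell at all, and there all basis functions vanish.\<close>

lemma finite_overlap: "AE x in M. card {i. i < n \<and> \<phi> i x \<noteq> 0} \<le> nloc"
proof -
  obtain T where T: "uniform_mesh \<sigma> t D T" "\<And>i. i < n \<Longrightarrow> \<exists>z. \<forall>x \<in> D - \<Union>{c \<in> T. z \<in> c}. \<phi> i x = 0"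
    "\<And>c. c \<in> T \<Longrightarrow> card {i. i < n \<and> (\<exists>x\<in>interior c. \<phi> i x \<noteq> 0)} \<le> nloc"
    using fe unfolding fe_basis_def by blast
  have "finite T" and poly: "\<And>c. c \<in> T \<Longrightarrow> polytope c" using T(1) by (auto simp: uniform_mesh_def)
  then have "negligible (\<Union>(frontier ` T))"
    by (intro negligible_Union) (auto intro!: negligible_convex_frontier polytope_imp_convex)
  then have "AE x in lebesgue. x \<notin> (\<Union>c\<in>T. frontier c)"
    by (intro AE_not_in) (simp add: negligible_iff_null_sets)
  then have "AE x in M. x \<notin> (\<Union>c\<in>T. frontier c)"
    using sets_D by (subst AE_restrict_space_iff) (auto elim: AE_mp)
  moreover have "AE x in M. x \<in> D" by (intro AE_I2) (simp add: space_restrict_space)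
  ultimately show ?thesis
  proof eventually_elim
    case (elim x)
    show ?case
    proof (cases "\<exists>c\<in>T. x \<in> c")
      case True
      then obtain c where c: "c \<in> T" "x \<in> c" by blast
      then have "x \<in> interior c" using elim polytope_imp_closed[OF poly[OF c(1)]] by (auto simp: frontier_def)
      then have "{i. i < n \<and> \<phi> i x \<noteq> 0} \<subseteq> {i. i < n \<and> (\<exists>x\<in>interior c. \<phi> i x \<noteq> 0)}" by blast
      then have "card {i. i < n \<and> \<phi> i x \<noteq> 0} \<le> card {i. i < n \<and> (\<exists>x\<in>interior c. \<phi> i x \<noteq> 0)}"
        by (intro card_mono) auto
      then show ?thesis using T(3)[OF c(1)] by simp
    next
      case False
      then have "\<phi> i x = 0" if "i < n" for i using T(2)[OF that] elim by blast
      then have "{i. i < n \<and> \<phi> i x \<noteq> 0} = {}" by auto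
      then show ?thesis by (simp only: card.empty zero_le)
    qed
  qed
qed

lemma diag_le: assumes y: "y \<in> Gam" and i: "i < n"
  shows "amin * (l2 M (grad (\<phi> i)))\<^sup>2 \<le> mat_norm2 (A y)"
proof -
  have "(sqrt amin * l2 M (grad (\<phi> i)))\<^sup>2 \<le> (l2 M (wt y (grad (\<phi> i))))\<^sup>2"
    using amin l2_nonneg[of M "grad (\<phi> i)"] by (intro power_mono l2_le_wt y L2s_grad \<phi>_S1 i) simp
  also have "\<dots> = A y $$ (i, i)"
    using i energy_form_eq[OF y \<phi>_S1[OF i] \<phi>_S1[OF i]] by (simp add: stiffness_def l2_sq power2_norm_eq_inner)
  also have "\<dots> \<le> mat_norm2 (A y)" by (rule spd.diag_le_norm[OF spd.intro[OF spd_A[OF y]] i])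
  finally show ?thesis using amin by (simp add: power_mult_distrib)
qed

text \<open>An entry of the load vector is at most the norm of \<open>f\<close> on the support of \<open>\<phi> i\<close> times the
  norm of \<open>\<phi> i\<close>. The latter is of order \<open>t\<close> times the norm of the gradient by the Poincare
  inequality, and the squared norm of the gradient is dominated by a diagonal entry of the
  stiffness matrix. Summation costs the factor \<open>nloc\<close>, since the supports overlap finitely often.\<close>

lemma load_norm_le: assumes y: "y \<in> Gam"
  shows "(vec_norm2 (b y))\<^sup>2 \<le> 4 * t\<^sup>2 * real nloc * (l2 M (\<lambda>x. f x y))\<^sup>2 * mat_norm2 (A y) / amin"
proof -
  define E where "E i = {x. \<phi> i x \<noteq> 0}" for i
  define fi where "fi i x = indicator (E i) x *\<^sub>R f x y" for i x
  have fm: "L2s M (\<lambda>x. f x y)" by (rule f_L2[OF y])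
  have \<phi>m: "L2s M (\<phi> i)" if "i < n" for i using that by (intro Sob1_L2s \<phi>_S1)
  have fi: "L2s M (fi i)" if "i < n" for i
    unfolding fi_def
  proof (rule L2s_bounded_mult[OF fm])
    have "{x \<in> space M. \<phi> i x \<noteq> 0} \<in> sets M" using L2s_measurable[OF \<phi>m[OF that]] by measurable
    then have "indicator {x \<in> space M. \<phi> i x \<noteq> 0} \<in> borel_measurable M" by (rule borel_measurable_indicator)
    moreover have "indicator {x \<in> space M. \<phi> i x \<noteq> 0} x = (indicator (E i) x :: real)" if "x \<in> space M" for x
      using that by (auto simp: E_def indicator_def)
    ultimately show "indicat_real (E i) \<in> borel_measurable M" by (subst measurable_cong[symmetric]) auto
    show "AE x in M. \<bar>indicat_real (E i) x\<bar> \<le> 1" by (auto simp: indicator_def)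
  qed
  obtain j :: 'd where True by simp
  have bi: "(vec_index (b y) i)\<^sup>2 \<le> (l2 M (fi i))\<^sup>2 * (4 * t\<^sup>2 * (mat_norm2 (A y) / amin))" if i: "i < n" for i
  proof -
    obtain z where z: "\<And>x. x \<in> D \<Longrightarrow> \<phi> i x \<noteq> 0 \<Longrightarrow> dist x z \<le> t" using local_support[OF i] by blast
    have "l2 M (\<phi> i) \<le> 2 * t * l2 M (weak_deriv D [j] (\<phi> i))"
    proof (rule Poincare_inequality[OF H10_approx[OF \<phi>_H10[OF i]]])
      show "AE x in M. \<phi> i x \<noteq> 0 \<longrightarrow> \<bar>x $ j - z $ j\<bar> \<le> t"
      proof (rule AE_I2, rule impI)
        fix x assume "x \<in> space M" "\<phi> i x \<noteq> 0"
        then have "dist x z \<le> t" by (intro z) (simp_all add: space_restrict_space)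
        then show "\<bar>x $ j - z $ j\<bar> \<le> t" using dist_vec_nth_le[of x j z] by (simp add: dist_real_def)
      qed
    qed (use t in simp)
    also have "weak_deriv D [j] (\<phi> i) = (\<lambda>x. grad (\<phi> i) x $ j)" by (simp add: grad_def)
    also have "2 * t * l2 M \<dots> \<le> 2 * t * l2 M (grad (\<phi> i))"
      using t by (intro mult_left_mono l2_component_le L2s_grad \<phi>_S1 i) simp
    finally have "(l2 M (\<phi> i))\<^sup>2 \<le> (2 * t * l2 M (grad (\<phi> i)))\<^sup>2" by (intro power_mono l2_nonneg)
    also have "\<dots> = 4 * t\<^sup>2 * (l2 M (grad (\<phi> i)))\<^sup>2" by (simp add: power_mult_distrib)
    also have "\<dots> \<le> 4 * t\<^sup>2 * (mat_norm2 (A y) / amin)"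
      using diag_le[OF y i] amin by (intro mult_left_mono) (auto simp: field_simps)
    finally have l2\<phi>: "(l2 M (\<phi> i))\<^sup>2 \<le> 4 * t\<^sup>2 * (mat_norm2 (A y) / amin)" .
    have "vec_index (b y) i = (LINT x|M. fi i x \<bullet> \<phi> i x)"
    proof -
      have e: "f x y * \<phi> i x = fi i x \<bullet> \<phi> i x" for x by (cases "\<phi> i x = 0") (simp_all add: fi_def E_def)
      have "vec_index (b y) i = (LINT x|M. f x y * \<phi> i x)" using i by (simp add: load_vec_def)
      then show ?thesis unfolding e .
    qed
    then have "\<bar>vec_index (b y) i\<bar> \<le> l2 M (fi i) * l2 M (\<phi> i)" using L2s_inner_le[OF fi[OF i] \<phi>m[OF i]] by simp
    then have "\<bar>vec_index (b y) i\<bar>\<^sup>2 \<le> (l2 M (fi i) * l2 M (\<phi> i))\<^sup>2" by (intro power_mono) auto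
    also have "\<dots> = (l2 M (fi i))\<^sup>2 * (l2 M (\<phi> i))\<^sup>2" by (simp add: power_mult_distrib)
    also have "\<dots> \<le> (l2 M (fi i))\<^sup>2 * (4 * t\<^sup>2 * (mat_norm2 (A y) / amin))"
      by (intro mult_left_mono l2\<phi>) simp
    finally show ?thesis by simp
  qed
  have sumfi: "(\<Sum>i<n. (l2 M (fi i))\<^sup>2) \<le> real nloc * (l2 M (\<lambda>x. f x y))\<^sup>2"
  proof -
    have "(\<Sum>i<n. (l2 M (fi i))\<^sup>2) = (LINT x|M. (\<Sum>i<n. (norm (fi i x))\<^sup>2))"
      unfolding l2_sq using fi by (subst Bochner_Integration.integral_sum) (auto simp: L2s_def)
    also have "\<dots> \<le> (LINT x|M. real nloc * (norm (f x y))\<^sup>2)"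
    proof (rule integral_mono_AE)
      show "integrable M (\<lambda>x. \<Sum>i<n. (norm (fi i x))\<^sup>2)" using fi by (intro Bochner_Integration.integrable_sum) (auto simp: L2s_def)
      show "integrable M (\<lambda>x. real nloc * (norm (f x y))\<^sup>2)" using fm by (simp add: L2s_def)
      show "AE x in M. (\<Sum>i<n. (norm (fi i x))\<^sup>2) \<le> real nloc * (norm (f x y))\<^sup>2"
        using finite_overlap
      proof eventually_elim
        case (elim x)
        have "(\<Sum>i<n. (norm (fi i x))\<^sup>2) = (\<Sum>i<n. if \<phi> i x \<noteq> 0 then (norm (f x y))\<^sup>2 else 0)"
          by (intro sum.cong refl) (auto simp: fi_def E_def)
        also have "\<dots> = (\<Sum>i\<in>{i. i < n \<and> \<phi> i x \<noteq> 0}. (norm (f x y))\<^sup>2)"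
          by (subst sum.inter_filter[symmetric]) (auto intro: sum.cong)
        also have "\<dots> = real (card {i. i < n \<and> \<phi> i x \<noteq> 0}) * (norm (f x y))\<^sup>2" by simp
        also have "\<dots> \<le> real nloc * (norm (f x y))\<^sup>2" using elim by (intro mult_right_mono) auto
        finally show ?case .
      qed
    qed
    finally show ?thesis by (simp add: l2_sq)
  qed
  have N0: "0 \<le> mat_norm2 (A y)" by (rule mat_norm2_nonneg[OF A_carrier])
  have "(vec_norm2 (b y))\<^sup>2 = (\<Sum>i<n. (vec_index (b y) i)\<^sup>2)"
    unfolding vec_norm2_sq by (simp add: scalar_prod_def load_vec_def atLeast0LessThan power2_eq_square)
  also have "\<dots> \<le> (\<Sum>i<n. (l2 M (fi i))\<^sup>2 * (4 * t\<^sup>2 * (mat_norm2 (A y) / amin)))"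
    by (intro sum_mono bi) simp
  also have "\<dots> = (\<Sum>i<n. (l2 M (fi i))\<^sup>2) * (4 * t\<^sup>2 * (mat_norm2 (A y) / amin))" by (rule sum_distrib_right[symmetric])
  also have "\<dots> \<le> (real nloc * (l2 M (\<lambda>x. f x y))\<^sup>2) * (4 * t\<^sup>2 * (mat_norm2 (A y) / amin))"
    using sumfi amin N0 by (intro mult_right_mono) auto
  finally show ?thesis by (simp add: mult_ac)
qed

text \<open>The energy of the Galerkin solution is at most \<open>\<parallel>A\<^sup>-\<^sup>1\<parallel> \<parallel>b\<parallel>\<^sup>2\<close>. Inserting the bound of the load
  vector produces the condition number times the square of the mesh size: a condition number that
  stays bounded would force the Galerkin solutions to tend to zero.\<close>

lemma galerkin_norm_le_cond: assumes y: "y \<in> Gam"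
  shows "(H10_norm D (galerkin D a f n \<phi> y))\<^sup>2
    \<le> (4 * real nloc * (l2 M (\<lambda>x. f x y))\<^sup>2 / amin\<^sup>2) * t\<^sup>2 * cond_number (A y)"
proof -
  interpret S: spd n "A y" by (rule spd.intro[OF spd_A[OF y]])
  let ?I = "mat_norm2 (mat_inv (A y))"
  have I0: "0 \<le> ?I" by (rule mat_norm2_nonneg[OF S.mat_inv(1)])
  have "(sqrt amin * l2 M (G (c y)))\<^sup>2 \<le> (l2 M (wt y (G (c y))))\<^sup>2"
    using amin l2_nonneg[of M "G (c y)"] by (intro power_mono l2_le_wt y L2s_G) simp
  then have "amin * (l2 M (G (c y)))\<^sup>2 \<le> (l2 M (wt y (G (c y))))\<^sup>2" using amin by (simp add: power_mult_distrib)
  also have "\<dots> = scalar_prod (c y) (A y *\<^sub>v c y)"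
    using scalar_prod_A[OF y c_carrier[OF y] c_carrier[OF y]] by (simp add: l2_sq power2_norm_eq_inner)
  also have "\<dots> \<le> ?I * (vec_norm2 (b y))\<^sup>2"
    using S.energy_le_inv[OF c_carrier[OF y]] A_c[OF y] by simp
  also have "\<dots> \<le> ?I * (4 * t\<^sup>2 * real nloc * (l2 M (\<lambda>x. f x y))\<^sup>2 * mat_norm2 (A y) / amin)"
    by (intro mult_left_mono load_norm_le y I0)
  also have "\<dots> = (4 * real nloc * (l2 M (\<lambda>x. f x y))\<^sup>2 / amin) * t\<^sup>2 * cond_number (A y)"
    by (simp add: cond_number_def mult_ac)
  finally have "(l2 M (G (c y)))\<^sup>2 \<le> (4 * real nloc * (l2 M (\<lambda>x. f x y))\<^sup>2 / amin) * t\<^sup>2 * cond_number (A y) / amin"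
    using amin by (simp add: field_simps)
  then show ?thesis by (simp add: H10_norm_galerkin power2_eq_square mult_ac)
qed

section \<open>Dependence of the stiffness matrix on the parameter\<close>

lemma energy_norm_compare:
  assumes y: "y \<in> Gam" and y': "y' \<in> Gam" and v: "v \<in> carrier_vec n"
  shows "energy_norm (A y) v \<le> sqrt (amax / amin) * energy_norm (A y') v"
proof -
  have "energy_norm (A y) v \<le> sqrt amax * l2 M (G v)"
    unfolding energy_norm_eq[OF y v] by (rule l2_wt_le[OF y L2s_G])
  also have "\<dots> = sqrt (amax / amin) * (sqrt amin * l2 M (G v))" using amin by (simp add: real_sqrt_divide)
  also have "\<dots> \<le> sqrt (amax / amin) * energy_norm (A y') v"
    unfolding energy_norm_eq[OF y' v] using amin by (intro mult_left_mono l2_le_wt y' L2s_G) auto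
  finally show ?thesis .
qed

lemma energy_norm_sq: assumes y: "y \<in> Gam" and v: "v \<in> carrier_vec n"
  shows "(energy_norm (A y) v)\<^sup>2 = scalar_prod v (A y *\<^sub>v v)"
  using spd.A_nonneg[OF spd.intro[OF spd_A[OF y]] v] by (simp add: energy_norm_def)

text \<open>Ellipticity compares the energy forms at any two parameters by the factor \<open>amax / amin\<close>,
  hence also the norms of the matrices and of their inverses with those at the parameter \<open>0\<close>.
  Boundedness is needed for the supremum in \<open>kappabar\<close> to be meaningful.\<close>

lemma cond_bdd: "bdd_above ((\<lambda>y. cond_number (A y)) ` Gam)"
proof -
  define y0 :: "real^'n" where "y0 = 0"
  have y0: "y0 \<in> Gam" by (simp add: y0_def Gam_def)
  interpret S0: spd n "A y0" by (rule spd.intro[OF spd_A[OF y0]])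
  define N0 where "N0 = mat_norm2 (A y0)"
  define I0 where "I0 = mat_norm2 (mat_inv (A y0))"
  define q where "q = amax / amin"
  have q: "0 \<le> q" using amin by (simp add: q_def)
  have pos: "0 \<le> N0" "0 \<le> I0" unfolding N0_def I0_def by (auto intro: mat_norm2_nonneg[OF A_carrier] mat_norm2_nonneg[OF S0.mat_inv(1)])
  have cmp: "scalar_prod v (A y *\<^sub>v v) \<le> q * scalar_prod v (A y' *\<^sub>v v)"
    if "y \<in> Gam" "y' \<in> Gam" "v \<in> carrier_vec n" for y y' v
  proof -
    have nn: "0 \<le> energy_norm (A y) v" using energy_norm_eq[OF that(1,3)] by (simp add: l2_nonneg)
    have "(energy_norm (A y) v)\<^sup>2 \<le> (sqrt (amax / amin) * energy_norm (A y') v)\<^sup>2"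
      by (intro power_mono energy_norm_compare that nn)
    then show ?thesis using amin that by (simp add: energy_norm_sq power_mult_distrib q_def)
  qed
  have up0: "scalar_prod v (A y0 *\<^sub>v v) \<le> N0 * (vec_norm2 v)\<^sup>2" if v: "v \<in> carrier_vec n" for v
  proof -
    have "scalar_prod v (A y0 *\<^sub>v v) \<le> vec_norm2 v * vec_norm2 (A y0 *\<^sub>v v)"
      using abs_scalar_prod_le[of v n "A y0 *\<^sub>v v"] v by simp
    also have "\<dots> \<le> vec_norm2 v * (N0 * vec_norm2 v)"
      unfolding N0_def by (intro mult_left_mono S0.norm_A_le v vec_norm2_nonneg)
    finally show ?thesis by (simp add: power2_eq_square mult_ac)
  qed
  have low0: "(vec_norm2 v)\<^sup>2 \<le> I0\<^sup>2 * N0 * scalar_prod v (A y0 *\<^sub>v v)" if v: "v \<in> carrier_vec n" for v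
  proof -
    have "(vec_norm2 v)\<^sup>2 \<le> (I0 * vec_norm2 (A y0 *\<^sub>v v))\<^sup>2"
      unfolding I0_def by (intro power_mono S0.norm_le_inv v vec_norm2_nonneg)
    also have "\<dots> = I0\<^sup>2 * (vec_norm2 (A y0 *\<^sub>v v))\<^sup>2" by (simp add: power_mult_distrib)
    also have "\<dots> \<le> I0\<^sup>2 * (N0 * scalar_prod v (A y0 *\<^sub>v v))"
      unfolding N0_def by (intro mult_left_mono S0.norm_sq_le_energy v) simp
    finally show ?thesis by (simp add: mult.assoc)
  qed
  have "cond_number (A y) \<le> (q * N0) * (I0\<^sup>2 * N0 * q)" if y: "y \<in> Gam" for y
  proof -
    interpret S: spd n "A y" by (rule spd.intro[OF spd_A[OF y]])
    have 1: "mat_norm2 (A y) \<le> q * N0"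
    proof (rule mat_norm2_le[OF A_carrier])
      fix v :: "real vec" assume v: "v \<in> carrier_vec n"
      let ?w = "A y *\<^sub>v v"
      have w: "?w \<in> carrier_vec n" using v by simp
      have "(scalar_prod ?w ?w)\<^sup>2 = (scalar_prod v (A y *\<^sub>v ?w))\<^sup>2" using S.A_sym[OF v w] by simp
      also have "\<dots> \<le> scalar_prod v (A y *\<^sub>v v) * scalar_prod ?w (A y *\<^sub>v ?w)" by (rule S.energy_Cauchy_Schwarz[OF v w])
      also have "\<dots> \<le> (q * (N0 * (vec_norm2 v)\<^sup>2)) * (q * (N0 * (vec_norm2 ?w)\<^sup>2))"
      proof (rule mult_mono)
        show "scalar_prod v (A y *\<^sub>v v) \<le> q * (N0 * (vec_norm2 v)\<^sup>2)"
          using cmp[OF y y0 v] mult_left_mono[OF up0[OF v] q] by linarith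
        show "scalar_prod ?w (A y *\<^sub>v ?w) \<le> q * (N0 * (vec_norm2 ?w)\<^sup>2)"
          using cmp[OF y y0 w] mult_left_mono[OF up0[OF w] q] by linarith
      qed (use q pos S.A_nonneg[OF w] in auto)
      also have "\<dots> = ((q * N0) * vec_norm2 v)\<^sup>2 * (vec_norm2 ?w)\<^sup>2" by (simp add: power2_eq_square mult_ac)
      finally have "((vec_norm2 ?w)\<^sup>2)\<^sup>2 \<le> ((q * N0) * vec_norm2 v)\<^sup>2 * (vec_norm2 ?w)\<^sup>2"
        unfolding vec_norm2_sq[of ?w] .
      then have *: "(vec_norm2 ?w)\<^sup>2 * (vec_norm2 ?w)\<^sup>2 \<le> ((q * N0) * vec_norm2 v)\<^sup>2 * (vec_norm2 ?w)\<^sup>2"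
        by (simp add: power2_eq_square)
      show "vec_norm2 ?w \<le> (q * N0) * vec_norm2 v"
      proof (cases "vec_norm2 ?w = 0")
        case True then show ?thesis using q pos vec_norm2_nonneg[of v] by simp
      next
        case False
        then have "0 < (vec_norm2 ?w)\<^sup>2" by simp
        with * have "(vec_norm2 ?w)\<^sup>2 \<le> ((q * N0) * vec_norm2 v)\<^sup>2" by (rule mult_right_le_imp_le)
        then show ?thesis by (rule power2_le_imp_le) (use q pos vec_norm2_nonneg[of v] in simp)
      qed
    qed (use q pos in simp)
    have 2: "mat_norm2 (mat_inv (A y)) \<le> I0\<^sup>2 * N0 * q"
    proof (rule mat_norm2_le[OF S.mat_inv(1)])
      fix w :: "real vec" assume w: "w \<in> carrier_vec n"
      define v where "v = mat_inv (A y) *\<^sub>v w"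
      have v: "v \<in> carrier_vec n" and Av: "A y *\<^sub>v v = w"
        unfolding v_def using S.A_inv[OF w] mult_mat_vec_carrier[OF S.mat_inv(1) w] by auto
      have "(vec_norm2 v)\<^sup>2 \<le> I0\<^sup>2 * N0 * scalar_prod v (A y0 *\<^sub>v v)" by (rule low0[OF v])
      also have "\<dots> \<le> I0\<^sup>2 * N0 * (q * scalar_prod v (A y *\<^sub>v v))"
        using pos by (intro mult_left_mono cmp y0 y v) auto
      also have "\<dots> \<le> I0\<^sup>2 * N0 * (q * (vec_norm2 v * vec_norm2 w))"
        using abs_scalar_prod_le[OF v w] pos q by (intro mult_left_mono) (auto simp: Av)
      finally have *: "vec_norm2 v * vec_norm2 v \<le> (I0\<^sup>2 * N0 * q * vec_norm2 w) * vec_norm2 v"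
        by (simp add: power2_eq_square mult_ac)
      have "vec_norm2 v \<le> I0\<^sup>2 * N0 * q * vec_norm2 w"
      proof (cases "vec_norm2 v = 0")
        case True then show ?thesis using q pos vec_norm2_nonneg[of w] by simp
      next
        case False
        then have "0 < vec_norm2 v" using vec_norm2_nonneg[of v] by simp
        then show ?thesis using * by simp
      qed
      then show "vec_norm2 (mat_inv (A y) *\<^sub>v w) \<le> I0\<^sup>2 * N0 * q * vec_norm2 w" by (simp add: v_def)
    qed (use q pos in simp)
    show ?thesis unfolding cond_number_def
      by (intro mult_mono 1 2 mat_norm2_nonneg[OF S.mat_inv(1)]) (use q pos in simp)
  qed
  then show ?thesis by (intro bdd_aboveI2)
qed

section \<open>The accelerated algorithm\<close>

abbreviation acc where "acc \<tau> \<equiv> acc_vec A b n \<tau>"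

lemma cg_iterate_carrier: assumes y: "y \<in> Gam" and x0: "x0 \<in> carrier_vec n"
  shows "cg_iterate (A y) (b y) x0 k \<in> carrier_vec n"
proof -
  interpret cg_run n "A y" "b y" x0 "c y"
    by unfold_locales (use spd_A[OF y] b_carrier x0 c_carrier[OF y] A_c[OF y] in auto)
  show ?thesis using closed(1)[of k] by (simp add: x_eq)
qed

lemma start_carrier: "start_vec n L v y \<in> carrier_vec n"
  by (simp add: start_vec_def)

lemma acc_carrier: "y \<in> Gam \<Longrightarrow> acc \<tau> L y \<in> carrier_vec n"
  by (induction L arbitrary: y) (auto simp: Let_def intro!: cg_iterate_carrier start_carrier)

text \<open>Points of coarser grids keep their vectors, which met the tolerance when they were
  computed.\<close>

lemma acc_error:
  assumes K: "\<And>y. y \<in> Gam \<Longrightarrow> cond_number (A y) \<le> K" "1 < K" and \<tau>: "0 < \<tau>" and y: "y \<in> Gam"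
  shows "energy_norm (A y) (c y - acc \<tau> (Suc L) y) \<le> \<tau>"
proof (induction L)
  case 0
  show ?case
    using spd.cg_count_bounds(1)[OF spd.intro[OF spd_A[OF y]] n_pos K(1)[OF y] K(2) b_carrier start_carrier \<tau>] by (simp add: Let_def)
next
  case (Suc L)
  show ?case
  proof (cases "y \<in> sparse_grid (Suc L)")
    case True
    then show ?thesis using Suc by simp
  next
    case False
    then show ?thesis
      using spd.cg_count_bounds(1)[OF spd.intro[OF spd_A[OF y]] n_pos K(1)[OF y] K(2) b_carrier
          start_carrier[of "Suc (Suc L)" "acc \<tau> (Suc L)" y] \<tau>]
      by (subst acc_vec.simps(2)) (simp add: Let_def del: acc_vec.simps)
  qed
qed

lemma G_diff: "v \<in> carrier_vec n \<Longrightarrow> w \<in> carrier_vec n \<Longrightarrow> G (v - w) = (\<lambda>x. G v x - G w x)"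
  by (simp add: G_def fun_eq_iff scaleR_left_diff_distrib sum_subtractf)

lemma energy_norm_diff_le: assumes y: "y \<in> Gam" and v: "v \<in> carrier_vec n" "w \<in> carrier_vec n"
  shows "energy_norm (A y) (v - w) \<le> energy_norm (A y) v + energy_norm (A y) w"
proof -
  have eq: "wt y (G (v - w)) = (\<lambda>x. wt y (G v) x + (-1) *\<^sub>R wt y (G w) x)"
    unfolding G_diff[OF v] by (simp add: wt_def fun_eq_iff scaleR_right_diff_distrib)
  have "l2 M (wt y (G (v - w))) \<le> l2 M (wt y (G v)) + l2 M (\<lambda>x. (-1) *\<^sub>R wt y (G w) x)"
    unfolding eq by (intro l2_triangle L2s_scaleR L2s_wt y L2s_G)
  also have "l2 M (\<lambda>x. (-1) *\<^sub>R wt y (G w) x) = l2 M (wt y (G w))" by (subst l2_scaleR) simp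
  finally show ?thesis using v by (simp add: energy_norm_eq[OF y])
qed

text \<open>The stored vectors have energy norm bounded by that of the Galerkin solution plus the
  tolerance, and the interpolant is a combination of them with coefficients that grow only
  polynomially in \<open>L\<close>. A bound of this size suffices, since only its logarithm counts.\<close>

lemma start_error:
  assumes K: "\<And>y. y \<in> Gam \<Longrightarrow> cond_number (A y) \<le> K" "1 < K" and \<tau>: "0 < \<tau>" "\<tau> \<le> 1"
    and U: "\<And>y. y \<in> Gam \<Longrightarrow> H10_norm D (u y) \<le> U"
    and y: "y \<in> Gam" and L: "1 \<le> L"
  shows "energy_norm (A y) (c y - start_vec n L (acc \<tau> (L - 1)) y)
    \<le> (1 + sqrt (amax / amin)) * (sqrt amax * U + 1) *
      (1 + real (card (sparse_grid (L - 1) :: (real^'n) set)) * (4 * real L) ^ CARD('n))"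
proof -
  define E where "E = sqrt amax * U"
  define q where "q = sqrt (amax / amin)"
  have q: "0 \<le> q" using amin by (simp add: q_def)
  have E: "energy_norm (A y) (c y) \<le> E" if "y \<in> Gam" for y
    using order_trans[OF galerkin_energy_le[OF that] mult_left_mono[OF U[OF that], of "sqrt amax"]] amax by (simp add: E_def)
  have E0: "0 \<le> E" using E[OF y] energy_norm_eq[OF y c_carrier[OF y]] l2_nonneg[of M "wt y (G (c y))"] by linarith
  let ?S = "sparse_grid (L - 1) :: (real^'n) set"
  let ?B = "real (card ?S) * (4 * real L) ^ CARD('n)"
  have B0: "0 \<le> ?B" by simp
  show ?thesis
  proof (cases "L \<le> 1")
    case True
    have cz: "c y - 0\<^sub>v n = c y" using c_carrier[OF y] by (intro eq_vecI) auto
    have "energy_norm (A y) (c y - start_vec n L (acc \<tau> (L - 1)) y) \<le> 1 * (E + 1) * 1"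
      using True E[OF y] by (simp add: start_vec_def cz)
    also have "\<dots> \<le> (1 + q) * (E + 1) * (1 + ?B)"
      using q E0 B0 by (intro mult_mono) auto
    finally show ?thesis by (simp add: E_def q_def)
  next
    case False
    define s where "s = start_vec n L (acc \<tau> (L - 1)) y"
    have s: "s \<in> carrier_vec n" unfolding s_def by (rule start_carrier)
    have Sg: "q' \<in> Gam" if "q' \<in> ?S" for q' using that sparse_grid_subset_Gam by blast
    have Gs: "G s x = (\<Sum>q'\<in>?S. sparse_basis (L - 1) q' y *\<^sub>R G (acc \<tau> (L - 1) q') x)" for x
    proof -
      have "G s x = (\<Sum>i<n. \<Sum>q'\<in>?S. (vec_index (acc \<tau> (L - 1) q') i * sparse_basis (L - 1) q' y) *\<^sub>R grad (\<phi> i) x)"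
        using False by (simp add: G_def s_def start_vec_def scaleR_sum_left)
      also have "\<dots> = (\<Sum>q'\<in>?S. \<Sum>i<n. (vec_index (acc \<tau> (L - 1) q') i * sparse_basis (L - 1) q' y) *\<^sub>R grad (\<phi> i) x)"
        by (rule sum.swap)
      finally show ?thesis by (simp add: G_def scaleR_sum_right mult.commute)
    qed
    have "wt y (G s) = (\<lambda>x. \<Sum>q'\<in>?S. sparse_basis (L - 1) q' y *\<^sub>R wt y (G (acc \<tau> (L - 1) q')) x)"
      by (simp add: wt_def Gs scaleR_sum_right mult.commute fun_eq_iff)
    then have "energy_norm (A y) s = l2 M (\<lambda>x. \<Sum>q'\<in>?S. sparse_basis (L - 1) q' y *\<^sub>R wt y (G (acc \<tau> (L - 1) q')) x)"
      by (simp only: energy_norm_eq[OF y s])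
    also have "\<dots> \<le> (\<Sum>q'\<in>?S. l2 M (\<lambda>x. sparse_basis (L - 1) q' y *\<^sub>R wt y (G (acc \<tau> (L - 1) q')) x))"
      by (intro l2_sum L2s_scaleR L2s_wt y L2s_G)
    also have "\<dots> \<le> (\<Sum>q'\<in>?S. (4 * real L) ^ CARD('n) * (q * (E + 1)))"
    proof (rule sum_mono)
      fix q' assume q': "q' \<in> ?S"
      have ac: "acc \<tau> (L - 1) q' \<in> carrier_vec n" by (rule acc_carrier[OF Sg[OF q']])
      have sb: "\<bar>sparse_basis (L - 1) q' y\<bar> \<le> (4 * real L) ^ CARD('n)"
        using sparse_basis_bound[OF y, of "L - 1" q'] L by (simp add: of_nat_diff)
      have "energy_norm (A y) (acc \<tau> (L - 1) q') \<le> q * energy_norm (A q') (acc \<tau> (L - 1) q')"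
        unfolding q_def by (rule energy_norm_compare[OF y Sg[OF q'] ac])
      also have "energy_norm (A q') (acc \<tau> (L - 1) q') \<le> E + 1"
      proof -
        obtain L' where L': "L - 1 = Suc L'" using False by (metis One_nat_def Suc_diff_Suc not_le)
        have cc: "c q' \<in> carrier_vec n" by (rule c_carrier[OF Sg[OF q']])
        have dd: "c q' - acc \<tau> (L - 1) q' \<in> carrier_vec n" using cc ac by simp
        have "acc \<tau> (L - 1) q' = c q' - (c q' - acc \<tau> (L - 1) q')" using cc ac by (intro eq_vecI) auto
        then have "energy_norm (A q') (acc \<tau> (L - 1) q') \<le> energy_norm (A q') (c q') + energy_norm (A q') (c q' - acc \<tau> (L - 1) q')"
          using energy_norm_diff_le[OF Sg[OF q'] cc dd] by simp
        also have "\<dots> \<le> E + \<tau>"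
          unfolding L' using acc_error[OF K \<tau>(1) Sg[OF q'], of L'] E[OF Sg[OF q']] by (intro add_mono)
        finally show ?thesis using \<tau>(2) by simp
      qed
      finally have "energy_norm (A y) (acc \<tau> (L - 1) q') \<le> q * (E + 1)"
        using q by (simp add: mult_left_mono)
      then have "l2 M (wt y (G (acc \<tau> (L - 1) q'))) \<le> q * (E + 1)" unfolding energy_norm_eq[OF y ac] .
      then show "l2 M (\<lambda>x. sparse_basis (L - 1) q' y *\<^sub>R wt y (G (acc \<tau> (L - 1) q')) x) \<le> (4 * real L) ^ CARD('n) * (q * (E + 1))"
        unfolding l2_scaleR by (intro mult_mono sb) (auto simp: l2_nonneg)
    qed
    also have "\<dots> = ?B * (q * (E + 1))" by simp
    finally have "energy_norm (A y) s \<le> ?B * (q * (E + 1))" .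
    then have "energy_norm (A y) (c y - s) \<le> E + ?B * (q * (E + 1))"
      using energy_norm_diff_le[OF y c_carrier[OF y] s] E[OF y] by linarith
    also have "\<dots> \<le> (E + 1) * ((1 + q) * 1) + (E + 1) * ((1 + q) * ?B)"
    proof (rule add_mono)
      have "E * 1 \<le> (E + 1) * (1 + q)" using q E0 by (intro mult_mono) auto
      then show "E \<le> (E + 1) * ((1 + q) * 1)" by simp
      have "?B * ((E + 1) * q) \<le> ?B * ((E + 1) * (1 + q))" using E0 B0 by (intro mult_left_mono) auto
      then show "?B * (q * (E + 1)) \<le> (E + 1) * ((1 + q) * ?B)" by (simp only: mult_ac)
    qed
    also have "\<dots> = (1 + q) * (E + 1) * (1 + ?B)" by (simp add: algebra_simps)
    finally show ?thesis by (simp add: s_def E_def q_def)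
  qed
qed

lemma card_grid_mono: "L \<le> L' \<Longrightarrow> card (sparse_grid L :: (real^'n) set) \<le> card (sparse_grid L' :: (real^'n) set)"
proof (induction L' rule: dec_induct)
  case (step k)
  then show ?case using card_mono[OF finite_sparse_grid sparse_grid_nested[of k, where 'n = 'n]] by simp
qed simp

text \<open>The number of new points, summed over all levels, is the size of the final grid, and all
  points share one bound of the iteration count.\<close>

lemma acc_iterations_le:
  assumes K: "\<And>y. y \<in> Gam \<Longrightarrow> cond_number (A y) \<le> K" "1 < K" and \<tau>: "0 < \<tau>" "\<tau> \<le> 1"
    and U: "\<And>y. y \<in> Gam \<Longrightarrow> H10_norm D (u y) \<le> U" "0 \<le> U" and L: "1 \<le> L"
  shows "real (acc_iterations A b n \<tau> L) \<le> real (card (sparse_grid L :: (real^'n) set)) *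
    (ln (2 * ((1 + sqrt (amax / amin)) * (sqrt amax * U + 1) *
      (1 + real (card (sparse_grid L :: (real^'n) set)) * (4 * real L) ^ CARD('n))) / \<tau>)
      / ln ((sqrt K + 1) / (sqrt K - 1)) + 1)"
proof -
  define E where "E = (1 + sqrt (amax / amin)) * (sqrt amax * U + 1) *
      (1 + real (card (sparse_grid L :: (real^'n) set)) * (4 * real L) ^ CARD('n))"
  define k where "k = ln (2 * E / \<tau>) / ln ((sqrt K + 1) / (sqrt K - 1)) + 1"
  have c0: "1 \<le> (1 + sqrt (amax / amin)) * (sqrt amax * U + 1)"
    using amin U(2) mult_mono[of 1 "1 + sqrt (amax / amin)" 1 "sqrt amax * U + 1"] by simp
  have E1: "1 \<le> E"
    unfolding E_def using mult_mono[OF c0, of 1 "1 + real (card (sparse_grid L :: (real^'n) set)) * (4 * real L) ^ CARD('n)"] c0 by simp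
  have cnt: "real (cg_count (A y) (b y) (start_vec n l (acc \<tau> (l - 1)) y) \<tau>) \<le> k"
    if l: "1 \<le> l" "l \<le> L" and y: "y \<in> Gam" for l y
    unfolding k_def
  proof (rule spd.cg_count_bounds(2)[OF spd.intro[OF spd_A[OF y]] n_pos K(1)[OF y] K(2) b_carrier start_carrier \<tau>(1)])
    have "energy_norm (A y) (c y - start_vec n l (acc \<tau> (l - 1)) y)
      \<le> (1 + sqrt (amax / amin)) * (sqrt amax * U + 1) *
        (1 + real (card (sparse_grid (l - 1) :: (real^'n) set)) * (4 * real l) ^ CARD('n))"
      by (rule start_error[OF K \<tau> U(1) y l(1)])
    also have "\<dots> \<le> E"
      unfolding E_def using c0 l card_grid_mono[of "l - 1" L]
      by (intro mult_left_mono add_left_mono mult_mono power_mono) auto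
    finally show "energy_norm (A y) (c y - start_vec n l (acc \<tau> (l - 1)) y) \<le> E" .
    show "\<tau> \<le> 2 * E" using E1 \<tau>(2) by simp
  qed
  have np: "(new_points l :: (real^'n) set) \<subseteq> Gam" for l
    using sparse_grid_subset_Gam by (auto simp: new_points_def)
  have "real (acc_iterations A b n \<tau> L)
      = (\<Sum>l = 1..L. \<Sum>y\<in>new_points l. real (cg_count (A y) (b y) (start_vec n l (acc \<tau> (l - 1)) y) \<tau>))"
    by (simp add: acc_iterations_def)
  also have "\<dots> \<le> (\<Sum>l = 1..L. \<Sum>y\<in>(new_points l :: (real^'n) set). k)"
    by (intro sum_mono cnt) (use np in auto)
  also have "\<dots> = real (\<Sum>l = 1..L. card (new_points l :: (real^'n) set)) * k" by (simp add: sum_distrib_right)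
  also have "(\<Sum>l = 1..L. card (new_points l :: (real^'n) set)) = card (sparse_grid L :: (real^'n) set)"
    using sum_card_new_points[of "L - 1", where 'n = 'n] L by simp
  finally show ?thesis unfolding k_def E_def .
qed

text \<open>If the exact solution vanishes, then so do all load vectors, and the zero vector, from which
  every run then starts, is already the solution.\<close>

lemma acc_iterations_zero:
  assumes z: "\<And>y. y \<in> Gam \<Longrightarrow> H10_norm D (u y) = 0" and \<tau>: "0 < \<tau>"
  shows "acc_iterations A b n \<tau> L = 0"
proof -
  have c0: "c y = 0\<^sub>v n" if y: "y \<in> Gam" for y
    by (rule spd.lin_sol_eqI[OF spd.intro[OF spd_A[OF y]]])
      (simp_all add: b_zero[OF y z[OF y]] spd.A_zero[OF spd.intro[OF spd_A[OF y]]])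
  have cg0: "cg_count (A y) (b y) (0\<^sub>v n) \<tau> = 0" if y: "y \<in> Gam" for y
  proof -
    have "cg_iterate (A y) (b y) (0\<^sub>v n) 0 = 0\<^sub>v n" by (simp add: cg_iterate_def Let_def)
    then have "energy_norm (A y) (c y - cg_iterate (A y) (b y) (0\<^sub>v n) 0) \<le> \<tau>"
      using \<tau> spd.A_zero[OF spd.intro[OF spd_A[OF y]]] by (simp add: c0[OF y] energy_norm_def)
    then show ?thesis unfolding cg_count_def by (intro Least_eq_0)
  qed
  have st0: "start_vec n l v y = 0\<^sub>v n" if "\<And>q. q \<in> Gam \<Longrightarrow> v q = 0\<^sub>v n" for l v and y :: "real^'n"
  proof -
    have "vec_index (v q) i = 0" if "q \<in> sparse_grid (l - 1)" "i < n" for q i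
      using that sparse_grid_subset_Gam \<open>\<And>q. q \<in> Gam \<Longrightarrow> v q = 0\<^sub>v n\<close> by (metis index_zero_vec(1) subsetD)
    then show ?thesis unfolding start_vec_def by (auto intro!: eq_vecI)
  qed
  have acc0: "acc \<tau> l y = 0\<^sub>v n" if "y \<in> Gam" for l y
    using that
  proof (induction l arbitrary: y)
    case (Suc l)
    have "start_vec n (Suc l) (acc \<tau> l) y = 0\<^sub>v n" by (rule st0) (rule Suc.IH)
    then show ?case using Suc cg0[OF Suc.prems] by (simp add: Let_def cg_iterate_def)
  qed simp
  have "cg_count (A y) (b y) (start_vec n l (acc \<tau> (l - 1)) y) \<tau> = 0" if "y \<in> new_points l" for y l
  proof -
    have y: "y \<in> Gam" using that sparse_grid_subset_Gam by (auto simp: new_points_def split: if_splits)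
    have "start_vec n l (acc \<tau> (l - 1)) y = 0\<^sub>v n" by (rule st0) (rule acc0)
    then show ?thesis using cg0[OF y] by simp
  qed
  then show ?thesis by (simp add: acc_iterations_def)
qed

lemma cond_ge_1: "y \<in> Gam \<Longrightarrow> 1 \<le> cond_number (A y)"
  by (rule spd.cond_number_ge_1[OF spd.intro[OF spd_A] n_pos])

end

section \<open>Comparison of constants\<close>

text \<open>An elementary form of Stirling's bound, by induction with \<open>(1 + 1 / N)\<^sup>N \<le> e\<close>.\<close>

lemma power_self_le_exp_fact: "1 \<le> N \<Longrightarrow> real N ^ N \<le> exp 1 ^ (N - 1) * fact N"
proof (induction N rule: dec_induct)
  case base
  show ?case by simp
next
  case (step N)
  have N: "0 < real N" using step by simp
  have "real (Suc N) ^ Suc N = real (Suc N) * ((1 + 1 / real N) ^ N * real N ^ N)"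
  proof -
    have "real (Suc N) = (1 + 1 / real N) * real N" using N by (simp add: field_simps)
    then have "real (Suc N) ^ N = (1 + 1 / real N) ^ N * real N ^ N" by (metis power_mult_distrib)
    then show ?thesis by simp
  qed
  also have "\<dots> \<le> real (Suc N) * (exp 1 * (exp 1 ^ (N - 1) * fact N))"
    using step exp_ge_one_plus_x_over_n_power_n[of N 1]
    by (intro mult_left_mono mult_mono) auto
  also have "\<dots> = exp 1 ^ (Suc N - 1) * fact (Suc N)"
    using step power_Suc[of "exp 1 :: real" "N - 1"] by (simp add: mult_ac)
  finally show ?case .
qed

lemma root_two_gt: "1 \<le> N \<Longrightarrow> ln 2 / real N < 2 powr (1 / real N) - 1"
proof -
  assume N: "1 \<le> N"
  define x where "x = ln 2 / real N"
  have x: "0 < x" using N by (simp add: x_def)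
  have "1 + x + x\<^sup>2 / 2 \<le> exp x" using x by (intro exp_lower_Taylor_quadratic) simp
  moreover have "exp x = 2 powr (1 / real N)" by (simp add: powr_def x_def)
  moreover have "0 < x\<^sup>2 / 2" using x by simp
  ultimately show ?thesis unfolding x_def by linarith
qed

text \<open>On the left is the leading constant of the number of iterations as it is estimated here, on
  the right that of the bound to be proved. After replacing \<open>2 powr (1 / N) - 1\<close> by \<open>ln 2 / N\<close> the
  inequality reduces to \<open>N ^ N \<le> e ^ (N - 1) * fact N\<close>, \<open>2 * N \<le> 2 ^ N\<close> and \<open>ln 2 \<le> 1\<close>. That it is
  strict makes room for all lower order terms.\<close>

lemma grid_constant_less:
  assumes N: "2 \<le> N"
  shows "4 / fact (N - 1) < 2 ^ N * (exp 1 / (real N * ln 2)) ^ (N - 1) * (2 * (2 powr (1 / real N) - 1))"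
proof -
  have ln2: "0 < ln (2::real)" "ln (2::real) \<le> 1" using ln_2_less_1 by auto
  define k where "k = N - 2"
  have k: "N = Suc (Suc k)" using N by (simp add: k_def)
  have pos: "0 < 2 ^ N * (exp 1 / (real N * ln 2)) ^ (N - 1)"
  proof -
    have "0 < exp 1 / (real N * ln 2)" using N by (simp add: ln2(1))
    then show ?thesis by simp
  qed
  have f: "fact N = real N * fact (N - 1)" using N fact_reduce[of N] by simp
  have e0: "0 < (exp 1 :: real) ^ (N - 1)" by simp
  have NN: "real N ^ N \<le> exp 1 ^ (N - 1) * (real N * fact (N - 1))"
    using power_self_le_exp_fact[of N] N f by simp
  have pw: "2 * real N \<le> 2 ^ N"
  proof -
    have "2 * m \<le> (2::nat) ^ m" if "2 \<le> m" for m using that by (induction m rule: dec_induct) auto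
    from this[OF N] have "real (2 * N) \<le> real (2 ^ N)" by (simp only: of_nat_le_iff)
    then show ?thesis by simp
  qed
  have lnk: "ln (2::real) ^ k \<le> 1" using ln2 by (intro power_le_one) auto
  have "4 / fact (N - 1) \<le> 2 ^ N * (exp 1 / (real N * ln 2)) ^ (N - 1) * (2 * (ln 2 / real N))"
  proof -
    have "4 * (real N ^ N * ln 2 ^ k) \<le> 4 * ((exp 1 ^ (N - 1) * (real N * fact (N - 1))) * 1)"
      using NN lnk ln2 by (intro mult_left_mono mult_mono) auto
    also have "\<dots> = 2 * (2 * real N) * (exp 1 ^ (N - 1) * fact (N - 1))" by simp
    also have "\<dots> \<le> 2 * 2 ^ N * (exp 1 ^ (N - 1) * fact (N - 1))"
      using pw by (intro mult_right_mono mult_left_mono) auto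
    finally have *: "4 * (real N ^ N * ln 2 ^ k) \<le> 2 * 2 ^ N * (exp 1 ^ (N - 1) * fact (N - 1))" .
    have "2 ^ N * (exp 1 / (real N * ln 2)) ^ (N - 1) * (2 * (ln 2 / real N)) = 2 * 2 ^ N * exp 1 ^ (N - 1) / (real N ^ N * ln 2 ^ k)"
    proof -
      have "(exp 1 / (real N * ln 2)) ^ (N - 1) = exp 1 ^ (N - 1) / (real N ^ (N - 1) * ln 2 ^ (N - 1))"
        by (simp only: power_divide power_mult_distrib)
      moreover have "real N ^ N = real N * real N ^ (N - 1)" "ln (2::real) ^ (N - 1) = ln 2 * ln 2 ^ k"
        unfolding k by simp_all
      moreover have "real N \<noteq> 0" "ln (2::real) \<noteq> 0" using N ln2 by auto
      ultimately show ?thesis by (simp add: divide_simps)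
    qed
    moreover have "4 / fact (N - 1) \<le> 2 * 2 ^ N * exp 1 ^ (N - 1) / (real N ^ N * ln 2 ^ k)"
    proof -
      have "0 < real N ^ N * ln (2::real) ^ k" using N ln2(1) by simp
      moreover have "(0::real) < fact (N - 1)" by simp
      ultimately show ?thesis using * by (simp add: frac_le_eq divide_le_eq le_divide_eq mult_ac)
    qed
    ultimately show ?thesis by simp
  qed
  also have "\<dots> < 2 ^ N * (exp 1 / (real N * ln 2)) ^ (N - 1) * (2 * (2 powr (1 / real N) - 1))"
    using root_two_gt[of N] N pos by (intro mult_strict_left_mono) auto
  finally show ?thesis .
qed

lemma ln_affine_little:
  assumes "(\<epsilon>::real) > 0" shows "\<forall>\<^sub>F X in at_top. p * ln X + q \<le> \<epsilon> * X"
proof -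
  have "((\<lambda>X::real. p * (ln X / X) + q / X) \<longlongrightarrow> p * 0 + 0) at_top"
    by (intro tendsto_intros lim_ln_over_n ln_x_over_x_tendsto_0 tendsto_divide_0[OF tendsto_const] filterlim_at_top_imp_at_infinity filterlim_ident)
  then have "\<forall>\<^sub>F X in at_top. p * (ln X / X) + q / X < \<epsilon>"
    using assms by (intro order_tendstoD) auto
  then show ?thesis using eventually_gt_at_top[of "0::real"]
    by eventually_elim (simp add: field_simps)
qed

text \<open>The logarithm in the iteration count is \<open>ln (3 Csc / \<epsilon>)\<close> up to a term linear in \<open>L\<close>: all
  other factors, namely the grid size, the bound of the basis functions and the denominator of the
  tolerance, are at most exponential in \<open>L\<close>.\<close>

lemma log_error_bound:
  fixes N :: nat and c0 \<beta> Csc :: real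
  assumes pos: "0 < c0" "0 < \<beta>" "0 < Csc"
  shows "\<exists>c2\<ge>0. \<forall>L g \<epsilon>. g \<le> 2 ^ Suc L * ((L + N - 1) choose (N - 1)) \<longrightarrow> 0 < \<epsilon> \<longrightarrow>
    ln (2 * (c0 * (1 + real g * (4 * real L) ^ N)) / (sqrt \<beta> * \<epsilon> / (3 * (real L + 2) ^ (2 * N))))
      \<le> ln (3 * Csc / \<epsilon>) + c2 * (real L + 1)"
proof -
  define K0 where "K0 = 2 * c0 / (sqrt \<beta> * Csc)"
  have K0: "0 < K0" using pos by (simp add: K0_def)
  show ?thesis
  proof (intro exI[of _ "\<bar>ln K0\<bar> + real (3 + 7 * N)"] conjI allI impI)
    fix L g :: nat and \<epsilon> :: real
    assume g: "g \<le> 2 ^ Suc L * ((L + N - 1) choose (N - 1))" and \<epsilon>: "0 < \<epsilon>"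
    have "g \<le> 2 ^ Suc L * 2 ^ (L + N - 1)" using g binomial_le_pow2[of "L + N - 1" "N - 1"]
      by (meson le_trans mult_le_mono2)
    also have "\<dots> \<le> 2 ^ Suc L * 2 ^ (L + N)" by (intro mult_left_mono power_increasing) auto
    also have "\<dots> = 2 ^ (2 * L + N + 1)" unfolding power_add[symmetric] by (rule arg_cong[where f = "\<lambda>k. 2 ^ k"]) simp
    finally have g2: "real g \<le> 2 ^ (2 * L + N + 1)"
      by (metis of_nat_le_iff of_nat_numeral of_nat_power)
    have LL: "real L \<le> 2 ^ L" using less_exp[of L] by (metis less_imp_le of_nat_le_iff of_nat_numeral of_nat_power)
    have l4: "(4 * real L) ^ N \<le> (2 ^ (L + 2)) ^ N" using LL by (intro power_mono) (auto simp: power_add)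
    have "(1::real) \<le> 2 ^ L" "2 ^ (L + 2) = 4 * (2::real) ^ L" by (simp_all add: power_add)
    then have "real L + 2 \<le> 2 ^ (L + 2)" using LL by linarith
    then have l2: "(real L + 2) ^ (2 * N) \<le> (2 ^ (L + 2)) ^ (2 * N)" by (intro power_mono) auto
    have "1 * 1 \<le> (2::real) ^ (2 * L + N + 1) * (2 ^ (L + 2)) ^ N" by (intro mult_mono one_le_power) auto
    then have one: "1 \<le> (2::real) ^ (2 * L + N + 1) * (2 ^ (L + 2)) ^ N" by (simp only: mult_1_right)
    have "real g * (4 * real L) ^ N \<le> 2 ^ (2 * L + N + 1) * (2 ^ (L + 2)) ^ N"
      by (intro mult_mono g2 l4) auto
    then have "1 + real g * (4 * real L) ^ N \<le> 2 * (2 ^ (2 * L + N + 1) * (2 ^ (L + 2)) ^ N)" using one by linarith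
    then have "(1 + real g * (4 * real L) ^ N) * (real L + 2) ^ (2 * N)
        \<le> (2 * (2 ^ (2 * L + N + 1) * (2 ^ (L + 2)) ^ N)) * (2 ^ (L + 2)) ^ (2 * N)"
      by (intro mult_mono l2) auto
    also have "\<dots> = 2 ^ (1 + ((2 * L + N + 1) + (L + 2) * N) + (L + 2) * (2 * N))"
      by (simp only: power_add power_mult power_one_right)
    also have "\<dots> \<le> 2 ^ ((3 + 7 * N) * (L + 1))" by (intro power_increasing) (auto simp: algebra_simps)
    finally have P: "(1 + real g * (4 * real L) ^ N) * (real L + 2) ^ (2 * N) \<le> 2 ^ ((3 + 7 * N) * (L + 1))" .
    have "2 * (c0 * (1 + real g * (4 * real L) ^ N)) / (sqrt \<beta> * \<epsilon> / (3 * (real L + 2) ^ (2 * N)))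
        = K0 * (3 * Csc / \<epsilon>) * ((1 + real g * (4 * real L) ^ N) * (real L + 2) ^ (2 * N))"
      using pos \<epsilon> by (simp add: K0_def field_simps)
    also have "\<dots> \<le> K0 * (3 * Csc / \<epsilon>) * 2 ^ ((3 + 7 * N) * (L + 1))"
      using P K0 pos \<epsilon> by (intro mult_left_mono) auto
    finally have le: "2 * (c0 * (1 + real g * (4 * real L) ^ N)) / (sqrt \<beta> * \<epsilon> / (3 * (real L + 2) ^ (2 * N)))
        \<le> K0 * (3 * Csc / \<epsilon>) * 2 ^ ((3 + 7 * N) * (L + 1))" .
    have p1: "0 < 1 + real g * (4 * real L) ^ N" by (intro add_pos_nonneg mult_nonneg_nonneg) auto
    have lhs: "0 < 2 * (c0 * (1 + real g * (4 * real L) ^ N)) / (sqrt \<beta> * \<epsilon> / (3 * (real L + 2) ^ (2 * N)))"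
      using pos \<epsilon> p1 by (intro divide_pos_pos mult_pos_pos) auto
    have "ln (2 * (c0 * (1 + real g * (4 * real L) ^ N)) / (sqrt \<beta> * \<epsilon> / (3 * (real L + 2) ^ (2 * N))))
        \<le> ln (K0 * (3 * Csc / \<epsilon>) * 2 ^ ((3 + 7 * N) * (L + 1)))" by (rule ln_mono[OF le lhs])
    also have "\<dots> = ln K0 + ln (3 * Csc / \<epsilon>) + ln (2 ^ ((3 + 7 * N) * (L + 1)))"
    proof -
      have x: "0 < 3 * Csc / \<epsilon>" using pos \<epsilon> by simp
      have "ln (K0 * (3 * Csc / \<epsilon>) * 2 ^ ((3 + 7 * N) * (L + 1))) = ln (K0 * (3 * Csc / \<epsilon>)) + ln (2 ^ ((3 + 7 * N) * (L + 1)))"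
        by (intro ln_mult_pos mult_pos_pos K0 x) simp
      also have "ln (K0 * (3 * Csc / \<epsilon>)) = ln K0 + ln (3 * Csc / \<epsilon>)" by (intro ln_mult_pos K0 x)
      finally show ?thesis .
    qed
    also have "ln ((2::real) ^ ((3 + 7 * N) * (L + 1))) = real (3 + 7 * N) * (real L + 1) * ln 2"
      by (subst ln_realpow) (simp_all add: algebra_simps)
    also have "ln K0 + ln (3 * Csc / \<epsilon>) + real (3 + 7 * N) * (real L + 1) * ln 2
        \<le> \<bar>ln K0\<bar> * (real L + 1) + ln (3 * Csc / \<epsilon>) + real (3 + 7 * N) * (real L + 1) * 1"
    proof (intro add_mono mult_left_mono order_refl)
      have "\<bar>ln K0\<bar> * 1 \<le> \<bar>ln K0\<bar> * (real L + 1)" by (intro mult_left_mono) auto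
      then show "ln K0 \<le> \<bar>ln K0\<bar> * (real L + 1)" by linarith
      show "ln (2::real) \<le> 1" using ln_2_less_1 by simp
    qed simp
    also have "\<dots> = ln (3 * Csc / \<epsilon>) + (\<bar>ln K0\<bar> + real (3 + 7 * N)) * (real L + 1)" by (simp add: algebra_simps)
    finally show "ln (2 * (c0 * (1 + real g * (4 * real L) ^ N)) / (sqrt \<beta> * \<epsilon> / (3 * (real L + 2) ^ (2 * N))))
      \<le> ln (3 * Csc / \<epsilon>) + (\<bar>ln K0\<bar> + real (3 + 7 * N)) * (real L + 1)" .
  qed simp
qed

text \<open>\<open>X\<close> is \<open>ln (3 Csc / \<epsilon>)\<close>, and \<open>P\<close> and \<open>W\<close> are the two factors of the bound to be proved. With
  \<open>Y = X / (r N)\<close> the level before rounding is \<open>Lr = N ln Y / ln 2\<close>, so that \<open>2 powr Lr = Y ^ N\<close>,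
  and \<open>P\<close> is a constant times \<open>Y ^ N * (Lr + N) ^ (N - 1)\<close>; the rounding at most doubles \<open>2 ^ L\<close>.
  The grid size is a smaller constant times the same product, and terms of order \<open>L\<close>, which is
  logarithmic in \<open>X\<close>, fit into the difference.\<close>

lemma claimed_bound_eventually:
  fixes N :: nat and r c2 C1 C2 C5 :: real and g L :: "nat \<Rightarrow> nat"
  assumes N: "1 \<le> N" and r: "0 < r" and c2: "0 \<le> c2"
    and g1: "\<And>L. N = 1 \<Longrightarrow> 1 \<le> L \<Longrightarrow> g L \<le> 2 ^ L + 1"
    and g2: "\<And>L. g L \<le> 2 ^ Suc L * ((L + N - 1) choose (N - 1))"
    and C1: "C1 = (exp 1 / ln 2) ^ (N - 1) * (2 / (r * real N)) ^ N"
    and C2: "C2 = 1 + 1 / ln 2 * ln (1 / (r * real N))"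
  shows "\<forall>\<^sub>F X in at_top. let L = nat \<lceil>real N / ln 2 * ln (1 / (r * real N) * X)\<rceil>;
      P = C1 * X ^ N * (C2 + 1 / ln 2 * ln X) ^ (N - 1);
      W = C5 + 2 * (2 powr (1 / real N) - 1) * X + 2 * real N * ln (ln (1 / (r * real N) * X))
    in 1 \<le> L \<and> X \<le> r * real N * 2 powr (real L / real N) \<and> 0 \<le> P \<and> 0 \<le> W \<and>
       real (g L) * (X + c2 * (real L + 1) + 1) \<le> P * W"
proof -
  \<comment> \<open>the leading coefficient of \<open>W\<close> in \<open>X\<close>\<close>
  define \<theta> where "\<theta> = 2 * (2 powr (1 / real N) - 1)"
  define B0 where "B0 = 2 ^ N * (exp 1 / (real N * ln 2)) ^ (N - 1)"
  \<comment> \<open>the constant in the grid size; for \<open>N = 1\<close> it comes from \<open>2 Y + 1 \<le> 5 Y / 2\<close>\<close>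
  define A where "A = (if N = 1 then 5 / 2 else 4 / fact (N - 1) :: real)"
  have ln2: "0 < ln (2::real)" by simp
  have rN: "0 < r * real N" using r N by simp
  have A0: "0 < A" by (simp add: A_def)
  have B0: "0 < B0" using N ln2 unfolding B0_def by (intro mult_pos_pos zero_less_power divide_pos_pos) auto
  have "0 < ln 2 / real N" using N ln2 by simp
  then have \<theta>: "0 < \<theta>" using root_two_gt[OF N] by (simp add: \<theta>_def)
  have gap: "A < B0 * \<theta>"
  proof (cases "N = 1")
    case False
    then show ?thesis using grid_constant_less[of N] N by (simp add: A_def B0_def \<theta>_def)
  qed (simp add: A_def B0_def \<theta>_def)
  define p where "p = A * c2 * (real N / ln 2)"
  define q where "q = A * (c2 * (real N / ln 2 * ln (1 / (r * real N)) + 2) + 1) - B0 * C5"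
  have ev1: "\<forall>\<^sub>F X in at_top. p * ln X + q \<le> (B0 * \<theta> - A) * X" using gap by (intro ln_affine_little) simp
  have ev2: "\<forall>\<^sub>F X in at_top. 0 * ln X + (- C5) \<le> \<theta> * X" using \<theta> by (rule ln_affine_little)
  show ?thesis
    using ev1 ev2 eventually_ge_at_top[of "r * real N * exp 1"] eventually_ge_at_top[of "r * real N * 2"]
  proof eventually_elim
    case (elim X)
    define Y where "Y = 1 / (r * real N) * X"
    define Lr where "Lr = real N / ln 2 * ln Y"
    define L where "L = nat \<lceil>Lr\<rceil>"
    define P where "P = C1 * X ^ N * (C2 + 1 / ln 2 * ln X) ^ (N - 1)"
    define W where "W = C5 + 2 * (2 powr (1 / real N) - 1) * X + 2 * real N * ln (ln Y)"
    define Q where "Q = Y ^ N * (Lr + real N) ^ (N - 1)"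
    have X0: "0 < X" using elim(3) rN by (meson exp_gt_zero less_le_trans mult_pos_pos)
    have Y: "exp 1 \<le> Y" "2 \<le> Y" "0 < Y" using elim(3,4) rN X0 by (auto simp: Y_def field_simps)
    have lnY: "1 \<le> ln Y" using Y by (metis ln_exp ln_mono exp_gt_zero)
    have lnY2: "ln Y = ln (1 / (r * real N)) + ln X" unfolding Y_def using rN X0 by (intro ln_mult_pos) auto
    have Lr0: "0 < Lr" using N ln2 lnY by (simp add: Lr_def)
    have L1: "1 \<le> L" using Lr0 by (simp add: L_def) linarith
    have LrL: "Lr \<le> real L" unfolding L_def by (rule real_nat_ceiling_ge)
    have LLr: "real L < Lr + 1" using Lr0 unfolding L_def by linarith
    have powLr: "2 powr Lr = Y ^ N"
    proof -
      have "2 powr Lr = exp (real N * ln Y)" using ln2 by (simp add: powr_def Lr_def)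
      also have "\<dots> = Y ^ N" using Y(3) by (simp add: exp_of_nat_mult)
      finally show ?thesis .
    qed
    have X_le: "X \<le> r * real N * 2 powr (real L / real N)"
    proof -
      have "Y = 2 powr (Lr / real N)" using N ln2 Y(3) by (simp add: powr_def Lr_def)
      also have "\<dots> \<le> 2 powr (real L / real N)" using LrL N by (intro powr_mono divide_right_mono) auto
      finally have "r * real N * Y \<le> r * real N * 2 powr (real L / real N)" using rN by (intro mult_left_mono) auto
      moreover have "r * real N * Y = X" unfolding Y_def using rN by (metis mult.assoc mult_1 nonzero_eq_divide_eq times_divide_eq_right mult.commute less_irrefl)
      ultimately show ?thesis by simp
    qed
    have pow2L: "2 ^ L \<le> 2 * Y ^ N"
    proof -
      have "(2::real) ^ L = 2 powr real L" by (simp add: powr_realpow)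
      also have "\<dots> \<le> 2 powr (Lr + 1)" using LLr by (intro powr_mono) auto
      also have "\<dots> = 2 * Y ^ N" by (simp add: powr_add powLr)
      finally show ?thesis .
    qed
    have Q0: "0 < Q" using Y Lr0 unfolding Q_def by (intro mult_pos_pos zero_less_power) auto
    have PQ: "P = B0 * Q"
    proof -
      have e0: "C2 + 1 / ln 2 * ln X = (Lr + real N) / real N"
        using N ln2 unfolding C2 Lr_def lnY2 by (simp add: field_simps)
      have e1: "(2 / (r * real N)) ^ N * X ^ N = 2 ^ N * Y ^ N"
        unfolding Y_def power_mult_distrib[symmetric] by simp
      have e2: "(exp 1 / ln 2) ^ (N - 1) * ((Lr + real N) / real N) ^ (N - 1) = (exp 1 / (real N * ln 2)) ^ (N - 1) * (Lr + real N) ^ (N - 1)"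
        unfolding power_mult_distrib[symmetric] by (simp add: mult_ac)
      have "P = ((exp 1 / ln 2) ^ (N - 1) * ((Lr + real N) / real N) ^ (N - 1)) * ((2 / (r * real N)) ^ N * X ^ N)"
        unfolding P_def C1 e0 by (simp only: mult_ac)
      also have "\<dots> = B0 * Q" unfolding e1 e2 B0_def Q_def by (simp only: mult_ac)
      finally show ?thesis .
    qed
    have card: "real (g L) \<le> A * Q"
    proof (cases "N = 1")
      case True
      have "real (g L) \<le> real (2 ^ L + 1)" using g1[OF True L1] of_nat_le_iff by blast
      also have "\<dots> \<le> 2 * Y + 1" using pow2L True by simp
      also have "\<dots> \<le> 5 / 2 * Y" using Y(2) by simp
      finally show ?thesis using True by (simp add: A_def Q_def)
    next
      case False
      define m where "m = L + N - 1"
      have mr: "real m \<le> Lr + real N" using LLr N by (simp add: m_def of_nat_diff)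
      have "(m choose (N - 1)) * fact (N - 1) \<le> m ^ (N - 1)" by (rule binomial_fact_pow)
      then have "real (m choose (N - 1)) * fact (N - 1) \<le> real m ^ (N - 1)"
        by (metis of_nat_fact of_nat_le_iff of_nat_mult of_nat_power)
      also have "\<dots> \<le> (Lr + real N) ^ (N - 1)" using mr by (intro power_mono) auto
      finally have ch: "real (m choose (N - 1)) \<le> (Lr + real N) ^ (N - 1) / fact (N - 1)" by (simp add: field_simps)
      have "real (g L) \<le> real (2 ^ Suc L * (m choose (N - 1)))" using g2[of L] unfolding m_def of_nat_le_iff .
      also have "\<dots> = 2 * 2 ^ L * real (m choose (N - 1))" by simp
      also have "\<dots> \<le> 2 * (2 * Y ^ N) * ((Lr + real N) ^ (N - 1) / fact (N - 1))"
        using pow2L Y(3) by (intro mult_mono mult_left_mono ch) auto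
      finally show ?thesis using False by (simp add: A_def Q_def)
    qed
    have W_ge: "\<theta> * X + C5 \<le> W" using lnY N by (simp add: W_def \<theta>_def)
    have W0: "0 \<le> W" using W_ge elim(2) by simp
    have key: "A * (X + c2 * (real L + 1) + 1) \<le> B0 * (\<theta> * X + C5)"
    proof -
      have "A * (X + c2 * (real L + 1) + 1) \<le> A * (X + c2 * (Lr + 2) + 1)"
      proof -
        have "real L + 1 \<le> Lr + 2" using LLr by simp
        then have "c2 * (real L + 1) \<le> c2 * (Lr + 2)" using c2 by (rule mult_left_mono)
        then show ?thesis using A0 by (intro mult_left_mono) auto
      qed
      also have "\<dots> = A * X + (p * ln X + q) + B0 * C5"
        unfolding p_def q_def Lr_def lnY2 by (simp add: algebra_simps)
      also have "\<dots> \<le> A * X + (B0 * \<theta> - A) * X + B0 * C5" using elim(1) by simp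
      also have "\<dots> = B0 * (\<theta> * X + C5)" by (simp add: algebra_simps)
      finally show ?thesis .
    qed
    have f0: "0 \<le> X + c2 * (real L + 1) + 1" using X0 c2 by simp
    have "real (g L) * (X + c2 * (real L + 1) + 1) \<le> A * Q * (X + c2 * (real L + 1) + 1)"
      by (rule mult_right_mono[OF card f0])
    also have "\<dots> = Q * (A * (X + c2 * (real L + 1) + 1))" by (simp only: mult_ac)
    also have "\<dots> \<le> Q * (B0 * (\<theta> * X + C5))" using Q0 by (intro mult_left_mono key) simp
    also have "\<dots> \<le> Q * (B0 * W)" using Q0 B0 W_ge by (intro mult_left_mono) auto
    also have "\<dots> = P * W" by (simp add: PQ)
    finally have main: "real (g L) * (X + c2 * (real L + 1) + 1) \<le> P * W" .
    have P0: "0 \<le> P" using PQ B0 Q0 by simp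
    show ?case
      unfolding Let_def using L1 X_le P0 W0 main
      unfolding L_def Lr_def Y_def P_def W_def by blast
  qed
qed

section \<open>Growth of the condition number\<close>

context diffusion
begin

text \<open>Continuity gives measurability on the parameter box and a maximum.\<close>

lemma continuous_H10_norm:
  fixes w :: "real^'n \<Rightarrow> real^'d \<Rightarrow> real"
  assumes w: "\<And>y. y \<in> Gam \<Longrightarrow> w y \<in> S1"
    and lim: "\<And>y. y \<in> Gam \<Longrightarrow> ((\<lambda>y'. H10_norm D (\<lambda>x. w y' x - w y x)) \<longlongrightarrow> 0) (at y within Gam)"
  shows "continuous_on Gam (\<lambda>y. H10_norm D (w y))"
  unfolding continuous_on_def
proof
  fix y :: "real^'n" assume y: "y \<in> Gam"
  have "((\<lambda>y'. H10_norm D (w y') - H10_norm D (w y)) \<longlongrightarrow> 0) (at y within Gam)"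
  proof (rule Lim_null_comparison[OF _ lim[OF y]])
    show "\<forall>\<^sub>F y' in at y within Gam. norm (H10_norm D (w y') - H10_norm D (w y)) \<le> H10_norm D (\<lambda>x. w y' x - w y x)"
      using H10_norm_triangle_diff[OF w w[OF y]] by (auto simp: eventually_at_filter)
  qed
  then show "((\<lambda>y. H10_norm D (w y)) \<longlongrightarrow> H10_norm D (w y)) (at y within Gam)" by (rule LIM_zero_cancel)
qed

text \<open>Suppose the condition numbers stayed below \<open>B\<close> along mesh sizes tending to zero. Then the
  Galerkin solutions would tend to zero at every parameter, while they converge to \<open>u\<close> in \<open>L\<^sup>2\<^sub>\<rho>\<close>;
  by Fatou's lemma \<open>u\<close> would vanish almost everywhere for the given probability measure. But the
  zero set of \<open>u\<close> is Lebesgue negligible by analyticity, and a probability measure with a density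
  cannot be carried by it.\<close>

lemma cond_unbounded:
  fixes rho :: "'n \<Rightarrow> real \<Rightarrow> real" and Mf :: "real \<Rightarrow> nat" and phi :: "real \<Rightarrow> nat \<Rightarrow> real^'d \<Rightarrow> real"
  assumes fe: "\<And>t. 0 < t \<Longrightarrow> t \<le> h0 \<Longrightarrow> fe_basis D \<sigma> p nloc t (Mf t) (phi t)" and h0: "0 < h0"
    and rho: "bounded_probability_density rho"
    and Cfem: "0 < Cfem" "1 \<le> s" "\<And>t. 0 < t \<Longrightarrow> t \<le> h0 \<Longrightarrow>
          (\<integral>\<^sup>+ y. ennreal ((H10_norm D (\<lambda>x. u y x - galerkin D a f (Mf t) (phi t) y x))\<^sup>2) \<partial>rho_measure rho)
            \<le> ennreal ((Cfem * t ^ s)\<^sup>2)"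
    and gam: "\<And>n. 1 < gam n" and u_an: "has_analytic_extension D gam u"
    and uh_an: "\<And>t. 0 < t \<Longrightarrow> t \<le> h0 \<Longrightarrow> has_analytic_extension D gam (galerkin D a f (Mf t) (phi t))"
    and y1: "y1 \<in> Gam" "H10_norm D (u y1) \<noteq> 0"
  shows "\<exists>t1>0. \<forall>t. 0 < t \<longrightarrow> t \<le> t1 \<longrightarrow> B < (SUP y\<in>Gam. cond_number (stiffness D a (Mf t) (phi t) y))"
proof (rule ccontr)
  assume "\<not> ?thesis"
  then have ex: "\<exists>t. 0 < t \<and> t \<le> min h0 (1 / real (Suc k)) \<and> (SUP y\<in>Gam. cond_number (stiffness D a (Mf t) (phi t) y)) \<le> B" for k
    using h0 by (metis min_less_iff_conj not_le of_nat_0_less_iff zero_less_Suc zero_less_divide_1_iff)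
  define t where "t k = (SOME t. 0 < t \<and> t \<le> min h0 (1 / real (Suc k)) \<and> (SUP y\<in>Gam. cond_number (stiffness D a (Mf t) (phi t) y)) \<le> B)" for k
  have t: "0 < t k" "t k \<le> h0" "t k \<le> 1 / real (Suc k)" "(SUP y\<in>Gam. cond_number (stiffness D a (Mf (t k)) (phi (t k)) y)) \<le> B" for k
    using someI_ex[OF ex[of k]] unfolding t_def[symmetric] by auto
  have t0: "t \<longlonglongrightarrow> 0"
  proof (rule Lim_null_comparison[OF always_eventually])
    show "\<forall>k. norm (t k) \<le> 1 / real (Suc k)" using t(1,3) by (simp add: less_imp_le)
    show "(\<lambda>k. 1 / real (Suc k)) \<longlonglongrightarrow> 0" by (rule LIMSEQ_Suc[OF lim_1_over_n])
  qed
  define uk where "uk k = galerkin D a f (Mf (t k)) (phi (t k))" for k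
  have fes: "fe_space D a f u amin amax \<sigma> (t k) p nloc (Mf (t k)) (phi (t k))" for k
    by unfold_locales (use fe t in auto)
  have ukS: "uk k y \<in> S1" for k y unfolding uk_def by (rule fe_space.galerkin_S1[OF fes])
  have uk0: "(\<lambda>k. H10_norm D (uk k y)) \<longlonglongrightarrow> 0" if y: "y \<in> Gam" for y
  proof -
    define C where "C = 4 * real nloc * (l2 M (\<lambda>x. f x y))\<^sup>2 / amin\<^sup>2"
    have C: "0 \<le> C" by (simp add: C_def)
    have "(H10_norm D (uk k y))\<^sup>2 \<le> C * (t k)\<^sup>2 * B" for k
    proof -
      have "cond_number (stiffness D a (Mf (t k)) (phi (t k)) y) \<le> (SUP y\<in>Gam. cond_number (stiffness D a (Mf (t k)) (phi (t k)) y))"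
        by (rule cSUP_upper[OF y fe_space.cond_bdd[OF fes]])
      then have "cond_number (stiffness D a (Mf (t k)) (phi (t k)) y) \<le> B" using t(4)[of k] by linarith
      then have "C * (t k)\<^sup>2 * cond_number (stiffness D a (Mf (t k)) (phi (t k)) y) \<le> C * (t k)\<^sup>2 * B"
        using C by (intro mult_left_mono) auto
      then show ?thesis using fe_space.galerkin_norm_le_cond[OF fes y, of k] unfolding uk_def C_def by linarith
    qed
    then have "H10_norm D (uk k y) \<le> sqrt (C * (t k)\<^sup>2 * B)" for k
      by (rule real_le_rsqrt)
    moreover have "(\<lambda>k. sqrt (C * (t k)\<^sup>2 * B)) \<longlonglongrightarrow> sqrt (C * 0\<^sup>2 * B)" by (intro tendsto_intros t0)
    ultimately have le: "\<forall>k. norm (H10_norm D (uk k y)) \<le> sqrt (C * (t k)\<^sup>2 * B)"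
      and lim: "(\<lambda>k. sqrt (C * (t k)\<^sup>2 * B)) \<longlonglongrightarrow> 0" by (auto simp: H10_norm_nonneg)
    show ?thesis by (rule Lim_null_comparison[OF always_eventually[OF le] lim])
  qed
  have ucont: "continuous_on Gam (\<lambda>y. H10_norm D (u y))"
    using continuous_H10_norm[of u] u_H10 analytic_extension_zero_set(1)[OF u_an gam u_H10] by blast
  define d where "d k y = H10_norm D (\<lambda>x. u y x - uk k y x)" for k y
  have dcont: "continuous_on Gam (d k)" for k
    unfolding d_def
  proof (rule continuous_H10_norm)
    show "(\<lambda>x. u y x - uk k y x) \<in> S1" if "y \<in> Gam" for y by (intro Sob1_diff u_H10 ukS that)
    fix y :: "real^'n" assume y: "y \<in> Gam"
    have l1: "((\<lambda>y'. H10_norm D (\<lambda>x. u y' x - u y x)) \<longlongrightarrow> 0) (at y within Gam)"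
      by (rule analytic_extension_zero_set(1)[OF u_an gam u_H10 y])
    have l2: "((\<lambda>y'. H10_norm D (\<lambda>x. uk k y' x - uk k y x)) \<longlongrightarrow> 0) (at y within Gam)"
      unfolding uk_def by (rule analytic_extension_zero_set(1)[OF uh_an[OF t(1,2)] gam fe_space.galerkin_S1[OF fes] y])
    show "((\<lambda>y'. H10_norm D (\<lambda>x. u y' x - uk k y' x - (u y x - uk k y x))) \<longlongrightarrow> 0) (at y within Gam)"
    proof (rule Lim_null_comparison)
      have "norm (H10_norm D (\<lambda>x. u y' x - uk k y' x - (u y x - uk k y x)))
          \<le> H10_norm D (\<lambda>x. u y' x - u y x) + H10_norm D (\<lambda>x. uk k y' x - uk k y x)" if y': "y' \<in> Gam" for y'
      proof -
        have a: "(\<lambda>x. u y' x - u y x) \<in> S1" by (intro Sob1_diff u_H10 y y')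
        have b: "(\<lambda>x. uk k y' x - uk k y x) \<in> S1" by (intro Sob1_diff ukS)
        have b': "(\<lambda>x. uk k y x - uk k y' x) \<in> S1" by (intro Sob1_diff ukS)
        have "H10_norm D (\<lambda>x. (u y' x - u y x) + (uk k y x - uk k y' x)) \<le> H10_norm D (\<lambda>x. u y' x - u y x) + H10_norm D (\<lambda>x. uk k y x - uk k y' x)"
          by (rule H10_norm_triangle[OF a b'])
        moreover have "H10_norm D (\<lambda>x. uk k y x - uk k y' x) = H10_norm D (\<lambda>x. uk k y' x - uk k y x)"
        proof -
          have eq: "(\<lambda>x. uk k y x - uk k y' x) = (\<lambda>x. - (uk k y' x - uk k y x))" by simp
          have bl: "bounded_linear (\<lambda>z::real. - z)" by (rule bounded_linear_minus[OF bounded_linear_ident])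
          have "AE x in M. grad (\<lambda>x. - (uk k y' x - uk k y x)) x = (\<chi> j. - (grad (\<lambda>x. uk k y' x - uk k y x) x $ j))"
            by (rule grad_linear[OF bl b])
          then have "AE x in M. (norm (grad (\<lambda>x. - (uk k y' x - uk k y x)) x))\<^sup>2 = (norm (grad (\<lambda>x. uk k y' x - uk k y x) x))\<^sup>2"
            by eventually_elim (simp add: norm_vec_def)
          then show ?thesis unfolding H10_norm_eq l2_def eq
            using L2s_measurable[OF L2s_grad[OF b]] L2s_measurable[OF L2s_grad[OF Sob1_linear[OF bl b]]]
            by (intro arg_cong[where f = sqrt] integral_cong_AE) auto
        qed
        moreover have "(\<lambda>x. (u y' x - u y x) + (uk k y x - uk k y' x)) = (\<lambda>x. u y' x - uk k y' x - (u y x - uk k y x))"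
          by (simp add: algebra_simps)
        ultimately show ?thesis by (simp add: H10_norm_nonneg)
      qed
      then show "\<forall>\<^sub>F y' in at y within Gam. norm (H10_norm D (\<lambda>x. u y' x - uk k y' x - (u y x - uk k y x)))
          \<le> H10_norm D (\<lambda>x. u y' x - u y x) + H10_norm D (\<lambda>x. uk k y' x - uk k y x)"
        by (auto simp: eventually_at_filter)
      show "((\<lambda>y'. H10_norm D (\<lambda>x. u y' x - u y x) + H10_norm D (\<lambda>x. uk k y' x - uk k y x)) \<longlongrightarrow> 0) (at y within Gam)"
        using tendsto_add[OF l1 l2] by simp
    qed
  qed
  let ?R = "rho_measure rho"
  have GamL: "(Gam :: (real^'n) set) \<in> sets lebesgue" by (rule fmeasurableD[OF lmeasurable_compact[OF Gam_compact]])
  have spR: "space ?R = Gam" by (simp add: rho_measure_def space_restrict_space)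
  have jm: "(\<lambda>y. ennreal (joint_density rho y)) \<in> borel_measurable (lebesgue_on Gam)"
    using rho by (auto simp: bounded_probability_density_def)
  have dmeas: "(\<lambda>y. ennreal ((d k y)\<^sup>2)) \<in> borel_measurable ?R" for k
  proof -
    have "d k \<in> borel_measurable (lebesgue_on Gam)"
      by (rule continuous_imp_measurable_on_sets_lebesgue[OF dcont GamL])
    then show ?thesis by (simp add: rho_measure_def)
  qed
  have dlim: "(\<lambda>k. ennreal ((d k y)\<^sup>2)) \<longlonglongrightarrow> ennreal ((H10_norm D (u y))\<^sup>2)" if y: "y \<in> Gam" for y
  proof -
    have "(\<lambda>k. d k y - H10_norm D (u y)) \<longlonglongrightarrow> 0"
    proof (rule Lim_null_comparison[OF always_eventually uk0[OF y]])
      show "\<forall>k. norm (d k y - H10_norm D (u y)) \<le> H10_norm D (uk k y)"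
      proof
        fix k
        have s: "(\<lambda>x. u y x - uk k y x) \<in> S1" by (intro Sob1_diff u_H10 ukS y)
        have e: "(\<lambda>x. u y x - (u y x - uk k y x)) = uk k y" by simp
        show "norm (d k y - H10_norm D (u y)) \<le> H10_norm D (uk k y)"
          using H10_norm_triangle_diff[OF u_H10[OF y] s] unfolding e d_def by (simp add: abs_minus_commute)
      qed
    qed
    then have "(\<lambda>k. d k y) \<longlonglongrightarrow> H10_norm D (u y)" by (rule LIM_zero_cancel)
    then show ?thesis by (intro tendsto_ennrealI tendsto_power)
  qed
  have "(\<integral>\<^sup>+ y. ennreal ((H10_norm D (u y))\<^sup>2) \<partial>?R) = (\<integral>\<^sup>+ y. liminf (\<lambda>k. ennreal ((d k y)\<^sup>2)) \<partial>?R)"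
    by (intro nn_integral_cong lim_imp_Liminf[symmetric] dlim) (simp_all add: spR)
  also have "\<dots> \<le> liminf (\<lambda>k. \<integral>\<^sup>+ y. ennreal ((d k y)\<^sup>2) \<partial>?R)" by (rule nn_integral_liminf[OF dmeas])
  also have "\<dots> \<le> liminf (\<lambda>k. ennreal ((Cfem * t k ^ s)\<^sup>2))"
    by (intro Liminf_mono always_eventually allI) (use Cfem(3) t in \<open>simp add: d_def uk_def\<close>)
  also have "\<dots> = 0"
  proof (rule lim_imp_Liminf)
    have "(\<lambda>k. (Cfem * t k ^ s)\<^sup>2) \<longlonglongrightarrow> (Cfem * 0 ^ s)\<^sup>2" by (intro tendsto_intros t0)
    moreover have "(Cfem * 0 ^ s)\<^sup>2 = 0" using Cfem(2) by simp
    ultimately have "(\<lambda>k. (Cfem * t k ^ s)\<^sup>2) \<longlonglongrightarrow> 0" by (simp only:)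
    from tendsto_ennrealI[OF this] show "(\<lambda>k. ennreal ((Cfem * t k ^ s)\<^sup>2)) \<longlonglongrightarrow> 0" by (simp only: ennreal_0)
  qed simp
  finally have int0: "(\<integral>\<^sup>+ y. ennreal ((H10_norm D (u y))\<^sup>2) \<partial>?R) = 0" by simp
  have um: "(\<lambda>y. ennreal ((H10_norm D (u y))\<^sup>2)) \<in> borel_measurable ?R"
    using continuous_imp_measurable_on_sets_lebesgue[OF ucont GamL] by (simp add: rho_measure_def)
  have ae1: "AE y in ?R. H10_norm D (u y) = 0"
    using int0 unfolding nn_integral_0_iff_AE[OF um] by simp
  have "negligible {y \<in> Gam. H10_norm D (u y) = 0}"
    by (rule analytic_extension_zero_set(2)[OF u_an gam u_H10 y1])
  then have "AE y in lebesgue. y \<notin> {y \<in> Gam. H10_norm D (u y) = 0}"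
    by (intro AE_not_in) (simp add: negligible_iff_null_sets)
  then have "AE y in lebesgue_on Gam. H10_norm D (u y) \<noteq> 0"
    using GamL by (simp add: AE_restrict_space_iff)
  then have ae2: "AE y in ?R. H10_norm D (u y) \<noteq> 0"
    unfolding rho_measure_def AE_density[OF jm] by eventually_elim simp
  have "AE y in ?R. False" using ae1 ae2 by eventually_elim simp
  then have "emeasure ?R (space ?R) = 0" by (simp only: eventually_False ae_filter_eq_bot_iff)
  then show False using rho by (simp add: spR bounded_probability_density_def)
qed

end

section \<open>The iteration count\<close>

lemma cg_rate_pos:
  assumes "1 < (K::real)" shows "0 < ln ((sqrt K + 1) / (sqrt K - 1))"
proof -
  have "1 < sqrt K" using assms by simp
  then have "1 < (sqrt K + 1) / (sqrt K - 1)" by (simp add: field_simps)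
  then show ?thesis by simp
qed

text \<open>For rates up to \<open>e\<close> one additional iteration costs no more than \<open>1 / ln \<eta>\<close>, where \<open>\<eta>\<close> is the
  rate; any sufficiently large threshold for \<open>K\<close> would do.\<close>

lemma cg_rate_le_1:
  assumes "16 < (K::real)" shows "ln ((sqrt K + 1) / (sqrt K - 1)) \<le> 1"
proof -
  have s: "4 < sqrt K" using assms real_less_rsqrt[of 4 K] by simp
  define q where "q = sqrt K"
  note s = s[folded q_def]
  have "(q + 1) / (q - 1) > 0" using s by (intro divide_pos_pos; linarith)
  then have "ln ((q + 1) / (q - 1)) \<le> (q + 1) / (q - 1) - 1" by (rule ln_le_minus_one)
  also have "\<dots> = 2 / (q - 1)"
  proof -
    have "q - 1 \<noteq> 0" using s by simp
    then show ?thesis by (simp add: field_simps)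
  qed
  also have "\<dots> \<le> 1" using s by (simp add: field_simps)
  finally show ?thesis unfolding q_def .
qed

context diffusion
begin

text \<open>The admissibility of the chosen parameters and the iteration bound for them. The rounding up
  of the iteration count at each point adds one iteration, which is absorbed because the condition
  number exceeds any given number for small \<open>\<epsilon>\<close>; if \<open>u\<close> vanishes identically this may fail, but
  then no iterations are performed.\<close>

lemma accelerated_iterations_eventually_le:
  fixes rho :: "'n \<Rightarrow> real \<Rightarrow> real" and Mf :: "real \<Rightarrow> nat" and phi :: "real \<Rightarrow> nat \<Rightarrow> real^'d \<Rightarrow> real"
    and h tau kappabar :: "real \<Rightarrow> real" and Lmax :: "real \<Rightarrow> nat" and N s :: nat
    and r \<beta> Csc Cfem C1 C2 C5 :: real
  assumes N: "N = CARD('n)"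
    and fe: "\<And>t. 0 < t \<Longrightarrow> t \<le> h0 \<Longrightarrow> fe_basis D \<sigma> p nloc t (Mf t) (phi t)" and h0: "0 < h0"
    and rho: "bounded_probability_density rho"
    and Cfem: "0 < Cfem" "1 \<le> s" "\<And>t. 0 < t \<Longrightarrow> t \<le> h0 \<Longrightarrow>
          (\<integral>\<^sup>+ y. ennreal ((H10_norm D (\<lambda>x. u y x - galerkin D a f (Mf t) (phi t) y x))\<^sup>2) \<partial>rho_measure rho)
            \<le> ennreal ((Cfem * t ^ s)\<^sup>2)"
    and gam: "\<And>n. 1 < gam n" and u_an: "has_analytic_extension D gam u"
    and uh_an: "\<And>t. 0 < t \<Longrightarrow> t \<le> h0 \<Longrightarrow> has_analytic_extension D gam (galerkin D a f (Mf t) (phi t))"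
    and pos: "0 < r" "0 < \<beta>" "0 < Csc"
    and h: "\<And>\<epsilon>. h \<epsilon> = (\<epsilon> / (3 * Cfem)) powr (1 / real s)"
    and Lmax: "\<And>\<epsilon>. Lmax \<epsilon> = nat \<lceil>real N / ln 2 * ln (1 / (r * real N) * ln (3 * Csc / \<epsilon>))\<rceil>"
    and tau: "\<And>\<epsilon>. tau \<epsilon> = sqrt \<beta> * \<epsilon> / (3 * (real (Lmax \<epsilon>) + 2) ^ (2 * N))"
    and kappabar: "\<And>\<epsilon>. kappabar \<epsilon> = (SUP y\<in>Gam. cond_number (stiffness D a (Mf (h \<epsilon>)) (phi (h \<epsilon>)) y))"
    and C1: "C1 = (exp 1 / ln 2) ^ (N - 1) * (2 / (r * real N)) ^ N"
    and C2: "C2 = 1 + 1 / ln 2 * ln (1 / (r * real N))"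
  shows "\<forall>\<^sub>F \<epsilon> in at_right 0.
      0 < h \<epsilon> \<and> h \<epsilon> \<le> h0 \<and> 1 \<le> Lmax \<epsilon> \<and> 0 < tau \<epsilon> \<and> Cfem * h \<epsilon> ^ s \<le> \<epsilon> / 3 \<and>
      Csc * exp (- (r * real N * 2 powr (real (Lmax \<epsilon>) / real N))) \<le> \<epsilon> / 3 \<and>
      (real (Lmax \<epsilon>) + 2) ^ (2 * N) * (tau \<epsilon> / sqrt \<beta>) \<le> \<epsilon> / 3 \<and>
      real (acc_iterations (stiffness D a (Mf (h \<epsilon>)) (phi (h \<epsilon>))) (load_vec D f (Mf (h \<epsilon>)) (phi (h \<epsilon>)))
          (Mf (h \<epsilon>)) (tau \<epsilon>) (Lmax \<epsilon>)) \<le>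
        C1 * ln (3 * Csc / \<epsilon>) ^ N * (C2 + 1 / ln 2 * ln (ln (3 * Csc / \<epsilon>))) ^ (N - 1)
        * (1 / ln ((sqrt (kappabar \<epsilon>) + 1) / (sqrt (kappabar \<epsilon>) - 1)))
        * (C5 + 2 * (2 powr (1 / real N) - 1) * ln (3 * Csc / \<epsilon>)
           + 2 * real N * ln (ln (1 / (r * real N) * ln (3 * Csc / \<epsilon>))))"
proof -
  let ?g = "\<lambda>L. card (sparse_grid L :: (real^'n) set)"
  have N1: "1 \<le> N" unfolding N by (simp add: Suc_leI)
  obtain t1 where t1: "0 < t1" "t1 \<le> h0"
    and alt: "(\<forall>y\<in>Gam. H10_norm D (u y) = 0) \<or>
      (\<forall>t. 0 < t \<longrightarrow> t \<le> t1 \<longrightarrow> 16 < (SUP y\<in>Gam. cond_number (stiffness D a (Mf t) (phi t) y)))"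
  proof (cases "\<forall>y\<in>Gam. H10_norm D (u y) = 0")
    case True
    then show ?thesis using that[of h0] h0 by blast
  next
    case False
    then obtain y1 where y1: "y1 \<in> Gam" "H10_norm D (u y1) \<noteq> 0" by blast
    obtain t0 where t0: "0 < t0" "\<forall>t. 0 < t \<longrightarrow> t \<le> t0 \<longrightarrow> 16 < (SUP y\<in>Gam. cond_number (stiffness D a (Mf t) (phi t) y))"
      using cond_unbounded[OF fe h0 rho Cfem gam u_an uh_an y1, where B = 16] by blast
    then show ?thesis using that[of "min t0 h0"] h0 by simp
  qed
  have fes: "fe_space D a f u amin amax \<sigma> t p nloc (Mf t) (phi t)" if "0 < t" "t \<le> h0" for t
    by unfold_locales (use fe that in auto)
  have "continuous_on Gam (\<lambda>y. H10_norm D (u y))"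
    using continuous_H10_norm[of u] u_H10 analytic_extension_zero_set(1)[OF u_an gam u_H10] by blast
  moreover have "(0 :: real^'n) \<in> Gam" by (simp add: Gam_def)
  ultimately obtain ym where ym: "\<And>y. y \<in> Gam \<Longrightarrow> H10_norm D (u y) \<le> H10_norm D (u ym)"
    using continuous_attains_sup[OF Gam_compact] by (metis empty_iff)
  \<comment> \<open>compactness: all exact solutions are bounded by one constant\<close>
  define U where "U = H10_norm D (u ym)"
  have U: "\<And>y. y \<in> Gam \<Longrightarrow> H10_norm D (u y) \<le> U" "0 \<le> U" using ym by (simp_all add: U_def H10_norm_nonneg)
  define c0 where "c0 = (1 + sqrt (amax / amin)) * (sqrt amax * U + 1)"
  have c0: "0 < c0" using amin U(2) unfolding c0_def by (intro mult_pos_pos add_pos_nonneg add_nonneg_pos mult_nonneg_nonneg) auto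
  obtain c2 where c2: "0 \<le> c2" and log_le: "\<And>L g \<epsilon>. g \<le> 2 ^ Suc L * ((L + N - 1) choose (N - 1)) \<Longrightarrow> 0 < \<epsilon> \<Longrightarrow>
    ln (2 * (c0 * (1 + real g * (4 * real L) ^ N)) / (sqrt \<beta> * \<epsilon> / (3 * (real L + 2) ^ (2 * N))))
      \<le> ln (3 * Csc / \<epsilon>) + c2 * (real L + 1)"
    using log_error_bound[OF c0 pos(2,3), of N] by blast
  have g1: "?g L \<le> 2 ^ L + 1" if "N = 1" "1 \<le> L" for L
    using card_sparse_grid_1[where ?'n = 'n] that N by simp
  have g2: "?g L \<le> 2 ^ Suc L * ((L + N - 1) choose (N - 1))" for L
    unfolding N by (rule card_sparse_grid_le)
  have "filterlim (\<lambda>\<epsilon>. 3 * Csc * inverse \<epsilon>) at_top (at_right 0)"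
    using pos by (intro filterlim_tendsto_pos_mult_at_top[OF tendsto_const _ filterlim_inverse_at_top_right]) simp
  then have "filterlim (\<lambda>\<epsilon>. ln (3 * Csc / \<epsilon>)) at_top (at_right 0)"
    using filterlim_compose[OF ln_at_top] by (simp add: divide_inverse)
  from eventually_compose_filterlim[OF claimed_bound_eventually[OF N1 pos(1) c2 g1 g2 C1 C2] this, of C5]
  have evX: "\<forall>\<^sub>F \<epsilon> in at_right 0. let X = ln (3 * Csc / \<epsilon>); L = Lmax \<epsilon>;
      P = C1 * X ^ N * (C2 + 1 / ln 2 * ln X) ^ (N - 1);
      W = C5 + 2 * (2 powr (1 / real N) - 1) * X + 2 * real N * ln (ln (1 / (r * real N) * X))
    in 1 \<le> L \<and> X \<le> r * real N * 2 powr (real L / real N) \<and> 0 \<le> P \<and> 0 \<le> W \<and>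
       real (?g L) * (X + c2 * (real L + 1) + 1) \<le> P * W"
    unfolding Let_def Lmax .
  \<comment> \<open>ensures \<open>h \<epsilon> \<le> t1\<close> and \<open>tau \<epsilon> \<le> 1\<close>\<close>
  define e1 where "e1 = min (3 * Cfem * t1 ^ s) (1 / sqrt \<beta>)"
  have e1: "0 < e1" using Cfem(1) t1(1) pos(2) by (simp add: e1_def)
  have "\<forall>\<^sub>F \<epsilon> in at_right 0. 0 < \<epsilon> \<and> \<epsilon> < e1" by (rule eventually_at_rightI[OF _ e1]) auto
  from evX this show ?thesis
  proof eventually_elim
    case (elim \<epsilon>)
    define X where "X = ln (3 * Csc / \<epsilon>)"
    define L where "L = Lmax \<epsilon>"
    define P where "P = C1 * X ^ N * (C2 + 1 / ln 2 * ln X) ^ (N - 1)"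
    define W where "W = C5 + 2 * (2 powr (1 / real N) - 1) * X + 2 * real N * ln (ln (1 / (r * real N) * X))"
    define K where "K = kappabar \<epsilon>"
    define lam where "lam = ln ((sqrt K + 1) / (sqrt K - 1))"
    define acc where "acc = real (acc_iterations (stiffness D a (Mf (h \<epsilon>)) (phi (h \<epsilon>))) (load_vec D f (Mf (h \<epsilon>)) (phi (h \<epsilon>)))
          (Mf (h \<epsilon>)) (tau \<epsilon>) L)"
    have \<epsilon>: "0 < \<epsilon>" "\<epsilon> < 3 * Cfem * t1 ^ s" "\<epsilon> < 1 / sqrt \<beta>" using elim(2) by (simp_all add: e1_def)
    have L: "1 \<le> L" and XL: "X \<le> r * real N * 2 powr (real L / real N)" and P: "0 \<le> P" and W: "0 \<le> W"
      and main: "real (?g L) * (X + c2 * (real L + 1) + 1) \<le> P * W"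
      using elim(1) unfolding Let_def X_def[symmetric] L_def[symmetric] P_def[symmetric] W_def[symmetric] by blast+
    have hpos: "0 < h \<epsilon>" using \<epsilon> Cfem(1) by (simp add: h)
    have hs: "h \<epsilon> ^ s = \<epsilon> / (3 * Cfem)"
    proof -
      have "h \<epsilon> ^ s = h \<epsilon> powr real s" using hpos by (simp add: powr_realpow)
      also have "\<dots> = \<epsilon> / (3 * Cfem)" using \<epsilon> Cfem(1,2) by (simp add: h powr_powr)
      finally show ?thesis .
    qed
    have h_t1: "h \<epsilon> \<le> t1"
    proof (rule ccontr)
      assume "\<not> h \<epsilon> \<le> t1"
      then have "t1 ^ s \<le> h \<epsilon> ^ s" using t1(1) by (intro power_mono) auto
      then show False using \<epsilon>(2) Cfem(1) unfolding hs by (simp add: field_simps)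
    qed
    have h_h0: "h \<epsilon> \<le> h0" using h_t1 t1(2) by simp
    interpret fe_space D a f u amin amax \<sigma> "h \<epsilon>" p nloc "Mf (h \<epsilon>)" "phi (h \<epsilon>)" by (rule fes[OF hpos h_h0])
    have L2: "1 \<le> (real L + 2) ^ (2 * N)" by (intro one_le_power) simp
    have tau_pos: "0 < tau \<epsilon>" using \<epsilon>(1) pos(2) unfolding tau by simp
    have tau_1: "tau \<epsilon> \<le> 1"
    proof -
      have "tau \<epsilon> \<le> sqrt \<beta> * \<epsilon> / 1"
        unfolding tau L_def[symmetric]
      proof (rule divide_left_mono)
        show "1 \<le> 3 * (real L + 2) ^ (2 * N)" using L2 by linarith
      qed (use \<epsilon>(1) pos(2) in auto)
      also have "\<dots> \<le> 1" using \<epsilon>(3) pos(2) by (simp add: field_simps)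
      finally show ?thesis .
    qed
    have sc: "Csc * exp (- (r * real N * 2 powr (real L / real N))) \<le> \<epsilon> / 3"
    proof -
      have "exp (- (r * real N * 2 powr (real L / real N))) \<le> exp (- X)" using XL by simp
      also have "\<dots> = \<epsilon> / (3 * Csc)" using \<epsilon>(1) pos(3) by (simp add: X_def exp_minus)
      finally show ?thesis using pos(3) by (simp add: field_simps)
    qed
    have third: "(real L + 2) ^ (2 * N) * (tau \<epsilon> / sqrt \<beta>) \<le> \<epsilon> / 3"
      using L2 pos(2) unfolding tau L_def[symmetric] by (simp add: field_simps)
    have Kge: "cond_number (stiffness D a (Mf (h \<epsilon>)) (phi (h \<epsilon>)) y) \<le> K" if "y \<in> Gam" for y
      unfolding K_def kappabar by (rule cSUP_upper[OF that cond_bdd])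
    have K1: "1 \<le> K" using cond_ge_1[of 0] Kge[of 0] by (force simp: Gam_def)
    have bound: "acc \<le> P * (1 / lam) * W"
    proof (cases "\<forall>y\<in>Gam. H10_norm D (u y) = 0")
      case True
      then have "acc = 0" unfolding acc_def using acc_iterations_zero[OF _ tau_pos] by simp
      moreover have "0 \<le> lam"
        \<comment> \<open>for \<open>K = 1\<close> the quotient is a division by zero, hence \<open>lam = ln 0 = 0\<close>\<close>
        using cg_rate_pos[of K] K1 by (cases "K = 1") (auto simp: lam_def)
      ultimately show ?thesis using P W by simp
    next
      case False
      then have K16: "16 < K" using alt hpos h_t1 unfolding K_def kappabar by blast
      then have lam: "0 < lam" "lam \<le> 1" using cg_rate_pos[of K] cg_rate_le_1[of K] by (simp_all add: lam_def)
      have "acc \<le> real (?g L) * (ln (2 * (c0 * (1 + real (?g L) * (4 * real L) ^ N)) / tau \<epsilon>) / lam + 1)"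
        unfolding acc_def lam_def c0_def N using K16
        by (intro acc_iterations_le Kge tau_pos tau_1 U L) auto
      \<comment> \<open>here \<open>lam \<le> 1\<close> turns the additional iteration into \<open>1 / lam\<close>\<close>
      also have "\<dots> \<le> real (?g L) * ((X + c2 * (real L + 1)) / lam + 1 / lam)"
        using log_le[OF g2 \<epsilon>(1), of L] lam unfolding tau L_def[symmetric] X_def
        by (intro mult_left_mono add_mono divide_right_mono) (auto simp: L_def)
      also have "\<dots> = real (?g L) * (X + c2 * (real L + 1) + 1) / lam"
        by (simp only: add_divide_distrib[symmetric] times_divide_eq_right)
      also have "\<dots> \<le> P * W / lam" using main lam by (intro divide_right_mono) auto
      finally show ?thesis by simp
    qed
    show ?case
      using hpos h_h0 L tau_pos sc third bound hs Cfem(1)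
      unfolding acc_def P_def W_def X_def lam_def K_def L_def by simp
  qed
qed

end

theorem theorem4p10:
  fixes D :: "(real^'d::finite) set"
    and a f :: "real^'d \<Rightarrow> real^'n::finite \<Rightarrow> real"
    and rho :: "'n \<Rightarrow> real \<Rightarrow> real"
    and u :: "real^'n \<Rightarrow> real^'d \<Rightarrow> real"
    and phi :: "real \<Rightarrow> nat \<Rightarrow> real^'d \<Rightarrow> real"
    and M :: "real \<Rightarrow> nat"
    and gam :: "'n \<Rightarrow> real"
    and s p nloc N :: nat
    and uh :: "real \<Rightarrow> real^'n \<Rightarrow> real^'d \<Rightarrow> real"
    and Kacc :: "real \<Rightarrow> nat \<Rightarrow> real \<Rightarrow> nat"
    and Kmin :: "real \<Rightarrow> nat"
    and kappabar :: "real \<Rightarrow> real"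
    and h tau :: "real \<Rightarrow> real"
    and Lmax :: "real \<Rightarrow> nat"
    and amin amax \<alpha> \<beta> h0 \<sigma> Cfem \<delta> r Csc C1 C2 C5 :: real
  assumes N: "N = CARD('n)"
    and dim: "CARD('d) \<le> 3"
    and domain: "open D" "connected D" "bounded D" "D \<noteq> {}"
    and rho: "bounded_probability_density rho"
    \<comment> \<open>the diffusion problem\<close>
    and a_meas: "\<And>y. y \<in> Gam \<Longrightarrow> (\<lambda>x. a x y) \<in> borel_measurable (lebesgue_on D)"
    and a_bounds: "0 < amin" "\<And>y. y \<in> Gam \<Longrightarrow> AE x in lebesgue_on D. amin \<le> a x y \<and> a x y \<le> amax"
    and f_L2: "\<And>y. y \<in> Gam \<Longrightarrow> (\<lambda>x. f x y) \<in> L2_space D"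
    and u_sol: "\<And>y. y \<in> Gam \<Longrightarrow> weak_solution D a f y (u y)"
    and alpha: "0 < \<alpha>" "\<And>y v w. y \<in> Gam \<Longrightarrow> v \<in> H10 D \<Longrightarrow> w \<in> H10 D \<Longrightarrow>
          \<bar>energy_form D a y v w\<bar> \<le> \<alpha> * H10_norm D v * H10_norm D w"
    and beta: "0 < \<beta>" "\<And>y v. y \<in> Gam \<Longrightarrow> v \<in> H10 D \<Longrightarrow>
          \<beta> * (H10_norm D v)\<^sup>2 \<le> energy_form D a y v v"
    \<comment> \<open>finite elements, for all mesh sizes up to some \<open>h0\<close>\<close>
    and fe: "0 < h0" "0 < \<sigma>" "\<And>t. 0 < t \<Longrightarrow> t \<le> h0 \<Longrightarrow> fe_basis D \<sigma> p nloc t (M t) (phi t)"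
    and M_growth: "\<exists>C. \<forall>t. 0 < t \<and> t \<le> h0 \<longrightarrow> real (M t) \<le> C / t ^ CARD('d)"
    and uh: "\<And>t. uh t = galerkin D a f (M t) (phi t)"
    and s: "1 \<le> s"
    and u_reg: "in_L2_rho rho (H10 D \<inter> Sob_space D (s + 1)) (Sob_norm D (s + 1)) u"
    and Cfem: "0 < Cfem" "\<And>t. 0 < t \<Longrightarrow> t \<le> h0 \<Longrightarrow>
          (\<integral>\<^sup>+ y. ennreal ((H10_norm D (\<lambda>x. u y x - uh t y x))\<^sup>2) \<partial>rho_measure rho)
            \<le> ennreal ((Cfem * t ^ s)\<^sup>2)"
    \<comment> \<open>regularity and sparse grid interpolation error\<close>
    and gam: "\<And>n. 1 < gam n"
    and u_analytic: "has_analytic_extension D gam u"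
    and uh_analytic: "\<And>t. 0 < t \<Longrightarrow> t \<le> h0 \<Longrightarrow> has_analytic_extension D gam (uh t)"
    and delta: "0 < \<delta>" "\<delta> < 1"
    and r: "r = (1 - \<delta>) * Min (range (\<lambda>n. ln (gam n)))"
    and Csc: "0 < Csc"
      "\<And>L. 1 \<le> L \<Longrightarrow> AE y in lebesgue_on Gam.
          H10_norm D (\<lambda>x. u y x - sparse_interp L (\<lambda>y'. u y' x) y)
            \<le> Csc * exp (- (r * real N * 2 powr (real L / real N)))"
      "\<And>L t. 1 \<le> L \<Longrightarrow> 0 < t \<Longrightarrow> t \<le> h0 \<Longrightarrow> AE y in lebesgue_on Gam.
          H10_norm D (\<lambda>x. uh t y x - sparse_interp L (\<lambda>y'. uh t y' x) y)
            \<le> Csc * exp (- (r * real N * 2 powr (real L / real N)))"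
    \<comment> \<open>iteration counts: with mesh size, maximal level and tolerance as arguments; minimal for given \<open>\<epsilon>\<close>\<close>
    and Kacc: "\<And>t L \<tau>. Kacc t L \<tau> =
          acc_iterations (stiffness D a (M t) (phi t)) (load_vec D f (M t) (phi t)) (M t) \<tau> L"
    and Kmin: "\<And>\<epsilon>. Kmin \<epsilon> = Inf {Kacc t L \<tau> | t L \<tau>.
          0 < t \<and> t \<le> h0 \<and> 1 \<le> L \<and> 0 < \<tau> \<and>
          Cfem * t ^ s \<le> \<epsilon> / 3 \<and>
          Csc * exp (- (r * real N * 2 powr (real L / real N))) \<le> \<epsilon> / 3 \<and>
          (real L + 2) ^ (2 * N) * (\<tau> / sqrt \<beta>) \<le> \<epsilon> / 3}"
    and h: "\<And>\<epsilon>. h \<epsilon> = (\<epsilon> / (3 * Cfem)) powr (1 / real s)"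
    and Lmax: "\<And>\<epsilon>. Lmax \<epsilon> =
          nat \<lceil>real N / ln 2 * ln (1 / (r * real N) * ln (3 * Csc / \<epsilon>))\<rceil>"
    and tau: "\<And>\<epsilon>. tau \<epsilon> = sqrt \<beta> * \<epsilon> / (3 * (real (Lmax \<epsilon>) + 2) ^ (2 * N))"
    and kappabar: "\<And>\<epsilon>. kappabar \<epsilon> =
          (SUP y\<in>Gam. cond_number (stiffness D a (M (h \<epsilon>)) (phi (h \<epsilon>)) y))"
    and C1: "C1 = (exp 1 / ln 2) ^ (N - 1) * (2 / (r * real N)) ^ N"
    and C2: "C2 = 1 + 1 / ln 2 * ln (1 / (r * real N))"
    and C5: "C5 = 2 * real N * ln (2 * real N / ln 2) + ln (4 * sqrt (\<alpha> / \<beta>))"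
  shows "\<forall>\<^sub>F \<epsilon> in at_right 0.
           real (Kmin \<epsilon>) \<le> real (Kacc (h \<epsilon>) (Lmax \<epsilon>) (tau \<epsilon>)) \<and>
           real (Kacc (h \<epsilon>) (Lmax \<epsilon>) (tau \<epsilon>)) \<le>
             C1 * ln (3 * Csc / \<epsilon>) ^ N * (C2 + 1 / ln 2 * ln (ln (3 * Csc / \<epsilon>))) ^ (N - 1)
             * (1 / ln ((sqrt (kappabar \<epsilon>) + 1) / (sqrt (kappabar \<epsilon>) - 1)))
             * (C5 + 2 * (2 powr (1 / real N) - 1) * ln (3 * Csc / \<epsilon>)
                + 2 * real N * ln (ln (1 / (r * real N) * ln (3 * Csc / \<epsilon>))))"
proof -
  have L2: "L2s (lebesgue_on D) (\<lambda>x. f x y)" if "y \<in> Gam" for y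
    using f_L2[OF that] by (simp add: L2_space_iff)
  \<comment> \<open>the two bounds of \<open>a\<close> are ordered only where they hold, hence the maximum\<close>
  interpret diffusion D a f u amin "max amin amax"
  proof unfold_locales
    show "AE x in lebesgue_on D. amin \<le> a x y \<and> a x y \<le> max amin amax" if "y \<in> Gam" for y
      using a_bounds(2)[OF that] by eventually_elim auto
  qed (use domain a_meas a_bounds(1) L2 u_sol in auto)
  have "0 < Min (range (\<lambda>n. ln (gam n)))" using gam by (subst Min_gr_iff) (auto intro: ln_gt_zero)
  then have r_pos: "0 < r" using delta by (simp add: r)
  let "\<forall>\<^sub>F \<epsilon> in _. _ \<epsilon> \<and> _ \<epsilon> \<le> ?bound \<epsilon>" = ?thesis
  have "\<forall>\<^sub>F \<epsilon> in at_right 0.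
      0 < h \<epsilon> \<and> h \<epsilon> \<le> h0 \<and> 1 \<le> Lmax \<epsilon> \<and> 0 < tau \<epsilon> \<and> Cfem * h \<epsilon> ^ s \<le> \<epsilon> / 3 \<and>
      Csc * exp (- (r * real N * 2 powr (real (Lmax \<epsilon>) / real N))) \<le> \<epsilon> / 3 \<and>
      (real (Lmax \<epsilon>) + 2) ^ (2 * N) * (tau \<epsilon> / sqrt \<beta>) \<le> \<epsilon> / 3 \<and>
      real (Kacc (h \<epsilon>) (Lmax \<epsilon>) (tau \<epsilon>)) \<le> ?bound \<epsilon>"
    unfolding Kacc
    by (rule accelerated_iterations_eventually_le[OF N fe(3,1) rho Cfem(1) s Cfem(2)[unfolded uh] gam
          u_analytic uh_analytic[unfolded uh] r_pos beta(1) Csc(1) h Lmax tau kappabar C1 C2])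
  then show ?thesis
  proof eventually_elim
    case (elim \<epsilon>)
    then have "Kacc (h \<epsilon>) (Lmax \<epsilon>) (tau \<epsilon>) \<in> {Kacc t L \<tau> | t L \<tau>.
          0 < t \<and> t \<le> h0 \<and> 1 \<le> L \<and> 0 < \<tau> \<and>
          Cfem * t ^ s \<le> \<epsilon> / 3 \<and>
          Csc * exp (- (r * real N * 2 powr (real L / real N))) \<le> \<epsilon> / 3 \<and>
          (real L + 2) ^ (2 * N) * (\<tau> / sqrt \<beta>) \<le> \<epsilon> / 3}"
      by blast
    then have "Kmin \<epsilon> \<le> Kacc (h \<epsilon>) (Lmax \<epsilon>) (tau \<epsilon>)"
      unfolding Kmin by (rule cInf_lower) simp
    then show ?case using elim by simp
  qed
qed

end
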